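(* Let $\mu_+,\mu_-\in\mathbb{R}$, $\beta\in(-1,1)$, $t>0$, $x\in\mathbb{R}$, and let $X=(X_t)_{t\ge 0}$ be the refracted skew Brownian motion with parameters $(\beta,\mu_+,\mu_-)$, skew level $a=0$ and starting point $X_0=x$. Then the transition density $p(t;x,y)$ (the density in $y$ of $X_t$ under $\mathbb{P}_x$) is given as follows. For $y>0$, $$p(t;x,y)=\begin{cases}\phi(y-x;\mu_+)-e^{-2\mu_+x}\phi(x+y;\mu_+)\\ \quad+2(1+\beta)e^{2\mu_+y}\displaystyle\int_0^\infty\!\int_0^t h(t-\tau;(1+\beta)b+x+y,\mu_+)\,h(\tau;(1-\beta)b,-\mu_-)\,\mathrm{d}\tau\,\mathrm{d}b, & x\ge0,\\[3mm] 2(1+\beta)e^{2\mu_+y}\displaystyle\int_0^\infty\!\int_0^t h(\tau;(1+\beta)b+y,\mu_+)\,h(t-\tau;(1-\beta)b-x,-\mu_-)\,\mathrm{d}\tau\,\mathrm{d}b, & x<0,\end{cases}$$ and for $y<0$, $$p(t;x,y)=\begin{cases}2(1-\beta)e^{2\mu_-y}\displaystyle\int_0^\infty\!\int_0^t h(t-\tau;(1+\beta)b+x,\mu_+)\,h(\tau;(1-\beta)b-y,-\mu_-)\,\mathrm{d}\tau\,\mathrm{d}b, & x>0,\\[3mm] \phi(y-x;\mu_-)-e^{2\mu_-y}\phi(-x-y;\mu_-)\\ \quad+2(1-\beta)e^{2\mu_-y}\displaystyle\int_0^\infty\!\int_0^t h(\tau;(1+\beta)b,\mu_+)\,h(t-\tau;(1-\beta)b-y-x,-\mu_-)\,\mathrm{d}\tau\,\mathrm{d}b,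 & x\le0,\end{cases}$$ where $h(s;x,\mu):=\frac{|x|}{\sqrt{2\pi s^3}}\,e^{-\frac{(x+\mu s)^2}{2s}}$ for $x,\mu\in\mathbb{R}$, $s>0$, and $\phi(z;\mu):=\frac{1}{\sqrt{2\pi t}}\,e^{-\frac{(z-\mu t)^2}{2t}}$ is the density at time $t$ of a Brownian motion with drift $\mu$ started at $0$.
   Context: The refracted skew Brownian motion with parameters $\beta\in(-1,1)$, $\mu_+,\mu_-\in\mathbb{R}$ and skew level $a\in\mathbb{R}$ is the pathwise unique (strong) solution $X$ of $$X_t=X_0+B_t+\beta L^X(t,a)+\mu_+\int_0^t \mathbf{1}_{\{X_s>a\}}\,\mathrm{d}s+\mu_-\int_0^t\mathbf{1}_{\{X_s<a\}}\,\mathrm{d}s,\qquad t\ge 0,$$ where $B$ is a standard Brownian motion and $L^X(t,a)=\lim_{\epsilon\to0^+}\frac{1}{2\epsilon}\mathrm{Leb}(\{s\le t:|X_s-a|\le\epsilon\})$ is the symmetric local time of $X$ at level $a$. $\mathbb{P}_x$ denotes the law of $X$ with $X_0=x$. *)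

theory Defs
  imports "HOL-Probability.Probability"
begin

text \<open>
  Time is indexed by the reals, but only times \<open>t \<ge> 0\<close> are constrained.  A filtration on
  \<open>[0, \<infinity>)\<close> extends to negative indices, e.g. by its value at time 0.
\<close>

locale brownian_motion = prob_space M + filtration "space M" F
  for M :: "'a measure" and F :: "real \<Rightarrow> 'a measure" +
  fixes B :: "real \<Rightarrow> 'a \<Rightarrow> real"
  assumes subalgebra_F: "\<And>t. 0 \<le> t \<Longrightarrow> subalgebra M (F t)"
    and B_adapted: "\<And>t. 0 \<le> t \<Longrightarrow> B t \<in> borel_measurable (F t)"
    and B_start: "AE \<omega> in M. B 0 \<omega> = 0"
    and B_increment: "\<And>s t. 0 \<le> s \<Longrightarrow> s < t \<Longrightarrow>
      distributed M lborel (\<lambda>\<omega>. B t \<omega> - B s \<omega>) (normal_density 0 (sqrt (t - s)))"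
    and B_indep: "\<And>s t. 0 \<le> s \<Longrightarrow> s < t \<Longrightarrow>
      indep_set (sets (F s)) (sets (vimage_algebra (space M) (\<lambda>\<omega>. B t \<omega> - B s \<omega>) borel))"
    and B_continuous: "AE \<omega> in M. continuous_on {0..} (\<lambda>t. B t \<omega>)"

definition occupation_quotient :: "(real \<Rightarrow> real) \<Rightarrow> real \<Rightarrow> real \<Rightarrow> real \<Rightarrow> real" where
  "occupation_quotient f t a \<epsilon> = measure lborel {s \<in> {0..t}. \<bar>f s - a\<bar> \<le> \<epsilon>} / (2 * \<epsilon>)"

text \<open>
  Meaningful only if the limit exists; this is required separately for the paths of a solution
  of the stochastic differential equation below.
\<close>

definition local_time :: "(real \<Rightarrow> real) \<Rightarrow> real \<Rightarrow> real \<Rightarrow> real" where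
  "local_time f t a = Lim (at_right 0) (occupation_quotient f t a)"

text \<open>
  \<open>X\<close> solves the equation with respect to the \<open>F\<close>-Brownian motion \<open>B\<close>.  The filtration is
  arbitrary; the augmented filtration generated by \<open>B\<close> gives the strong solution, and by pathwise
  uniqueness every other choice of \<open>F\<close> gives the same process.
\<close>

locale refracted_skew_BM = brownian_motion M F B
  for M :: "'a measure" and F :: "real \<Rightarrow> 'a measure" and B :: "real \<Rightarrow> 'a \<Rightarrow> real" +
  fixes X :: "real \<Rightarrow> 'a \<Rightarrow> real" and \<beta> \<mu>p \<mu>m a x :: real
  assumes X_adapted: "\<And>t. 0 \<le> t \<Longrightarrow> X t \<in> borel_measurable (F t)"
    and X_start: "AE \<omega> in M. X 0 \<omega> = x"
    and X_continuous: "AE \<omega> in M. continuous_on {0..} (\<lambda>t. X t \<omega>)"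
    and local_time_exists: "AE \<omega> in M. \<forall>t\<ge>0. \<exists>l.
      (occupation_quotient (\<lambda>s. X s \<omega>) t a \<longlongrightarrow> l) (at_right 0)"
    and X_equation: "AE \<omega> in M. \<forall>t\<ge>0.
      X t \<omega> = X 0 \<omega> + B t \<omega> + \<beta> * local_time (\<lambda>s. X s \<omega>) t a
        + \<mu>p * (LBINT s:{0..t}. indicator {s. X s \<omega> > a} s)
        + \<mu>m * (LBINT s:{0..t}. indicator {s. X s \<omega> < a} s)"

definition h :: "real \<Rightarrow> real \<Rightarrow> real \<Rightarrow> real" where
  "h s x \<mu> = \<bar>x\<bar> / sqrt (2 * pi * s ^ 3) * exp (- ((x + \<mu> * s)\<^sup>2 / (2 * s)))"

definition \<phi> :: "real \<Rightarrow> real \<Rightarrow> real \<Rightarrow> real" where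
  "\<phi> t z \<mu> = 1 / sqrt (2 * pi * t) * exp (- ((z - \<mu> * t)\<^sup>2 / (2 * t)))"

text \<open>
  The formula is specified for \<open>y \<noteq> 0\<close> only; the value 0 at the Lebesgue-null point \<open>y = 0\<close> is
  a convention.
\<close>

definition transition_density ::
    "real \<Rightarrow> real \<Rightarrow> real \<Rightarrow> real \<Rightarrow> real \<Rightarrow> real \<Rightarrow> real" where
  "transition_density \<beta> \<mu>p \<mu>m t x y =
    (if y > 0 then
       (if x \<ge> 0 then
          \<phi> t (y - x) \<mu>p - exp (- 2 * \<mu>p * x) * \<phi> t (x + y) \<mu>p
          + 2 * (1 + \<beta>) * exp (2 * \<mu>p * y) *
            (LBINT b:{0<..}. (LBINT \<tau>:{0<..<t}.
               h (t - \<tau>) ((1 + \<beta>) * b + x + y) \<mu>p * h \<tau> ((1 - \<beta>) * b) (- \<mu>m)))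
        else
          2 * (1 + \<beta>) * exp (2 * \<mu>p * y) *
            (LBINT b:{0<..}. (LBINT \<tau>:{0<..<t}.
               h \<tau> ((1 + \<beta>) * b + y) \<mu>p * h (t - \<tau>) ((1 - \<beta>) * b - x) (- \<mu>m))))
     else if y < 0 then
       (if x > 0 then
          2 * (1 - \<beta>) * exp (2 * \<mu>m * y) *
            (LBINT b:{0<..}. (LBINT \<tau>:{0<..<t}.
               h (t - \<tau>) ((1 + \<beta>) * b + x) \<mu>p * h \<tau> ((1 - \<beta>) * b - y) (- \<mu>m)))
        else
          \<phi> t (y - x) \<mu>m - exp (2 * \<mu>m * y) * \<phi> t (- x - y) \<mu>m
          + 2 * (1 - \<beta>) * exp (2 * \<mu>m * y) *
            (LBINT b:{0<..}. (LBINT \<tau>:{0<..<t}.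
               h \<tau> ((1 + \<beta>) * b) \<mu>p * h (t - \<tau>) ((1 - \<beta>) * b - y - x) (- \<mu>m))))
     else 0)"

end

theory Submission
  imports Defs "HOL-Real_Asymp.Real_Asymp"
begin

text \<open>
  The law of \<open>X t\<close> is identified through its resolvent.  For a Lipschitz function \<open>g\<close> with compact
  support let \<open>f x = \<integral>y. G x y * g y\<close>, where \<open>G\<close> is the Green function of the operator that is
  \<open>f''/2 + \<mu>p f'\<close> on the right and \<open>f''/2 + \<mu>m f'\<close> on the left half-line, with the interface condition
  \<open>(1 + \<beta>) f' (0+) = (1 - \<beta>) f' (0-)\<close>; then \<open>f\<close> solves \<open>\<alpha> f - g = \<close> (operator applied to \<open>f\<close>).
  In Ito's formula for \<open>f (X t)\<close> the kink of \<open>f\<close> and the term \<open>\<beta> L\<close> of the equation both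
  produce multiples of the local time, and the interface condition says that they cancel.  Hence
  \<open>E f (X t) = f x + E \<integral>s\<in>{0..t}. (\<alpha> f - g) (X s)\<close>, so that the Laplace transform of \<open>t \<mapsto> E g (X t)\<close>
  at \<open>\<alpha>\<close> is \<open>f x\<close>.

  On the other side \<open>h\<close> is a first-passage density with Laplace transform
  \<open>exp (- z (\<mu> + sqrt (\<mu>\<^sup>2 + 2 \<alpha>)))\<close>.  The time integral in the transition density is a convolution,
  and integrating the resulting exponential over \<open>b\<close> gives the Green function.  Both sides are
  continuous in \<open>t\<close>, so they agree by uniqueness of Laplace transforms.

  No stochastic integral is needed for Ito's formula in expectation: along a grid the martingale
  part has mean zero, and the remaining sums converge pathwise.
\<close>

section \<open>First-passage densities and their Laplace transforms\<close>

text \<open>Two obstacles shape the probabilistic half. The local time is given only as an almost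
  sure limit of occupation quotients, which shows neither moments nor continuity in time, and no
  joint measurability of \<open>X\<close> is assumed. The equation yields continuity and a square
  integrable bound only for \<beta> times the local time, which says nothing when \<beta> = 0,
  whereas smoothing the kink needs convergence of the expected occupation for every \<beta>. That
  convergence comes from Ito's formula itself, applied to a smoothed absolute value: its first
  derivative is bounded by 2 whatever the width of the smoothing, and this controls the tails of the
  occupation uniformly. Measurable versions of pathwise quantities are limits of Riemann sums. In
  the analytic half, reflection exchanges the half-lines, so starting points
  \<open>x \<ge> 0\<close> suffice. Test functions are Lipschitz so that \<open>f\<close> has a
  Lipschitz second derivative on each half-line, and compactly supported because the density is
  estimated only locally in \<open>y\<close>.\<close>

lemma continuous_antiderivative:
  fixes k :: "real \<Rightarrow> real"
  assumes "continuous_on UNIV k"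
  obtains K where "K c = 0" "\<And>x. (K has_real_derivative k x) (at x)"
proof -
  let ?K = "\<lambda>u. LBINT y=ereal c..ereal u. k y"
  have "(?K has_real_derivative k x) (at x)" for x
  proof -
    define a b where "a = min c x - 1" and "b = max c x + 1"
    have "(?K has_vector_derivative k x) (at x within {a..b})"
      by (rule interval_integral_FTC2) (auto simp: a_def b_def intro: continuous_on_subset[OF assms])
    moreover have "at x within {a..b} = at x"
      by (rule at_within_interior) (auto simp: a_def b_def)
    ultimately show ?thesis
      by (simp add: has_real_derivative_iff_has_vector_derivative)
  qed
  then show thesis by (intro that[of ?K]) auto
qed

text \<open>Endpoint values enter as limits because the integrands below may be singular at 0;
  nonnegativity makes the improper integral absolutely convergent.\<close>

lemma nn_integral_FTC_Ioi:
  fixes f F :: "real \<Rightarrow> real"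
  assumes F: "\<And>x. 0 < x \<Longrightarrow> (F has_real_derivative f x) (at x)"
    and cont: "\<And>x. 0 < x \<Longrightarrow> isCont f x"
    and nonneg: "\<And>x. 0 < x \<Longrightarrow> 0 \<le> f x"
    and A: "(F \<longlongrightarrow> A) (at_right 0)" and B: "(F \<longlongrightarrow> B) at_top"
  shows "(\<integral>\<^sup>+s\<in>{0<..}. ennreal (f s) \<partial>lborel) = ennreal (B - A)"
proof -
  have ei: "einterval 0 \<infinity> = {0<..}" by (auto simp: einterval_def)
  have A': "((F \<circ> real_of_ereal) \<longlongrightarrow> A) (at_right 0)"
    using A by (simp add: zero_ereal_def ereal_tendsto_simps)
  have B': "((F \<circ> real_of_ereal) \<longlongrightarrow> B) (at_left \<infinity>)"
    using B by (simp add: ereal_tendsto_simps)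
  note FTC = interval_integral_FTC_nonneg[OF _ F cont _ A' B', simplified]
  have int: "set_integrable lborel {0<..} f" and eq: "(LBINT x=0..\<infinity>. f x) = B - A"
    using FTC nonneg by (auto simp: ei)
  have "(\<integral>\<^sup>+s\<in>{0<..}. ennreal (f s) \<partial>lborel) = (\<integral>\<^sup>+s. ennreal (indicator {0<..} s *\<^sub>R f s) \<partial>lborel)"
    by (intro nn_integral_cong) (auto simp: indicator_def)
  also have "\<dots> = ennreal (LBINT s:{0<..}. f s)"
    unfolding set_lebesgue_integral_def
    by (intro nn_integral_eq_integral int[unfolded set_integrable_def])
       (auto simp: indicator_def nonneg)
  also have "(LBINT s:{0<..}. f s) = B - A"
    using eq by (simp add: interval_lebesgue_integral_def ei)
  finally show ?thesis .
qed

text \<open>Differentiability comes from a primitive \<open>K\<close> of the density and the limits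
  at both ends from the distribution function. Their increments agree, so the two differ by a
  constant.\<close>

lemma normal_cdf:
  obtains N :: "real \<Rightarrow> real" where
    "\<And>x. (N has_real_derivative std_normal_density x) (at x)"
    "(N \<longlongrightarrow> 0) at_bot" "(N \<longlongrightarrow> 1) at_top"
proof -
  interpret D: real_distribution std_normal_distribution by (rule real_dist_normal_dist)
  have cont: "continuous_on UNIV std_normal_density"
    by (auto intro!: continuous_intros simp: std_normal_density_def)
  obtain K where K: "K 0 = (0::real)" "\<And>x. (K has_real_derivative std_normal_density x) (at x)"
    using continuous_antiderivative[OF cont, of 0] by blast
  have diff: "cdf std_normal_distribution y - cdf std_normal_distribution x = K y - K x"
    if "x < y" for x y
  proof -
    have "emeasure std_normal_distribution {x<..y} = ennreal (K y - K x)"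
    proof -
      have "emeasure std_normal_distribution {x<..y}
          = (\<integral>\<^sup>+u. ennreal (std_normal_density u) * indicator {x<..y} u \<partial>lborel)"
        by (subst emeasure_density) auto
      also have "\<dots> = (\<integral>\<^sup>+u. ennreal (std_normal_density u) * indicator {x..y} u \<partial>lborel)"
        by (intro nn_integral_cong_AE AE_I[where N="{x}"]) (auto simp: indicator_def)
      also have "\<dots> = ennreal (K y - K x)"
        using that K(2) by (intro nn_integral_FTC_Icc) (auto intro: DERIV_subset has_field_derivative_at_within)
      finally show ?thesis .
    qed
    moreover have "K x \<le> K y"
      by (rule DERIV_nonneg_imp_nondecreasing[OF less_imp_le[OF that]]) (use K(2) in fastforce)
    ultimately show ?thesis
      using D.cdf_diff_eq[OF that] by (simp add: measure_def)
  qed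
  have eq: "cdf std_normal_distribution x = K x + cdf std_normal_distribution 0" for x
    using diff[of 0 x] diff[of x 0] K(1) by (cases x "0::real" rule: linorder_cases) auto
  show thesis
  proof (rule that)
    show "(cdf std_normal_distribution has_real_derivative std_normal_density x) (at x)" for x
      by (subst eq[abs_def]) (auto intro!: derivative_eq_intros K(2))
    show "(cdf std_normal_distribution \<longlongrightarrow> 0) at_bot" by (rule D.cdf_lim_at_bot)
    show "(cdf std_normal_distribution \<longlongrightarrow> 1) at_top" by (rule D.cdf_lim_at_top_prob)
  qed
qed

text \<open>\<open>P + Q\<close> is the first-passage distribution function of a Brownian motion with drift \<open>c\<close> to the
  level \<open>z\<close>, and \<open>P - Q\<close> is a primitive of \<open>c\<close> times its density at \<open>z\<close>.\<close>

lemma inverse_gaussian_primitive: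
  fixes c z :: real
  assumes c: "c > 0" and z: "z \<ge> 0"
  obtains P Q :: "real \<Rightarrow> real" where
    "\<And>s. s > 0 \<Longrightarrow> (P has_real_derivative (c / (2 * sqrt s) + z / (2 * s * sqrt s)) * std_normal_density ((c * s - z)/sqrt s)) (at s)"
    "\<And>s. s > 0 \<Longrightarrow> (Q has_real_derivative (z / (2 * s * sqrt s) - c / (2 * sqrt s)) * std_normal_density ((c * s - z)/sqrt s)) (at s)"
    "(P \<longlongrightarrow> 1) at_top" "(Q \<longlongrightarrow> 0) at_top"
    "z > 0 \<Longrightarrow> (P \<longlongrightarrow> 0) (at_right 0)" "z > 0 \<Longrightarrow> (Q \<longlongrightarrow> 0) (at_right 0)"
    "z = 0 \<Longrightarrow> ((\<lambda>s. P s - Q s) \<longlongrightarrow> 0) (at_right 0)"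
proof -
  obtain N :: "real \<Rightarrow> real" where N: "\<And>x. (N has_real_derivative std_normal_density x) (at x)"
    "(N \<longlongrightarrow> 0) at_bot" "(N \<longlongrightarrow> 1) at_top" using normal_cdf by blast
  define P where "P = (\<lambda>s. N ((c * s - z)/sqrt s))"
  define Q where "Q = (\<lambda>s. exp (2 * c * z) * N (- (c * s + z)/sqrt s))"
  have isN: "isCont N x" for x using N(1) DERIV_isCont by blast
  show thesis
  proof (rule that[of P Q])
    fix s :: real assume s: "s > 0"
    then have sq: "sqrt s > 0" "sqrt s * sqrt s = s" by auto
    have s2: "s = (sqrt s)\<^sup>2" using s by simp
    show "(P has_real_derivative (c / (2 * sqrt s) + z / (2 * s * sqrt s)) * std_normal_density ((c * s - z)/sqrt s)) (at s)"
    proof -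
      have "((\<lambda>s. (c * s - z)/sqrt s) has_real_derivative (c / (2 * sqrt s) + z / (2 * s * sqrt s))) (at s)"
        using s sq by (auto intro!: derivative_eq_intros simp: field_simps)
      from DERIV_chain2[OF N(1) this] show ?thesis by (simp add: P_def mult.commute)
    qed
    \<comment> \<open>The two squares differ by \<open>4 * c * z\<close>, so the reflection weight
      \<open>exp (2 * c * z)\<close> moves the Gaussian from the mirrored argument back to
      \<open>(c * s - z)/sqrt s\<close>. This is why the derivatives of \<open>P\<close> and
      \<open>Q\<close> share one Gaussian factor and can be added and subtracted.\<close>
    have e: "exp (2 * c * z) * std_normal_density (- (c * s + z)/sqrt s) = std_normal_density ((c * s - z)/sqrt s)"
    proof -
      have "(- (c * s + z)/sqrt s)\<^sup>2 = ((c * s - z)/sqrt s)\<^sup>2 + 4 * c * z"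
        using s by (simp add: power_divide field_simps power2_eq_square)
      then have "2 * c * z - (- (c * s + z)/sqrt s)\<^sup>2/2 = - ((c * s - z)/sqrt s)\<^sup>2/2"
        by (simp add: field_simps)
      then show ?thesis
        by (simp add: std_normal_density_def exp_add[symmetric] del: power_divide flip: exp_diff)
    qed
    show "(Q has_real_derivative (z / (2 * s * sqrt s) - c / (2 * sqrt s)) * std_normal_density ((c * s - z)/sqrt s)) (at s)"
    proof -
      have "((\<lambda>s. - (c * s + z)/sqrt s) has_real_derivative (z / (2 * s * sqrt s) - c / (2 * sqrt s))) (at s)"
        using s sq by (auto intro!: derivative_eq_intros simp: field_simps)
      from DERIV_cmult[OF DERIV_chain2[OF N(1) this], of "exp (2 * c * z)"] show ?thesis
        unfolding Q_def mult.assoc[symmetric] e by (simp only: mult.commute)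
    qed
  next
    have "filterlim (\<lambda>s. (c * s - z)/sqrt s) at_top at_top"
      using c z by real_asymp
    then show "(P \<longlongrightarrow> 1) at_top" unfolding P_def by (rule filterlim_compose[OF N(3)])
    have "filterlim (\<lambda>s. - (c * s + z)/sqrt s) at_bot at_top"
      using c z by real_asymp
    from tendsto_mult_right_zero[OF filterlim_compose[OF N(2) this]]
    show "(Q \<longlongrightarrow> 0) at_top" by (simp add: Q_def)
  next
    assume z: "z > 0"
    have "filterlim (\<lambda>s. (c * s - z)/sqrt s) at_bot (at_right 0)"
      using c z by real_asymp
    then show "(P \<longlongrightarrow> 0) (at_right 0)" unfolding P_def by (rule filterlim_compose[OF N(2)])
    have "filterlim (\<lambda>s. - (c * s + z)/sqrt s) at_bot (at_right 0)"
      using c z by real_asymp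
    from tendsto_mult_right_zero[OF filterlim_compose[OF N(2) this]]
    show "(Q \<longlongrightarrow> 0) (at_right 0)" by (simp add: Q_def)
  next
    \<comment> \<open>Here both arguments tend to 0, so \<open>P\<close> and \<open>Q\<close> both
      tend to \<open>N 0\<close> and only their difference vanishes.\<close>
    assume z: "z = 0"
    have "((\<lambda>s. c * s/sqrt s) \<longlongrightarrow> 0) (at_right 0)" "((\<lambda>s. -(c * s)/sqrt s) \<longlongrightarrow> 0) (at_right 0)"
      using c by real_asymp+
    then have "((\<lambda>s. N (c * s/sqrt s) - N (-(c * s)/sqrt s)) \<longlongrightarrow> N 0 - N 0) (at_right 0)"
      by (intro tendsto_diff isCont_tendsto_compose[OF isN])
    then show "((\<lambda>s. P s - Q s) \<longlongrightarrow> 0) (at_right 0)" by (simp add: P_def Q_def z)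
  qed
qed

text \<open>The integrand is the derivative of \<open>P + Q\<close>, a first-passage law; drift
  towards the level makes it a probability.\<close>

lemma laplace_h_aux:
  assumes c: "c > 0" and z: "z > 0"
  shows "(\<integral>\<^sup>+s\<in>{0<..}. ennreal (z / (s * sqrt s) * std_normal_density ((c * s - z)/sqrt s)) \<partial>lborel) = 1"
proof (rule inverse_gaussian_primitive[OF c less_imp_le[OF z]], goal_cases)
  case PQ: (1 P Q)
  have "(\<integral>\<^sup>+s\<in>{0<..}. ennreal (z / (s * sqrt s) * std_normal_density ((c * s - z)/sqrt s)) \<partial>lborel) = ennreal ((1 + 0) - (0 + 0))"
  proof (rule nn_integral_FTC_Ioi[where F="\<lambda>s. P s + Q s"])
    fix s :: real assume s: "0 < s"
    show "((\<lambda>s. P s + Q s) has_real_derivative z / (s * sqrt s) * std_normal_density ((c * s - z)/sqrt s)) (at s)"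
      by (rule DERIV_cong[OF DERIV_add[OF PQ(1)[OF s] PQ(2)[OF s]]]) (simp add: field_simps)
    show "isCont (\<lambda>s. z / (s * sqrt s) * std_normal_density ((c * s - z)/sqrt s)) s"
      using s by (auto intro!: continuous_intros simp: std_normal_density_def)
    show "0 \<le> z / (s * sqrt s) * std_normal_density ((c * s - z)/sqrt s)"
      using s z by simp
  qed (intro tendsto_add PQ z)+
  then show ?thesis by simp
qed

text \<open>The integrand is the derivative of \<open>P - Q\<close>, that is, \<open>c\<close> times
  the density at \<open>z\<close> of a motion with drift \<open>c\<close>. The total occupation
  density of a level in the direction of the drift is \<open>1 / c\<close>.\<close>

lemma laplace_heat_aux:
  assumes c: "c > 0" and z: "z \<ge> 0"
  shows "(\<integral>\<^sup>+s\<in>{0<..}. ennreal (c / sqrt s * std_normal_density ((c * s - z)/sqrt s)) \<partial>lborel) = 1"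
proof (rule inverse_gaussian_primitive[OF c z], goal_cases)
  case PQ: (1 P Q)
  have lim0: "((\<lambda>s. P s - Q s) \<longlongrightarrow> 0) (at_right 0)"
    using PQ(7) tendsto_diff[OF PQ(5,6)] z by (cases "z = 0") auto
  have "(\<integral>\<^sup>+s\<in>{0<..}. ennreal (c / sqrt s * std_normal_density ((c * s - z)/sqrt s)) \<partial>lborel) = ennreal ((1 - 0) - 0)"
  proof (rule nn_integral_FTC_Ioi[where F="\<lambda>s. P s - Q s"])
    fix s :: real assume s: "0 < s"
    show "((\<lambda>s. P s - Q s) has_real_derivative c / sqrt s * std_normal_density ((c * s - z)/sqrt s)) (at s)"
      by (rule DERIV_cong[OF DERIV_diff[OF PQ(1)[OF s] PQ(2)[OF s]]]) (use s in \<open>simp add: field_simps\<close>)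
    show "isCont (\<lambda>s. c / sqrt s * std_normal_density ((c * s - z)/sqrt s)) s"
      using s by (auto intro!: continuous_intros simp: std_normal_density_def)
    show "0 \<le> c / sqrt s * std_normal_density ((c * s - z)/sqrt s)"
      using s c by simp
  qed (intro tendsto_diff PQ lim0)+
  then show ?thesis by simp
qed

text \<open>The decay rate in \<open>z\<close> of the Laplace transform at \<open>\<alpha>\<close> of \<open>h _ z \<mu>\<close>.\<close>

definition char_root :: "real \<Rightarrow> real \<Rightarrow> real" where
  "char_root \<alpha> \<mu> = \<mu> + sqrt (\<mu>\<^sup>2 + 2 * \<alpha>)"

lemma char_root_pos: "\<alpha> > 0 \<Longrightarrow> char_root \<alpha> \<mu> > 0"
proof -
  assume "\<alpha> > 0"
  then have "sqrt (\<mu>\<^sup>2) < sqrt (\<mu>\<^sup>2 + 2 * \<alpha>)" by (intro real_sqrt_less_mono) simp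
  then show ?thesis by (simp add: char_root_def)
qed

section \<open>Laplace transforms of the first-passage density, the Gaussian density and
  convolutions\<close>

lemma h_nonneg: "0 \<le> s \<Longrightarrow> 0 \<le> h s z \<mu>"
  by (simp add: h_def)

lemma h_measurable [measurable]:
  assumes [measurable]: "f \<in> borel_measurable M" "g \<in> borel_measurable M"
  shows "(\<lambda>x. h (f x) (g x) \<mu>) \<in> borel_measurable M"
  unfolding h_def by measurable

text \<open>Completing the square turns discounting at rate \<alpha> into a change of drift. The
  first-passage density \<open>h _ z \<mu>\<close> belongs to the drift -\<mu>; discounted, it is
  \<open>exp (- z * char_root \<alpha> \<mu>)\<close> times the one for the drift \<open>c\<close>,
  whose mass is one.\<close>

lemma laplace_h:
  assumes \<alpha>: "\<alpha> > 0" and z: "z > 0"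
  shows "(\<integral>\<^sup>+s\<in>{0<..}. ennreal (exp (- \<alpha> * s) * h s z \<mu>) \<partial>lborel) = ennreal (exp (- z * char_root \<alpha> \<mu>))"
proof -
  define c where "c = sqrt (\<mu>\<^sup>2 + 2 * \<alpha>)"
  have c: "c > 0" "c\<^sup>2 = \<mu>\<^sup>2 + 2 * \<alpha>"
    using \<alpha> by (auto simp: c_def add_nonneg_pos)
  have *: "exp (- \<alpha> * s) * h s z \<mu> = exp (- z * char_root \<alpha> \<mu>) * (z / (s * sqrt s) * std_normal_density ((c * s - z)/sqrt s))"
    if s: "s > 0" for s
  proof -
    have "- \<alpha> * s - (z + \<mu> * s)\<^sup>2 / (2 * s) = - z * (\<mu> + c) - ((c * s - z)/sqrt s)\<^sup>2 / 2"
    proof -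
      have *: "\<alpha> = (c\<^sup>2 - \<mu>\<^sup>2)/2" using c by simp
      show ?thesis unfolding * using s by (simp add: power_divide field_simps power2_eq_square)
    qed
    then have "exp (- \<alpha> * s) * exp (- ((z + \<mu> * s)\<^sup>2 / (2 * s))) = exp (- z * char_root \<alpha> \<mu>) * exp (- ((c * s - z)/sqrt s)\<^sup>2 / 2)"
      by (simp add: char_root_def c_def exp_add[symmetric] del: power_divide)
    moreover have "sqrt (2 * pi * s ^ 3) = sqrt (2 * pi) * (s * sqrt s)"
      using s by (simp add: real_sqrt_mult power3_eq_cube)
    ultimately show ?thesis
      using z by (simp add: h_def std_normal_density_def mult_ac divide_simps del: power_divide)
  qed
  have "(\<integral>\<^sup>+s\<in>{0<..}. ennreal (exp (- \<alpha> * s) * h s z \<mu>) \<partial>lborel)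
      = (\<integral>\<^sup>+s. ennreal (exp (- z * char_root \<alpha> \<mu>)) * (ennreal (z / (s * sqrt s) * std_normal_density ((c * s - z)/sqrt s)) * indicator {0<..} s) \<partial>lborel)"
  proof (intro nn_integral_cong)
    fix s :: real
    show "ennreal (exp (- \<alpha> * s) * h s z \<mu>) * indicator {0<..} s = ennreal (exp (- z * char_root \<alpha> \<mu>)) * (ennreal (z / (s * sqrt s) * std_normal_density ((c * s - z)/sqrt s)) * indicator {0<..} s)"
    proof (cases "0 < s")
      case True
      show ?thesis using True c(1) by (subst *[OF True], subst ennreal_mult') simp_all
    qed simp
  qed
  also have "\<dots> = ennreal (exp (- z * char_root \<alpha> \<mu>))"
    using laplace_h_aux[OF c(1) z] by (subst nn_integral_cmult) auto
  finally show ?thesis .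
qed

text \<open>The same change of drift. Only the factor \<open>exp (\<mu> * z)\<close> sees the sign
  of \<open>z\<close>; the rest depends on \<open>\<bar>z\<bar>\<close>, so
  \<open>laplace_heat_aux\<close> applies to a level in the direction of the drift.\<close>

lemma laplace_\<phi>:
  assumes \<alpha>: "\<alpha> > 0"
  shows "(\<integral>\<^sup>+s\<in>{0<..}. ennreal (exp (- \<alpha> * s) * \<phi> s z \<mu>) \<partial>lborel)
    = ennreal (exp (\<mu> * z - sqrt (\<mu>\<^sup>2 + 2 * \<alpha>) * \<bar>z\<bar>) / sqrt (\<mu>\<^sup>2 + 2 * \<alpha>))"
proof -
  define c where "c = sqrt (\<mu>\<^sup>2 + 2 * \<alpha>)"
  have c: "c > 0" "c\<^sup>2 = \<mu>\<^sup>2 + 2 * \<alpha>"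
    using \<alpha> by (auto simp: c_def add_nonneg_pos)
  have *: "exp (- \<alpha> * s) * \<phi> s z \<mu> = exp (\<mu> * z - c * \<bar>z\<bar>) / c * (c / sqrt s * std_normal_density ((c * s - \<bar>z\<bar>)/sqrt s))"
    if s: "s > 0" for s
  proof -
    have "- \<alpha> * s - (z - \<mu> * s)\<^sup>2 / (2 * s) = \<mu> * z - c * \<bar>z\<bar> - ((c * s - \<bar>z\<bar>)/sqrt s)\<^sup>2 / 2"
    proof -
      have *: "\<alpha> = (c\<^sup>2 - \<mu>\<^sup>2)/2" using c by simp
      have "\<bar>z\<bar>\<^sup>2 = z\<^sup>2" by simp
      then show ?thesis unfolding * using s by (simp add: power_divide field_simps power2_eq_square)
    qed
    then have "exp (- \<alpha> * s) * exp (- ((z - \<mu> * s)\<^sup>2 / (2 * s))) = exp (\<mu> * z - c * \<bar>z\<bar>) * exp (- ((c * s - \<bar>z\<bar>)/sqrt s)\<^sup>2 / 2)"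
      by (simp add: exp_add[symmetric] del: power_divide)
    moreover have "sqrt (2 * pi * s) = sqrt (2 * pi) * sqrt s"
      by (simp add: real_sqrt_mult)
    ultimately show ?thesis
      using c by (simp add: \<phi>_def std_normal_density_def mult_ac divide_simps del: power_divide)
  qed
  have "(\<integral>\<^sup>+s\<in>{0<..}. ennreal (exp (- \<alpha> * s) * \<phi> s z \<mu>) \<partial>lborel)
      = (\<integral>\<^sup>+s. ennreal (exp (\<mu> * z - c * \<bar>z\<bar>) / c) * (ennreal (c / sqrt s * std_normal_density ((c * s - \<bar>z\<bar>)/sqrt s)) * indicator {0<..} s) \<partial>lborel)"
  proof (intro nn_integral_cong)
    fix s :: real
    show "ennreal (exp (- \<alpha> * s) * \<phi> s z \<mu>) * indicator {0<..} s = ennreal (exp (\<mu> * z - c * \<bar>z\<bar>) / c) * (ennreal (c / sqrt s * std_normal_density ((c * s - \<bar>z\<bar>)/sqrt s)) * indicator {0<..} s)"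
    proof (cases "0 < s")
      case True
      show ?thesis using True c(1) by (subst *[OF True], subst ennreal_mult') simp_all
    qed simp
  qed
  also have "\<dots> = ennreal (exp (\<mu> * z - c * \<bar>z\<bar>) / c)"
    using laplace_heat_aux[OF c(1), of "\<bar>z\<bar>"] by (subst nn_integral_cmult) auto
  finally show ?thesis by (simp add: c_def)
qed

text \<open>Cutting both factors off at 0 by indicators turns the triangle
  \<open>0 < \<tau> < t\<close> into a product, after which Tonelli's theorem and a translation
  separate the integrals. Infinite values are allowed.\<close>

lemma laplace_convolution:
  fixes u v :: "real \<Rightarrow> real"
  assumes [measurable]: "u \<in> borel_measurable borel" "v \<in> borel_measurable borel"
    and nonneg: "\<And>s. s > 0 \<Longrightarrow> 0 \<le> u s" "\<And>s. s > 0 \<Longrightarrow> 0 \<le> v s"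
  shows "(\<integral>\<^sup>+t\<in>{0<..}. ennreal (exp (- \<alpha> * t)) * (\<integral>\<^sup>+\<tau>\<in>{0<..<t}. ennreal (u (t - \<tau>) * v \<tau>) \<partial>lborel) \<partial>lborel)
    = (\<integral>\<^sup>+s\<in>{0<..}. ennreal (exp (- \<alpha> * s) * u s) \<partial>lborel) * (\<integral>\<^sup>+s\<in>{0<..}. ennreal (exp (- \<alpha> * s) * v s) \<partial>lborel)"
    (is "?L = ?U * ?V")
proof -
  let ?u = "\<lambda>s. ennreal (exp (- \<alpha> * s) * u s) * indicator {0<..} s"
  let ?v = "\<lambda>s. ennreal (exp (- \<alpha> * s) * v s) * indicator {0<..} s"
  have "?L = (\<integral>\<^sup>+t. (\<integral>\<^sup>+\<tau>. ?u (t - \<tau>) * ?v \<tau> \<partial>lborel) \<partial>lborel)"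
  proof (intro nn_integral_cong)
    fix t :: real
    have "ennreal (exp (- \<alpha> * t)) * (\<integral>\<^sup>+\<tau>\<in>{0<..<t}. ennreal (u (t - \<tau>) * v \<tau>) \<partial>lborel) * indicator {0<..} t
      = (ennreal (exp (- \<alpha> * t)) * indicator {0<..} t) * (\<integral>\<^sup>+\<tau>\<in>{0<..<t}. ennreal (u (t - \<tau>) * v \<tau>) \<partial>lborel)"
      by (simp only: mult_ac)
    also have "\<dots> = (\<integral>\<^sup>+\<tau>. (ennreal (exp (- \<alpha> * t)) * indicator {0<..} t) * (ennreal (u (t - \<tau>) * v \<tau>) * indicator {0<..<t} \<tau>) \<partial>lborel)"
      by (rule nn_integral_cmult[symmetric]) measurable
    also have "\<dots> = (\<integral>\<^sup>+\<tau>. ?u (t - \<tau>) * ?v \<tau> \<partial>lborel)"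
    proof (intro nn_integral_cong)
      fix \<tau> :: real
      show "(ennreal (exp (- \<alpha> * t)) * indicator {0<..} t) * (ennreal (u (t - \<tau>) * v \<tau>) * indicator {0<..<t} \<tau>) = ?u (t - \<tau>) * ?v \<tau>"
      proof (cases "0 < \<tau> \<and> \<tau> < t")
        case True
        have e: "exp (- \<alpha> * t) = exp (- \<alpha> * (t - \<tau>)) * exp (- \<alpha> * \<tau>)"
          by (simp add: exp_add[symmetric] algebra_simps)
        show ?thesis unfolding e using True nonneg[of "t - \<tau>"] nonneg[of \<tau>]
          by (simp add: ennreal_mult'[symmetric] ennreal_mult''[symmetric] mult_ac)
      qed (auto simp: indicator_def)
    qed
    finally show "ennreal (exp (- \<alpha> * t)) * (\<integral>\<^sup>+\<tau>\<in>{0<..<t}. ennreal (u (t - \<tau>) * v \<tau>) \<partial>lborel) * indicator {0<..} t = \<dots>" .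
  qed
  also have "\<dots> = (\<integral>\<^sup>+\<tau>. (\<integral>\<^sup>+t. ?u (t - \<tau>) * ?v \<tau> \<partial>lborel) \<partial>lborel)"
    by (rule lborel_pair.Fubini') measurable
  also have "\<dots> = (\<integral>\<^sup>+\<tau>. ?U * ?v \<tau> \<partial>lborel)"
  proof (intro nn_integral_cong)
    fix \<tau> :: real
    have "(\<integral>\<^sup>+t. ?u (t - \<tau>) * ?v \<tau> \<partial>lborel) = (\<integral>\<^sup>+t. ?u (t - \<tau>) \<partial>lborel) * ?v \<tau>"
      by (rule nn_integral_multc) measurable
    also have "(\<integral>\<^sup>+t. ?u (t - \<tau>) \<partial>lborel) = ?U"
      by (subst nn_integral_real_affine[where c=1 and t="\<tau>"]) auto
    finally show "(\<integral>\<^sup>+t. ?u (t - \<tau>) * ?v \<tau> \<partial>lborel) = ?U * ?v \<tau>" .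
  qed
  also have "\<dots> = ?U * ?V" by (rule nn_integral_cmult) measurable
  finally show ?thesis .
qed

text \<open>All double integrals of the transition density are instances of \<open>excursion\<close>, up to interchanging
  \<open>\<tau>\<close> and \<open>t - \<tau>\<close>.  The version with values in \<open>ennreal\<close> is the one to which Tonelli's theorem applies.\<close>

definition excursion_nn :: "real \<Rightarrow> real \<Rightarrow> real \<Rightarrow> real \<Rightarrow> real \<Rightarrow> real \<Rightarrow> real \<Rightarrow> ennreal" where
  "excursion_nn t p c \<mu> q d \<nu> =
    (\<integral>\<^sup>+b\<in>{0<..}. (\<integral>\<^sup>+\<tau>\<in>{0<..<t}. ennreal (h (t - \<tau>) (p * b + c) \<mu> * h \<tau> (q * b + d) \<nu>) \<partial>lborel) \<partial>lborel)"

definition excursion :: "real \<Rightarrow> real \<Rightarrow> real \<Rightarrow> real \<Rightarrow> real \<Rightarrow> real \<Rightarrow> real \<Rightarrow> real" where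
  "excursion t p c \<mu> q d \<nu> =
    (LBINT b:{0<..}. (LBINT \<tau>:{0<..<t}. h (t - \<tau>) (p * b + c) \<mu> * h \<tau> (q * b + d) \<nu>))"

lemma nn_integral_exp_Ioi:
  assumes "r > 0"
  shows "(\<integral>\<^sup>+b\<in>{0<..}. ennreal (exp (- r * b)) \<partial>lborel) = ennreal (1 / r)"
proof -
  have "(\<integral>\<^sup>+b\<in>{0<..}. ennreal (exp (- r * b)) \<partial>lborel) = ennreal (0 - (- 1 / r))"
  proof (rule nn_integral_FTC_Ioi[where F="\<lambda>b. - exp (- r * b) / r"])
    show "((\<lambda>b. - exp (- r * b) / r) has_real_derivative exp (- r * x)) (at x)" for x
      using assms by (auto intro!: derivative_eq_intros)
    show "((\<lambda>b. - exp (- r * b) / r) \<longlongrightarrow> - 1 / r) (at_right 0)"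
    proof -
      have "isCont (\<lambda>b. - exp (- r * b) / r) 0" using assms by (auto intro!: continuous_intros)
      then show ?thesis by (simp add: isCont_def filterlim_at_split)
    qed
    show "((\<lambda>b. - exp (- r * b) / r) \<longlongrightarrow> 0) at_top"
      using assms by real_asymp
  qed auto
  then show ?thesis by simp
qed

text \<open>For fixed \<open>b\<close> the convolution becomes a product of two first-passage
  transforms, hence an exponential in \<open>b\<close>; its integral over \<open>b\<close> produces
  the denominator.\<close>

lemma excursion_nn_laplace:
  assumes \<alpha>: "\<alpha> > 0" and pq: "p > 0" "q > 0" and cd: "c \<ge> 0" "d \<ge> 0"
  shows "(\<integral>\<^sup>+t\<in>{0<..}. ennreal (exp (- \<alpha> * t)) * excursion_nn t p c \<mu> q d \<nu> \<partial>lborel)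
    = ennreal (exp (- c * char_root \<alpha> \<mu> - d * char_root \<alpha> \<nu>) / (p * char_root \<alpha> \<mu> + q * char_root \<alpha> \<nu>))"
proof -
  define r r' where "r = char_root \<alpha> \<mu>" and "r' = char_root \<alpha> \<nu>"
  have r: "r > 0" "r' > 0" using \<alpha> by (auto simp: r_def r'_def char_root_pos)
  let ?I = "\<lambda>t b. \<integral>\<^sup>+\<tau>\<in>{0<..<t}. ennreal (h (t - \<tau>) (p * b + c) \<mu> * h \<tau> (q * b + d) \<nu>) \<partial>lborel"
  \<comment> \<open>The indicator of an interval with moving endpoint is rewritten as a condition on
    the variables, whose joint measurability is evident.\<close>
  have [measurable]: "(\<lambda>(t,b). ?I t b) \<in> borel_measurable (lborel \<Otimes>\<^sub>M lborel)"
  proof -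
    have "(\<lambda>(t,b). \<integral>\<^sup>+\<tau>. ennreal (h (t - \<tau>) (p * b + c) \<mu> * h \<tau> (q * b + d) \<nu>) * (if 0 < \<tau> \<and> \<tau> < t then 1 else 0) \<partial>lborel) \<in> borel_measurable (lborel \<Otimes>\<^sub>M lborel)"
      by measurable
    moreover have "indicator {0<..<t} \<tau> = (if 0 < \<tau> \<and> \<tau> < t then 1 else 0 :: ennreal)" for t \<tau> :: real
      by (auto simp: indicator_def)
    ultimately show ?thesis by simp
  qed
  have "(\<integral>\<^sup>+t\<in>{0<..}. ennreal (exp (- \<alpha> * t)) * excursion_nn t p c \<mu> q d \<nu> \<partial>lborel)
     = (\<integral>\<^sup>+t. (\<integral>\<^sup>+b. ennreal (exp (- \<alpha> * t)) * ?I t b * indicator {0<..} t * indicator {0<..} b \<partial>lborel) \<partial>lborel)"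
  proof (intro nn_integral_cong)
    fix t :: real
    have "(\<integral>\<^sup>+b. ennreal (exp (- \<alpha> * t)) * ?I t b * indicator {0<..} t * indicator {0<..} b \<partial>lborel)
        = (\<integral>\<^sup>+b. (ennreal (exp (- \<alpha> * t)) * indicator {0<..} t) * (?I t b * indicator {0<..} b) \<partial>lborel)"
      by (simp add: mult_ac)
    also have "\<dots> = (ennreal (exp (- \<alpha> * t)) * indicator {0<..} t) * excursion_nn t p c \<mu> q d \<nu>"
      unfolding excursion_nn_def by (rule nn_integral_cmult) measurable
    finally show "ennreal (exp (- \<alpha> * t)) * excursion_nn t p c \<mu> q d \<nu> * indicator {0<..} t = (\<integral>\<^sup>+b. ennreal (exp (- \<alpha> * t)) * ?I t b * indicator {0<..} t * indicator {0<..} b \<partial>lborel)"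
      by (simp add: mult_ac)
  qed
  also have "\<dots> = (\<integral>\<^sup>+b. (\<integral>\<^sup>+t. ennreal (exp (- \<alpha> * t)) * ?I t b * indicator {0<..} t * indicator {0<..} b \<partial>lborel) \<partial>lborel)"
    by (rule lborel_pair.Fubini') measurable
  also have "\<dots> = (\<integral>\<^sup>+b. ennreal (exp (- c * r - d * r')) * (ennreal (exp (- (p * r + q * r') * b)) * indicator {0<..} b) \<partial>lborel)"
  proof (intro nn_integral_cong)
    fix b :: real
    have "(\<integral>\<^sup>+t. ennreal (exp (- \<alpha> * t)) * ?I t b * indicator {0<..} t * indicator {0<..} b \<partial>lborel)
       = (\<integral>\<^sup>+t\<in>{0<..}. ennreal (exp (- \<alpha> * t)) * ?I t b \<partial>lborel) * indicator {0<..} b"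
      by (rule nn_integral_multc) measurable
    also have "\<dots> = ennreal (exp (- c * r - d * r')) * (ennreal (exp (- (p * r + q * r') * b)) * indicator {0<..} b)"
    proof (cases "b > 0")
      case True
      have pos: "p * b + c > 0" "q * b + d > 0" using True pq cd by (auto intro: add_pos_nonneg)
      have "(\<integral>\<^sup>+t\<in>{0<..}. ennreal (exp (- \<alpha> * t)) * ?I t b \<partial>lborel)
        = ennreal (exp (- (p * b + c) * r)) * ennreal (exp (- (q * b + d) * r'))"
        unfolding r_def r'_def laplace_h[OF \<alpha> pos(1), symmetric] laplace_h[OF \<alpha> pos(2), symmetric]
        by (rule laplace_convolution) (auto simp: h_nonneg)
      also have "\<dots> = ennreal (exp (- c * r - d * r')) * ennreal (exp (- (p * r + q * r') * b))"
        by (simp add: ennreal_mult'[symmetric] exp_add[symmetric]) (simp add: algebra_simps)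
      finally show ?thesis using True by simp
    qed simp
    finally show "(\<integral>\<^sup>+t. ennreal (exp (- \<alpha> * t)) * ?I t b * indicator {0<..} t * indicator {0<..} b \<partial>lborel) = \<dots>" .
  qed
  also have "\<dots> = ennreal (exp (- c * r - d * r')) * ennreal (1 / (p * r + q * r'))"
    using r pq by (subst nn_integral_cmult, measurable, subst nn_integral_exp_Ioi) (auto simp: add_pos_pos)
  also have "\<dots> = ennreal (exp (- c * r - d * r') / (p * r + q * r'))"
    using r pq by (simp add: ennreal_mult'[symmetric])
  finally show ?thesis by (simp add: r_def r'_def)
qed

section \<open>Bounds for the excursion integral and its continuity in time\<close>

lemma hitting_mass_le:
  assumes "z \<ge> 0" "T \<ge> 0"
  shows "(\<integral>\<^sup>+\<tau>\<in>{0<..<T}. ennreal (h \<tau> z \<nu>) \<partial>lborel) \<le> ennreal (exp T)"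
proof (cases "z = 0")
  case True then show ?thesis by (simp add: h_def)
next
  case False
  then have z: "z > 0" using assms by simp
  \<comment> \<open>On the range of integration \<open>exp (T - \<tau>)\<close> is at least 1, so
    the mass is at most \<open>exp T\<close> times the Laplace transform at 1, and the latter is at
    most 1.\<close>
  have "(\<integral>\<^sup>+\<tau>\<in>{0<..<T}. ennreal (h \<tau> z \<nu>) \<partial>lborel) \<le> (\<integral>\<^sup>+\<tau>. ennreal (exp T) * (ennreal (exp (- 1 * \<tau>) * h \<tau> z \<nu>) * indicator {0<..} \<tau>) \<partial>lborel)"
  proof (intro nn_integral_mono)
    fix \<tau> :: real
    show "ennreal (h \<tau> z \<nu>) * indicator {0<..<T} \<tau> \<le> ennreal (exp T) * (ennreal (exp (- 1 * \<tau>) * h \<tau> z \<nu>) * indicator {0<..} \<tau>)"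
    proof (cases "0 < \<tau> \<and> \<tau> < T")
      case True
      have "1 * h \<tau> z \<nu> \<le> exp (T - \<tau>) * h \<tau> z \<nu>"
        using True by (intro mult_right_mono) (auto simp: h_nonneg)
      also have "\<dots> = exp T * (exp (- 1 * \<tau>) * h \<tau> z \<nu>)" by (simp add: exp_diff exp_minus field_simps)
      finally have "ennreal (h \<tau> z \<nu>) \<le> ennreal (exp T * (exp (- 1 * \<tau>) * h \<tau> z \<nu>))"
        by (intro ennreal_leI) simp
      then show ?thesis using True by (simp add: ennreal_mult')
    qed (auto simp: indicator_def)
  qed
  also have "\<dots> = ennreal (exp T) * ennreal (exp (- z * char_root 1 \<nu>))"
    using laplace_h[OF _ z, of 1 \<nu>] by (subst nn_integral_cmult) auto
  also have "\<dots> \<le> ennreal (exp T)"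
    using z char_root_pos[of 1 \<nu>] by (simp add: ennreal_mult'[symmetric])
  finally show ?thesis .
qed

definition h_bound :: "real \<Rightarrow> real \<Rightarrow> real \<Rightarrow> real" where
  "h_bound a b \<mu> = exp (b / 2 * (\<bar>\<mu>\<bar> + 2)\<^sup>2) / sqrt (2 * pi * a ^ 3)"

text \<open>The Gaussian still dominates after a tilt by \<open>exp (2 * z)\<close>. One factor
  \<open>exp (- z)\<close> of the decay gained in this way pays for the prefactor \<open>z\<close>
  of the density, the other one survives.\<close>

lemma h_le:
  assumes "0 < a" "a \<le> s" "s \<le> b" "z \<ge> 0"
  shows "h s z \<mu> \<le> h_bound a b \<mu> * exp (- z)"
proof -
  have s: "s > 0" using assms by simp
  have "- ((z + \<mu> * s)\<^sup>2 / (2 * s)) \<le> b / 2 * (\<bar>\<mu>\<bar> + 2)\<^sup>2 - 2 * z"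
  proof -
    \<comment> \<open>Adding \<open>2 * z\<close> and completing the square lowers the drift by 2 at
      the cost of a term linear in \<open>s\<close>. Its coefficient \<open>4 - 4 * \<mu>\<close> is
      at most \<open>(\<bar>\<mu>\<bar> + 2)\<^sup>2\<close>, which is the origin of the constant in
      \<open>h_bound\<close>.\<close>
    have "- ((z + \<mu> * s)\<^sup>2 / (2 * s)) + 2 * z = (s / 2) * (2 * \<mu> * - 2 + 4) - (z + (\<mu> - 2) * s)\<^sup>2 / (2 * s)"
      using s by (simp add: field_simps power2_eq_square)
    also have "\<dots> \<le> (s / 2) * (2 * \<mu> * - 2 + 4)" using s by simp
    also have "\<dots> \<le> (s / 2) * (\<bar>\<mu>\<bar> + 2)\<^sup>2"
    proof (rule mult_left_mono)
      have "4 - 4 * \<mu> \<le> \<bar>\<mu>\<bar>\<^sup>2 + 4 * \<bar>\<mu>\<bar> + 4" by (smt (verit) zero_le_power2)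
      then show "2 * \<mu> * - 2 + 4 \<le> (\<bar>\<mu>\<bar> + 2)\<^sup>2" by (simp add: power2_eq_square algebra_simps)
    qed (use s in simp)
    also have "\<dots> \<le> (b / 2) * (\<bar>\<mu>\<bar> + 2)\<^sup>2" using assms by (intro mult_right_mono) auto
    finally show ?thesis by simp
  qed
  then have e: "exp (- ((z + \<mu> * s)\<^sup>2 / (2 * s))) \<le> exp (b / 2 * (\<bar>\<mu>\<bar> + 2)\<^sup>2) * exp (- 2 * z)"
    by (simp add: exp_add[symmetric])
  have "h s z \<mu> \<le> z / sqrt (2 * pi * a ^ 3) * (exp (b / 2 * (\<bar>\<mu>\<bar> + 2)\<^sup>2) * exp (- 2 * z))"
    unfolding h_def
  proof (intro mult_mono e)
    show "\<bar>z\<bar> / sqrt (2 * pi * s ^ 3) \<le> z / sqrt (2 * pi * a ^ 3)"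
      using assms by (auto intro!: divide_left_mono power_mono mult_pos_pos)
  qed (use assms in auto)
  also have "\<dots> = h_bound a b \<mu> * (z * exp (- 2 * z))" by (simp add: h_bound_def)
  also have "\<dots> \<le> h_bound a b \<mu> * exp (- z)"
  proof (rule mult_left_mono)
    have "z \<le> exp z" using exp_ge_add_one_self[of z] by linarith
    then have "z * exp (- 2 * z) \<le> exp z * exp (- 2 * z)" by (intro mult_right_mono) auto
    then show "z * exp (- 2 * z) \<le> exp (- z)" by (simp add: exp_add[symmetric])
  qed (use assms in \<open>auto simp: h_bound_def\<close>)
  finally show ?thesis .
qed

text \<open>The factor \<open>h \<tau>\<close> is singular at \<open>\<tau> = 0\<close>.  Splitting the time integral at \<open>t/2\<close> keeps one of the two
  factors away from its singularity; the other one only contributes its mass.\<close>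

definition half_excursion :: "real \<Rightarrow> real \<Rightarrow> real \<Rightarrow> real \<Rightarrow> real \<Rightarrow> real \<Rightarrow> real \<Rightarrow> ennreal" where
  "half_excursion t p c \<mu> q d \<nu> =
    (\<integral>\<^sup>+b\<in>{0<..}. (\<integral>\<^sup>+\<tau>\<in>{0<..<t/2}. ennreal (h (t - \<tau>) (p * b + c) \<mu> * h \<tau> (q * b + d) \<nu>) \<partial>lborel) \<partial>lborel)"

text \<open>The decay \<open>exp (- z)\<close> is kept because with \<open>z = p * b + c\<close> it
  makes the bound integrable in \<open>b\<close>. Uniformity over \<open>{a..T}\<close> supplies one
  majorant for a whole sequence of times.\<close>

lemma inner_half_le:
  assumes z: "z \<ge> 0" "z' \<ge> 0" and t: "0 < a" "a \<le> t" "t \<le> T"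
  shows "(\<integral>\<^sup>+\<tau>\<in>{0<..<t/2}. ennreal (h (t - \<tau>) z \<mu> * h \<tau> z' \<nu>) \<partial>lborel) \<le> ennreal (h_bound (a/2) T \<mu> * exp T * exp (- z))"
proof -
  have hb: "h_bound (a/2) T \<mu> \<ge> 0" using t by (auto simp: h_bound_def)
  have "(\<integral>\<^sup>+\<tau>\<in>{0<..<t/2}. ennreal (h (t - \<tau>) z \<mu> * h \<tau> z' \<nu>) \<partial>lborel)
    \<le> (\<integral>\<^sup>+\<tau>. ennreal (h_bound (a/2) T \<mu> * exp (- z)) * (ennreal (h \<tau> z' \<nu>) * indicator {0<..<T} \<tau>) \<partial>lborel)"
  proof (intro nn_integral_mono)
    fix \<tau> :: real
    show "ennreal (h (t - \<tau>) z \<mu> * h \<tau> z' \<nu>) * indicator {0<..<t/2} \<tau> \<le> ennreal (h_bound (a/2) T \<mu> * exp (- z)) * (ennreal (h \<tau> z' \<nu>) * indicator {0<..<T} \<tau>)"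
    proof (cases "0 < \<tau> \<and> \<tau> < t/2")
      case True
      have "h (t - \<tau>) z \<mu> * h \<tau> z' \<nu> \<le> (h_bound (a/2) T \<mu> * exp (- z)) * h \<tau> z' \<nu>"
        using True t z by (intro mult_right_mono h_le) (auto simp: h_nonneg)
      then show ?thesis using True t hb by (simp add: ennreal_mult'[symmetric] ennreal_leI)
    qed (auto simp: indicator_def)
  qed
  also have "\<dots> = ennreal (h_bound (a/2) T \<mu> * exp (- z)) * (\<integral>\<^sup>+\<tau>\<in>{0<..<T}. ennreal (h \<tau> z' \<nu>) \<partial>lborel)"
    by (rule nn_integral_cmult) measurable
  also have "\<dots> \<le> ennreal (h_bound (a/2) T \<mu> * exp (- z)) * ennreal (exp T)"
    using z t by (intro mult_left_mono hitting_mass_le) auto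
  also have "\<dots> = ennreal (h_bound (a/2) T \<mu> * exp T * exp (- z))"
    using hb by (simp add: ennreal_mult'[symmetric] mult_ac)
  finally show ?thesis .
qed

lemma half_excursion_le:
  assumes pq: "p > 0" "q > 0" and cd: "c \<ge> 0" "d \<ge> 0" and t: "0 < a" "a \<le> t" "t \<le> T"
  shows "half_excursion t p c \<mu> q d \<nu> \<le> ennreal (h_bound (a/2) T \<mu> * exp T / p)"
proof -
  have hb: "h_bound (a/2) T \<mu> \<ge> 0" using t by (auto simp: h_bound_def)
  have "half_excursion t p c \<mu> q d \<nu> \<le> (\<integral>\<^sup>+b. ennreal (h_bound (a/2) T \<mu> * exp T) * (ennreal (exp (- p * b)) * indicator {0<..} b) \<partial>lborel)"
    unfolding half_excursion_def
  proof (intro nn_integral_mono)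
    fix b :: real
    show "(\<integral>\<^sup>+\<tau>\<in>{0<..<t/2}. ennreal (h (t - \<tau>) (p * b + c) \<mu> * h \<tau> (q * b + d) \<nu>) \<partial>lborel) * indicator {0<..} b \<le> ennreal (h_bound (a/2) T \<mu> * exp T) * (ennreal (exp (- p * b)) * indicator {0<..} b)"
    proof (cases "b > 0")
      case True
      have "(\<integral>\<^sup>+\<tau>\<in>{0<..<t/2}. ennreal (h (t - \<tau>) (p * b + c) \<mu> * h \<tau> (q * b + d) \<nu>) \<partial>lborel) \<le> ennreal (h_bound (a/2) T \<mu> * exp T * exp (- (p * b + c)))"
        using True pq cd by (intro inner_half_le t) auto
      also have "\<dots> \<le> ennreal (h_bound (a/2) T \<mu> * exp T * exp (- p * b))"
        using hb cd by (intro ennreal_leI mult_left_mono) auto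
      finally show ?thesis using True hb by (simp add: ennreal_mult')
    qed simp
  qed
  also have "\<dots> = ennreal (h_bound (a/2) T \<mu> * exp T) * ennreal (1 / p)"
    by (subst nn_integral_cmult, measurable, subst nn_integral_exp_Ioi) (use pq in auto)
  also have "\<dots> = ennreal (h_bound (a/2) T \<mu> * exp T / p)"
    using hb pq by (simp add: ennreal_mult'[symmetric])
  finally show ?thesis .
qed

lemma isCont_h: "s > 0 \<Longrightarrow> isCont (\<lambda>s. h s z \<mu>) s"
  unfolding h_def by (auto intro!: continuous_intros)

text \<open>Dominated convergence, first in \<tau> for fixed \<open>b\<close>, then in
  \<open>b\<close>. The two-sided bounds on \<open>u\<close> keep the majorants independent of
  \<open>n\<close>.\<close>

lemma half_excursion_tendsto:
  assumes pq: "p > 0" "q > 0" and cd: "c \<ge> 0" "d \<ge> 0" and t: "0 < t" and lim: "u \<longlonglongrightarrow> t"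
    and u: "\<And>n. t / 2 \<le> u n" "\<And>n. u n \<le> 2 * t"
  shows "(\<lambda>n. half_excursion (u n) p c \<mu> q d \<nu>) \<longlonglongrightarrow> half_excursion t p c \<mu> q d \<nu>"
proof -
  define H where "H = h_bound (t/2/2) (2*t) \<mu>"
  have H: "H \<ge> 0" using t by (auto simp: h_bound_def H_def)
  let ?f = "\<lambda>n b \<tau>. ennreal (h (u n - \<tau>) (p * b + c) \<mu> * h \<tau> (q * b + d) \<nu>) * indicator {0<..<u n/2} \<tau>"
  let ?g = "\<lambda>b \<tau>. ennreal (h (t - \<tau>) (p * b + c) \<mu> * h \<tau> (q * b + d) \<nu>) * indicator {0<..<t/2} \<tau>"
  have inner: "(\<lambda>n. \<integral>\<^sup>+\<tau>. ?f n b \<tau> \<partial>lborel) \<longlonglongrightarrow> (\<integral>\<^sup>+\<tau>. ?g b \<tau> \<partial>lborel)" if b: "b > 0" for b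
  proof (rule nn_integral_dominated_convergence[where w="\<lambda>\<tau>. ennreal (H * exp (- (p * b + c))) * (ennreal (h \<tau> (q * b + d) \<nu>) * indicator {0<..<2*t} \<tau>)"])
    have pos: "p * b + c \<ge> 0" "q * b + d \<ge> 0" using b pq cd by auto
    have "(\<integral>\<^sup>+\<tau>. ennreal (H * exp (- (p * b + c))) * (ennreal (h \<tau> (q * b + d) \<nu>) * indicator {0<..<2*t} \<tau>) \<partial>lborel)
       = ennreal (H * exp (- (p * b + c))) * (\<integral>\<^sup>+\<tau>\<in>{0<..<2*t}. ennreal (h \<tau> (q * b + d) \<nu>) \<partial>lborel)"
      by (rule nn_integral_cmult) measurable
    also have "\<dots> \<le> ennreal (H * exp (- (p * b + c))) * ennreal (exp (2*t))"
      using pos t by (intro mult_left_mono hitting_mass_le) auto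
    also have "\<dots> < \<infinity>" by (simp add: ennreal_mult_less_top)
    finally show "(\<integral>\<^sup>+\<tau>. ennreal (H * exp (- (p * b + c))) * (ennreal (h \<tau> (q * b + d) \<nu>) * indicator {0<..<2*t} \<tau>) \<partial>lborel) < \<infinity>" .
    show "AE \<tau> in lborel. ?f n b \<tau> \<le> ennreal (H * exp (- (p * b + c))) * (ennreal (h \<tau> (q * b + d) \<nu>) * indicator {0<..<2*t} \<tau>)" for n
    proof (rule AE_I2)
      fix \<tau> :: real
      show "?f n b \<tau> \<le> ennreal (H * exp (- (p * b + c))) * (ennreal (h \<tau> (q * b + d) \<nu>) * indicator {0<..<2*t} \<tau>)"
      proof (cases "0 < \<tau> \<and> \<tau> < u n/2")
        case True
        have "h (u n - \<tau>) (p * b + c) \<mu> * h \<tau> (q * b + d) \<nu> \<le> (H * exp (- (p * b + c))) * h \<tau> (q * b + d) \<nu>"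
          unfolding H_def using True t pos u[of n] by (intro mult_right_mono h_le) (auto simp: h_nonneg)
        then show ?thesis using True t u[of n] H by (simp add: ennreal_mult'[symmetric] ennreal_leI)
      qed (auto simp: indicator_def)
    qed
    \<comment> \<open>With the moving endpoint \<open>u n / 2\<close> the integrands may fail to
      converge at the single point \<tau> = t/2.\<close>
    have "AE \<tau> in lborel. \<tau> \<noteq> t/2" by (rule AE_lborel_singleton)
    then show "AE \<tau> in lborel. (\<lambda>n. ?f n b \<tau>) \<longlonglongrightarrow> ?g b \<tau>"
    proof eventually_elim
      case (elim \<tau>)
      consider "0 < \<tau> \<and> \<tau> < t/2" | "\<tau> \<le> 0" | "\<tau> > t/2" using elim by linarith
      then show ?case
      proof cases
        case 1
        have ev: "\<forall>\<^sub>F n in sequentially. \<tau> < u n/2"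
          by (rule order_tendstoD(1)[where y="t/2"]) (use 1 lim in \<open>auto intro!: tendsto_intros\<close>)
        have "(\<lambda>n. h (u n - \<tau>) (p * b + c) \<mu>) \<longlonglongrightarrow> h (t - \<tau>) (p * b + c) \<mu>"
          by (rule isCont_tendsto_compose[OF isCont_h]) (use 1 t lim in \<open>auto intro!: tendsto_intros\<close>)
        then have "(\<lambda>n. ennreal (h (u n - \<tau>) (p * b + c) \<mu> * h \<tau> (q * b + d) \<nu>)) \<longlonglongrightarrow> ennreal (h (t - \<tau>) (p * b + c) \<mu> * h \<tau> (q * b + d) \<nu>)"
          by (intro tendsto_ennrealI tendsto_intros)
        then have "(\<lambda>n. ?f n b \<tau>) \<longlonglongrightarrow> ennreal (h (t - \<tau>) (p * b + c) \<mu> * h \<tau> (q * b + d) \<nu>)"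
          by (rule Lim_transform_eventually) (use ev 1 in \<open>auto elim!: eventually_mono\<close>)
        then show ?thesis using 1 by simp
      next
        case 2 then show ?thesis by simp
      next
        case 3
        have ev: "\<forall>\<^sub>F n in sequentially. u n/2 < \<tau>"
          by (rule order_tendstoD(2)[where y="t/2"]) (use 3 lim in \<open>auto intro!: tendsto_intros\<close>)
        have "(\<lambda>n. ?f n b \<tau>) \<longlonglongrightarrow> 0"
          by (rule tendsto_eventually) (use ev in \<open>auto elim!: eventually_mono\<close>)
        then show ?thesis using 3 by simp
      qed
    qed
  qed measurable
  show ?thesis unfolding half_excursion_def
  proof (rule nn_integral_dominated_convergence[where w="\<lambda>b. ennreal (H * exp (2*t)) * (ennreal (exp (- p * b)) * indicator {0<..} b)"])
    have "(\<integral>\<^sup>+b. ennreal (H * exp (2*t)) * (ennreal (exp (- p * b)) * indicator {0<..} b) \<partial>lborel) = ennreal (H * exp (2*t)) * ennreal (1/p)"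
      by (subst nn_integral_cmult, measurable, subst nn_integral_exp_Ioi) (use pq in auto)
    also have "\<dots> < \<infinity>" by (simp add: ennreal_mult_less_top)
    finally show "(\<integral>\<^sup>+b. ennreal (H * exp (2*t)) * (ennreal (exp (- p * b)) * indicator {0<..} b) \<partial>lborel) < \<infinity>" .
    show "AE b in lborel. (\<integral>\<^sup>+\<tau>. ?f n b \<tau> \<partial>lborel) * indicator {0<..} b \<le> ennreal (H * exp (2*t)) * (ennreal (exp (- p * b)) * indicator {0<..} b)" for n
    proof (rule AE_I2)
      fix b :: real
      show "(\<integral>\<^sup>+\<tau>. ?f n b \<tau> \<partial>lborel) * indicator {0<..} b \<le> ennreal (H * exp (2*t)) * (ennreal (exp (- p * b)) * indicator {0<..} b)"
      proof (cases "b > 0")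
        case True
        have "(\<integral>\<^sup>+\<tau>. ?f n b \<tau> \<partial>lborel) \<le> ennreal (H * exp (2*t) * exp (- (p * b + c)))"
          unfolding H_def using True pq cd t u[of n] by (intro inner_half_le) auto
        also have "\<dots> \<le> ennreal (H * exp (2*t) * exp (- p * b))"
          using H cd by (intro ennreal_leI mult_left_mono) auto
        finally show ?thesis using True H by (simp add: ennreal_mult')
      qed simp
    qed
    show "AE b in lborel. (\<lambda>n. (\<integral>\<^sup>+\<tau>. ?f n b \<tau> \<partial>lborel) * indicator {0<..} b) \<longlonglongrightarrow> (\<integral>\<^sup>+\<tau>. ?g b \<tau> \<partial>lborel) * indicator {0<..} b"
      using inner by (intro AE_I2) (auto simp: indicator_def)
  qed measurable
qed

text \<open>Replacing \<tau> by t - \<tau> maps the second half of the time interval onto the first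
  and exchanges the two factors.\<close>

lemma excursion_nn_split:
  assumes t: "t > 0"
  shows "excursion_nn t p c \<mu> q d \<nu> = half_excursion t p c \<mu> q d \<nu> + half_excursion t q d \<nu> p c \<mu>"
proof -
  let ?k = "\<lambda>b \<tau>. ennreal (h (t - \<tau>) (p * b + c) \<mu> * h \<tau> (q * b + d) \<nu>)"
  have eq: "(\<integral>\<^sup>+\<tau>\<in>{0<..<t}. ?k b \<tau> \<partial>lborel) = (\<integral>\<^sup>+\<tau>\<in>{0<..<t/2}. ?k b \<tau> \<partial>lborel) + (\<integral>\<^sup>+\<tau>\<in>{0<..<t/2}. ennreal (h (t - \<tau>) (q * b + d) \<nu> * h \<tau> (p * b + c) \<mu>) \<partial>lborel)" for b
  proof -
    have "(\<integral>\<^sup>+\<tau>\<in>{0<..<t}. ?k b \<tau> \<partial>lborel) = (\<integral>\<^sup>+\<tau>. (?k b \<tau> * indicator {0<..<t/2} \<tau> + ?k b \<tau> * indicator {t/2<..<t} \<tau>) \<partial>lborel)"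
      by (rule nn_integral_cong_AE, rule AE_mp[OF AE_lborel_singleton[of "t/2"]], rule AE_I2) (use t in \<open>auto simp: indicator_def\<close>)
    also have "\<dots> = (\<integral>\<^sup>+\<tau>\<in>{0<..<t/2}. ?k b \<tau> \<partial>lborel) + (\<integral>\<^sup>+\<tau>\<in>{t/2<..<t}. ?k b \<tau> \<partial>lborel)"
      by (rule nn_integral_add) measurable
    also have "(\<integral>\<^sup>+\<tau>\<in>{t/2<..<t}. ?k b \<tau> \<partial>lborel) = (\<integral>\<^sup>+\<tau>\<in>{0<..<t/2}. ennreal (h (t - \<tau>) (q * b + d) \<nu> * h \<tau> (p * b + c) \<mu>) \<partial>lborel)"
      by (subst nn_integral_real_affine[where c="-1" and t="t"])
         (auto intro!: nn_integral_cong simp: indicator_def mult.commute)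
    finally show ?thesis .
  qed
  show ?thesis unfolding excursion_nn_def half_excursion_def eq distrib_right
    by (rule nn_integral_add) measurable
qed

lemma excursion_nn_le:
  assumes pq: "p > 0" "q > 0" and t: "0 < a" "a \<le> t" "t \<le> T" and cd: "c \<ge> 0" "d \<ge> 0"
  shows "excursion_nn t p c \<mu> q d \<nu> \<le> ennreal (h_bound (a/2) T \<mu> * exp T / p + h_bound (a/2) T \<nu> * exp T / q)"
proof -
  have "excursion_nn t p c \<mu> q d \<nu> \<le> ennreal (h_bound (a/2) T \<mu> * exp T / p) + ennreal (h_bound (a/2) T \<nu> * exp T / q)"
    using assms by (subst excursion_nn_split) (auto intro!: add_mono half_excursion_le)
  then show ?thesis using assms by (simp add: ennreal_plus h_bound_def)
qed

text \<open>A Bochner integral is 0 by default when the function is not integrable, so the two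
  versions agree only because the double integral is finite, by
  \<open>excursion_nn_le\<close>.\<close>

lemma excursion_eq_nn: "t > 0 \<Longrightarrow> p > 0 \<Longrightarrow> q > 0 \<Longrightarrow> c \<ge> 0 \<Longrightarrow> d \<ge> 0 \<Longrightarrow>
  ennreal (excursion t p c \<mu> q d \<nu>) = excursion_nn t p c \<mu> q d \<nu>"
proof -
  assume a: "t > 0" "p > 0" "q > 0" "c \<ge> 0" "d \<ge> 0"
  have fin: "excursion_nn t p c \<mu> q d \<nu> < \<top>"
    using excursion_nn_le[OF a(2,3,1) order_refl order_refl a(4,5), of \<mu> \<nu>] by (rule order_le_less_trans) simp
  let ?I = "\<lambda>b. \<integral>\<^sup>+\<tau>\<in>{0<..<t}. ennreal (h (t - \<tau>) (p * b + c) \<mu> * h \<tau> (q * b + d) \<nu>) \<partial>lborel"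
  have inner: "(LBINT \<tau>:{0<..<t}. h (t - \<tau>) (p * b + c) \<mu> * h \<tau> (q * b + d) \<nu>) = enn2real (?I b)" for b
    unfolding set_lebesgue_integral_def
    by (subst integral_eq_nn_integral)
       (auto simp: h_nonneg indicator_def intro!: arg_cong[where f=enn2real] nn_integral_cong)
  \<comment> \<open>A finite outer integral forces finite inner ones for almost every
    \<open>b\<close>; there \<open>enn2real\<close> loses nothing.\<close>
  have "AE b in lborel. ?I b * indicator {0<..} b \<noteq> \<infinity>"
    by (rule nn_integral_PInf_AE) (use fin in \<open>auto simp: excursion_nn_def top_unique less_top\<close>)
  then have "excursion_nn t p c \<mu> q d \<nu> = (\<integral>\<^sup>+b. ennreal (indicator {0<..} b * enn2real (?I b)) \<partial>lborel)"
    unfolding excursion_nn_def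
    by (intro nn_integral_cong_AE) (auto simp: indicator_def less_top elim!: eventually_mono)
  moreover have "excursion t p c \<mu> q d \<nu> = enn2real (\<integral>\<^sup>+b. ennreal (indicator {0<..} b * enn2real (?I b)) \<partial>lborel)"
    unfolding excursion_def inner unfolding set_lebesgue_integral_def
    by (subst integral_eq_nn_integral) auto
  ultimately show ?thesis using fin by (simp add: less_top)
qed

lemma excursion_nonneg: "excursion t p c \<mu> q d \<nu> \<ge> 0"
  unfolding excursion_def set_lebesgue_integral_def
  by (intro integral_nonneg_AE AE_I2) (auto simp: indicator_def h_nonneg intro!: integral_nonneg_AE AE_I2)

lemma excursion_le:
  assumes pq: "p > 0" "q > 0" and t: "0 < a" "a \<le> t" "t \<le> T" and cd: "c \<ge> 0" "d \<ge> 0"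
  shows "excursion t p c \<mu> q d \<nu> \<le> h_bound (a/2) T \<mu> * exp T / p + h_bound (a/2) T \<nu> * exp T / q"
proof -
  have "ennreal (excursion t p c \<mu> q d \<nu>) \<le> ennreal (h_bound (a/2) T \<mu> * exp T / p + h_bound (a/2) T \<nu> * exp T / q)"
    using excursion_nn_le[OF assms, of \<mu> \<nu>] excursion_eq_nn[of t p q c d \<mu> \<nu>] assms by simp
  moreover have "0 \<le> h_bound (a/2) T \<mu> * exp T / p + h_bound (a/2) T \<nu> * exp T / q"
    using assms by (intro add_nonneg_nonneg divide_nonneg_pos mult_nonneg_nonneg) (auto simp: h_bound_def)
  ultimately show ?thesis by (subst (asm) ennreal_le_iff)
qed

lemma excursion_continuous:
  assumes pq: "p > 0" "q > 0" and cd: "c \<ge> 0" "d \<ge> 0" and t: "0 < t"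
  shows "isCont (\<lambda>t. excursion t p c \<mu> q d \<nu>) t"
proof (rule continuous_at_sequentiallyI)
  fix u :: "nat \<Rightarrow> real" assume u: "u \<longlonglongrightarrow> t"
  have "\<forall>\<^sub>F n in sequentially. t/2 < u n" "\<forall>\<^sub>F n in sequentially. u n < 2 * t"
    by (rule order_tendstoD[OF u], use t in simp)+
  then have ev: "\<forall>\<^sub>F n in sequentially. t/2 < u n \<and> u n < 2 * t" by eventually_elim simp
  \<comment> \<open>\<open>half_excursion_tendsto\<close> asks for the bounds at every index;
    clipping the sequence changes only finitely many terms.\<close>
  define v where "v n = max (t/2) (min (u n) (2*t))" for n
  have v: "t/2 \<le> v n" "v n \<le> 2*t" for n using t by (auto simp: v_def)
  have vu: "\<forall>\<^sub>F n in sequentially. v n = u n" using ev by eventually_elim (simp add: v_def)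
  have vl: "v \<longlonglongrightarrow> t" by (rule Lim_transform_eventually[OF u]) (use vu in \<open>auto elim: eventually_mono\<close>)
  have vpos: "v n > 0" for n using v(1)[of n] t by linarith
  have "(\<lambda>n. excursion_nn (v n) p c \<mu> q d \<nu>) \<longlonglongrightarrow> excursion_nn t p c \<mu> q d \<nu>"
    unfolding excursion_nn_split[OF vpos] excursion_nn_split[OF t]
    by (intro tendsto_add half_excursion_tendsto vl v pq cd t)
  then have "(\<lambda>n. ennreal (excursion (v n) p c \<mu> q d \<nu>)) \<longlonglongrightarrow> ennreal (excursion t p c \<mu> q d \<nu>)"
    using pq cd t vpos by (simp add: excursion_eq_nn)
  then have "(\<lambda>n. excursion (v n) p c \<mu> q d \<nu>) \<longlonglongrightarrow> excursion t p c \<mu> q d \<nu>"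
    by (subst (asm) tendsto_ennreal_iff) (auto simp: excursion_nonneg)
  then show "(\<lambda>n. excursion (u n) p c \<mu> q d \<nu>) \<longlonglongrightarrow> excursion t p c \<mu> q d \<nu>"
    by (rule Lim_transform_eventually) (use vu in \<open>auto elim: eventually_mono\<close>)
qed

section \<open>The transition density and its Laplace transform\<close>

text \<open>The density of the part of the motion that has not yet hit the skew level.\<close>

definition killed_density :: "real \<Rightarrow> real \<Rightarrow> real \<Rightarrow> real \<Rightarrow> real" where
  "killed_density t x y \<mu> = \<phi> t (y - x) \<mu> - exp (- 2 * \<mu> * x) * \<phi> t (x + y) \<mu>"

lemma transition_density_pos:
  "x \<ge> 0 \<Longrightarrow> y > 0 \<Longrightarrow> transition_density \<beta> \<mu>p \<mu>m t x y =
    killed_density t x y \<mu>p + 2 * (1 + \<beta>) * exp (2 * \<mu>p * y) * excursion t (1 + \<beta>) (x + y) \<mu>p (1 - \<beta>) 0 (- \<mu>m)"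
  by (simp add: transition_density_def killed_density_def excursion_def add.assoc)

lemma set_integral_reflect_Ioo:
  fixes f :: "real \<Rightarrow> real"
  shows "(LBINT \<tau>:{0<..<t}. f (t - \<tau>)) = (LBINT \<tau>:{0<..<t}. f \<tau>)"
  unfolding set_lebesgue_integral_def
  by (subst lborel_integral_real_affine[where c="-1" and t=t])
     (auto intro!: Bochner_Integration.integral_cong simp: indicator_def)

lemma excursion_commute: "excursion t p c \<mu> q d \<nu> = excursion t q d \<nu> p c \<mu>"
proof -
  have "(LBINT \<tau>:{0<..<t}. h (t - \<tau>) (p * b + c) \<mu> * h \<tau> (q * b + d) \<nu>)
    = (LBINT \<tau>:{0<..<t}. h (t - \<tau>) (q * b + d) \<nu> * h \<tau> (p * b + c) \<mu>)" for b
    using set_integral_reflect_Ioo[of t "\<lambda>\<tau>. h \<tau> (p * b + c) \<mu> * h (t - \<tau>) (q * b + d) \<nu>"]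
    by (simp add: mult.commute)
  then show ?thesis by (simp add: excursion_def)
qed

text \<open>The weight of the image term may be written in the starting point or in the end point.
  The density uses the first form on the right and the second on the left half-line.\<close>

lemma \<phi>_reflect:
  assumes "t > 0"
  shows "exp (2 * \<mu> * y) * \<phi> t (- x - y) \<mu> = exp (- 2 * \<mu> * x) * \<phi> t (x + y) \<mu>"
proof -
  have "2 * \<mu> * y - (- x - y - \<mu> * t)\<^sup>2 / (2 * t) = - 2 * \<mu> * x - ((x + y - \<mu> * t)\<^sup>2 / (2 * t))"
    using assms by (simp add: field_simps power2_eq_square)
  then have "exp (2 * \<mu> * y) * exp (- ((- x - y - \<mu> * t)\<^sup>2 / (2 * t))) = exp (- 2 * \<mu> * x) * exp (- ((x + y - \<mu> * t)\<^sup>2 / (2 * t)))"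
    by (simp add: exp_add[symmetric])
  then show ?thesis by (simp add: \<phi>_def mult.left_commute)
qed

text \<open>Carries the formula of the branch \<open>x > 0\<close> over to \<open>x = 0\<close>,
  where the definition switches branches: there the killed part vanishes by
  \<open>\<phi>_reflect\<close>, and the two excursion integrals differ by exchanging \<tau> and t -
  \<tau>.\<close>

lemma transition_density_neg:
  assumes "x \<ge> 0" "y < 0" "t > 0"
  shows "transition_density \<beta> \<mu>p \<mu>m t x y =
    2 * (1 - \<beta>) * exp (2 * \<mu>m * y) * excursion t (1 + \<beta>) x \<mu>p (1 - \<beta>) (- y) (- \<mu>m)"
proof (cases "x > 0")
  case True then show ?thesis using assms by (simp add: transition_density_def excursion_def)
next
  case False
  then have x: "x = 0" using assms by simp
  have "exp (2 * \<mu>m * y) * \<phi> t (- y) \<mu>m = \<phi> t y \<mu>m"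
    using \<phi>_reflect[OF assms(3), of \<mu>m y 0] by simp
  moreover have "(LBINT b:{0<..}. (LBINT \<tau>:{0<..<t}. h \<tau> ((1 + \<beta>) * b) \<mu>p * h (t - \<tau>) ((1 - \<beta>) * b - y) (- \<mu>m)))
     = excursion t (1 - \<beta>) (- y) (- \<mu>m) (1 + \<beta>) 0 \<mu>p"
    by (simp add: excursion_def mult.commute)
  ultimately show ?thesis using x assms
    by (simp add: transition_density_def excursion_commute[of t "1 + \<beta>"])
qed

lemma transition_density_0: "transition_density \<beta> \<mu>p \<mu>m t x 0 = 0"
  by (simp add: transition_density_def)

text \<open>If \<open>X\<close> solves the equation for \<beta>, \<open>\<mu>p\<close>,
  \<open>\<mu>m\<close>, then its negative solves it for the parameters on the right. The formula
  has the same symmetry, and negative starting points are reduced to positive ones by it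
  throughout.\<close>

lemma transition_density_reflect:
  assumes "t > 0" "x \<noteq> 0"
  shows "transition_density \<beta> \<mu>p \<mu>m t x y = transition_density (- \<beta>) (- \<mu>m) (- \<mu>p) t (- x) (- y)"
proof -
  have "\<phi> t z (- \<mu>) = \<phi> t (- z) \<mu>" for z \<mu>
  proof -
    have "(z - - \<mu> * t)\<^sup>2 = (- z - \<mu> * t)\<^sup>2" by (simp add: power2_eq_square algebra_simps)
    then show ?thesis by (simp add: \<phi>_def)
  qed
  moreover have "exp (2 * \<mu> * y) * \<phi> t (- x - y) \<mu> = exp (- 2 * \<mu> * x) * \<phi> t (x + y) \<mu>" for \<mu>
    by (rule \<phi>_reflect[OF assms(1)])
  ultimately show ?thesis using assms
    by (simp add: transition_density_def mult.commute algebra_simps)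
qed

lemma \<phi>_nonneg: "t > 0 \<Longrightarrow> \<phi> t z \<mu> \<ge> 0"
  by (simp add: \<phi>_def)

lemma \<phi>_le: "0 < a \<Longrightarrow> a \<le> t \<Longrightarrow> \<phi> t z \<mu> \<le> 1 / sqrt (2 * pi * a)"
proof -
  assume a: "0 < a" "a \<le> t"
  have "1 / sqrt (2 * pi * t) * exp (- ((z - \<mu> * t)\<^sup>2 / (2 * t))) \<le> 1 / sqrt (2 * pi * a) * 1"
    using a by (intro mult_mono) (auto intro!: divide_left_mono mult_pos_pos)
  then show ?thesis by (simp add: \<phi>_def)
qed

text \<open>The exponents of the Gaussian and of its weighted image differ by
  \<open>2 * x * y / t\<close>, which has a sign when both points lie on the same side.\<close>

lemma killed_density_nonneg:
  assumes "x \<ge> 0" "y \<ge> 0" "t > 0" shows "killed_density t x y \<mu> \<ge> 0"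
proof -
  have "- 2 * \<mu> * x - (x + y - \<mu> * t)\<^sup>2 / (2 * t) \<le> - ((y - x - \<mu> * t)\<^sup>2 / (2 * t))"
  proof -
    have "- ((y - x - \<mu> * t)\<^sup>2 / (2 * t)) - (- 2 * \<mu> * x - (x + y - \<mu> * t)\<^sup>2 / (2 * t)) = 2 * x * y / t"
      using assms by (simp add: field_simps power2_eq_square)
    moreover have "0 \<le> 2 * x * y / t" using assms by simp
    ultimately show ?thesis by linarith
  qed
  then have "exp (- 2 * \<mu> * x) * exp (- ((x + y - \<mu> * t)\<^sup>2 / (2 * t))) \<le> exp (- ((y - x - \<mu> * t)\<^sup>2 / (2 * t)))"
    by (simp add: exp_add[symmetric])
  then have "1 / sqrt (2 * pi * t) * (exp (- 2 * \<mu> * x) * exp (- ((x + y - \<mu> * t)\<^sup>2 / (2 * t)))) \<le> 1 / sqrt (2 * pi * t) * exp (- ((y - x - \<mu> * t)\<^sup>2 / (2 * t)))"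
    using assms by (intro mult_left_mono) auto
  then show ?thesis by (simp add: killed_density_def \<phi>_def mult_ac)
qed

lemma transition_density_nonneg_aux:
  assumes "\<beta> \<in> {-1<..<1}" "x \<ge> 0" "t > 0"
  shows "transition_density \<beta> \<mu>p \<mu>m t x y \<ge> 0"
  using assms excursion_nonneg killed_density_nonneg
  by (cases y "0::real" rule: linorder_cases)
     (auto simp: transition_density_pos transition_density_neg transition_density_0
        intro!: add_nonneg_nonneg mult_nonneg_nonneg simp del: distrib_left_numeral)

lemma transition_density_nonneg:
  assumes "\<beta> \<in> {-1<..<1}" "t > 0"
  shows "transition_density \<beta> \<mu>p \<mu>m t x y \<ge> 0"
proof (cases "x \<ge> 0")
  case False
  then have "transition_density (- \<beta>) (- \<mu>m) (- \<mu>p) t (- x) (- y) \<ge> 0"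
    using assms by (intro transition_density_nonneg_aux) auto
  then show ?thesis using False assms by (subst transition_density_reflect) auto
qed (use assms transition_density_nonneg_aux in blast)

lemma \<phi>_measurable [measurable]:
  assumes [measurable]: "f \<in> borel_measurable M" "g \<in> borel_measurable M"
  shows "(\<lambda>x. \<phi> (f x) (g x) \<mu>) \<in> borel_measurable M"
  unfolding \<phi>_def by measurable

lemma excursion_measurable [measurable]:
  assumes [measurable]: "t \<in> borel_measurable M" "c \<in> borel_measurable M" "d \<in> borel_measurable M"
  shows "(\<lambda>x. excursion (t x) p (c x) \<mu> q (d x) \<nu>) \<in> borel_measurable M"
proof -
  have eq: "excursion (t x) p (c x) \<mu> q (d x) \<nu> = (\<integral>b. indicator {0<..} b * (\<integral>\<tau>. (if 0 < \<tau> \<and> \<tau> < t x then h (t x - \<tau>) (p * b + c x) \<mu> * h \<tau> (q * b + d x) \<nu> else 0) \<partial>lborel) \<partial>lborel)" for x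
    unfolding excursion_def set_lebesgue_integral_def
    by (auto intro!: Bochner_Integration.integral_cong simp: indicator_def)
  show ?thesis unfolding eq by measurable
qed

text \<open>Cut off at nonpositive times because the closed form for \<open>y < 0\<close> holds for
  \<open>t > 0\<close>. Joint measurability prepares the exchange of the integrals over
  \<open>t\<close> and \<open>y\<close>.\<close>

lemma transition_density_measurable_aux:
  assumes "x \<ge> 0"
  shows "(\<lambda>(t, y). if t > 0 then transition_density \<beta> \<mu>p \<mu>m t x y else 0) \<in> borel_measurable (borel \<Otimes>\<^sub>M borel)"
proof -
  have eq: "(\<lambda>(t, y). if t > 0 then transition_density \<beta> \<mu>p \<mu>m t x y else 0) = (\<lambda>(t, y). if t > 0 then
      if y > 0 then \<phi> t (y - x) \<mu>p - exp (- 2 * \<mu>p * x) * \<phi> t (x + y) \<mu>p + 2 * (1 + \<beta>) * exp (2 * \<mu>p * y) * excursion t (1 + \<beta>) (x + y) \<mu>p (1 - \<beta>) 0 (- \<mu>m)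
      else if y < 0 then 2 * (1 - \<beta>) * exp (2 * \<mu>m * y) * excursion t (1 + \<beta>) x \<mu>p (1 - \<beta>) (- y) (- \<mu>m) else 0 else 0)"
    using assms by (auto simp: fun_eq_iff transition_density_pos transition_density_neg transition_density_0 killed_density_def)
  show ?thesis unfolding eq by measurable
qed

lemma transition_density_measurable [measurable]:
  "(\<lambda>(t, y). if t > 0 then transition_density \<beta> \<mu>p \<mu>m t x y else 0) \<in> borel_measurable (borel \<Otimes>\<^sub>M borel)"
proof (cases "x \<ge> 0")
  case False
  have [measurable]: "(\<lambda>(t, y). if t > 0 then transition_density (- \<beta>) (- \<mu>m) (- \<mu>p) t (- x) y else 0) \<in> borel_measurable (borel \<Otimes>\<^sub>M borel)"
    using False by (intro transition_density_measurable_aux) auto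
  have "(\<lambda>p. (\<lambda>(t, y). if t > 0 then transition_density (- \<beta>) (- \<mu>m) (- \<mu>p) t (- x) y else 0) (fst p, - snd p)) \<in> borel_measurable (borel \<Otimes>\<^sub>M borel)"
    by measurable
  moreover have "(\<lambda>p. (\<lambda>(t, y). if t > 0 then transition_density (- \<beta>) (- \<mu>m) (- \<mu>p) t (- x) y else 0) (fst p, - snd p)) = (\<lambda>(t, y). if t > 0 then transition_density \<beta> \<mu>p \<mu>m t x y else 0)"
    using False by (auto simp: fun_eq_iff transition_density_reflect[of _ x])
  ultimately show ?thesis by (simp only:)
qed (rule transition_density_measurable_aux)

lemma borel_measurable_transition_density:
  assumes "t > 0"
  shows "transition_density \<beta> \<mu>p \<mu>m t x \<in> borel_measurable borel"
proof -
  have "(\<lambda>y. (\<lambda>(t, y). if t > 0 then transition_density \<beta> \<mu>p \<mu>m t x y else 0) (t, y)) \<in> borel_measurable borel"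
    by measurable
  then show ?thesis using assms by simp
qed

text \<open>Intended for \<open>x \<ge> 0\<close>. For \<open>y > 0\<close> the first summand is the
  Green function of the motion killed at 0; the terms divided by \<open>W\<close> account for the
  paths that reach 0. The null point \<open>y = 0\<close> falls into the second branch.\<close>

definition green :: "real \<Rightarrow> real \<Rightarrow> real \<Rightarrow> real \<Rightarrow> real \<Rightarrow> real \<Rightarrow> real" where
  "green \<beta> \<mu>p \<mu>m \<alpha> x y =
    (let c = sqrt (\<mu>p\<^sup>2 + 2 * \<alpha>); r = char_root \<alpha> \<mu>p; r' = char_root \<alpha> (- \<mu>m);
         W = (1 + \<beta>) * r + (1 - \<beta>) * r'
     in if y > 0 then exp (\<mu>p * (y - x)) * (exp (- c * \<bar>y - x\<bar>) - exp (- c * (x + y))) / c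
          + 2 * (1 + \<beta>) * exp (2 * \<mu>p * y) * exp (- (x + y) * r) / W
        else 2 * (1 - \<beta>) * exp (2 * \<mu>m * y) * exp (- x * r + y * r') / W)"

text \<open>Subtraction in \<open>ennreal\<close> truncates, so the image term has to be finite
  after integration and dominated pointwise; the domination is
  \<open>killed_density_nonneg\<close>.\<close>

lemma killed_density_laplace:
  fixes \<mu> :: real
  assumes \<alpha>: "\<alpha> > 0" and "x \<ge> 0" "y > 0"
  defines "c \<equiv> sqrt (\<mu>\<^sup>2 + 2 * \<alpha>)"
  shows "(\<integral>\<^sup>+t\<in>{0<..}. ennreal (exp (- \<alpha> * t) * killed_density t x y \<mu>) \<partial>lborel)
    = ennreal (exp (\<mu> * (y - x)) * (exp (- c * \<bar>y - x\<bar>) - exp (- c * (x + y))) / c)"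
proof -
  have c: "c > 0" using \<alpha> by (simp add: c_def add_nonneg_pos)
  let ?a = "\<lambda>t. ennreal (exp (- \<alpha> * t) * \<phi> t (y - x) \<mu>) * indicator {0<..} t"
  let ?b = "\<lambda>t. ennreal (exp (- 2 * \<mu> * x)) * (ennreal (exp (- \<alpha> * t) * \<phi> t (x + y) \<mu>) * indicator {0<..} t)"
  have B: "(\<integral>\<^sup>+t. ?b t \<partial>lborel) = ennreal (exp (\<mu> * (y - x)) * exp (- c * (x + y)) / c)"
  proof -
    have "(\<integral>\<^sup>+t. ?b t \<partial>lborel) = ennreal (exp (- 2 * \<mu> * x)) * ennreal (exp (\<mu> * (x + y) - c * \<bar>x + y\<bar>) / c)"
      using laplace_\<phi>[OF \<alpha>, of "x + y" \<mu>] by (subst nn_integral_cmult) (auto simp: c_def)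
    also have "\<dots> = ennreal (exp (\<mu> * (y - x)) * exp (- c * (x + y)) / c)"
      using assms by (simp add: ennreal_mult'[symmetric] exp_add[symmetric]) (simp add: algebra_simps)
    finally show ?thesis .
  qed
  have "(\<integral>\<^sup>+t\<in>{0<..}. ennreal (exp (- \<alpha> * t) * killed_density t x y \<mu>) \<partial>lborel) = (\<integral>\<^sup>+t. ?a t - ?b t \<partial>lborel)"
  proof (intro nn_integral_cong)
    fix t :: real
    show "ennreal (exp (- \<alpha> * t) * killed_density t x y \<mu>) * indicator {0<..} t = ?a t - ?b t"
    proof (cases "t > 0")
      case True
      then show ?thesis using \<phi>_nonneg[OF True]
        by (simp add: killed_density_def ennreal_mult'[symmetric] ennreal_minus right_diff_distrib mult.left_commute)
    qed simp
  qed
  also have "\<dots> = (\<integral>\<^sup>+t. ?a t \<partial>lborel) - (\<integral>\<^sup>+t. ?b t \<partial>lborel)"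
  proof (rule nn_integral_diff)
    show "(\<integral>\<^sup>+t. ?b t \<partial>lborel) \<noteq> \<infinity>" unfolding B by simp
    show "AE t in lborel. ?b t \<le> ?a t"
    proof (rule AE_I2)
      fix t :: real
      show "?b t \<le> ?a t"
      proof (cases "t > 0")
        case True
        have "exp (- 2 * \<mu> * x) * \<phi> t (x + y) \<mu> \<le> \<phi> t (y - x) \<mu>"
          using killed_density_nonneg[of x y t \<mu>] assms True by (simp add: killed_density_def)
        then have "exp (- \<alpha> * t) * (exp (- 2 * \<mu> * x) * \<phi> t (x + y) \<mu>) \<le> exp (- \<alpha> * t) * \<phi> t (y - x) \<mu>"
          by (intro mult_left_mono) auto
        then show ?thesis using True by (simp add: ennreal_mult'[symmetric] ennreal_leI mult.left_commute)
      qed simp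
    qed
  qed measurable
  also have "\<dots> = ennreal (exp (\<mu> * (y - x) - c * \<bar>y - x\<bar>) / c) - ennreal (exp (\<mu> * (y - x)) * exp (- c * (x + y)) / c)"
    unfolding B laplace_\<phi>[OF \<alpha>] c_def ..
  also have "\<dots> = ennreal (exp (\<mu> * (y - x)) * (exp (- c * \<bar>y - x\<bar>) - exp (- c * (x + y))) / c)"
    using c by (subst ennreal_minus) (auto simp: right_diff_distrib diff_divide_distrib exp_diff exp_minus divide_inverse mult_ac)
  finally show ?thesis .
qed

text \<open>At \<open>y = 0\<close> the density is 0 by convention while \<open>green\<close> is
  positive, hence the exclusion of that point.\<close>

lemma transition_density_laplace:
  assumes \<beta>: "\<beta> \<in> {-1<..<1}" and \<alpha>: "\<alpha> > 0" and x: "x \<ge> 0" and y: "y \<noteq> 0"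
  shows "(\<integral>\<^sup>+t\<in>{0<..}. ennreal (exp (- \<alpha> * t) * transition_density \<beta> \<mu>p \<mu>m t x y) \<partial>lborel)
    = ennreal (green \<beta> \<mu>p \<mu>m \<alpha> x y)"
proof -
  define r r' where "r = char_root \<alpha> \<mu>p" and "r' = char_root \<alpha> (- \<mu>m)"
  have r: "r > 0" "r' > 0" using \<alpha> by (auto simp: r_def r'_def char_root_pos)
  have exc: "(\<integral>\<^sup>+t. ennreal k * (ennreal (exp (- \<alpha> * t) * excursion t (1 + \<beta>) c \<mu>p (1 - \<beta>) d (- \<mu>m)) * indicator {0<..} t) \<partial>lborel)
     = ennreal (k * exp (- c * r - d * r') / ((1 + \<beta>) * r + (1 - \<beta>) * r'))"
    if "k \<ge> 0" "c \<ge> 0" "d \<ge> 0" for k c d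
  proof -
    have "(\<integral>\<^sup>+t. (ennreal (exp (- \<alpha> * t) * excursion t (1 + \<beta>) c \<mu>p (1 - \<beta>) d (- \<mu>m)) * indicator {0<..} t) \<partial>lborel)
       = (\<integral>\<^sup>+t\<in>{0<..}. ennreal (exp (- \<alpha> * t)) * excursion_nn t (1 + \<beta>) c \<mu>p (1 - \<beta>) d (- \<mu>m) \<partial>lborel)"
      using \<beta> that by (intro nn_integral_cong) (auto simp: indicator_def ennreal_mult' excursion_eq_nn)
    also have "\<dots> = ennreal (exp (- c * r - d * r') / ((1 + \<beta>) * r + (1 - \<beta>) * r'))"
      using excursion_nn_laplace[OF \<alpha>, of "1 + \<beta>" "1 - \<beta>" c d \<mu>p "- \<mu>m"] \<beta> that by (simp add: r_def r'_def)
    finally show ?thesis using that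
      by (subst nn_integral_cmult) (auto simp: ennreal_mult'[symmetric])
  qed
  show ?thesis
  proof (cases "y > 0")
    case True
    have "(\<integral>\<^sup>+t\<in>{0<..}. ennreal (exp (- \<alpha> * t) * transition_density \<beta> \<mu>p \<mu>m t x y) \<partial>lborel)
      = (\<integral>\<^sup>+t. ennreal (exp (- \<alpha> * t) * killed_density t x y \<mu>p) * indicator {0<..} t
          + ennreal (2 * (1 + \<beta>) * exp (2 * \<mu>p * y)) * (ennreal (exp (- \<alpha> * t) * excursion t (1 + \<beta>) (x + y) \<mu>p (1 - \<beta>) 0 (- \<mu>m)) * indicator {0<..} t) \<partial>lborel)"
    proof (intro nn_integral_cong)
      fix t :: real
      have "exp (- \<alpha> * t) * transition_density \<beta> \<mu>p \<mu>m t x y = exp (- \<alpha> * t) * killed_density t x y \<mu>p + (2 * (1 + \<beta>) * exp (2 * \<mu>p * y)) * (exp (- \<alpha> * t) * excursion t (1 + \<beta>) (x + y) \<mu>p (1 - \<beta>) 0 (- \<mu>m))"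
        using True x by (simp add: transition_density_pos algebra_simps)
      moreover have "t > 0 \<Longrightarrow> killed_density t x y \<mu>p \<ge> 0" using True x by (intro killed_density_nonneg) auto
      moreover have "excursion t (1 + \<beta>) (x + y) \<mu>p (1 - \<beta>) 0 (- \<mu>m) \<ge> 0" by (rule excursion_nonneg)
      ultimately show "ennreal (exp (- \<alpha> * t) * transition_density \<beta> \<mu>p \<mu>m t x y) * indicator {0<..} t = ennreal (exp (- \<alpha> * t) * killed_density t x y \<mu>p) * indicator {0<..} t
          + ennreal (2 * (1 + \<beta>) * exp (2 * \<mu>p * y)) * (ennreal (exp (- \<alpha> * t) * excursion t (1 + \<beta>) (x + y) \<mu>p (1 - \<beta>) 0 (- \<mu>m)) * indicator {0<..} t)"
        using \<beta> by (cases "t > 0") (simp_all add: ennreal_mult'[symmetric] ennreal_plus[symmetric] del: ennreal_plus)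
    qed
    also have "\<dots> = (\<integral>\<^sup>+t. ennreal (exp (- \<alpha> * t) * killed_density t x y \<mu>p) * indicator {0<..} t \<partial>lborel)
        + (\<integral>\<^sup>+t. ennreal (2 * (1 + \<beta>) * exp (2 * \<mu>p * y)) * (ennreal (exp (- \<alpha> * t) * excursion t (1 + \<beta>) (x + y) \<mu>p (1 - \<beta>) 0 (- \<mu>m)) * indicator {0<..} t) \<partial>lborel)"
      unfolding killed_density_def by (rule nn_integral_add) measurable
    also have "\<dots> = ennreal (exp (\<mu>p * (y - x)) * (exp (- sqrt (\<mu>p\<^sup>2 + 2 * \<alpha>) * \<bar>y - x\<bar>) - exp (- sqrt (\<mu>p\<^sup>2 + 2 * \<alpha>) * (x + y))) / sqrt (\<mu>p\<^sup>2 + 2 * \<alpha>))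
       + ennreal (2 * (1 + \<beta>) * exp (2 * \<mu>p * y) * exp (- (x + y) * r) / ((1 + \<beta>) * r + (1 - \<beta>) * r'))"
      using killed_density_laplace[OF \<alpha> x True, of \<mu>p] exc[of "2 * (1 + \<beta>) * exp (2 * \<mu>p * y)" "x + y" 0] True x \<beta>
      by (simp only: ) simp
    also have "\<dots> = ennreal (green \<beta> \<mu>p \<mu>m \<alpha> x y)"
      unfolding green_def Let_def using True r x \<alpha> \<beta>
      by (subst ennreal_plus[symmetric])
         (auto simp: r_def r'_def intro!: divide_nonneg_pos divide_nonneg_nonneg mult_nonneg_nonneg add_nonneg_nonneg mult_left_mono)
    finally show ?thesis .
  next
    case False
    then have y: "y < 0" using y by simp
    have "(\<integral>\<^sup>+t\<in>{0<..}. ennreal (exp (- \<alpha> * t) * transition_density \<beta> \<mu>p \<mu>m t x y) \<partial>lborel)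
      = (\<integral>\<^sup>+t. ennreal (2 * (1 - \<beta>) * exp (2 * \<mu>m * y)) * (ennreal (exp (- \<alpha> * t) * excursion t (1 + \<beta>) x \<mu>p (1 - \<beta>) (- y) (- \<mu>m)) * indicator {0<..} t) \<partial>lborel)"
    proof (intro nn_integral_cong)
      fix t :: real
      show "ennreal (exp (- \<alpha> * t) * transition_density \<beta> \<mu>p \<mu>m t x y) * indicator {0<..} t = ennreal (2 * (1 - \<beta>) * exp (2 * \<mu>m * y)) * (ennreal (exp (- \<alpha> * t) * excursion t (1 + \<beta>) x \<mu>p (1 - \<beta>) (- y) (- \<mu>m)) * indicator {0<..} t)"
      proof (cases "t > 0")
        case True
        have "exp (- \<alpha> * t) * transition_density \<beta> \<mu>p \<mu>m t x y = (2 * (1 - \<beta>) * exp (2 * \<mu>m * y)) * (exp (- \<alpha> * t) * excursion t (1 + \<beta>) x \<mu>p (1 - \<beta>) (- y) (- \<mu>m))"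
          using True x y by (simp add: transition_density_neg algebra_simps)
        then show ?thesis using True \<beta> by (simp only:) (simp add: ennreal_mult'[symmetric])
      qed simp
    qed
    also have "\<dots> = ennreal (green \<beta> \<mu>p \<mu>m \<alpha> x y)"
      using exc[of "2 * (1 - \<beta>) * exp (2 * \<mu>m * y)" x "- y"] x y \<beta>
      by (simp add: green_def Let_def r_def r'_def)
    finally show ?thesis .
  qed
qed

text \<open>The bound is local in \<open>y\<close> because of the exponential factors, and in time
  it stays away from 0, where the Gaussian density is unbounded. Test functions of compact support
  ask for no more.\<close>

lemma transition_density_bounded_aux:
  assumes \<beta>: "\<beta> \<in> {-1<..<1}" and x: "x \<ge> 0" and a: "0 < a" "a \<le> T"
  obtains C where "\<And>t y. a \<le> t \<Longrightarrow> t \<le> T \<Longrightarrow> \<bar>y\<bar> \<le> R \<Longrightarrow> transition_density \<beta> \<mu>p \<mu>m t x y \<le> C"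
proof -
  define E where "E = h_bound (a/2) T \<mu>p * exp T / (1 + \<beta>) + h_bound (a/2) T (- \<mu>m) * exp T / (1 - \<beta>)"
  define C where "C = 1 / sqrt (2 * pi * a) + 2 * (1 + \<beta>) * exp (2 * \<bar>\<mu>p\<bar> * R) * E + 2 * (1 - \<beta>) * exp (2 * \<bar>\<mu>m\<bar> * R) * E"
  have E: "E \<ge> 0" using a \<beta> by (auto simp: E_def h_bound_def intro!: add_nonneg_nonneg divide_nonneg_pos mult_nonneg_nonneg)
  have e: "exp (2 * \<mu> * y) \<le> exp (2 * \<bar>\<mu>\<bar> * R)" if "\<bar>y\<bar> \<le> R" for \<mu> y
  proof -
    have "\<mu> * y \<le> \<bar>\<mu>\<bar> * \<bar>y\<bar>" by (metis abs_ge_self abs_mult)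
    also have "\<dots> \<le> \<bar>\<mu>\<bar> * R" using that by (intro mult_left_mono) auto
    finally show ?thesis by simp
  qed
  have "transition_density \<beta> \<mu>p \<mu>m t x y \<le> C" if t: "a \<le> t" "t \<le> T" and y: "\<bar>y\<bar> \<le> R" for t y
  proof (cases y "0::real" rule: linorder_cases)
    case equal then show ?thesis using E \<beta> a by (simp add: transition_density_0 C_def)
  next
    case greater
    have "transition_density \<beta> \<mu>p \<mu>m t x y = killed_density t x y \<mu>p + 2 * (1 + \<beta>) * exp (2 * \<mu>p * y) * excursion t (1 + \<beta>) (x + y) \<mu>p (1 - \<beta>) 0 (- \<mu>m)"
      by (rule transition_density_pos[OF x greater])
    also have "\<dots> \<le> 1 / sqrt (2 * pi * a) + 2 * (1 + \<beta>) * exp (2 * \<bar>\<mu>p\<bar> * R) * E"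
    proof (intro add_mono mult_mono e y)
      show "killed_density t x y \<mu>p \<le> 1 / sqrt (2 * pi * a)"
        using \<phi>_le[OF a(1) t(1), of "y - x" \<mu>p] \<phi>_nonneg[of t "x + y" \<mu>p] t a unfolding killed_density_def
        by (smt (verit) exp_gt_zero mult_nonneg_nonneg)
      show "excursion t (1 + \<beta>) (x + y) \<mu>p (1 - \<beta>) 0 (- \<mu>m) \<le> E"
        unfolding E_def using \<beta> greater x a t by (intro excursion_le) auto
    qed (use \<beta> excursion_nonneg in auto)
    also have "\<dots> \<le> C" using E \<beta> by (simp add: C_def)
    finally show ?thesis .
  next
    case less
    have "transition_density \<beta> \<mu>p \<mu>m t x y = 2 * (1 - \<beta>) * exp (2 * \<mu>m * y) * excursion t (1 + \<beta>) x \<mu>p (1 - \<beta>) (- y) (- \<mu>m)"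
      using less x t a by (intro transition_density_neg) auto
    also have "\<dots> \<le> 2 * (1 - \<beta>) * exp (2 * \<bar>\<mu>m\<bar> * R) * E"
    proof (intro mult_mono e y)
      show "excursion t (1 + \<beta>) x \<mu>p (1 - \<beta>) (- y) (- \<mu>m) \<le> E"
        unfolding E_def using \<beta> less x a t by (intro excursion_le) auto
    qed (use \<beta> excursion_nonneg in auto)
    also have "\<dots> \<le> C" using E \<beta> a by (simp add: C_def)
    finally show ?thesis .
  qed
  then show thesis by (rule that)
qed

lemma transition_density_bounded:
  assumes \<beta>: "\<beta> \<in> {-1<..<1}" and a: "0 < a" "a \<le> T"
  obtains C where "\<And>t y. a \<le> t \<Longrightarrow> t \<le> T \<Longrightarrow> \<bar>y\<bar> \<le> R \<Longrightarrow> transition_density \<beta> \<mu>p \<mu>m t x y \<le> C"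
proof (cases "x \<ge> 0")
  case True then show thesis using transition_density_bounded_aux[OF \<beta> True a] that by blast
next
  case False
  have "- \<beta> \<in> {-1<..<1}" "- x \<ge> 0" using \<beta> False by auto
  then obtain C where C: "\<And>t y. a \<le> t \<Longrightarrow> t \<le> T \<Longrightarrow> \<bar>y\<bar> \<le> R \<Longrightarrow> transition_density (- \<beta>) (- \<mu>m) (- \<mu>p) t (- x) y \<le> C"
    using transition_density_bounded_aux[of "- \<beta>" "- x" a T R "- \<mu>m" "- \<mu>p"] a by blast
  show thesis
  proof (rule that)
    fix t y assume "a \<le> t" "t \<le> T" "\<bar>y\<bar> \<le> R"
    then show "transition_density \<beta> \<mu>p \<mu>m t x y \<le> C"
      using C[of t "- y"] a False by (subst transition_density_reflect) auto
  qed
qed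

section \<open>Continuity in time and Laplace transform of the semigroup applied to a test
  function\<close>

lemma isCont_\<phi>: "t > 0 \<Longrightarrow> isCont (\<lambda>t. \<phi> t z \<mu>) t"
  unfolding \<phi>_def by (auto intro!: continuous_intros)

lemma transition_density_isCont_aux:
  assumes \<beta>: "\<beta> \<in> {-1<..<1}" and x: "x \<ge> 0" and t: "t > 0"
  shows "isCont (\<lambda>t. transition_density \<beta> \<mu>p \<mu>m t x y) t"
proof (cases y "0::real" rule: linorder_cases)
  case equal then show ?thesis by (simp add: transition_density_0)
next
  case greater
  show ?thesis unfolding transition_density_pos[OF x greater] killed_density_def
    using \<beta> t greater x by (intro continuous_intros isCont_\<phi> excursion_continuous) auto
next
  case less
  have *: "isCont (\<lambda>t. 2 * (1 - \<beta>) * exp (2 * \<mu>m * y) * excursion t (1 + \<beta>) x \<mu>p (1 - \<beta>) (- y) (- \<mu>m)) t"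
    using \<beta> t less x by (intro continuous_intros excursion_continuous) auto
  have "\<forall>\<^sub>F s in nhds t. s \<in> {0<..}" by (rule eventually_nhds_in_open) (use t in auto)
  then have "\<forall>\<^sub>F s in nhds t. transition_density \<beta> \<mu>p \<mu>m s x y = 2 * (1 - \<beta>) * exp (2 * \<mu>m * y) * excursion s (1 + \<beta>) x \<mu>p (1 - \<beta>) (- y) (- \<mu>m)"
    by eventually_elim (use x less transition_density_neg in auto)
  from isCont_cong[OF this] * show ?thesis by (rule iffD2)
qed

lemma transition_density_isCont:
  assumes \<beta>: "\<beta> \<in> {-1<..<1}" and t: "t > 0"
  shows "isCont (\<lambda>t. transition_density \<beta> \<mu>p \<mu>m t x y) t"
proof (cases "x \<ge> 0")
  case False
  have *: "isCont (\<lambda>t. transition_density (- \<beta>) (- \<mu>m) (- \<mu>p) t (- x) (- y)) t"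
    using \<beta> t False by (intro transition_density_isCont_aux) auto
  have "\<forall>\<^sub>F s in nhds t. s \<in> {0<..}" by (rule eventually_nhds_in_open) (use t in auto)
  then have "\<forall>\<^sub>F s in nhds t. transition_density \<beta> \<mu>p \<mu>m s x y = transition_density (- \<beta>) (- \<mu>m) (- \<mu>p) s (- x) (- y)"
    by eventually_elim (rule transition_density_reflect, use False in auto)
  from isCont_cong[OF this] * show ?thesis by (rule iffD2)
qed (use transition_density_isCont_aux assms in blast)

lemma transition_semigroup_isCont:
  fixes g :: "real \<Rightarrow> real"
  assumes \<beta>: "\<beta> \<in> {-1<..<1}" and t: "t > 0"
    and g[measurable]: "g \<in> borel_measurable borel" and gb: "\<And>y. \<bar>g y\<bar> \<le> G" and gs: "\<And>y. \<bar>y\<bar> > R \<Longrightarrow> g y = 0"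
  shows "integrable lborel (\<lambda>y. transition_density \<beta> \<mu>p \<mu>m t x y * g y)"
    and "isCont (\<lambda>t. \<integral>y. transition_density \<beta> \<mu>p \<mu>m t x y * g y \<partial>lborel) t"
proof -
  have G: "G \<ge> 0" using gb[of 0] by linarith
  obtain C where C: "\<And>s y. t/2 \<le> s \<Longrightarrow> s \<le> 2*t \<Longrightarrow> \<bar>y\<bar> \<le> R \<Longrightarrow> transition_density \<beta> \<mu>p \<mu>m s x y \<le> C"
    using transition_density_bounded[OF \<beta>, of "t/2" "2*t" R \<mu>p \<mu>m x] t by auto
  have dom: "norm (transition_density \<beta> \<mu>p \<mu>m s x y * g y) \<le> (C * G) * indicator {-R..R} y" if "t/2 \<le> s" "s \<le> 2*t" for s y
  proof (cases "\<bar>y\<bar> \<le> R")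
    case True
    have "0 \<le> transition_density \<beta> \<mu>p \<mu>m s x y" using that t by (intro transition_density_nonneg \<beta>) auto
    then show ?thesis using C[OF that True] gb[of y] G True
      by (auto simp: abs_mult indicator_def intro!: mult_mono)
  qed (auto simp: gs indicator_def)
  have int: "integrable lborel (\<lambda>y. (C * G) * indicator {-R..R} y :: real)"
    by (intro integrable_mult_right integrable_real_indicator) (auto simp: emeasure_lborel_Icc_eq)
  have meas: "s > 0 \<Longrightarrow> (\<lambda>y. transition_density \<beta> \<mu>p \<mu>m s x y * g y) \<in> borel_measurable lborel" for s
    using borel_measurable_transition_density[of s \<beta> \<mu>p \<mu>m x] by measurable
  show "integrable lborel (\<lambda>y. transition_density \<beta> \<mu>p \<mu>m t x y * g y)"
  proof (rule Bochner_Integration.integrable_bound[OF int meas[OF t]], rule AE_I2)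
    fix y
    show "norm (transition_density \<beta> \<mu>p \<mu>m t x y * g y) \<le> norm ((C * G) * indicator {-R..R} y :: real)"
      using dom[of t y] t by simp
  qed
  show "isCont (\<lambda>t. \<integral>y. transition_density \<beta> \<mu>p \<mu>m t x y * g y \<partial>lborel) t"
  proof (rule continuous_at_sequentiallyI)
    fix u :: "nat \<Rightarrow> real" assume u: "u \<longlonglongrightarrow> t"
    define v where "v n = max (t/2) (min (u n) (2*t))" for n
    have v: "t/2 \<le> v n" "v n \<le> 2*t" for n using t by (auto simp: v_def)
    have vpos: "v n > 0" for n using v(1)[of n] t by linarith
    have "\<forall>\<^sub>F n in sequentially. t/2 < u n" "\<forall>\<^sub>F n in sequentially. u n < 2 * t"
      by (rule order_tendstoD[OF u], use t in simp)+
    then have vu: "\<forall>\<^sub>F n in sequentially. v n = u n" by eventually_elim (simp add: v_def)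
    have vl: "v \<longlonglongrightarrow> t" by (rule Lim_transform_eventually[OF u]) (use vu in \<open>auto elim: eventually_mono\<close>)
    have "(\<lambda>n. \<integral>y. transition_density \<beta> \<mu>p \<mu>m (v n) x y * g y \<partial>lborel) \<longlonglongrightarrow> (\<integral>y. transition_density \<beta> \<mu>p \<mu>m t x y * g y \<partial>lborel)"
    proof (rule integral_dominated_convergence[where w="\<lambda>y. (C * G) * indicator {-R..R} y"])
      show "AE y in lborel. (\<lambda>n. transition_density \<beta> \<mu>p \<mu>m (v n) x y * g y) \<longlonglongrightarrow> transition_density \<beta> \<mu>p \<mu>m t x y * g y"
        by (intro AE_I2 tendsto_mult tendsto_const isCont_tendsto_compose[OF transition_density_isCont] vl \<beta> t)
    qed (use dom v meas[OF vpos] meas[OF t] int in auto)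
    then show "(\<lambda>n. \<integral>y. transition_density \<beta> \<mu>p \<mu>m (u n) x y * g y \<partial>lborel) \<longlonglongrightarrow> (\<integral>y. transition_density \<beta> \<mu>p \<mu>m t x y * g y \<partial>lborel)"
      by (rule Lim_transform_eventually) (use vu in \<open>auto elim: eventually_mono\<close>)
  qed
qed

lemma green_nonneg:
  assumes "\<beta> \<in> {-1<..<1}" "\<alpha> > 0" "x \<ge> 0"
  shows "green \<beta> \<mu>p \<mu>m \<alpha> x y \<ge> 0"
proof -
  have b: "0 < 1 + \<beta>" "0 < 1 - \<beta>" using assms by auto
  define r r' where "r = char_root \<alpha> \<mu>p" and "r' = char_root \<alpha> (- \<mu>m)"
  have r: "r > 0" "r' > 0" using assms by (auto simp: r_def r'_def char_root_pos)
  have W: "(1 + \<beta>) * r + (1 - \<beta>) * r' > 0" by (intro add_pos_pos mult_pos_pos b r)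
  have "0 \<le> exp (\<mu>p * (y - x)) * (exp (- sqrt (\<mu>p\<^sup>2 + 2 * \<alpha>) * \<bar>y - x\<bar>) - exp (- sqrt (\<mu>p\<^sup>2 + 2 * \<alpha>) * (x + y))) / sqrt (\<mu>p\<^sup>2 + 2 * \<alpha>)" if "y > 0"
    using that assms by (auto intro!: divide_nonneg_nonneg mult_nonneg_nonneg mult_left_mono)
  moreover have "0 \<le> 2 * (1 + \<beta>) * exp (2 * \<mu>p * y) * exp (- (x + y) * r) / ((1 + \<beta>) * r + (1 - \<beta>) * r')"
    by (rule divide_nonneg_pos[OF mult_nonneg_nonneg W]) (use b in simp_all)
  moreover have "0 \<le> 2 * (1 - \<beta>) * exp (2 * \<mu>m * y) * exp (- x * r + y * r') / ((1 + \<beta>) * r + (1 - \<beta>) * r')"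
    by (rule divide_nonneg_pos[OF mult_nonneg_nonneg W]) (use b in simp_all)
  ultimately show ?thesis unfolding green_def Let_def r_def r'_def by (simp only: if_split add_nonneg_nonneg) simp
qed

text \<open>The density is nonnegative, so Tonelli's theorem, integrating over \<open>t\<close>
  first, reduces joint integrability to that of the Green function times \<open>g\<close>. Fubini's
  theorem then exchanges the integrals.\<close>

lemma transition_semigroup_laplace:
  fixes g :: "real \<Rightarrow> real"
  assumes \<beta>: "\<beta> \<in> {-1<..<1}" and \<alpha>: "\<alpha> > 0" and x: "x \<ge> 0"
    and g[measurable]: "g \<in> borel_measurable borel"
    and int: "integrable lborel (\<lambda>y. green \<beta> \<mu>p \<mu>m \<alpha> x y * g y)"
  shows "set_integrable lborel {0<..} (\<lambda>t. exp (- \<alpha> * t) * (\<integral>y. transition_density \<beta> \<mu>p \<mu>m t x y * g y \<partial>lborel))"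
    and "(LBINT t:{0<..}. exp (- \<alpha> * t) * (\<integral>y. transition_density \<beta> \<mu>p \<mu>m t x y * g y \<partial>lborel)) = (\<integral>y. green \<beta> \<mu>p \<mu>m \<alpha> x y * g y \<partial>lborel)"
proof -
  define p where "p = (\<lambda>(t, y). if t > 0 then transition_density \<beta> \<mu>p \<mu>m t x y else 0)"
  have [measurable]: "p \<in> borel_measurable (borel \<Otimes>\<^sub>M borel)" unfolding p_def by measurable
  define f where "f = (\<lambda>(y, t). exp (- \<alpha> * t) * p (t, y) * g y)"
  have [measurable]: "f \<in> borel_measurable (lborel \<Otimes>\<^sub>M lborel)" unfolding f_def by measurable
  have pn: "p (t, y) \<ge> 0" for t y using transition_density_nonneg[OF \<beta>] by (auto simp: p_def)
  \<comment> \<open>The transform formula fails at \<open>y = 0\<close> because of the convention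
    there; all identities for fixed \<open>y\<close> are used off this null point.\<close>
  have ae: "AE y in lborel. y \<noteq> (0::real)" by (rule AE_lborel_singleton)
  have lap: "(\<integral>\<^sup>+t. ennreal (exp (- \<alpha> * t) * p (t, y)) \<partial>lborel) = ennreal (green \<beta> \<mu>p \<mu>m \<alpha> x y)" if "y \<noteq> 0" for y
    unfolding transition_density_laplace[OF \<beta> \<alpha> x that, symmetric]
    by (intro nn_integral_cong) (auto simp: p_def indicator_def)
  have gr: "green \<beta> \<mu>p \<mu>m \<alpha> x y \<ge> 0" for y by (rule green_nonneg[OF \<beta> \<alpha> x])
  have nn: "(\<integral>\<^sup>+t. ennreal (norm (f (y, t))) \<partial>lborel) = ennreal (norm (green \<beta> \<mu>p \<mu>m \<alpha> x y * g y))" if "y \<noteq> 0" for y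
  proof -
    have "(\<integral>\<^sup>+t. ennreal (norm (f (y, t))) \<partial>lborel) = (\<integral>\<^sup>+t. ennreal (exp (- \<alpha> * t) * p (t, y)) * ennreal \<bar>g y\<bar> \<partial>lborel)"
      using pn by (intro nn_integral_cong) (simp add: f_def abs_mult ennreal_mult')
    also have "\<dots> = ennreal (green \<beta> \<mu>p \<mu>m \<alpha> x y) * ennreal \<bar>g y\<bar>"
      unfolding lap[OF that, symmetric] by (rule nn_integral_multc) measurable
    finally show ?thesis using gr by (simp add: abs_mult ennreal_mult')
  qed
  have inner: "(\<integral>t. f (y, t) \<partial>lborel) = green \<beta> \<mu>p \<mu>m \<alpha> x y * g y" if "y \<noteq> 0" for y
  proof -
    have "(\<integral>t. exp (- \<alpha> * t) * p (t, y) \<partial>lborel) = green \<beta> \<mu>p \<mu>m \<alpha> x y"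
      using lap[OF that] pn gr by (subst integral_eq_nn_integral) auto
    then show ?thesis by (simp add: f_def)
  qed
  have fint: "integrable (lborel \<Otimes>\<^sub>M lborel) f"
  proof (rule integrableI_bounded)
    have "(\<integral>\<^sup>+z. ennreal (norm (f z)) \<partial>(lborel \<Otimes>\<^sub>M lborel)) = (\<integral>\<^sup>+y. \<integral>\<^sup>+t. ennreal (norm (f (y, t))) \<partial>lborel \<partial>lborel)"
      by (rule lborel.nn_integral_fst[symmetric]) measurable
    also have "\<dots> = (\<integral>\<^sup>+y. ennreal (norm (green \<beta> \<mu>p \<mu>m \<alpha> x y * g y)) \<partial>lborel)"
      by (intro nn_integral_cong_AE AE_mp[OF ae AE_I2]) (use nn in auto)
    also have "\<dots> < \<infinity>" using int by (simp add: integrable_iff_bounded)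
    finally show "(\<integral>\<^sup>+z. ennreal (norm (f z)) \<partial>(lborel \<Otimes>\<^sub>M lborel)) < \<infinity>" .
  qed measurable
  have eq: "(\<integral>y. f (y, t) \<partial>lborel) = indicator {0<..} t *\<^sub>R (exp (- \<alpha> * t) * (\<integral>y. transition_density \<beta> \<mu>p \<mu>m t x y * g y \<partial>lborel))" for t
    by (simp add: f_def p_def indicator_def mult.assoc)
  show "set_integrable lborel {0<..} (\<lambda>t. exp (- \<alpha> * t) * (\<integral>y. transition_density \<beta> \<mu>p \<mu>m t x y * g y \<partial>lborel))"
    using lborel_pair.integrable_snd[OF fint[unfolded f_def]] unfolding set_integrable_def eq[symmetric] f_def by simp
  have "(\<integral>t. (\<integral>y. f (y, t) \<partial>lborel) \<partial>lborel) = (\<integral>y. (\<integral>t. f (y, t) \<partial>lborel) \<partial>lborel)"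
    using lborel_pair.Fubini_integral[of "\<lambda>y t. f (y, t)"] fint by simp
  also have "\<dots> = (\<integral>y. green \<beta> \<mu>p \<mu>m \<alpha> x y * g y \<partial>lborel)"
    by (rule integral_cong_AE) (use ae inner int in \<open>auto elim!: eventually_mono\<close>)
  finally show "(LBINT t:{0<..}. exp (- \<alpha> * t) * (\<integral>y. transition_density \<beta> \<mu>p \<mu>m t x y * g y \<partial>lborel)) = (\<integral>y. green \<beta> \<mu>p \<mu>m \<alpha> x y * g y \<partial>lborel)"
    unfolding set_lebesgue_integral_def eq .
qed

section \<open>Uniqueness of Laplace transforms\<close>

text \<open>In the variable \<open>u = exp (- t)\<close> the hypothesis concerns the moments of a density on the unit
  interval, so the theorem of Weierstrass applies.\<close>

lemma laplace_test_zero: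
  fixes w \<psi> :: "real \<Rightarrow> real"
  assumes int: "set_integrable lborel {0<..} (\<lambda>t. exp (- t) * w t)"
    and zero: "\<And>n. n \<ge> 1 \<Longrightarrow> (LBINT t:{0<..}. exp (- real n * t) * w t) = 0"
    and \<psi>: "continuous_on UNIV \<psi>"
  shows "integrable lborel (\<lambda>t. indicator {0<..} t * (exp (- t) * w t) * \<psi> (exp (- t)))"
    and "(\<integral>t. indicator {0<..} t * (exp (- t) * w t) * \<psi> (exp (- t)) \<partial>lborel) = 0"
proof -
  let ?v = "\<lambda>t. indicator {0<..} t * (exp (- t) * w t)"
  have v: "integrable lborel ?v" using int by (simp add: set_integrable_def)
  have [measurable]: "\<psi> \<in> borel_measurable borel" using \<psi> by (rule borel_measurable_continuous_onI)
  have bdd: "integrable lborel (\<lambda>t. ?v t * f (exp (- t)))"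
    if f[measurable]: "f \<in> borel_measurable borel" and C: "\<And>u. u \<in> {0..1} \<Longrightarrow> \<bar>f u\<bar> \<le> C" for f :: "real \<Rightarrow> real" and C
  proof (rule Bochner_Integration.integrable_bound[OF integrable_mult_right[OF v, of C]])
    show "(\<lambda>t. ?v t * f (exp (- t))) \<in> borel_measurable lborel" using v by measurable
    show "AE t in lborel. norm (?v t * f (exp (- t))) \<le> norm (C * ?v t)"
    proof (rule AE_I2)
      fix t :: real
      show "norm (?v t * f (exp (- t))) \<le> norm (C * ?v t)"
      proof (cases "t > 0")
        case True
        have "\<bar>f (exp (- t))\<bar> \<le> C" using True by (intro C) auto
        then have "\<bar>f (exp (- t))\<bar> \<le> \<bar>C\<bar>" by linarith
        then have "\<bar>?v t\<bar> * \<bar>f (exp (- t))\<bar> \<le> \<bar>?v t\<bar> * \<bar>C\<bar>" by (intro mult_left_mono) auto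
        then show ?thesis by (simp add: abs_mult mult_ac)
      qed simp
    qed
  qed
  obtain C where C: "\<And>u. u \<in> {0..1} \<Longrightarrow> \<bar>\<psi> u\<bar> \<le> C"
  proof -
    have "compact (\<psi> ` {0..1})" using \<psi> by (intro compact_continuous_image) (auto intro: continuous_on_subset)
    then have "bounded (\<psi> ` {0..1})" by (rule compact_imp_bounded)
    then obtain a where "\<forall>x\<in>{0..1}. \<bar>\<psi> x\<bar> \<le> a" by (auto simp: bounded_iff)
    then show thesis by (intro that[of a]) blast
  qed
  show i\<psi>: "integrable lborel (\<lambda>t. ?v t * \<psi> (exp (- t)))" by (rule bdd[OF _ C]) measurable
  define N where "N = (\<integral>t. \<bar>?v t\<bar> \<partial>lborel)"
  \<comment> \<open>The factor \<open>exp (- t)\<close> inside \<open>?v\<close> shifts the exponent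
    by one: the moment of order \<open>i\<close> is the Laplace transform at \<open>Suc i\<close>,
    so order 0 is covered although \<open>zero\<close> starts at 1.\<close>
  have pow: "(\<integral>t. ?v t * exp (- t) ^ i \<partial>lborel) = 0" for i :: nat
  proof -
    have "(\<integral>t. ?v t * exp (- t) ^ i \<partial>lborel) = (LBINT t:{0<..}. exp (- real (Suc i) * t) * w t)"
      unfolding set_lebesgue_integral_def
      by (intro Bochner_Integration.integral_cong) (auto simp: exp_of_nat_mult[symmetric] exp_add[symmetric] algebra_simps indicator_def)
    then show ?thesis using zero[of "Suc i"] by simp
  qed
  have H: "\<bar>\<integral>t. ?v t * \<psi> (exp (- t)) \<partial>lborel\<bar> \<le> e * N" if e: "e > 0" for e
  proof -
    obtain g where g: "real_polynomial_function g" "\<And>u. u \<in> {0..1} \<Longrightarrow> \<bar>\<psi> u - g u\<bar> < e"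
      using Stone_Weierstrass_real_polynomial_function[of "{0..1::real}" \<psi> e] \<psi> e by (auto intro: continuous_on_subset)
    then obtain a n where gs: "g = (\<lambda>x. \<Sum>i\<le>n. a i * x ^ i)" by (auto simp: real_polynomial_function_iff_sum)
    have [measurable]: "g \<in> borel_measurable borel" unfolding gs by measurable
    have ip: "integrable lborel (\<lambda>t. ?v t * exp (- t) ^ i)" for i
      by (rule bdd[where f="\<lambda>x. x ^ i" and C=1]) (auto simp: power_le_one)
    have gz: "(\<integral>t. ?v t * g (exp (- t)) \<partial>lborel) = 0"
    proof -
      have "(\<lambda>t. ?v t * g (exp (- t))) = (\<lambda>t. \<Sum>i\<le>n. a i * (?v t * exp (- t) ^ i))"
        by (auto simp: gs sum_distrib_left mult_ac fun_eq_iff)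
      then show ?thesis using ip pow by simp
    qed
    have ig: "integrable lborel (\<lambda>t. ?v t * g (exp (- t)))"
    proof -
      have "(\<lambda>t. ?v t * g (exp (- t))) = (\<lambda>t. \<Sum>i\<le>n. a i * (?v t * exp (- t) ^ i))"
        by (auto simp: gs sum_distrib_left mult_ac fun_eq_iff)
      then show ?thesis using ip by simp
    qed
    have "\<bar>\<integral>t. ?v t * \<psi> (exp (- t)) \<partial>lborel\<bar> = \<bar>\<integral>t. ?v t * \<psi> (exp (- t)) - ?v t * g (exp (- t)) \<partial>lborel\<bar>"
      by (subst Bochner_Integration.integral_diff[OF i\<psi> ig]) (simp only: gz diff_zero)
    also have "\<dots> \<le> (\<integral>t. \<bar>?v t * \<psi> (exp (- t)) - ?v t * g (exp (- t))\<bar> \<partial>lborel)"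
      by (rule integral_abs_bound)
    also have "\<dots> \<le> (\<integral>t. e * \<bar>?v t\<bar> \<partial>lborel)"
    proof (rule integral_mono)
      fix t :: real
      have "\<bar>a * p - a * q\<bar> \<le> e * \<bar>a\<bar>" if "a \<noteq> 0 \<Longrightarrow> \<bar>p - q\<bar> < e" for a p q :: real
      proof -
        have "\<bar>a * p - a * q\<bar> = \<bar>a\<bar> * \<bar>p - q\<bar>" by (metis abs_mult right_diff_distrib)
        also have "\<dots> \<le> \<bar>a\<bar> * e" using that by (cases "a = 0") (auto intro!: mult_left_mono)
        finally show ?thesis by (simp only: mult.commute)
      qed
      from this[of "?v t" "\<psi> (exp (- t))" "g (exp (- t))"]
      show "\<bar>?v t * \<psi> (exp (- t)) - ?v t * g (exp (- t))\<bar> \<le> e * \<bar>?v t\<bar>"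
        using g(2)[of "exp (- t)"] by (cases "t > 0") auto
    next
      show "integrable lborel (\<lambda>t. \<bar>?v t * \<psi> (exp (- t)) - ?v t * g (exp (- t))\<bar>)"
        by (intro integrable_abs Bochner_Integration.integrable_diff i\<psi> ig)
      show "integrable lborel (\<lambda>t. e * \<bar>?v t\<bar>)" by (intro integrable_abs integrable_mult_right v)
    qed
    finally show ?thesis using v by (simp only: N_def integral_mult_right_zero)
  qed
  have N: "N \<ge> 0" unfolding N_def by (rule integral_nonneg_AE) simp
  have "\<bar>\<integral>t. ?v t * \<psi> (exp (- t)) \<partial>lborel\<bar> \<le> 0"
  proof (rule field_le_epsilon)
    fix e :: real assume e: "0 < e"
    \<comment> \<open>The denominator \<open>1 + N\<close> rather than \<open>N\<close> covers
      \<open>N = 0\<close>.\<close>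
    have "\<bar>\<integral>t. ?v t * \<psi> (exp (- t)) \<partial>lborel\<bar> \<le> e / (1 + N) * N"
      using N e by (intro H) (auto intro!: divide_pos_pos)
    also have "\<dots> \<le> e" using N e by (simp add: field_simps)
    finally show "\<bar>\<integral>t. ?v t * \<psi> (exp (- t)) \<partial>lborel\<bar> \<le> 0 + e" by simp
  qed
  then show "(\<integral>t. ?v t * \<psi> (exp (- t)) \<partial>lborel) = 0" by simp
qed

text \<open>A positive value at \<open>t0\<close> would persist nearby. Testing with a hat function
  of \<open>exp (- t)\<close> supported there gives a nonnegative integrand with integral zero that
  is positive on a nonempty open set. Being one-sided, the statement is applied to a difference and
  to its negative.\<close>

lemma laplace_unique_le:
  fixes w :: "real \<Rightarrow> real"
  assumes cont: "\<And>t. t > 0 \<Longrightarrow> isCont w t"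
    and int: "set_integrable lborel {0<..} (\<lambda>t. exp (- t) * w t)"
    and zero: "\<And>n. n \<ge> 1 \<Longrightarrow> (LBINT t:{0<..}. exp (- real n * t) * w t) = 0"
    and t0: "t0 > 0"
  shows "w t0 \<le> 0"
proof (rule ccontr)
  assume "\<not> w t0 \<le> 0"
  then have "\<forall>\<^sub>F t in nhds t0. w t > 0"
    using order_tendstoD(1)[of w "w t0" "nhds t0" 0] cont[OF t0] by (auto simp: isCont_def tendsto_at_iff_tendsto_nhds)
  moreover have "\<forall>\<^sub>F t in nhds t0. t \<in> {0<..}" by (rule eventually_nhds_in_open) (use t0 in auto)
  ultimately have "\<forall>\<^sub>F t in nhds t0. w t > 0 \<and> t > 0" by eventually_elim auto
  moreover have "filterlim (\<lambda>u. - ln u) (nhds t0) (nhds (exp (- t0)))"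
  proof -
    have "isCont (\<lambda>u. - ln u) (exp (- t0))" by (auto intro!: continuous_intros)
    then show ?thesis
      using tendsto_at_iff_tendsto_nhds[of "\<lambda>u. - ln u" "exp (- t0)"] by (simp add: isCont_def)
  qed
  ultimately have "\<forall>\<^sub>F u in nhds (exp (- t0)). w (- ln u) > 0 \<and> - ln u > 0"
    by (rule eventually_compose_filterlim)
  then obtain d where d: "d > 0" "\<And>u. dist u (exp (- t0)) < d \<Longrightarrow> w (- ln u) > 0 \<and> - ln u > 0"
    by (auto simp: eventually_nhds_metric)
  define \<psi> where "\<psi> u = max 0 (1 - \<bar>u - exp (- t0)\<bar> / d)" for u
  have c: "continuous_on UNIV \<psi>" unfolding \<psi>_def by (intro continuous_intros) (use d in auto)
  note L = laplace_test_zero[OF int zero c, simplified]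
  let ?k = "\<lambda>t. indicator {0<..} t * (exp (- t) * w t) * \<psi> (exp (- t))"
  have pos: "\<bar>exp (- t) - exp (- t0)\<bar> < d \<Longrightarrow> ?k t > 0" for t
    using d(2)[of "exp (- t)"] d(1) by (auto simp: dist_real_def \<psi>_def)
  have "0 \<le> ?k t" for t
  proof (cases "\<bar>exp (- t) - exp (- t0)\<bar> < d")
    case True then show ?thesis using pos by (intro less_imp_le)
  next
    case False then show ?thesis using d(1) by (simp add: \<psi>_def)
  qed
  then have "AE t in lborel. ?k t = 0"
    using L by (subst (asm) integral_nonneg_eq_0_iff_AE) auto
  then have "AE t in lborel. \<not> \<bar>exp (- t) - exp (- t0)\<bar> < d"
  proof eventually_elim
    case (elim t)
    then show ?case using pos[of t] by (metis less_irrefl)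
  qed
  moreover have op: "open {t. \<bar>exp (- t) - exp (- t0)\<bar> < d}"
    by (intro open_Collect_less continuous_intros)
  ultimately have "{t. \<bar>exp (- t) - exp (- t0)\<bar> < d} \<in> null_sets lborel"
    by (subst AE_iff_null_sets) auto
  moreover have "{t. \<bar>exp (- t) - exp (- t0)\<bar> < d} \<noteq> {}" using d(1) by (auto intro!: exI[of _ t0])
  ultimately show False
    using op open_not_negligible null_sets_completionI by (auto simp: negligible_iff_null_sets)
qed

lemma laplace_unique:
  fixes v w :: "real \<Rightarrow> real"
  assumes cont: "\<And>t. t > 0 \<Longrightarrow> isCont v t" "\<And>t. t > 0 \<Longrightarrow> isCont w t"
    and int: "\<And>n. n \<ge> 1 \<Longrightarrow> set_integrable lborel {0<..} (\<lambda>t. exp (- real n * t) * v t)"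
       "\<And>n. n \<ge> 1 \<Longrightarrow> set_integrable lborel {0<..} (\<lambda>t. exp (- real n * t) * w t)"
    and eq: "\<And>n. n \<ge> 1 \<Longrightarrow> (LBINT t:{0<..}. exp (- real n * t) * v t) = (LBINT t:{0<..}. exp (- real n * t) * w t)"
    and t0: "t0 > 0"
  shows "v t0 = w t0"
proof (rule antisym)
  have 1: "(LBINT t:{0<..}. exp (- real n * t) * (v t - w t)) = 0" "(LBINT t:{0<..}. exp (- real n * t) * (w t - v t)) = 0"
    if "n \<ge> 1" for n
    unfolding right_diff_distrib using eq[OF that] int[OF that] by (subst set_integral_diff; simp)+
  have 2: "set_integrable lborel {0<..} (\<lambda>t. exp (- t) * (v t - w t))" "set_integrable lborel {0<..} (\<lambda>t. exp (- t) * (w t - v t))"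
    unfolding right_diff_distrib using int[of 1] by (auto intro!: set_integral_diff(1))
  show "v t0 \<le> w t0" using laplace_unique_le[of "\<lambda>t. v t - w t", OF _ 2(1) 1(1) t0] cont by (auto intro!: continuous_intros)
  show "w t0 \<le> v t0" using laplace_unique_le[of "\<lambda>t. w t - v t", OF _ 2(2) 1(2) t0] cont by (auto intro!: continuous_intros)
qed

section \<open>The resolvent of a test function\<close>

lemma continuous_bounded_halfline:
  fixes f :: "real \<Rightarrow> real"
  assumes cont: "\<And>x. isCont f x" and bdd: "\<And>x. x \<ge> R \<Longrightarrow> \<bar>f x\<bar> \<le> C"
  obtains D where "\<And>x. x \<ge> 0 \<Longrightarrow> \<bar>f x\<bar> \<le> D"
proof -
  have "compact (f ` {0..R})" using cont by (intro compact_continuous_image continuous_at_imp_continuous_on) auto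
  then have "bounded (f ` {0..R})" by (rule compact_imp_bounded)
  then obtain E where "\<forall>x\<in>{0..R}. \<bar>f x\<bar> \<le> E" by (auto simp: bounded_iff)
  then have "\<bar>f x\<bar> \<le> max C E" if "x \<ge> 0" for x
    using bdd[of x] that by (cases "x \<le> R") (auto simp: le_max_iff_disj)
  then show thesis by (rule that)
qed

text \<open>\<open>U\<close> solves the Dirichlet problem on the right half-line by variation of
  constants, from the homogeneous solutions \<open>exp (- r * x)\<close> and
  \<open>exp (s * x)\<close>. It lives on the whole line so that its derivatives at 0 are two-sided;
  boundedness is claimed on the right only. The slope \<open>2 * J\<close> at 0 is what the
  interface condition will see.\<close>

lemma half_line_resolvent:
  fixes g :: "real \<Rightarrow> real" and \<mu> \<alpha> R :: real
  assumes \<alpha>: "\<alpha> > 0" and g: "continuous_on UNIV g" and R: "R > 0" "\<And>y. \<bar>y\<bar> \<ge> R \<Longrightarrow> g y = 0"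
  defines "c \<equiv> sqrt (\<mu>\<^sup>2 + 2 * \<alpha>)"
  defines "J \<equiv> LBINT y:{0<..}. exp (- (c - \<mu>) * y) * g y"
  obtains U U1 U2 :: "real \<Rightarrow> real" and D where
    "\<And>x. (U has_real_derivative U1 x) (at x)" "\<And>x. (U1 has_real_derivative U2 x) (at x)"
    "\<And>x. U2 x = 2 * (\<alpha> * U x - g x - \<mu> * U1 x)"
    "U 0 = 0" "U1 0 = 2 * J"
    "\<And>x. x \<ge> 0 \<Longrightarrow> \<bar>U x\<bar> \<le> D" "\<And>x. x \<ge> 0 \<Longrightarrow> \<bar>U1 x\<bar> \<le> D"
    "\<And>x. x \<ge> 0 \<Longrightarrow> has_bochner_integral lborel (\<lambda>y. indicator {0<..} y * (exp (\<mu> * (y - x)) * (exp (- c * \<bar>y - x\<bar>) - exp (- c * (x + y))) / c * g y)) (U x)"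
    "has_bochner_integral lborel (\<lambda>y. indicator {0<..} y * (exp (- (c - \<mu>) * y) * g y)) J"
proof -
  have c: "c > 0" "c\<^sup>2 = \<mu>\<^sup>2 + 2 * \<alpha>" using \<alpha> by (auto simp: c_def add_nonneg_pos)
  define r s where "r = c + \<mu>" and "s = c - \<mu>"
  have "r * r = c\<^sup>2 + 2 * (\<mu> * c) + \<mu>\<^sup>2" "s * s = c\<^sup>2 - 2 * (\<mu> * c) + \<mu>\<^sup>2"
       "\<mu> * r = \<mu> * c + \<mu>\<^sup>2" "\<mu> * s = \<mu> * c - \<mu>\<^sup>2"
    by (simp_all add: r_def s_def algebra_simps power2_eq_square)
  \<comment> \<open>The last two are the characteristic equations of the homogeneous
    solutions.\<close>
  then have rs: "r + s = 2 * c" "r * r / 2 = \<mu> * r + \<alpha>" "s * s / 2 = \<alpha> - \<mu> * s"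
    using c(2) by (simp_all add: r_def s_def)
  have r: "r > 0" using char_root_pos[OF \<alpha>, of \<mu>] by (simp add: char_root_def r_def c_def)
  have gc: "isCont g x" for x using g by (simp add: continuous_on_eq_continuous_at)
  have c1: "continuous_on UNIV (\<lambda>y. exp (r * y) * g y)" "continuous_on UNIV (\<lambda>y. exp (- s * y) * g y)"
    by (intro continuous_intros g)+
  obtain K1 where K1: "K1 0 = 0" "\<And>x. (K1 has_real_derivative exp (r * x) * g x) (at x)"
    using continuous_antiderivative[OF c1(1), of 0] by blast
  obtain K2 where K2: "K2 0 = 0" "\<And>x. (K2 has_real_derivative exp (- s * x) * g x) (at x)"
    using continuous_antiderivative[OF c1(2), of 0] by blast
  have const: "K x = K R" if "\<And>x. (K has_real_derivative e x * g x) (at x)" "x \<ge> R" for K e x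
  proof (cases "x = R")
    case False
    then have "R < x" using that by simp
    from MVT2[OF this, of K "\<lambda>x. e x * g x", OF that(1)]
    obtain z where "R < z" "z < x" "K x - K R = (x - R) * (e z * g z)" by blast
    then show ?thesis using R by simp
  qed simp
  \<comment> \<open>The full weight of \<open>g\<close> against \<open>exp (- s * y)\<close> on the
    right half-line. In the coefficient \<open>Z - K2 x\<close> it removes the growing solution
    beyond the support of \<open>g\<close>; in \<open>K1 x - Z\<close> it enforces
    \<open>U 0 = 0\<close>.\<close>
  define Z where "Z = K2 R"
  have K1R: "K1 x = K1 R" and K2R: "K2 x = Z" if "x \<ge> R" for x
    using const[of K1 "\<lambda>x. exp (r * x)", OF K1(2) that] const[of K2 "\<lambda>x. exp (- s * x)", OF K2(2) that] by (auto simp: Z_def)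
  have I1: "has_bochner_integral lborel (\<lambda>y. exp (r * y) * g y * indicator {a..b} y) (K1 b - K1 a)" if "a \<le> b" for a b
    using that K1(2) gc by (intro has_bochner_integral_FTC_Icc_real) (auto intro!: continuous_intros)
  have I2: "has_bochner_integral lborel (\<lambda>y. exp (- s * y) * g y * indicator {a..b} y) (K2 b - K2 a)" if "a \<le> b" for a b
    using that K2(2) gc by (intro has_bochner_integral_FTC_Icc_real) (auto intro!: continuous_intros)
  have AE2: "AE y in lborel. y \<noteq> 0 \<and> y \<noteq> a" for a :: real
    using AE_lborel_singleton[of 0] AE_lborel_singleton[of a] by eventually_elim simp
  have [measurable]: "g \<in> borel_measurable borel" using g by (rule borel_measurable_continuous_onI)
  have JI: "has_bochner_integral lborel (\<lambda>y. indicator {0<..} y * (exp (- s * y) * g y)) Z"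
  proof -
    have "has_bochner_integral lborel (\<lambda>y. exp (- s * y) * g y * indicator {0..R} y) Z"
      using I2[of 0 R] R K2 by (simp add: Z_def)
    moreover have "AE y in lborel. indicator {0<..} y * (exp (- s * y) * g y) = exp (- s * y) * g y * indicator {0..R} y"
      using AE2[of 0] by eventually_elim (use R in \<open>auto simp: indicator_def\<close>)
    ultimately show ?thesis by (subst has_bochner_integral_cong_AE) auto
  qed
  have JZ: "J = Z" using has_bochner_integral_integral_eq[OF JI]
    by (simp add: J_def set_lebesgue_integral_def s_def)
  define U where "U x = (exp (- r * x) * (K1 x - Z) + exp (s * x) * (Z - K2 x)) / c" for x
  define U1 where "U1 x = (- r * exp (- r * x) * (K1 x - Z) + s * exp (s * x) * (Z - K2 x)) / c" for x
  define U2 where "U2 x = (r * r * exp (- r * x) * (K1 x - Z) + s * s * exp (s * x) * (Z - K2 x)) / c - 2 * g x" for x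
  have e1: "exp (- r * x) * (exp (r * x) * g x) = g x" "exp (s * x) * (exp (- s * x) * g x) = g x" for x
    by (simp_all add: mult.assoc[symmetric] exp_add[symmetric])
    have dU: "(U has_real_derivative U1 x) (at x)" for x
    proof -
      have "(U has_real_derivative ((- r * exp (- r * x) * (K1 x - Z) + exp (- r * x) * (exp (r * x) * g x) + (s * exp (s * x) * (Z - K2 x) - exp (s * x) * (exp (- s * x) * g x))) / c)) (at x)"
        unfolding U_def[abs_def] by (rule DERIV_cdivide) (auto intro!: derivative_eq_intros K1(2) K2(2) simp: algebra_simps)
      then show ?thesis unfolding e1 U1_def by simp
    qed
    have dU1: "(U1 has_real_derivative U2 x) (at x)" for x
    proof -
      have "(U1 has_real_derivative ((r * r * exp (- r * x) * (K1 x - Z) - r * (exp (- r * x) * (exp (r * x) * g x)) + (s * s * exp (s * x) * (Z - K2 x) - s * (exp (s * x) * (exp (- s * x) * g x)))) / c)) (at x)"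
        unfolding U1_def[abs_def] by (rule DERIV_cdivide) (auto intro!: derivative_eq_intros K1(2) K2(2) simp: algebra_simps)
      moreover have "(r * r * exp (- r * x) * (K1 x - Z) - r * g x + (s * s * exp (s * x) * (Z - K2 x) - s * g x)) / c = U2 x"
      proof -
        have "(r * g x + s * g x) / c = 2 * g x" using rs(1) c(1) by (simp add: distrib_right[symmetric])
        then show ?thesis by (simp add: U2_def diff_divide_distrib add_divide_distrib)
      qed
      ultimately show ?thesis unfolding e1 by simp
    qed
    have far: "U x = exp (- r * x) * (K1 R - Z) / c" "U1 x = - r * exp (- r * x) * (K1 R - Z) / c" if "x \<ge> R" for x
      using that by (simp_all add: U_def U1_def K1R[OF that] K2R[OF that])
    obtain D1 where D1: "\<And>x. x \<ge> 0 \<Longrightarrow> \<bar>U x\<bar> \<le> D1"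
    proof (rule continuous_bounded_halfline[of U R "\<bar>K1 R - Z\<bar> / c"])
      show "isCont U x" for x using dU DERIV_isCont by blast
      show "\<bar>U x\<bar> \<le> \<bar>K1 R - Z\<bar> / c" if "x \<ge> R" for x
      proof -
        have "exp (- r * x) \<le> 1" using r R that by simp
        then have "exp (- r * x) * \<bar>K1 R - Z\<bar> \<le> 1 * \<bar>K1 R - Z\<bar>" by (intro mult_right_mono) auto
        then show ?thesis using c(1) by (simp add: far[OF that] abs_mult divide_right_mono)
      qed
    qed blast
    obtain D2 where D2: "\<And>x. x \<ge> 0 \<Longrightarrow> \<bar>U1 x\<bar> \<le> D2"
    proof (rule continuous_bounded_halfline[of U1 R "r * \<bar>K1 R - Z\<bar> / c"])
      show "isCont U1 x" for x using dU1 DERIV_isCont by blast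
      show "\<bar>U1 x\<bar> \<le> r * \<bar>K1 R - Z\<bar> / c" if "x \<ge> R" for x
      proof -
        have "exp (- r * x) \<le> 1" using r R that by simp
        then have "r * exp (- r * x) * \<bar>K1 R - Z\<bar> \<le> r * 1 * \<bar>K1 R - Z\<bar>" using r by (intro mult_right_mono mult_left_mono) auto
        then show ?thesis using c(1) r by (simp add: far[OF that] abs_mult divide_right_mono)
      qed
    qed blast
  show thesis
  proof (rule that[of U U1 U2 "max D1 D2"])
    show "(U has_real_derivative U1 x) (at x)" "(U1 has_real_derivative U2 x) (at x)" for x by (rule dU dU1)+
    show "U2 x = 2 * (\<alpha> * U x - g x - \<mu> * U1 x)" for x
    proof -
      have "r * r = 2 * (\<mu> * r + \<alpha>)" "s * s = 2 * (\<alpha> - \<mu> * s)" using rs by auto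
      then show ?thesis unfolding U_def U1_def U2_def by (simp only:) (simp add: algebra_simps add_divide_distrib diff_divide_distrib)
    qed
    show "U 0 = 0" by (simp add: U_def K1 K2)
    show "U1 0 = 2 * J" using rs(1) c(1) by (simp add: U1_def K1 K2 JZ distrib_right[symmetric])
    show "\<And>x. x \<ge> 0 \<Longrightarrow> \<bar>U x\<bar> \<le> max D1 D2" "\<And>x. x \<ge> 0 \<Longrightarrow> \<bar>U1 x\<bar> \<le> max D1 D2"
      using D1 D2 by (auto simp: le_max_iff_disj)
    show "has_bochner_integral lborel (\<lambda>y. indicator {0<..} y * (exp (- (c - \<mu>) * y) * g y)) J"
      using JI by (simp add: JZ s_def)
    show "has_bochner_integral lborel (\<lambda>y. indicator {0<..} y * (exp (\<mu> * (y - x)) * (exp (- c * \<bar>y - x\<bar>) - exp (- c * (x + y))) / c * g y)) (U x)" if x: "x \<ge> 0" for x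
    proof -
      \<comment> \<open>An endpoint beyond both \<open>x\<close> and the support makes all intervals
        compact; past \<open>S\<close> both sides vanish with \<open>g\<close>.\<close>
      define S where "S = max R x"
      have S: "S \<ge> x" "S \<ge> R" "S \<ge> 0" using R by (auto simp: S_def)
      have KS: "K2 S = Z" using K2R[OF S(2)] .
      have "has_bochner_integral lborel (\<lambda>y. exp (- r * x) / c * (exp (r * y) * g y * indicator {0..x} y)
          + exp (s * x) / c * (exp (- s * y) * g y * indicator {x..S} y)
          - exp (- r * x) / c * (exp (- s * y) * g y * indicator {0..S} y))
         (exp (- r * x) / c * (K1 x - K1 0) + exp (s * x) / c * (K2 S - K2 x) - exp (- r * x) / c * (K2 S - K2 0))"
        using S x by (intro has_bochner_integral_add has_bochner_integral_diff has_bochner_integral_mult_right I1 I2)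
      also have "exp (- r * x) / c * (K1 x - K1 0) + exp (s * x) / c * (K2 S - K2 x) - exp (- r * x) / c * (K2 S - K2 0) = U x"
        by (simp add: U_def K1 K2 KS) (simp add: algebra_simps add_divide_distrib diff_divide_distrib)
      finally have *: "has_bochner_integral lborel (\<lambda>y. exp (- r * x) / c * (exp (r * y) * g y * indicator {0..x} y)
          + exp (s * x) / c * (exp (- s * y) * g y * indicator {x..S} y)
          - exp (- r * x) / c * (exp (- s * y) * g y * indicator {0..S} y)) (U x)" .
      have "AE y in lborel. indicator {0<..} y * (exp (\<mu> * (y - x)) * (exp (- c * \<bar>y - x\<bar>) - exp (- c * (x + y))) / c * g y)
         = exp (- r * x) / c * (exp (r * y) * g y * indicator {0..x} y)
          + exp (s * x) / c * (exp (- s * y) * g y * indicator {x..S} y)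
          - exp (- r * x) / c * (exp (- s * y) * g y * indicator {0..S} y)"
        using AE2[of x]
      proof eventually_elim
        case (elim y)
        have E1: "exp (\<mu> * (y - x)) * exp (- c * (x + y)) = exp (- r * x) * exp (- s * y)"
          by (simp add: exp_add[symmetric] r_def s_def algebra_simps)
        consider "y < 0" | "0 < y" "y < x" | "0 < y" "x < y" using elim by linarith
        then show ?case
        proof cases
          case 2
          have "exp (\<mu> * (y - x)) * exp (- c * \<bar>y - x\<bar>) = exp (- r * x) * exp (r * y)"
            using 2 by (simp add: exp_add[symmetric] r_def algebra_simps)
          then have *: "exp (\<mu> * (y - x)) * (exp (- c * \<bar>y - x\<bar>) - exp (- c * (x + y))) = exp (- r * x) * exp (r * y) - exp (- r * x) * exp (- s * y)"
            using E1 by (simp only: right_diff_distrib)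
          show ?thesis using 2 S unfolding * by (simp add: algebra_simps diff_divide_distrib)
        next
          case 3
          have "exp (\<mu> * (y - x)) * exp (- c * \<bar>y - x\<bar>) = exp (s * x) * exp (- s * y)"
            using 3 by (simp add: exp_add[symmetric] s_def algebra_simps)
          then have *: "exp (\<mu> * (y - x)) * (exp (- c * \<bar>y - x\<bar>) - exp (- c * (x + y))) = exp (s * x) * exp (- s * y) - exp (- r * x) * exp (- s * y)"
            using E1 by (simp only: right_diff_distrib)
          show ?thesis
          proof (cases "y \<le> S")
            case True then show ?thesis using 3 x unfolding * by (simp add: algebra_simps diff_divide_distrib)
          next
            case False then show ?thesis using 3 S R(2)[of y] by simp
          qed
        qed (use x in simp)
      qed
      with * show ?thesis by (subst has_bochner_integral_cong_AE) auto
    qed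
  qed
qed

text \<open>The decay rate is \<open>char_root \<alpha> (- \<mu>)\<close>, that of the first passage
  from 0 up to \<open>y\<close> under the drift \<mu>.\<close>

definition one_sided_transform :: "real \<Rightarrow> real \<Rightarrow> (real \<Rightarrow> real) \<Rightarrow> real" where
  "one_sided_transform \<alpha> \<mu> g = (LBINT y:{0<..}. exp (- (sqrt (\<mu>\<^sup>2 + 2 * \<alpha>) - \<mu>) * y) * g y)"

text \<open>The integral of the Green function for \<open>x = 0\<close> against \<open>g\<close>. It
  is also the common value at 0 that the interface condition forces on the two branches: each slope
  at 0 is twice a one-sided transform minus a characteristic root times this value, and solving for
  the value gives the quotient.\<close>

definition resolvent_at_zero :: "real \<Rightarrow> real \<Rightarrow> real \<Rightarrow> real \<Rightarrow> (real \<Rightarrow> real) \<Rightarrow> real" where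
  "resolvent_at_zero \<beta> \<mu>p \<mu>m \<alpha> g =
    (2 * (1 + \<beta>) * one_sided_transform \<alpha> \<mu>p g + 2 * (1 - \<beta>) * one_sided_transform \<alpha> (- \<mu>m) (\<lambda>y. g (- y)))
    / ((1 + \<beta>) * char_root \<alpha> \<mu>p + (1 - \<beta>) * char_root \<alpha> (- \<mu>m))"

text \<open>The right branch is the Dirichlet solution plus \<open>a * exp (- r * x)\<close>, the
  decaying homogeneous solution that carries the value at 0. The equation expresses
  \<open>P2\<close> through \<open>P\<close>, \<open>P1\<close> and \<open>g\<close>, so that the
  Lipschitz bound of \<open>g\<close> passes to the second derivative. The left branch is later
  obtained from the same lemma with reflected data.\<close>

lemma half_resolvent:
  fixes g :: "real \<Rightarrow> real" and \<beta> \<mu>p \<mu>m \<alpha> R :: real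
  assumes \<beta>: "\<beta> \<in> {-1<..<1}" and \<alpha>: "\<alpha> > 0" and g: "L-lipschitz_on UNIV g" and R: "R > 0" "\<And>y. \<bar>y\<bar> \<ge> R \<Longrightarrow> g y = 0"
  obtains P P1 P2 :: "real \<Rightarrow> real" and C where
    "\<And>x. (P has_real_derivative P1 x) (at x)" "\<And>x. (P1 has_real_derivative P2 x) (at x)"
    "\<And>x. P2 x = 2 * (\<alpha> * P x - g x - \<mu>p * P1 x)"
    "P 0 = resolvent_at_zero \<beta> \<mu>p \<mu>m \<alpha> g"
    "P1 0 = 2 * one_sided_transform \<alpha> \<mu>p g - char_root \<alpha> \<mu>p * resolvent_at_zero \<beta> \<mu>p \<mu>m \<alpha> g"
    "\<And>x. x \<ge> 0 \<Longrightarrow> \<bar>P x\<bar> \<le> C" "\<And>x. x \<ge> 0 \<Longrightarrow> \<bar>P1 x\<bar> \<le> C" "\<And>x. x \<ge> 0 \<Longrightarrow> \<bar>P2 x\<bar> \<le> C"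
    "\<And>x y. x \<ge> 0 \<Longrightarrow> y \<ge> 0 \<Longrightarrow> \<bar>P2 x - P2 y\<bar> \<le> C * \<bar>x - y\<bar>"
    "\<And>x. x \<ge> 0 \<Longrightarrow> has_bochner_integral lborel (\<lambda>y. green \<beta> \<mu>p \<mu>m \<alpha> x y * g y) (P x)"
proof -
  have gc: "continuous_on UNIV g" using g by (rule lipschitz_on_continuous_on)
  have g'c: "continuous_on UNIV (\<lambda>y. g (- y))" by (rule continuous_on_compose2[OF gc]) (auto intro: continuous_intros)
  have R': "\<bar>y\<bar> \<ge> R \<Longrightarrow> g (- y) = 0" for y using R by simp
  define c where "c = sqrt (\<mu>p\<^sup>2 + 2 * \<alpha>)"
  define c' where "c' = sqrt (\<mu>m\<^sup>2 + 2 * \<alpha>)"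
  define r r' where "r = char_root \<alpha> \<mu>p" and "r' = char_root \<alpha> (- \<mu>m)"
  have r: "r > 0" "r' > 0" using \<alpha> by (auto simp: r_def r'_def char_root_pos)
  define W where "W = (1 + \<beta>) * r + (1 - \<beta>) * r'"
  have "0 < (1 + \<beta>) * r" "0 < (1 - \<beta>) * r'" using \<beta> r by auto
  then have W: "W > 0" unfolding W_def by (rule add_pos_pos)
  define a where "a = resolvent_at_zero \<beta> \<mu>p \<mu>m \<alpha> g"
  define J where "J = one_sided_transform \<alpha> \<mu>p g"
  define J' where "J' = one_sided_transform \<alpha> (- \<mu>m) (\<lambda>y. g (- y))"
  have a_eq: "a = 2 * (1 + \<beta>) / W * J + 2 * (1 - \<beta>) / W * J'"
    by (simp add: a_def resolvent_at_zero_def J_def[symmetric] J'_def[symmetric] W_def[symmetric] r_def[symmetric] r'_def[symmetric] add_divide_distrib[symmetric])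
  obtain G where G: "\<And>x. x \<ge> 0 \<Longrightarrow> \<bar>g x\<bar> \<le> G"
    by (rule continuous_bounded_halfline[of g R 0]) (use gc R in \<open>auto simp: continuous_on_eq_continuous_at\<close>)
  obtain V V1 V2 :: "real \<Rightarrow> real" and D' where
    V: "has_bochner_integral lborel (\<lambda>y. indicator {0<..} y * (exp (- (sqrt ((- \<mu>m)\<^sup>2 + 2 * \<alpha>) - (- \<mu>m)) * y) * g (- y))) (one_sided_transform \<alpha> (- \<mu>m) (\<lambda>y. g (- y)))"
    unfolding one_sided_transform_def using half_line_resolvent[OF \<alpha> g'c R(1) R', of "- \<mu>m"] by metis
  show thesis
  proof (rule half_line_resolvent[OF \<alpha> gc R, of \<mu>p], goal_cases)
    case (2 U U1 U2 D)
    note U = this[folded one_sided_transform_def c_def]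
    have U_int: "has_bochner_integral lborel (\<lambda>y. indicator {0<..} y * (exp (- (c - \<mu>p) * y) * g y)) J"
      using U(9) by (simp add: J_def one_sided_transform_def c_def)
    define P where "P x = U x + a * exp (- r * x)" for x
    define P1 where "P1 x = U1 x - r * a * exp (- r * x)" for x
    define P2 where "P2 x = U2 x + r * r * a * exp (- r * x)" for x
    have eq: "P2 x = 2 * (\<alpha> * P x - g x - \<mu>p * P1 x)" for x
    proof -
      have "r * r = 2 * (\<alpha> + \<mu>p * r)"
        using \<alpha> by (simp add: r_def char_root_def algebra_simps power2_eq_square)
      then have "r * r * a * exp (- r * x) = 2 * (\<alpha> * (a * exp (- r * x)) + \<mu>p * (r * a * exp (- r * x)))"
        by (simp add: algebra_simps)
      then show ?thesis unfolding P_def P1_def P2_def U(3) by (simp add: algebra_simps)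
    qed
    have dP: "(P has_real_derivative P1 x) (at x)" for x
      unfolding P_def[abs_def] P1_def by (auto intro!: derivative_eq_intros U(1))
    have dP1: "(P1 has_real_derivative P2 x) (at x)" for x
      unfolding P1_def[abs_def] P2_def by (auto intro!: derivative_eq_intros U(2))
    have ex: "\<bar>k * exp (- r * x)\<bar> \<le> \<bar>k\<bar>" if "x \<ge> 0" for x k
      using r that by (simp add: abs_mult mult_left_le)
    define C0 where "C0 = D + \<bar>a\<bar> + \<bar>r * a\<bar>"
    have b0: "\<bar>P x\<bar> \<le> C0" "\<bar>P1 x\<bar> \<le> C0" if "x \<ge> 0" for x
      using U(6,7)[OF that] ex[OF that, of a] ex[OF that, of "r * a"] unfolding P_def P1_def C0_def by linarith+
    define C1 where "C1 = 2 * (\<alpha> * C0 + G + \<bar>\<mu>p\<bar> * C0)"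
    have b1: "\<bar>P2 x\<bar> \<le> C1" if "x \<ge> 0" for x
    proof -
      have "\<bar>\<alpha> * P x - g x - \<mu>p * P1 x\<bar> \<le> \<bar>\<alpha> * P x\<bar> + \<bar>g x\<bar> + \<bar>\<mu>p * P1 x\<bar>" by linarith
      also have "\<dots> \<le> \<alpha> * C0 + G + \<bar>\<mu>p\<bar> * C0"
        using b0[OF that] G[OF that] \<alpha> by (intro add_mono) (auto simp: abs_mult intro!: mult_left_mono)
      finally show ?thesis unfolding eq C1_def abs_mult by simp
    qed
    have lip: "\<bar>f x - f y\<bar> \<le> E * \<bar>x - y\<bar>"
      if "\<And>x. (f has_real_derivative f' x) (at x)" "\<And>x. x \<ge> 0 \<Longrightarrow> \<bar>f' x\<bar> \<le> E" "x \<ge> 0" "y \<ge> 0" for f f' :: "real \<Rightarrow> real" and E x y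
    proof -
      have "norm (f x - f y) \<le> E * norm (x - y)"
        by (rule field_differentiable_bound[of "{0..}" f f'])
           (use that in \<open>auto intro: has_field_derivative_at_within\<close>)
      then show ?thesis by simp
    qed
    define C2 where "C2 = 2 * (\<alpha> * C0 + L + \<bar>\<mu>p\<bar> * C1)"
    have b2: "\<bar>P2 x - P2 y\<bar> \<le> C2 * \<bar>x - y\<bar>" if "x \<ge> 0" "y \<ge> 0" for x y
    proof -
      have l1: "\<bar>P x - P y\<bar> \<le> C0 * \<bar>x - y\<bar>" by (rule lip[OF dP b0(2) that])
      have l2: "\<bar>P1 x - P1 y\<bar> \<le> C1 * \<bar>x - y\<bar>" by (rule lip[OF dP1 b1 that])
      have l3: "\<bar>g x - g y\<bar> \<le> L * \<bar>x - y\<bar>" using lipschitz_onD[OF g, of x y] by (simp add: dist_real_def)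
      have "P2 x - P2 y = 2 * (\<alpha> * (P x - P y) - (g x - g y) - \<mu>p * (P1 x - P1 y))"
        unfolding eq by (simp add: algebra_simps)
      then have "\<bar>P2 x - P2 y\<bar> = 2 * \<bar>\<alpha> * (P x - P y) - (g x - g y) - \<mu>p * (P1 x - P1 y)\<bar>" by (simp only: abs_mult abs_numeral)
      also have "\<dots> \<le> 2 * (\<bar>\<alpha> * (P x - P y)\<bar> + \<bar>g x - g y\<bar> + \<bar>\<mu>p * (P1 x - P1 y)\<bar>)"
      proof -
        have "\<bar>p - q - w\<bar> \<le> \<bar>p\<bar> + \<bar>q\<bar> + \<bar>w\<bar>" for p q w :: real by linarith
        then show ?thesis by (intro mult_left_mono) simp_all
      qed
      also have "\<dots> \<le> 2 * (\<alpha> * (C0 * \<bar>x - y\<bar>) + L * \<bar>x - y\<bar> + \<bar>\<mu>p\<bar> * (C1 * \<bar>x - y\<bar>))"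
        using l1 l2 l3 \<alpha> by (intro mult_left_mono[of _ _ 2] add_mono) (auto simp: abs_mult intro!: mult_left_mono)
      also have "\<dots> = C2 * \<bar>x - y\<bar>"
        by (simp add: C2_def algebra_simps)
      finally show ?thesis .
    qed
    define C where "C = max C0 (max C1 C2)"
    show thesis
    proof (rule that[OF dP dP1 eq, where C=C])
      show "P 0 = resolvent_at_zero \<beta> \<mu>p \<mu>m \<alpha> g" by (simp add: P_def U(4) a_def)
      show "P1 0 = 2 * one_sided_transform \<alpha> \<mu>p g - char_root \<alpha> \<mu>p * resolvent_at_zero \<beta> \<mu>p \<mu>m \<alpha> g"
        using U(5) by (simp add: P1_def a_def r_def one_sided_transform_def c_def)
      show "\<And>x. x \<ge> 0 \<Longrightarrow> \<bar>P x\<bar> \<le> C" "\<And>x. x \<ge> 0 \<Longrightarrow> \<bar>P1 x\<bar> \<le> C" "\<And>x. x \<ge> 0 \<Longrightarrow> \<bar>P2 x\<bar> \<le> C"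
        using b0 b1 by (auto simp: C_def le_max_iff_disj)
      show "\<bar>P2 x - P2 y\<bar> \<le> C * \<bar>x - y\<bar>" if "x \<ge> 0" "y \<ge> 0" for x y
      proof -
        have "C2 * \<bar>x - y\<bar> \<le> C * \<bar>x - y\<bar>" by (intro mult_right_mono) (auto simp: C_def)
        then show ?thesis using b2[OF that] by linarith
      qed
      show "has_bochner_integral lborel (\<lambda>y. green \<beta> \<mu>p \<mu>m \<alpha> x y * g y) (P x)" if x: "x \<ge> 0" for x
      proof -
        \<comment> \<open>Reflection turns the transform of \<open>\<lambda>y. g (- y)\<close> on
          the right half-line into an integral of \<open>g\<close> over the left one.\<close>
        have V': "has_bochner_integral lborel (\<lambda>y. indicator {0<..} (- y) * (exp (- (c' + \<mu>m) * (- y)) * g y)) J'"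
          using lborel_has_bochner_integral_real_affine_iff[of "-1" _ _ 0, THEN iffD1, OF _ V]
          by (simp add: J'_def c'_def)
        have "has_bochner_integral lborel (\<lambda>y. indicator {0<..} y * (exp (\<mu>p * (y - x)) * (exp (- c * \<bar>y - x\<bar>) - exp (- c * (x + y))) / c * g y)
            + (2 * (1 + \<beta>) / W * exp (- r * x)) * (indicator {0<..} y * (exp (- (c - \<mu>p) * y) * g y))
            + (2 * (1 - \<beta>) / W * exp (- r * x)) * (indicator {0<..} (- y) * (exp (- (c' + \<mu>m) * (- y)) * g y)))
           (U x + (2 * (1 + \<beta>) / W * exp (- r * x)) * J + (2 * (1 - \<beta>) / W * exp (- r * x)) * J')"
          by (intro has_bochner_integral_add has_bochner_integral_mult_right U(8) U_int V' x)
        also have "U x + (2 * (1 + \<beta>) / W * exp (- r * x)) * J + (2 * (1 - \<beta>) / W * exp (- r * x)) * J' = P x"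
          by (simp add: P_def a_eq algebra_simps)
        finally have *: "has_bochner_integral lborel (\<lambda>y. indicator {0<..} y * (exp (\<mu>p * (y - x)) * (exp (- c * \<bar>y - x\<bar>) - exp (- c * (x + y))) / c * g y)
            + (2 * (1 + \<beta>) / W * exp (- r * x)) * (indicator {0<..} y * (exp (- (c - \<mu>p) * y) * g y))
            + (2 * (1 - \<beta>) / W * exp (- r * x)) * (indicator {0<..} (- y) * (exp (- (c' + \<mu>m) * (- y)) * g y))) (P x)" .
        have "AE y in lborel. y \<noteq> (0::real)" by (rule AE_lborel_singleton)
        then have ae: "AE y in lborel. green \<beta> \<mu>p \<mu>m \<alpha> x y * g y = indicator {0<..} y * (exp (\<mu>p * (y - x)) * (exp (- c * \<bar>y - x\<bar>) - exp (- c * (x + y))) / c * g y)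
            + (2 * (1 + \<beta>) / W * exp (- r * x)) * (indicator {0<..} y * (exp (- (c - \<mu>p) * y) * g y))
            + (2 * (1 - \<beta>) / W * exp (- r * x)) * (indicator {0<..} (- y) * (exp (- (c' + \<mu>m) * (- y)) * g y))"
        proof eventually_elim
          case (elim y)
          have e1: "exp (2 * \<mu>p * y) * exp (- (x + y) * r) = exp (- r * x) * exp (- (c - \<mu>p) * y)"
            by (simp add: exp_add[symmetric] r_def char_root_def c_def algebra_simps)
          have e2: "exp (2 * \<mu>m * y) * exp (- x * r + y * r') = exp (- r * x) * exp (- (c' + \<mu>m) * (- y))"
            by (simp add: exp_add[symmetric] r'_def char_root_def c'_def algebra_simps)
          show ?case
          proof (cases "y > 0")
            case True
            have "green \<beta> \<mu>p \<mu>m \<alpha> x y = exp (\<mu>p * (y - x)) * (exp (- c * \<bar>y - x\<bar>) - exp (- c * (x + y))) / c + 2 * (1 + \<beta>) * (exp (2 * \<mu>p * y) * exp (- (x + y) * r)) / W"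
              using True by (simp add: green_def Let_def c_def r_def r'_def W_def mult.assoc)
            then show ?thesis using True unfolding e1 by (simp add: distrib_right)
          next
            case False
            have "green \<beta> \<mu>p \<mu>m \<alpha> x y = 2 * (1 - \<beta>) * (exp (2 * \<mu>m * y) * exp (- x * r + y * r')) / W"
              using False by (simp add: green_def Let_def c_def r_def r'_def W_def mult.assoc)
            then show ?thesis using False elim unfolding e2 by simp
          qed
        qed
        have [measurable]: "g \<in> borel_measurable borel" using gc by (rule borel_measurable_continuous_onI)
        have "(\<lambda>y. green \<beta> \<mu>p \<mu>m \<alpha> x y * g y) \<in> borel_measurable lborel"
          unfolding green_def Let_def by measurable
        with * ae show ?thesis by (subst has_bochner_integral_cong_AE) auto
      qed
    qed
  qed auto
qed

section \<open>Paths of the equation\<close>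

definition grid :: "real \<Rightarrow> nat \<Rightarrow> nat \<Rightarrow> real" where
  "grid t n i = t * real i / real n"

lemma grid_0 [simp]: "grid t n 0 = 0"
  by (simp add: grid_def)

lemma grid_top [simp]: "n > 0 \<Longrightarrow> grid t n n = t"
  by (simp add: grid_def)

lemma grid_diff: "grid t n (Suc i) - grid t n i = t / real n"
  by (simp add: grid_def algebra_simps add_divide_distrib)

lemma grid_mono: "t \<ge> 0 \<Longrightarrow> i \<le> j \<Longrightarrow> grid t n i \<le> grid t n j"
  unfolding grid_def by (intro divide_right_mono mult_left_mono) auto

lemma grid_nonneg: "t \<ge> 0 \<Longrightarrow> 0 \<le> grid t n i"
  unfolding grid_def by simp

lemma grid_le: "t \<ge> 0 \<Longrightarrow> i \<le> n \<Longrightarrow> grid t n i \<le> t"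
  by (cases "n = 0") (use grid_mono[of t i n n] in auto)

lemma grid_uniform:
  fixes v :: "real \<Rightarrow> real"
  assumes t: "t \<ge> 0" and v: "continuous_on {0..t} v" and e: "e > 0"
  shows "\<forall>\<^sub>F n in sequentially. n > 0 \<and> (\<forall>i<n. \<forall>s\<in>{grid t n i..grid t n (Suc i)}. \<bar>v s - v (grid t n i)\<bar> \<le> e)"
proof -
  have "uniformly_continuous_on {0..t} v"
    using v by (rule compact_uniformly_continuous) simp
  then obtain d where d: "d > 0" "\<And>s s'. s \<in> {0..t} \<Longrightarrow> s' \<in> {0..t} \<Longrightarrow> dist s s' < d \<Longrightarrow> dist (v s) (v s') < e"
    using e unfolding uniformly_continuous_on_def by metis
  have "(\<lambda>n. t / real n) \<longlonglongrightarrow> 0" by (rule lim_const_over_n)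
  then have "\<forall>\<^sub>F n in sequentially. t / real n < d" using d(1) by (rule order_tendstoD)
  then show ?thesis using eventually_gt_at_top[of 0]
  proof eventually_elim
    case (elim n)
    show ?case
    proof (intro conjI allI impI ballI)
      fix i s assume i: "i < n" and s: "s \<in> {grid t n i..grid t n (Suc i)}"
      have "\<bar>s - grid t n i\<bar> < d" using s grid_diff[of t n i] elim by auto
      moreover have "s \<in> {0..t}" "grid t n i \<in> {0..t}"
        using s grid_nonneg[OF t, of n i] grid_le[OF t, of "Suc i" n] grid_le[OF t, of i n] i by auto
      ultimately show "\<bar>v s - v (grid t n i)\<bar> \<le> e"
        using d(2)[of s "grid t n i"] by (simp add: dist_real_def)
    qed (use elim in simp)
  qed
qed

lemma integrable_indicator_Icc: "integrable lborel (\<lambda>s. k * indicator {a..b} s :: real)" for a b :: real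
  by (intro integrable_mult_right integrable_real_indicator) (auto simp: emeasure_lborel_Icc_eq)

lemma set_integral_Icc_combine:
  fixes f :: "real \<Rightarrow> real"
  assumes "a \<le> b" "b \<le> c" "set_integrable lborel {a..c} f"
  shows "(LBINT s:{a..c}. f s) = (LBINT s:{a..b}. f s) + (LBINT s:{b..c}. f s)"
proof -
  have i: "set_integrable lborel {a..b} f" "set_integrable lborel {b..c} f"
    using assms by (auto intro: set_integrable_subset)
  have "(LBINT s:{a..b}. f s) + (LBINT s:{b..c}. f s) = (\<integral>s. indicator {a..b} s *\<^sub>R f s + indicator {b..c} s *\<^sub>R f s \<partial>lborel)"
    using i by (simp add: set_lebesgue_integral_def set_integrable_def)
  also have "\<dots> = (LBINT s:{a..c}. f s)"
    unfolding set_lebesgue_integral_def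
  proof (rule integral_cong_AE)
    show "(\<lambda>s. indicator {a..b} s *\<^sub>R f s + indicator {b..c} s *\<^sub>R f s) \<in> borel_measurable lborel"
      using i[unfolded set_integrable_def] by measurable
    show "(\<lambda>s. indicator {a..c} s *\<^sub>R f s) \<in> borel_measurable lborel"
      using assms(3)[unfolded set_integrable_def] by measurable
    have "AE s in lborel. s \<noteq> b" by (rule AE_lborel_singleton)
    then show "AE s in lborel. indicator {a..b} s *\<^sub>R f s + indicator {b..c} s *\<^sub>R f s = indicator {a..c} s *\<^sub>R f s"
      by eventually_elim (use assms in \<open>auto simp: indicator_def\<close>)
  qed
  finally show ?thesis ..
qed

lemma set_integral_grid:
  fixes f :: "real \<Rightarrow> real"
  assumes t: "t \<ge> 0" and n: "n > 0" and f: "set_integrable lborel {0..t} f"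
  shows "(LBINT s:{0..t}. f s) = (\<Sum>i<n. LBINT s:{grid t n i..grid t n (Suc i)}. f s)"
proof -
  have "k \<le> n \<Longrightarrow> (LBINT s:{0..grid t n k}. f s) = (\<Sum>i<k. LBINT s:{grid t n i..grid t n (Suc i)}. f s)" for k
  proof (induction k)
    case 0
    have "(LBINT s:{0..0::real}. f s) = 0"
      unfolding set_lebesgue_integral_def
      by (rule integral_eq_zero_AE, rule AE_mp[OF AE_lborel_singleton[of 0]], rule AE_I2) (auto simp: indicator_def)
    then show ?case by simp
  next
    case (Suc k)
    have "set_integrable lborel {0..grid t n (Suc k)} f"
      using Suc.prems grid_le[OF t, of "Suc k" n] by (intro set_integrable_subset[OF f]) auto
    then have "(LBINT s:{0..grid t n (Suc k)}. f s) = (LBINT s:{0..grid t n k}. f s) + (LBINT s:{grid t n k..grid t n (Suc k)}. f s)"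
      by (intro set_integral_Icc_combine grid_nonneg grid_mono t) auto
    then show ?case using Suc by simp
  qed
  from this[of n] show ?thesis using n by simp
qed

lemma set_integral_abs_bound_Icc:
  fixes f :: "real \<Rightarrow> real"
  assumes "a \<le> b" "\<And>s. s \<in> {a..b} \<Longrightarrow> \<bar>f s\<bar> \<le> C"
  shows "\<bar>LBINT s:{a..b}. f s\<bar> \<le> C * (b - a)"
proof -
  have C: "C \<ge> 0" using assms(2)[of a] assms(1) by simp
  have "\<bar>LBINT s:{a..b}. f s\<bar> \<le> (\<integral>s. \<bar>indicator {a..b} s *\<^sub>R f s\<bar> \<partial>lborel)"
    unfolding set_lebesgue_integral_def by (rule integral_abs_bound)
  also have "\<dots> \<le> (\<integral>s. C * indicator {a..b} s \<partial>lborel)"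
    by (rule integral_mono'[OF integrable_indicator_Icc]) (use assms(2) C in \<open>auto simp: indicator_def\<close>)
  finally show ?thesis using assms(1) by simp
qed

text \<open>Only the sampled factor has to be continuous. The weight is integrated exactly over each
  cell, since it will be the drift along the path, which jumps at 0.\<close>

lemma weighted_riemann_sum:
  fixes v w :: "real \<Rightarrow> real"
  assumes t: "t \<ge> 0" and v: "continuous_on {0..t} v" and w: "set_borel_measurable borel {0..t} w"
    and wb: "\<And>s. s \<in> {0..t} \<Longrightarrow> \<bar>w s\<bar> \<le> C"
  shows "(\<lambda>n. \<Sum>i<n. v (grid t n i) * (LBINT s:{grid t n i..grid t n (Suc i)}. w s)) \<longlonglongrightarrow> (LBINT s:{0..t}. v s * w s)"
proof -
  have C: "C \<ge> 0" using wb[of 0] t by simp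
  have w0: "set_integrable lborel {0..t} w"
    unfolding set_integrable_def
  proof (rule Bochner_Integration.integrable_bound[OF integrable_indicator_Icc[of C 0 t]])
    show "(\<lambda>s. indicator {0..t} s *\<^sub>R w s) \<in> borel_measurable lborel"
      using w by (simp add: set_borel_measurable_def)
    show "AE s in lborel. norm (indicator {0..t} s *\<^sub>R w s) \<le> norm (C * indicator {0..t} s)"
      using wb C by (intro AE_I2) (auto simp: indicator_def)
  qed
  obtain K where K: "\<And>s. s \<in> {0..t} \<Longrightarrow> \<bar>v s\<bar> \<le> K"
  proof -
    have "bounded (v ` {0..t})" using v by (intro compact_imp_bounded compact_continuous_image) auto
    then obtain a where "\<forall>x\<in>{0..t}. \<bar>v x\<bar> \<le> a" by (auto simp: bounded_iff)
    then show thesis by (intro that[of a]) blast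
  qed
  have K0: "K \<ge> 0" using K[of 0] t by simp
  have vm: "(\<lambda>s. indicator {0..t} s *\<^sub>R v s) \<in> borel_measurable borel"
    using borel_measurable_continuous_on_indicator[OF _ v] by simp
  have vw: "set_integrable lborel {0..t} (\<lambda>s. v s * w s)"
    unfolding set_integrable_def
  proof (rule Bochner_Integration.integrable_bound[OF integrable_indicator_Icc[of "K * C" 0 t]])
    have "(\<lambda>s. (indicator {0..t} s *\<^sub>R v s) * (indicator {0..t} s *\<^sub>R w s)) \<in> borel_measurable lborel"
      using vm w by (simp add: set_borel_measurable_def)
    moreover have "(\<lambda>s. (indicator {0..t} s *\<^sub>R v s) * (indicator {0..t} s *\<^sub>R w s)) = (\<lambda>s. indicator {0..t} s *\<^sub>R (v s * w s))"
      by (auto simp: indicator_def)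
    ultimately show "(\<lambda>s. indicator {0..t} s *\<^sub>R (v s * w s)) \<in> borel_measurable lborel" by simp
    show "AE s in lborel. norm (indicator {0..t} s *\<^sub>R (v s * w s)) \<le> norm ((K * C) * indicator {0..t} s)"
      using K wb K0 C by (intro AE_I2) (auto simp: indicator_def abs_mult intro!: mult_mono)
  qed
  show ?thesis
  proof (rule LIMSEQ_I)
    fix e :: real assume e: "e > 0"
    \<comment> \<open>The sum of the cell errors is \<open>e' * (C * t)\<close>; the added 1 makes
      the estimate strict and avoids a zero denominator.\<close>
    define e' where "e' = e / (C * t + 1)"
    have Ct: "C * t \<ge> 0" using C t by simp
    have e': "e' > 0" using e Ct by (simp add: e'_def)
    have "\<forall>\<^sub>F n in sequentially. norm ((\<Sum>i<n. v (grid t n i) * (LBINT s:{grid t n i..grid t n (Suc i)}. w s)) - (LBINT s:{0..t}. v s * w s)) < e"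
      using grid_uniform[OF t v e']
    proof eventually_elim
      case (elim n)
      have sub: "{grid t n i..grid t n (Suc i)} \<subseteq> {0..t}" if "i < n" for i
        using that grid_nonneg[OF t, of n i] grid_le[OF t, of "Suc i" n] by auto
      have each: "\<bar>v (grid t n i) * (LBINT s:{grid t n i..grid t n (Suc i)}. w s) - (LBINT s:{grid t n i..grid t n (Suc i)}. v s * w s)\<bar> \<le> e' * C * (t / n)" if i: "i < n" for i
      proof -
        have "v (grid t n i) * (LBINT s:{grid t n i..grid t n (Suc i)}. w s) - (LBINT s:{grid t n i..grid t n (Suc i)}. v s * w s)
           = (LBINT s:{grid t n i..grid t n (Suc i)}. (v (grid t n i) - v s) * w s)"
          unfolding left_diff_distrib
          using set_integrable_subset[OF w0 _ sub[OF i]] set_integrable_subset[OF vw _ sub[OF i]]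
          by (subst set_integral_diff) auto
        also have "\<bar>LBINT s:{grid t n i..grid t n (Suc i)}. (v (grid t n i) - v s) * w s\<bar> \<le> (e' * C) * (grid t n (Suc i) - grid t n i)"
        proof (rule set_integral_abs_bound_Icc)
          show "grid t n i \<le> grid t n (Suc i)" using t by (intro grid_mono) auto
          fix s assume s: "s \<in> {grid t n i..grid t n (Suc i)}"
          then have "\<bar>v (grid t n i) - v s\<bar> \<le> e'" using elim i by (auto simp: abs_minus_commute)
          moreover have "\<bar>w s\<bar> \<le> C" using s sub[OF i] by (intro wb) auto
          ultimately show "\<bar>(v (grid t n i) - v s) * w s\<bar> \<le> e' * C" using e' by (simp add: abs_mult mult_mono)
        qed
        finally show ?thesis by (simp add: grid_diff)
      qed
      have "\<bar>(\<Sum>i<n. v (grid t n i) * (LBINT s:{grid t n i..grid t n (Suc i)}. w s)) - (LBINT s:{0..t}. v s * w s)\<bar>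
         = \<bar>\<Sum>i<n. v (grid t n i) * (LBINT s:{grid t n i..grid t n (Suc i)}. w s) - (LBINT s:{grid t n i..grid t n (Suc i)}. v s * w s)\<bar>"
        using elim by (simp add: set_integral_grid[OF t _ vw, of n] sum_subtractf)
      also have "\<dots> \<le> (\<Sum>i<n. \<bar>v (grid t n i) * (LBINT s:{grid t n i..grid t n (Suc i)}. w s) - (LBINT s:{grid t n i..grid t n (Suc i)}. v s * w s)\<bar>)"
        by (rule sum_abs)
      also have "\<dots> \<le> (\<Sum>i<n. e' * C * (t / n))" by (intro sum_mono each) auto
      also have "\<dots> = e' * (C * t)" using elim by simp
      also have "\<dots> < e' * (C * t + 1)" using e' by (intro mult_strict_left_mono) auto
      also have "\<dots> = e" using Ct by (simp add: e'_def)
      finally show ?case by simp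
    qed
    then show "\<exists>N. \<forall>n\<ge>N. norm ((\<Sum>i<n. v (grid t n i) * (LBINT s:{grid t n i..grid t n (Suc i)}. w s)) - (LBINT s:{0..t}. v s * w s)) < e"
      by (simp add: eventually_sequentially)
  qed
qed

lemma riemann_sum:
  fixes v :: "real \<Rightarrow> real"
  assumes t: "t \<ge> 0" and v: "continuous_on {0..t} v"
  shows "(\<lambda>n. \<Sum>i<n. v (grid t n i) * (t / real n)) \<longlonglongrightarrow> (LBINT s:{0..t}. v s)"
proof -
  have "(LBINT s:{grid t n i..grid t n (Suc i)}. (1::real)) = t / n" for n i
    using grid_mono[OF t, of i "Suc i" n] grid_diff[of t n i] by (simp add: set_lebesgue_integral_def)
  then show ?thesis
    using weighted_riemann_sum[OF t v, of "\<lambda>_. 1" 1] by (simp add: set_borel_measurable_def)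
qed

text \<open>A Lipschitz majorant of the occupation kernel \<open>indicator {-\<epsilon>..\<epsilon>} / (2 \<epsilon>)\<close>.  The ramps have width
  \<open>\<epsilon>\<^sup>2 = o \<epsilon>\<close>, so that the majorant has the same limit, the local time.\<close>

definition trapezoid :: "real \<Rightarrow> real \<Rightarrow> real" where
  "trapezoid \<epsilon> y = max 0 (min 1 ((\<epsilon> + \<epsilon>\<^sup>2 - \<bar>y\<bar>) / \<epsilon>\<^sup>2)) / (2 * \<epsilon>)"

lemma trapezoid_nonneg: "\<epsilon> > 0 \<Longrightarrow> 0 \<le> trapezoid \<epsilon> y"
  by (simp add: trapezoid_def)

lemma trapezoid_le: "\<epsilon> > 0 \<Longrightarrow> trapezoid \<epsilon> y \<le> 1 / (2 * \<epsilon>)"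
  unfolding trapezoid_def by (intro divide_right_mono) auto

lemma trapezoid_in: "\<epsilon> > 0 \<Longrightarrow> \<bar>y\<bar> \<le> \<epsilon> \<Longrightarrow> trapezoid \<epsilon> y = 1 / (2 * \<epsilon>)"
proof -
  assume "\<epsilon> > 0" "\<bar>y\<bar> \<le> \<epsilon>"
  then have "1 \<le> (\<epsilon> + \<epsilon>\<^sup>2 - \<bar>y\<bar>) / \<epsilon>\<^sup>2" by (subst le_divide_eq_1_pos) auto
  then show ?thesis by (simp add: trapezoid_def)
qed

lemma trapezoid_out: "\<epsilon> > 0 \<Longrightarrow> \<bar>y\<bar> \<ge> \<epsilon> + \<epsilon>\<^sup>2 \<Longrightarrow> trapezoid \<epsilon> y = 0"
proof -
  assume "\<epsilon> > 0" "\<bar>y\<bar> \<ge> \<epsilon> + \<epsilon>\<^sup>2"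
  then have "(\<epsilon> + \<epsilon>\<^sup>2 - \<bar>y\<bar>) / \<epsilon>\<^sup>2 \<le> 0" by (intro divide_nonpos_nonneg) auto
  then show ?thesis by (simp add: trapezoid_def max_def min_def)
qed

lemma trapezoid_minus: "trapezoid \<epsilon> (- y) = trapezoid \<epsilon> y"
  by (simp add: trapezoid_def)

lemma trapezoid_continuous: "\<epsilon> > 0 \<Longrightarrow> continuous_on UNIV (trapezoid \<epsilon>)"
  unfolding trapezoid_def by (intro continuous_intros) auto

lemma trapezoid_lipschitz:
  assumes "\<epsilon> > 0" shows "\<bar>trapezoid \<epsilon> x - trapezoid \<epsilon> y\<bar> \<le> 1 / (2 * \<epsilon> * \<epsilon>\<^sup>2) * \<bar>x - y\<bar>"
proof -
  have cl: "\<bar>max 0 (min 1 a) - max 0 (min 1 b)\<bar> \<le> \<bar>a - b\<bar>" for a b :: real by (simp add: min_def max_def)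
  have "\<bar>trapezoid \<epsilon> x - trapezoid \<epsilon> y\<bar> = \<bar>max 0 (min 1 ((\<epsilon> + \<epsilon>\<^sup>2 - \<bar>x\<bar>) / \<epsilon>\<^sup>2)) - max 0 (min 1 ((\<epsilon> + \<epsilon>\<^sup>2 - \<bar>y\<bar>) / \<epsilon>\<^sup>2))\<bar> / (2 * \<epsilon>)"
    using assms unfolding trapezoid_def diff_divide_distrib[symmetric] by (simp only: abs_divide) simp
  also have "\<dots> \<le> \<bar>(\<epsilon> + \<epsilon>\<^sup>2 - \<bar>x\<bar>) / \<epsilon>\<^sup>2 - (\<epsilon> + \<epsilon>\<^sup>2 - \<bar>y\<bar>) / \<epsilon>\<^sup>2\<bar> / (2 * \<epsilon>)"
    using assms by (intro divide_right_mono cl) auto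
  also have "\<dots> = \<bar>\<bar>y\<bar> - \<bar>x\<bar>\<bar> / \<epsilon>\<^sup>2 / (2 * \<epsilon>)"
    using assms by (simp add: diff_divide_distrib[symmetric])
  also have "\<dots> \<le> \<bar>x - y\<bar> / \<epsilon>\<^sup>2 / (2 * \<epsilon>)"
    using assms by (intro divide_right_mono) auto
  finally show ?thesis by (simp add: field_simps)
qed

section \<open>A single path of the equation, without probability\<close>

locale sde_path =
  fixes \<xi> b :: "real \<Rightarrow> real" and \<beta> \<mu>p \<mu>m x :: real
  assumes cont_\<xi>: "continuous_on {0..} \<xi>" and cont_b: "continuous_on {0..} b"
    and start: "\<xi> 0 = x" "b 0 = 0"
    and occ_limit: "\<And>t. 0 \<le> t \<Longrightarrow> \<exists>l. (occupation_quotient \<xi> t 0 \<longlongrightarrow> l) (at_right 0)"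
    and equation: "\<And>t. 0 \<le> t \<Longrightarrow> \<xi> t = \<xi> 0 + b t + \<beta> * local_time \<xi> t 0
        + \<mu>p * (LBINT s:{0..t}. indicator {s. \<xi> s > 0} s)
        + \<mu>m * (LBINT s:{0..t}. indicator {s. \<xi> s < 0} s)"
begin

definition \<Lambda> :: "real \<Rightarrow> real" where "\<Lambda> t = local_time \<xi> t 0"

definition drift :: "real \<Rightarrow> real" where
  "drift s = \<mu>p * indicator {0<..} (\<xi> s) + \<mu>m * indicator {..<0} (\<xi> s)"

definition vel :: real where "vel = \<bar>\<mu>p\<bar> + \<bar>\<mu>m\<bar>"

lemma cont_\<xi>': "continuous_on {0..t} \<xi>"
  by (rule continuous_on_subset[OF cont_\<xi>]) auto

lemma \<xi>_measurable: "(\<lambda>s. indicator {0..t} s *\<^sub>R \<xi> s) \<in> borel_measurable borel"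
  by (rule borel_measurable_continuous_on_indicator[OF borel_closed[OF closed_real_atLeastAtMost] cont_\<xi>'])

lemma comp_measurable:
  fixes f :: "real \<Rightarrow> real"
  assumes [measurable]: "f \<in> borel_measurable borel"
  shows "set_borel_measurable borel {0..t} (\<lambda>s. f (\<xi> s))"
proof -
  note \<xi>_measurable[of t, measurable]
  have "(\<lambda>s. indicator {0..t} s * f (indicator {0..t} s *\<^sub>R \<xi> s)) \<in> borel_measurable borel" by measurable
  moreover have "(\<lambda>s. indicator {0..t} s * f (indicator {0..t} s *\<^sub>R \<xi> s)) = (\<lambda>s. indicator {0..t} s *\<^sub>R f (\<xi> s))"
    by (auto simp: indicator_def)
  ultimately show ?thesis by (simp add: set_borel_measurable_def)
qed

lemma sub_measurable:
  assumes [measurable]: "S \<in> sets borel"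
  shows "{s \<in> {0..t}. \<xi> s \<in> S} \<in> sets lborel"
proof -
  note \<xi>_measurable[of t, measurable]
  have "{s \<in> {0..t}. \<xi> s \<in> S} = {s \<in> space borel. s \<in> {0..t} \<and> indicator {0..t} s *\<^sub>R \<xi> s \<in> S}"
    by auto
  also have "\<dots> \<in> sets borel" by measurable
  finally show ?thesis by simp
qed

lemma sub_finite: "emeasure lborel {s \<in> {0..t}. P s} < \<infinity>" for t :: real
proof -
  have "emeasure lborel {s \<in> {0..t}. P s} \<le> emeasure lborel {0..t}" by (rule emeasure_mono) auto
  also have "\<dots> < \<infinity>" by (simp add: emeasure_lborel_Icc_eq)
  finally show ?thesis .
qed

lemma occ_measurable: "{s \<in> {0..t}. \<bar>\<xi> s - 0\<bar> \<le> \<epsilon>} \<in> sets lborel"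
  using sub_measurable[of "{- \<epsilon>..\<epsilon>}" t] by (simp add: abs_le_iff minus_le_iff conj_commute)

lemma comp_integrable:
  fixes f :: "real \<Rightarrow> real"
  assumes "f \<in> borel_measurable borel" "\<And>y. \<bar>f y\<bar> \<le> C"
  shows "set_integrable lborel {0..t} (\<lambda>s. f (\<xi> s))"
  unfolding set_integrable_def
proof (rule Bochner_Integration.integrable_bound[OF integrable_indicator_Icc[of C 0 t]])
  show "(\<lambda>s. indicator {0..t} s *\<^sub>R f (\<xi> s)) \<in> borel_measurable lborel"
    using comp_measurable[OF assms(1), of t] by (simp add: set_borel_measurable_def)
  show "AE s in lborel. norm (indicator {0..t} s *\<^sub>R f (\<xi> s)) \<le> norm (C * indicator {0..t} s)"
    using assms(2) by (intro AE_I2) (auto simp: indicator_def intro: order_trans[OF _ abs_ge_self])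
qed

lemma \<Lambda>_tendsto: assumes "0 \<le> t" shows "(occupation_quotient \<xi> t 0 \<longlongrightarrow> \<Lambda> t) (at_right 0)"
proof -
  obtain l where l: "(occupation_quotient \<xi> t 0 \<longlongrightarrow> l) (at_right 0)" using occ_limit[OF assms] by blast
  then have "\<Lambda> t = l" unfolding \<Lambda>_def local_time_def by (intro tendsto_Lim) auto
  then show ?thesis using l by simp
qed

lemma \<Lambda>_0: "\<Lambda> 0 = 0"
proof -
  have "measure lborel {s \<in> {0..0}. \<bar>\<xi> s - 0\<bar> \<le> \<epsilon>} = 0" for \<epsilon>
  proof -
    have "measure lborel {s \<in> {0..0}. \<bar>\<xi> s - 0\<bar> \<le> \<epsilon>} \<le> measure lborel {0::real}"
      by (rule measure_mono_fmeasurable) (use occ_measurable[of 0 \<epsilon>] in \<open>auto simp: fmeasurable_def\<close>)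
    then show ?thesis by (simp add: measure_le_0_iff)
  qed
  then have "occupation_quotient \<xi> 0 0 = (\<lambda>_. 0)" by (simp add: occupation_quotient_def fun_eq_iff)
  then show ?thesis using \<Lambda>_tendsto[of 0] by (simp add: tendsto_const_iff)
qed

lemma ev_pos: "\<forall>\<^sub>F \<epsilon> in at_right (0::real). \<epsilon> > 0"
  by (simp add: eventually_at_right_less)

lemma \<Lambda>_mono: assumes "0 \<le> s" "s \<le> t" shows "\<Lambda> s \<le> \<Lambda> t"
proof (rule tendsto_le[OF trivial_limit_at_right_real \<Lambda>_tendsto \<Lambda>_tendsto])
  show "\<forall>\<^sub>F \<epsilon> in at_right 0. occupation_quotient \<xi> s 0 \<epsilon> \<le> occupation_quotient \<xi> t 0 \<epsilon>"
    using ev_pos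
  proof eventually_elim
    case (elim \<epsilon>)
    have "measure lborel {r \<in> {0..s}. \<bar>\<xi> r - 0\<bar> \<le> \<epsilon>} \<le> measure lborel {r \<in> {0..t}. \<bar>\<xi> r - 0\<bar> \<le> \<epsilon>}"
      using assms occ_measurable sub_finite[of t] by (intro measure_mono_fmeasurable) (auto simp: fmeasurable_def)
    then show ?case using elim by (simp add: occupation_quotient_def divide_right_mono)
  qed
qed (use assms in auto)

lemma \<Lambda>_nonneg: "0 \<le> t \<Longrightarrow> 0 \<le> \<Lambda> t"
  using \<Lambda>_mono[of 0 t] \<Lambda>_0 by simp

text \<open>On \<open>{s..t}\<close> the path keeps a positive distance from 0, so for small
  \<epsilon> both occupation quotients count the same times.\<close>

lemma \<Lambda>_const:
  assumes st: "0 \<le> s" "s \<le> t" and nz: "\<And>r. s \<le> r \<Longrightarrow> r \<le> t \<Longrightarrow> \<xi> r \<noteq> 0"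
  shows "\<Lambda> t = \<Lambda> s"
proof -
  have "continuous_on {s..t} (\<lambda>r. \<bar>\<xi> r\<bar>)"
    using st by (intro continuous_intros continuous_on_subset[OF cont_\<xi>]) auto
  then obtain r0 where r0: "r0 \<in> {s..t}" "\<And>r. r \<in> {s..t} \<Longrightarrow> \<bar>\<xi> r0\<bar> \<le> \<bar>\<xi> r\<bar>"
    using continuous_attains_inf[of "{s..t}" "\<lambda>r. \<bar>\<xi> r\<bar>"] st by auto
  have pos: "\<bar>\<xi> r0\<bar> > 0" using nz[of r0] r0(1) by auto
  have "\<forall>\<^sub>F \<epsilon> in at_right 0. \<epsilon> < \<bar>\<xi> r0\<bar>"
    using pos by (intro order_tendstoD(2)[OF tendsto_ident_at])
  then have "\<forall>\<^sub>F \<epsilon> in at_right 0. occupation_quotient \<xi> s 0 \<epsilon> = occupation_quotient \<xi> t 0 \<epsilon>"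
  proof eventually_elim
    case (elim \<epsilon>)
    have "{r \<in> {0..s}. \<bar>\<xi> r - 0\<bar> \<le> \<epsilon>} = {r \<in> {0..t}. \<bar>\<xi> r - 0\<bar> \<le> \<epsilon>}"
    proof (intro set_eqI iffI)
      fix r assume r: "r \<in> {r \<in> {0..t}. \<bar>\<xi> r - 0\<bar> \<le> \<epsilon>}"
      then have "r \<notin> {s..t}" using r0(2)[of r] elim by auto
      then show "r \<in> {r \<in> {0..s}. \<bar>\<xi> r - 0\<bar> \<le> \<epsilon>}" using r by auto
    qed (use st in auto)
    then show ?case by (simp add: occupation_quotient_def)
  qed
  then have "(occupation_quotient \<xi> t 0 \<longlongrightarrow> \<Lambda> s) (at_right 0)"
    using \<Lambda>_tendsto[OF st(1)] by (rule Lim_transform_eventually[rotated])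
  then show ?thesis using \<Lambda>_tendsto[of t] st tendsto_unique[OF trivial_limit_at_right_real] by force
qed

text \<open>The quotient times \<open>2 * \<epsilon>\<close> bounds the measure of the zero set from
  above and tends to 0, because the quotient has a finite limit. The derivatives of the kinked
  function at 0 are therefore invisible to time integrals.\<close>

lemma null_at_zero: "0 \<le> t \<Longrightarrow> AE s in lborel. s \<in> {0..t} \<longrightarrow> \<xi> s \<noteq> 0"
proof -
  assume t: "0 \<le> t"
  have fin: "{s \<in> {0..t}. \<xi> s = 0} \<in> fmeasurable lborel"
    using sub_measurable[of "{0}" t] sub_finite[of t "\<lambda>s. \<xi> s = 0"] by (auto simp: fmeasurable_def)
  have "measure lborel {s \<in> {0..t}. \<xi> s = 0} \<le> 0"
  proof (rule tendsto_lowerbound)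
    show "((\<lambda>\<epsilon>. occupation_quotient \<xi> t 0 \<epsilon> * (2 * \<epsilon>)) \<longlongrightarrow> 0) (at_right 0)"
      by (rule tendsto_eq_rhs[OF tendsto_mult[OF \<Lambda>_tendsto[OF t] tendsto_mult[OF tendsto_const tendsto_ident_at]]]) simp
    show "\<forall>\<^sub>F \<epsilon> in at_right 0. measure lborel {s \<in> {0..t}. \<xi> s = 0} \<le> occupation_quotient \<xi> t 0 \<epsilon> * (2 * \<epsilon>)"
      using ev_pos
    proof eventually_elim
      case (elim \<epsilon>)
      have "measure lborel {s \<in> {0..t}. \<xi> s = 0} \<le> measure lborel {s \<in> {0..t}. \<bar>\<xi> s - 0\<bar> \<le> \<epsilon>}"
        using elim occ_measurable sub_finite[of t] fin by (intro measure_mono_fmeasurable) (auto simp: fmeasurable_def)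
      then show ?case using elim by (simp add: occupation_quotient_def)
    qed
  qed simp
  then have "measure lborel {s \<in> {0..t}. \<xi> s = 0} = 0" by (simp add: measure_le_0_iff)
  then have "emeasure lborel {s \<in> {0..t}. \<xi> s = 0} = 0" by (simp only: emeasure_eq_measure2[OF fin] ennreal_0)
  then have "{s \<in> {0..t}. \<xi> s = 0} \<in> null_sets lborel" using fmeasurableD[OF fin] by (rule null_setsI)
  then show ?thesis by (rule AE_I') auto
qed

lemma drift_measurable: "set_borel_measurable borel {0..t} drift"
  unfolding drift_def[abs_def] by (rule comp_measurable[of "\<lambda>y. \<mu>p * indicator {0<..} y + \<mu>m * indicator {..<0} y"]) measurable

lemma drift_le: "\<bar>drift s\<bar> \<le> vel"
  by (auto simp: drift_def vel_def indicator_def)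

lemma drift_integrable: "set_integrable lborel {0..t} drift"
  unfolding drift_def[abs_def]
  by (rule comp_integrable[of "\<lambda>y. \<mu>p * indicator {0<..} y + \<mu>m * indicator {..<0} y" vel])
     (auto simp: vel_def indicator_def)

definition D :: "real \<Rightarrow> real" where "D t = (LBINT s:{0..t}. drift s)"

lemma D_eq: "D t = \<mu>p * (LBINT s:{0..t}. indicator {s. \<xi> s > 0} s) + \<mu>m * (LBINT s:{0..t}. indicator {s. \<xi> s < 0} s)"
proof -
  have i: "set_integrable lborel {0..t} (\<lambda>s. indicator {0<..} (\<xi> s) :: real)" "set_integrable lborel {0..t} (\<lambda>s. indicator {..<0} (\<xi> s) :: real)"
    by (rule comp_integrable[of _ 1]; auto simp: indicator_def)+
  have "D t = \<mu>p * (LBINT s:{0..t}. indicator {0<..} (\<xi> s)) + \<mu>m * (LBINT s:{0..t}. indicator {..<0} (\<xi> s))"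
    unfolding D_def drift_def using i by (simp add: set_integral_add)
  also have "(\<lambda>s. indicator {0<..} (\<xi> s) :: real) = indicator {s. \<xi> s > 0}" by (auto simp: indicator_def)
  also have "(\<lambda>s. indicator {..<0} (\<xi> s) :: real) = indicator {s. \<xi> s < 0}" by (auto simp: indicator_def)
  finally show ?thesis .
qed

lemma D_increment: "0 \<le> s \<Longrightarrow> s \<le> t \<Longrightarrow> D t - D s = (LBINT r:{s..t}. drift r)"
  unfolding D_def by (subst set_integral_Icc_combine[of 0 s t]) (auto intro: drift_integrable)

lemma D_increment_le: "0 \<le> s \<Longrightarrow> s \<le> t \<Longrightarrow> \<bar>D t - D s\<bar> \<le> vel * (t - s)"
  unfolding D_increment by (intro set_integral_abs_bound_Icc drift_le)

lemma D_0: "D 0 = 0"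
proof -
  have "\<bar>LBINT s:{0..0}. drift s\<bar> \<le> vel * (0 - 0)" by (intro set_integral_abs_bound_Icc drift_le) auto
  then show ?thesis by (simp add: D_def)
qed

definition A :: "real \<Rightarrow> real" where "A t = \<xi> t - b t"

lemma A_eq: "0 \<le> t \<Longrightarrow> A t = x + \<beta> * \<Lambda> t + D t"
  using equation[of t] start by (simp add: A_def \<Lambda>_def D_eq)

lemma cont_A: "continuous_on {0..t} A"
  unfolding A_def by (intro continuous_intros cont_\<xi>' continuous_on_subset[OF cont_b]) auto

text \<open>Continuity is not visible in the occupation limit. It is read off the equation, where
  \<open>\<beta> * \<Lambda>\<close> is the only term not yet known to be continuous; hence the
  factor \<beta>.\<close>

lemma cont_\<beta>\<Lambda>: "continuous_on {0..t} (\<lambda>s. \<beta> * \<Lambda> s)"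
proof -
  have vel0: "vel \<ge> 0" by (simp add: vel_def)
  have "continuous_on {0..t} D"
  proof (rule lipschitz_on_continuous_on[of vel])
    show "vel-lipschitz_on {0..t} D"
    proof (rule lipschitz_onI[OF _ vel0])
      fix r s assume "r \<in> {0..t}" "s \<in> {0..t}"
      then show "dist (D r) (D s) \<le> vel * dist r s"
        using D_increment_le[of r s] D_increment_le[of s r] by (cases "r \<le> s") (auto simp: dist_real_def)
    qed
  qed
  then have "continuous_on {0..t} (\<lambda>s. A s - x - D s)" by (intro continuous_intros cont_A)
  then show ?thesis by (rule continuous_on_cong[THEN iffD1, rotated -1]) (auto simp: A_eq)
qed

text \<open>A nondecreasing majorant: its increments dominate those of \<open>A\<close>, so
  \<open>V t\<close> bounds the variation of \<open>A\<close> along every grid.\<close>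

definition V :: "real \<Rightarrow> real" where "V t = \<bar>\<beta>\<bar> * \<Lambda> t + vel * t"

lemma V_nonneg: "0 \<le> t \<Longrightarrow> 0 \<le> V t"
  using \<Lambda>_nonneg[of t] by (simp add: V_def vel_def)

lemma A_increment_le: "0 \<le> s \<Longrightarrow> s \<le> t \<Longrightarrow> \<bar>A t - A s\<bar> \<le> V t - V s"
proof -
  assume st: "0 \<le> s" "s \<le> t"
  have "A t - A s = \<beta> * (\<Lambda> t - \<Lambda> s) + (D t - D s)" using st by (simp add: A_eq algebra_simps)
  then have "\<bar>A t - A s\<bar> \<le> \<bar>\<beta> * (\<Lambda> t - \<Lambda> s)\<bar> + \<bar>D t - D s\<bar>" by linarith
  also have "\<dots> \<le> \<bar>\<beta>\<bar> * (\<Lambda> t - \<Lambda> s) + vel * (t - s)"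
    using D_increment_le[OF st] \<Lambda>_mono[OF st] by (simp add: abs_mult)
  finally show ?thesis by (simp add: V_def algebra_simps)
qed

lemma sum_A_le: assumes t: "0 \<le> t" shows "(\<Sum>i<n. \<bar>A (grid t n (Suc i)) - A (grid t n i)\<bar>) \<le> V t"
proof (cases "n = 0")
  case False
  have "(\<Sum>i<n. \<bar>A (grid t n (Suc i)) - A (grid t n i)\<bar>) \<le> (\<Sum>i<n. V (grid t n (Suc i)) - V (grid t n i))"
    by (intro sum_mono A_increment_le grid_nonneg grid_mono t) auto
  also have "\<dots> = V t - V 0" using False by (subst sum_lessThan_telescope) simp
  also have "V 0 = 0" by (simp add: V_def \<Lambda>_0)
  finally show ?thesis by simp
qed (use V_nonneg[OF t] in simp)

text \<open>At the last zero \<open>g\<close> of the path before \<open>t\<close> one has \<open>\<Lambda> t = \<Lambda> g\<close>, and the equation at time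
  \<open>g\<close>, where the left-hand side vanishes, expresses \<open>\<beta> \<Lambda> g\<close> through the driving path.\<close>

lemma \<Lambda>_le:
  assumes t: "0 \<le> t" and S: "\<And>s. 0 \<le> s \<Longrightarrow> s \<le> t \<Longrightarrow> \<bar>b s\<bar> \<le> S"
  shows "\<bar>\<beta>\<bar> * \<Lambda> t \<le> \<bar>x\<bar> + S + vel * t"
proof (cases "\<exists>s\<in>{0..t}. \<xi> s = 0")
  case False
  then have "\<Lambda> t = 0" using \<Lambda>_const[of 0 t] \<Lambda>_0 t by auto
  moreover have "S \<ge> 0" using S[of 0] t by simp
  ultimately show ?thesis using t by (simp add: vel_def)
next
  case True
  let ?Z = "{s \<in> {0..t}. \<xi> s = 0}"
  have "closed ?Z" using continuous_closed_preimage_constant[OF cont_\<xi>'] by simp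
  moreover have "?Z = {0..t} \<inter> ?Z" by auto
  ultimately have "compact ?Z" by (metis compact_Icc compact_Int_closed)
  moreover have "?Z \<noteq> {}" using True by blast
  ultimately obtain g where g: "g \<in> ?Z" "\<And>s. s \<in> ?Z \<Longrightarrow> s \<le> g"
    using compact_attains_sup[of ?Z] by meson
  \<comment> \<open>\<open>\<Lambda>_const\<close> gives constancy only after \<open>g\<close>,
    since the path vanishes at \<open>g\<close> itself; continuity of
    \<open>\<beta> * \<Lambda>\<close> carries the value back to \<open>g\<close>.\<close>
  have eq: "\<beta> * \<Lambda> t = \<beta> * \<Lambda> g"
  proof (cases "g = t")
    case False
    then have gt: "0 \<le> g" "g < t" using g(1) by auto
    have "((\<lambda>s. \<beta> * \<Lambda> s) \<longlongrightarrow> \<beta> * \<Lambda> g) (at g within {0..t})"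
      using cont_\<beta>\<Lambda>[of t] g(1) by (auto simp: continuous_on_def)
    then have "((\<lambda>s. \<beta> * \<Lambda> s) \<longlongrightarrow> \<beta> * \<Lambda> g) (at g within {g..t})"
      using gt by (elim tendsto_within_subset) auto
    moreover have "at g within {g..t} = at_right g" using gt by (intro at_within_Icc_at_right)
    ultimately have lim: "((\<lambda>s. \<beta> * \<Lambda> s) \<longlongrightarrow> \<beta> * \<Lambda> g) (at_right g)" by simp
    have "\<forall>\<^sub>F s in at_right g. s \<in> {g<..<t}" using gt(2) by (rule eventually_at_right_real)
    then have "\<forall>\<^sub>F s in at_right g. \<beta> * \<Lambda> s = \<beta> * \<Lambda> t"
    proof eventually_elim
      case (elim s)
      have "\<Lambda> t = \<Lambda> s"
      proof (rule \<Lambda>_const)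
        fix r assume r: "s \<le> r" "r \<le> t"
        show "\<xi> r \<noteq> 0" using g(2)[of r] r elim gt by auto
      qed (use elim gt in auto)
      then show ?case by simp
    qed
    then have "((\<lambda>s. \<beta> * \<Lambda> s) \<longlongrightarrow> \<beta> * \<Lambda> t) (at_right g)" by (rule tendsto_eventually)
    then show ?thesis using lim tendsto_unique[OF trivial_limit_at_right_real] by blast
  qed simp
  have g0: "0 \<le> g" "g \<le> t" "\<xi> g = 0" using g(1) by auto
  have "\<beta> * \<Lambda> g = - x - b g - D g" using A_eq[OF g0(1)] g0(3) by (simp add: A_def)
  moreover have "\<bar>D g\<bar> \<le> vel * t"
  proof -
    have "\<bar>D g\<bar> \<le> vel * g" using D_increment_le[of 0 g] g0 D_0 by simp
    also have "\<dots> \<le> vel * t" using g0 by (intro mult_left_mono) (auto simp: vel_def)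
    finally show ?thesis .
  qed
  moreover have "\<bar>b g\<bar> \<le> S" using S g0 by blast
  ultimately have "\<bar>\<beta> * \<Lambda> t\<bar> \<le> \<bar>x\<bar> + S + vel * t" using eq by linarith
  then show ?thesis using \<Lambda>_nonneg[OF t] by (simp add: abs_mult)
qed

text \<open>The path is starting point plus noise plus drift plus
  \<open>\<beta> * \<Lambda>\<close>, and the last term is bounded by the first three once more,
  hence the factor 2.\<close>

lemma \<xi>_le:
  assumes t: "0 \<le> t" and S: "\<And>s. 0 \<le> s \<Longrightarrow> s \<le> t \<Longrightarrow> \<bar>b s\<bar> \<le> S" and s: "0 \<le> s" "s \<le> t"
  shows "\<bar>\<xi> s\<bar> \<le> 2 * (\<bar>x\<bar> + S + vel * t)"
proof -
  have "\<bar>A s - A 0\<bar> \<le> V s - V 0" using s by (intro A_increment_le) auto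
  moreover have "V 0 = 0" "A 0 = x" using start by (auto simp: V_def \<Lambda>_0 A_def)
  moreover have "V s \<le> V t" using A_increment_le[OF s] by linarith
  moreover have "V t \<le> (\<bar>x\<bar> + S + vel * t) + vel * t" using \<Lambda>_le[OF t S] unfolding V_def by linarith
  moreover have "\<bar>b s\<bar> \<le> S" using S s by blast
  moreover have "\<bar>\<xi> s\<bar> \<le> \<bar>A s - A 0\<bar> + \<bar>A 0\<bar> + \<bar>b s\<bar>" unfolding A_def by linarith
  ultimately have "\<bar>\<xi> s\<bar> \<le> (\<bar>x\<bar> + S + vel * t) + vel * t + \<bar>x\<bar> + S" by linarith
  then show ?thesis by (simp add: algebra_simps)
qed

lemma V_le:
  assumes t: "0 \<le> t" and S: "\<And>s. 0 \<le> s \<Longrightarrow> s \<le> t \<Longrightarrow> \<bar>b s\<bar> \<le> S"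
  shows "V t \<le> 2 * (\<bar>x\<bar> + S + vel * t)"
proof -
  have "V t \<le> (\<bar>x\<bar> + S + vel * t) + vel * t" using \<Lambda>_le[OF t S] unfolding V_def by linarith
  moreover have "S \<ge> 0" using S[of 0] t by simp
  ultimately have "V t \<le> (\<bar>x\<bar> + S + vel * t) + vel * t + \<bar>x\<bar> + S" by linarith
  then show ?thesis by (simp add: algebra_simps)
qed

text \<open>The variation of \<open>A\<close> along the grid is at most \<open>V t\<close>, while
  the increments of \<open>b\<close> and \<open>A\<close> over one cell are uniformly small. These
  sums bound the mixed and second-order terms of the Taylor expansion that involve
  \<open>A\<close>.\<close>

lemma sum_A_small:
  assumes t: "0 \<le> t"
  shows "(\<lambda>n. \<Sum>i<n. \<bar>A (grid t n (Suc i)) - A (grid t n i)\<bar> *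
     (\<bar>b (grid t n (Suc i)) - b (grid t n i)\<bar> + \<bar>A (grid t n (Suc i)) - A (grid t n i)\<bar>)) \<longlonglongrightarrow> 0"
proof (rule LIMSEQ_I)
  fix e :: real assume e: "e > 0"
  have V: "V t \<ge> 0" by (rule V_nonneg[OF t])
  define e' where "e' = e / (V t + 1) / 2"
  have nz: "V t + 1 \<noteq> 0" using V by linarith
  have e': "e' > 0" using e V by (simp add: e'_def)
  have cb: "continuous_on {0..t} b" by (rule continuous_on_subset[OF cont_b]) auto
  have "\<forall>\<^sub>F n in sequentially. norm ((\<Sum>i<n. \<bar>A (grid t n (Suc i)) - A (grid t n i)\<bar> *
     (\<bar>b (grid t n (Suc i)) - b (grid t n i)\<bar> + \<bar>A (grid t n (Suc i)) - A (grid t n i)\<bar>)) - 0) < e"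
    using grid_uniform[OF t cb e'] grid_uniform[OF t cont_A e']
  proof eventually_elim
    case (elim n)
    have mem: "grid t n (Suc i) \<in> {grid t n i..grid t n (Suc i)}" for i using grid_mono[OF t, of i "Suc i" n] by simp
    have "(\<Sum>i<n. \<bar>A (grid t n (Suc i)) - A (grid t n i)\<bar> *
     (\<bar>b (grid t n (Suc i)) - b (grid t n i)\<bar> + \<bar>A (grid t n (Suc i)) - A (grid t n i)\<bar>))
       \<le> (\<Sum>i<n. \<bar>A (grid t n (Suc i)) - A (grid t n i)\<bar> * (2 * e'))"
    proof (intro sum_mono mult_left_mono)
      fix i assume "i \<in> {..<n}"
      then have "\<bar>b (grid t n (Suc i)) - b (grid t n i)\<bar> \<le> e'" "\<bar>A (grid t n (Suc i)) - A (grid t n i)\<bar> \<le> e'"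
        using elim mem[of i] by blast+
      then show "\<bar>b (grid t n (Suc i)) - b (grid t n i)\<bar> + \<bar>A (grid t n (Suc i)) - A (grid t n i)\<bar> \<le> 2 * e'" by simp
    qed auto
    also have "\<dots> \<le> V t * (2 * e')"
      unfolding sum_distrib_right[symmetric] using e' by (intro mult_right_mono sum_A_le t) auto
    also have "\<dots> < (V t + 1) * (2 * e')" using e' by (intro mult_strict_right_mono) auto
    also have "\<dots> = e"
    proof -
      have "a * (2 * (e / a / 2)) = e" if "a \<noteq> 0" for a using that by simp
      from this[OF nz] show ?thesis unfolding e'_def .
    qed
    finally show ?case by (simp add: sum_nonneg)
  qed
  then show "\<exists>N. \<forall>n\<ge>N. norm ((\<Sum>i<n. \<bar>A (grid t n (Suc i)) - A (grid t n i)\<bar> *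
     (\<bar>b (grid t n (Suc i)) - b (grid t n i)\<bar> + \<bar>A (grid t n (Suc i)) - A (grid t n i)\<bar>)) - 0) < e"
    by (simp add: eventually_sequentially)
qed

text \<open>Since \<open>\<Lambda>\<close> grows only on intervals that contain a zero of the path, \<open>\<psi> (\<xi> s)\<close> may be replaced
  by \<open>\<psi> 0\<close>.\<close>

lemma stieltjes_\<Lambda>:
  assumes t: "0 \<le> t" and \<psi>: "C-lipschitz_on UNIV \<psi>"
  shows "(\<lambda>n. \<Sum>i<n. \<psi> (\<xi> (grid t n i)) * (\<Lambda> (grid t n (Suc i)) - \<Lambda> (grid t n i))) \<longlonglongrightarrow> \<psi> 0 * \<Lambda> t"
proof (rule LIMSEQ_I)
  fix e :: real assume e: "e > 0"
  have L: "\<Lambda> t \<ge> 0" by (rule \<Lambda>_nonneg[OF t])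
  have C: "C \<ge> 0" using \<psi> by (simp add: lipschitz_on_def)
  define e' where "e' = e / ((C + 1) * (\<Lambda> t + 1))"
  have e': "e' > 0" using e L C by (auto simp: e'_def intro!: divide_pos_pos mult_pos_pos)
  have "\<forall>\<^sub>F n in sequentially. norm ((\<Sum>i<n. \<psi> (\<xi> (grid t n i)) * (\<Lambda> (grid t n (Suc i)) - \<Lambda> (grid t n i))) - \<psi> 0 * \<Lambda> t) < e"
    using grid_uniform[OF t cont_\<xi>' e']
  proof eventually_elim
    case (elim n)
    have tel: "(\<Sum>i<n. \<Lambda> (grid t n (Suc i)) - \<Lambda> (grid t n i)) = \<Lambda> t"
      using elim by (subst sum_lessThan_telescope) (simp add: \<Lambda>_0)
    have each: "\<bar>(\<psi> (\<xi> (grid t n i)) - \<psi> 0) * (\<Lambda> (grid t n (Suc i)) - \<Lambda> (grid t n i))\<bar> \<le> C * e' * (\<Lambda> (grid t n (Suc i)) - \<Lambda> (grid t n i))"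
      if i: "i < n" for i
    proof -
      have d: "\<Lambda> (grid t n (Suc i)) - \<Lambda> (grid t n i) \<ge> 0"
        using \<Lambda>_mono[of "grid t n i" "grid t n (Suc i)"] grid_nonneg[OF t, of n i] grid_mono[OF t, of i "Suc i" n] by simp
      show ?thesis
      proof (cases "\<exists>r\<in>{grid t n i..grid t n (Suc i)}. \<xi> r = 0")
        case True
        then obtain r where r: "r \<in> {grid t n i..grid t n (Suc i)}" "\<xi> r = 0" by blast
        then have "\<bar>\<xi> r - \<xi> (grid t n i)\<bar> \<le> e'" using elim i by blast
        then have "\<bar>\<xi> (grid t n i) - 0\<bar> \<le> e'" using r(2) by simp
        then have "C * \<bar>\<xi> (grid t n i) - 0\<bar> \<le> C * e'" using C by (intro mult_left_mono) auto
        moreover have "\<bar>\<psi> (\<xi> (grid t n i)) - \<psi> 0\<bar> \<le> C * \<bar>\<xi> (grid t n i) - 0\<bar>"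
          using lipschitz_onD[OF \<psi>, of "\<xi> (grid t n i)" 0] by (simp add: dist_real_def)
        ultimately have "\<bar>\<psi> (\<xi> (grid t n i)) - \<psi> 0\<bar> \<le> C * e'" by linarith
        then show ?thesis using d by (simp add: abs_mult mult_right_mono)
      next
        case False
        then have "\<Lambda> (grid t n (Suc i)) = \<Lambda> (grid t n i)"
          by (intro \<Lambda>_const grid_nonneg grid_mono t) auto
        then show ?thesis by simp
      qed
    qed
    have "(\<Sum>i<n. \<psi> (\<xi> (grid t n i)) * (\<Lambda> (grid t n (Suc i)) - \<Lambda> (grid t n i))) - \<psi> 0 * \<Lambda> t
       = (\<Sum>i<n. (\<psi> (\<xi> (grid t n i)) - \<psi> 0) * (\<Lambda> (grid t n (Suc i)) - \<Lambda> (grid t n i)))"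
      unfolding tel[symmetric] sum_distrib_left sum_subtractf[symmetric] by (intro sum.cong) (auto simp: algebra_simps)
    then have "\<bar>(\<Sum>i<n. \<psi> (\<xi> (grid t n i)) * (\<Lambda> (grid t n (Suc i)) - \<Lambda> (grid t n i))) - \<psi> 0 * \<Lambda> t\<bar>
       \<le> (\<Sum>i<n. \<bar>(\<psi> (\<xi> (grid t n i)) - \<psi> 0) * (\<Lambda> (grid t n (Suc i)) - \<Lambda> (grid t n i))\<bar>)"
      by (simp only: sum_abs)
    also have "\<dots> \<le> (\<Sum>i<n. C * e' * (\<Lambda> (grid t n (Suc i)) - \<Lambda> (grid t n i)))"
      by (intro sum_mono each) auto
    also have "\<dots> = C * e' * \<Lambda> t" unfolding sum_distrib_left[symmetric] tel ..
    also have "\<dots> < (C + 1) * (\<Lambda> t + 1) * e'"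
    proof -
      have "C * \<Lambda> t < (C + 1) * (\<Lambda> t + 1)" using C L by (simp add: algebra_simps)
      then have "(C * \<Lambda> t) * e' < ((C + 1) * (\<Lambda> t + 1)) * e'" using e' by (intro mult_strict_right_mono)
      then show ?thesis by (simp add: mult_ac)
    qed
    also have "\<dots> = e" using C L by (simp add: e'_def)
    finally show ?case by simp
  qed
  then show "\<exists>N. \<forall>n\<ge>N. norm ((\<Sum>i<n. \<psi> (\<xi> (grid t n i)) * (\<Lambda> (grid t n (Suc i)) - \<Lambda> (grid t n i))) - \<psi> 0 * \<Lambda> t) < e"
    by (simp add: eventually_sequentially)
qed

lemma stieltjes_A:
  assumes t: "0 \<le> t" and \<psi>: "C-lipschitz_on UNIV \<psi>"
  shows "(\<lambda>n. \<Sum>i<n. \<psi> (\<xi> (grid t n i)) * (A (grid t n (Suc i)) - A (grid t n i)))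
    \<longlonglongrightarrow> (LBINT s:{0..t}. \<psi> (\<xi> s) * drift s) + \<beta> * (\<psi> 0 * \<Lambda> t)"
proof -
  have c\<psi>: "continuous_on UNIV \<psi>" using \<psi> by (rule lipschitz_on_continuous_on)
  have cv: "continuous_on {0..t} (\<lambda>s. \<psi> (\<xi> s))"
    by (rule continuous_on_compose2[OF c\<psi> cont_\<xi>']) auto
  have "(\<lambda>n. (\<Sum>i<n. \<psi> (\<xi> (grid t n i)) * (LBINT s:{grid t n i..grid t n (Suc i)}. drift s)) + \<beta> * (\<Sum>i<n. \<psi> (\<xi> (grid t n i)) * (\<Lambda> (grid t n (Suc i)) - \<Lambda> (grid t n i))))
    \<longlonglongrightarrow> (LBINT s:{0..t}. \<psi> (\<xi> s) * drift s) + \<beta> * (\<psi> 0 * \<Lambda> t)"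
    by (intro tendsto_add tendsto_mult tendsto_const weighted_riemann_sum[OF t cv drift_measurable drift_le] stieltjes_\<Lambda>[OF t \<psi>])
  moreover have "(\<Sum>i<n. \<psi> (\<xi> (grid t n i)) * (LBINT s:{grid t n i..grid t n (Suc i)}. drift s)) + \<beta> * (\<Sum>i<n. \<psi> (\<xi> (grid t n i)) * (\<Lambda> (grid t n (Suc i)) - \<Lambda> (grid t n i)))
     = (\<Sum>i<n. \<psi> (\<xi> (grid t n i)) * (A (grid t n (Suc i)) - A (grid t n i)))" for n
    unfolding sum_distrib_left sum.distrib[symmetric]
  proof (intro sum.cong refl)
    fix i
    have g: "0 \<le> grid t n i" "grid t n i \<le> grid t n (Suc i)" using grid_nonneg[OF t] grid_mono[OF t] by auto
    have inc: "A (grid t n (Suc i)) - A (grid t n i) = \<beta> * (\<Lambda> (grid t n (Suc i)) - \<Lambda> (grid t n i)) + (LBINT s:{grid t n i..grid t n (Suc i)}. drift s)"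
      using g D_increment[OF g] by (simp add: A_eq algebra_simps)
    show "\<psi> (\<xi> (grid t n i)) * (LBINT s:{grid t n i..grid t n (Suc i)}. drift s) + \<beta> * (\<psi> (\<xi> (grid t n i)) * (\<Lambda> (grid t n (Suc i)) - \<Lambda> (grid t n i)))
      = \<psi> (\<xi> (grid t n i)) * (A (grid t n (Suc i)) - A (grid t n i))" unfolding inc by (simp add: algebra_simps)
  qed
  ultimately show ?thesis by simp
qed

text \<open>The kernel lies between the normalised indicators of radius \<epsilon> and
  \<open>\<epsilon> + \<epsilon>\<^sup>2\<close>, both divided by
  \<open>2 * \<epsilon>\<close>.\<close>

lemma trapezoid_occupation:
  assumes t: "0 \<le> t"
  shows "((\<lambda>\<epsilon>. LBINT s:{0..t}. trapezoid \<epsilon> (\<xi> s)) \<longlongrightarrow> \<Lambda> t) (at_right 0)"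
proof (rule tendsto_sandwich)
  have occ_int: "(LBINT s:{0..t}. indicator {r. \<bar>\<xi> r - 0\<bar> \<le> e} s) = measure lborel {s \<in> {0..t}. \<bar>\<xi> s - 0\<bar> \<le> e}"
    "set_integrable lborel {0..t} (indicator {r. \<bar>\<xi> r - 0\<bar> \<le> e} :: real \<Rightarrow> real)" for e
  proof -
    have eq: "(\<lambda>s. indicator {0..t} s *\<^sub>R (indicator {r. \<bar>\<xi> r - 0\<bar> \<le> e} s :: real)) = indicator {s \<in> {0..t}. \<bar>\<xi> s - 0\<bar> \<le> e}"
      by (auto simp: indicator_def)
    show "(LBINT s:{0..t}. indicator {r. \<bar>\<xi> r - 0\<bar> \<le> e} s) = measure lborel {s \<in> {0..t}. \<bar>\<xi> s - 0\<bar> \<le> e}"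
      unfolding set_lebesgue_integral_def eq by simp
    show "set_integrable lborel {0..t} (indicator {r. \<bar>\<xi> r - 0\<bar> \<le> e} :: real \<Rightarrow> real)"
      unfolding set_integrable_def eq using occ_measurable sub_finite by (intro integrable_real_indicator) auto
  qed
  have ti: "set_integrable lborel {0..t} (\<lambda>s. trapezoid \<epsilon> (\<xi> s))" if "\<epsilon> > 0" for \<epsilon>
    using that trapezoid_nonneg[OF that] trapezoid_le[OF that]
    by (intro comp_integrable[of _ "1 / (2 * \<epsilon>)"] borel_measurable_continuous_onI trapezoid_continuous) auto
  show "\<forall>\<^sub>F \<epsilon> in at_right 0. occupation_quotient \<xi> t 0 \<epsilon> \<le> (LBINT s:{0..t}. trapezoid \<epsilon> (\<xi> s))"
    using ev_pos
  proof eventually_elim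
    case (elim \<epsilon>)
    have "occupation_quotient \<xi> t 0 \<epsilon> = (LBINT s:{0..t}. 1 / (2 * \<epsilon>) * indicator {r. \<bar>\<xi> r - 0\<bar> \<le> \<epsilon>} s)"
      using occ_int[of \<epsilon>] by (subst set_integral_mult_right) (auto simp: occupation_quotient_def)
    also have "\<dots> \<le> (LBINT s:{0..t}. trapezoid \<epsilon> (\<xi> s))"
    proof (rule set_integral_mono)
      show "set_integrable lborel {0..t} (\<lambda>s. 1 / (2 * \<epsilon>) * indicator {r. \<bar>\<xi> r - 0\<bar> \<le> \<epsilon>} s)"
        by (rule set_integrable_mult_right[OF occ_int(2)])
    qed (use elim trapezoid_nonneg[OF elim] ti in \<open>auto simp: indicator_def trapezoid_in\<close>)
    finally show ?case .
  qed
  show "\<forall>\<^sub>F \<epsilon> in at_right 0. (LBINT s:{0..t}. trapezoid \<epsilon> (\<xi> s)) \<le> (1 + \<epsilon>) * occupation_quotient \<xi> t 0 (\<epsilon> + \<epsilon>\<^sup>2)"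
    using ev_pos
  proof eventually_elim
    case (elim \<epsilon>)
    have "(LBINT s:{0..t}. trapezoid \<epsilon> (\<xi> s)) \<le> (LBINT s:{0..t}. 1 / (2 * \<epsilon>) * indicator {r. \<bar>\<xi> r - 0\<bar> \<le> \<epsilon> + \<epsilon>\<^sup>2} s)"
    proof (rule set_integral_mono)
      show "set_integrable lborel {0..t} (\<lambda>s. 1 / (2 * \<epsilon>) * indicator {r. \<bar>\<xi> r - 0\<bar> \<le> \<epsilon> + \<epsilon>\<^sup>2} s)"
        by (rule set_integrable_mult_right[OF occ_int(2)])
    qed (use elim trapezoid_le[OF elim] ti in \<open>auto simp: indicator_def trapezoid_out\<close>)
    \<comment> \<open>The wider indicator carries the normalisation of the narrower one; correcting
      it costs the factor \<open>1 + \<epsilon>\<close>, which disappears in the limit.\<close>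
    also have "\<dots> = (1 + \<epsilon>) * occupation_quotient \<xi> t 0 (\<epsilon> + \<epsilon>\<^sup>2)"
    proof -
      have "1 / (2 * \<epsilon>) * m = (1 + \<epsilon>) * (m / (2 * (\<epsilon> + \<epsilon>\<^sup>2)))" for m :: real
      proof -
        have e: "\<epsilon> + \<epsilon>\<^sup>2 = \<epsilon> * (1 + \<epsilon>)" by (simp add: power2_eq_square algebra_simps)
        have "1 / (2 * a) * m = k * (m / (2 * (a * k)))" if "a \<noteq> 0" "k \<noteq> 0" for a k :: real
          using that by simp
        from this[of \<epsilon> "1 + \<epsilon>"] show ?thesis using elim unfolding e by simp
      qed
      then show ?thesis using occ_int[of "\<epsilon> + \<epsilon>\<^sup>2"] by (subst set_integral_mult_right) (simp_all only: occupation_quotient_def)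
    qed
    finally show ?case .
  qed
  show "(occupation_quotient \<xi> t 0 \<longlongrightarrow> \<Lambda> t) (at_right 0)" by (rule \<Lambda>_tendsto[OF t])
  have "filterlim (\<lambda>\<epsilon>::real. \<epsilon> + \<epsilon>\<^sup>2) (at_right 0) (at_right 0)" by real_asymp
  then have "((\<lambda>\<epsilon>. occupation_quotient \<xi> t 0 (\<epsilon> + \<epsilon>\<^sup>2)) \<longlongrightarrow> \<Lambda> t) (at_right 0)"
    by (rule filterlim_compose[OF \<Lambda>_tendsto[OF t]])
  moreover have "((\<lambda>\<epsilon>::real. 1 + \<epsilon>) \<longlongrightarrow> 1) (at_right 0)" by real_asymp
  ultimately show "((\<lambda>\<epsilon>. (1 + \<epsilon>) * occupation_quotient \<xi> t 0 (\<epsilon> + \<epsilon>\<^sup>2)) \<longlongrightarrow> \<Lambda> t) (at_right 0)"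
    using tendsto_mult[of "\<lambda>\<epsilon>. 1 + \<epsilon>" 1 "at_right 0" "\<lambda>\<epsilon>. occupation_quotient \<xi> t 0 (\<epsilon> + \<epsilon>\<^sup>2)" "\<Lambda> t"] by simp
qed

end

section \<open>Maximal inequality along a grid\<close>

text \<open>The maximum starts from 0, the initial value of the motion, so it is nonnegative and
  \<open>w 0\<close> does not enter.\<close>

fun running_max :: "(nat \<Rightarrow> real) \<Rightarrow> nat \<Rightarrow> real" where
  "running_max w 0 = 0"
| "running_max w (Suc k) = max (running_max w k) (w (Suc k))"

lemma running_max_nonneg: "0 \<le> running_max w k"
  by (induction k) auto

lemma running_max_ge: "i \<le> k \<Longrightarrow> 0 < i \<Longrightarrow> w i \<le> running_max w k"
  by (induction k) (auto simp: le_Suc_eq le_max_iff_disj)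

text \<open>A pathwise form of Doob's \<open>L\<^sup>2\<close> inequality: for a martingale \<open>w\<close> the last sum has mean zero.\<close>

lemma running_max_sq_le:
  "(running_max w k)\<^sup>2 \<le> 2 * (running_max w k * w k) - 2 * (\<Sum>i<k. running_max w i * (w (Suc i) - w i))"
proof (induction k)
  case (Suc k)
  define m m' where "m = running_max w k" and "m' = running_max w (Suc k)"
  \<comment> \<open>The maximum changes only at a step where \<open>w (Suc k)\<close> is the new
    maximum, so there \<open>w (Suc k)\<close> may be replaced by \<open>m'\<close>.\<close>
  have "2 * ((m' - m) * w (Suc k)) \<ge> m'\<^sup>2 - m\<^sup>2"
  proof (cases "w (Suc k) \<le> m")
    case False
    then have "m' = w (Suc k)" by (simp add: m_def m'_def)
    moreover have "2 * ((m' - m) * m') = (m'\<^sup>2 - m\<^sup>2) + (m' - m)\<^sup>2" by (simp add: power2_eq_square algebra_simps)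
    ultimately show ?thesis by simp
  qed (simp add: m_def m'_def)
  then show ?case using Suc.IH by (simp add: m_def m'_def algebra_simps)
qed simp

lemma integrable_product_of_squares:
  fixes f g :: "'a \<Rightarrow> real"
  assumes [measurable]: "f \<in> borel_measurable M" "g \<in> borel_measurable M"
    and "integrable M (\<lambda>x. (f x)\<^sup>2)" "integrable M (\<lambda>x. (g x)\<^sup>2)"
  shows "integrable M (\<lambda>x. f x * g x)"
proof (rule Bochner_Integration.integrable_bound)
  show "integrable M (\<lambda>x. (f x)\<^sup>2 + (g x)\<^sup>2)" using assms by simp
  show "AE x in M. norm (f x * g x) \<le> norm ((f x)\<^sup>2 + (g x)\<^sup>2)"
  proof (rule AE_I2)
    fix x
    have "2 * (\<bar>f x\<bar> * \<bar>g x\<bar>) \<le> (f x)\<^sup>2 + (g x)\<^sup>2"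
      using zero_le_power2[of "\<bar>f x\<bar> - \<bar>g x\<bar>"] by (simp add: power2_diff)
    moreover have "0 \<le> \<bar>f x\<bar> * \<bar>g x\<bar>" by simp
    ultimately have "\<bar>f x\<bar> * \<bar>g x\<bar> \<le> (f x)\<^sup>2 + (g x)\<^sup>2" by linarith
    then show "norm (f x * g x) \<le> norm ((f x)\<^sup>2 + (g x)\<^sup>2)" by (simp add: abs_mult)
  qed
qed measurable

lemma integrable_sum_square:
  fixes f g :: "'a \<Rightarrow> real"
  assumes [measurable]: "f \<in> borel_measurable M" "g \<in> borel_measurable M"
    and "integrable M (\<lambda>x. (f x)\<^sup>2)" "integrable M (\<lambda>x. (g x)\<^sup>2)"
  shows "integrable M (\<lambda>x. (f x + g x)\<^sup>2)"
  using assms integrable_product_of_squares[OF assms] by (simp add: power2_sum mult.assoc)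

section \<open>Moments of Brownian increments and discrete stochastic integrals\<close>

context brownian_motion
begin

lemma F_sub: "0 \<le> t \<Longrightarrow> Y \<in> borel_measurable (F t) \<Longrightarrow> Y \<in> borel_measurable M" for Y :: "'a \<Rightarrow> real"
  using measurable_from_subalg[OF subalgebra_F] by blast

lemma F_mono: "s \<le> t \<Longrightarrow> Y \<in> borel_measurable (F s) \<Longrightarrow> Y \<in> borel_measurable (F t)" for Y :: "'a \<Rightarrow> real"
  using sets_F_mono[of s t] space_F by (auto simp: measurable_def)

lemma B_measurable [measurable]: "0 \<le> t \<Longrightarrow> B t \<in> borel_measurable M"
  by (rule F_sub[OF _ B_adapted])

lemma increment_expectation:
  fixes Y :: "'a \<Rightarrow> real" and u :: "real \<Rightarrow> real"
  assumes st: "0 \<le> s" "s < t" and Y: "Y \<in> borel_measurable (F s)" "integrable M Y"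
    and [measurable]: "u \<in> borel_measurable borel" and u: "integrable M (\<lambda>\<omega>. u (B t \<omega> - B s \<omega>))"
  shows "integrable M (\<lambda>\<omega>. Y \<omega> * u (B t \<omega> - B s \<omega>))"
    and "expectation (\<lambda>\<omega>. Y \<omega> * u (B t \<omega> - B s \<omega>)) = expectation Y * expectation (\<lambda>\<omega>. u (B t \<omega> - B s \<omega>))"
proof -
  have [measurable]: "Y \<in> borel_measurable M" "B t \<in> borel_measurable M" "B s \<in> borel_measurable M"
    using F_sub[OF st(1) Y(1)] st by auto
  have "indep_var borel Y borel (\<lambda>\<omega>. u (B t \<omega> - B s \<omega>))"
    unfolding indep_var_eq
  proof (intro conjI)
    have 1: "sigma_sets (space M) {Y -` A \<inter> space M |A. A \<in> sets borel} \<subseteq> sets (F s)"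
      using measurable_sets[OF Y(1)] space_F[of s]
      by (subst space_F[of s, symmetric]) (intro sets.sigma_sets_subset, auto)
    have 2: "sigma_sets (space M) {(\<lambda>\<omega>. u (B t \<omega> - B s \<omega>)) -` A \<inter> space M |A. A \<in> sets borel}
       \<subseteq> sets (vimage_algebra (space M) (\<lambda>\<omega>. B t \<omega> - B s \<omega>) borel)"
    proof -
      let ?V = "vimage_algebra (space M) (\<lambda>\<omega>. B t \<omega> - B s \<omega>) borel"
      have "(\<lambda>\<omega>. B t \<omega> - B s \<omega>) \<in> borel_measurable ?V" by (rule measurable_vimage_algebra1) auto
      then have "(\<lambda>\<omega>. u (B t \<omega> - B s \<omega>)) \<in> borel_measurable ?V" by measurable
      from measurable_sets[OF this] have "{(\<lambda>\<omega>. u (B t \<omega> - B s \<omega>)) -` A \<inter> space M |A. A \<in> sets borel} \<subseteq> sets ?V" by auto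
      from sets.sigma_sets_subset[OF this] show ?thesis by simp
    qed
    have ev: "sets (F s) \<subseteq> events" using subalgebra_F[OF st(1)] by (auto simp: subalgebra_def)
    show "indep_set (sigma_sets (space M) {Y -` A \<inter> space M |A. A \<in> sets borel})
      (sigma_sets (space M) {(\<lambda>\<omega>. u (B t \<omega> - B s \<omega>)) -` A \<inter> space M |A. A \<in> sets borel})"
      using B_indep[OF st] 1 2 unfolding indep_sets2_eq by blast
  qed measurable
  then show "integrable M (\<lambda>\<omega>. Y \<omega> * u (B t \<omega> - B s \<omega>))"
    "expectation (\<lambda>\<omega>. Y \<omega> * u (B t \<omega> - B s \<omega>)) = expectation Y * expectation (\<lambda>\<omega>. u (B t \<omega> - B s \<omega>))"
    using Y(2) u by (auto intro: indep_var_integrable indep_var_lebesgue_integral)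
qed

lemma increment_moments:
  assumes st: "0 \<le> s" "s < t"
  shows "integrable M (\<lambda>\<omega>. (B t \<omega> - B s \<omega>) ^ k)"
    and "expectation (\<lambda>\<omega>. B t \<omega> - B s \<omega>) = 0"
    and "expectation (\<lambda>\<omega>. (B t \<omega> - B s \<omega>)\<^sup>2) = t - s"
    and "expectation (\<lambda>\<omega>. (B t \<omega> - B s \<omega>) ^ 4) = 3 * (t - s)\<^sup>2"
proof -
  note N = B_increment[OF st]
  have s: "sqrt (t - s) > 0" using st by simp
  have m: "has_bochner_integral lborel (\<lambda>x. normal_density 0 (sqrt (t - s)) x * x ^ k) c \<Longrightarrow>
    expectation (\<lambda>\<omega>. (B t \<omega> - B s \<omega>) ^ k) = c" for k c
    using distributed_integral[OF N, of "\<lambda>x. x ^ k"] by (simp add: has_bochner_integral_integral_eq)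
  show "integrable M (\<lambda>\<omega>. (B t \<omega> - B s \<omega>) ^ k)"
    using distributed_integrable[OF N, of "\<lambda>x. x ^ k"] integrable_normal_moment[OF s, of 0 k] by simp
  show "expectation (\<lambda>\<omega>. B t \<omega> - B s \<omega>) = 0"
    using m[of 1 0] normal_moment_odd[OF s, of 0 0] by simp
  show "expectation (\<lambda>\<omega>. (B t \<omega> - B s \<omega>)\<^sup>2) = t - s"
    using normal_moment_even[OF s, of 0 1] st by (intro m) (simp add: diff_divide_distrib)
  show "expectation (\<lambda>\<omega>. (B t \<omega> - B s \<omega>) ^ 4) = 3 * (t - s)\<^sup>2"
  proof (intro m)
    have "fact (2 * 2) / ((2 / (sqrt (t - s))\<^sup>2)\<^sup>2 * fact 2) = 3 * (t - s)\<^sup>2"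
      using st by (simp add: fact_numeral power_divide)
    then show "has_bochner_integral lborel (\<lambda>x. normal_density 0 (sqrt (t - s)) x * x ^ 4) (3 * (t - s)\<^sup>2)"
      using normal_moment_even[OF s, of 0 2] by (simp only:) simp
  qed
qed

lemma B_square_integrable: "0 \<le> s \<Longrightarrow> integrable M (\<lambda>\<omega>. (B s \<omega>)\<^sup>2)"
  and B_square_expectation: "0 \<le> s \<Longrightarrow> expectation (\<lambda>\<omega>. (B s \<omega>)\<^sup>2) = s"
proof -
  assume s: "0 \<le> s"
  have "integrable M (\<lambda>\<omega>. (B s \<omega> - B 0 \<omega>)\<^sup>2) \<and> expectation (\<lambda>\<omega>. (B s \<omega> - B 0 \<omega>)\<^sup>2) = s"
    using increment_moments(1)[of 0 s 2] increment_moments(3)[of 0 s] s by (cases "s = 0") auto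
  moreover have ae: "AE \<omega> in M. (B s \<omega>)\<^sup>2 = (B s \<omega> - B 0 \<omega>)\<^sup>2" using B_start by eventually_elim simp
  have m: "(\<lambda>\<omega>. (B s \<omega>)\<^sup>2) \<in> borel_measurable M" "(\<lambda>\<omega>. (B s \<omega> - B 0 \<omega>)\<^sup>2) \<in> borel_measurable M" using s by measurable
  ultimately show "integrable M (\<lambda>\<omega>. (B s \<omega>)\<^sup>2)" "expectation (\<lambda>\<omega>. (B s \<omega>)\<^sup>2) = s"
    using integrable_cong_AE[OF m ae] integral_cong_AE[OF m ae] by auto
qed

lemma grid_strict: "t > 0 \<Longrightarrow> n > 0 \<Longrightarrow> grid t n i < grid t n (Suc i)"
  using grid_diff[of t n i] by (smt (verit) divide_pos_pos of_nat_0_less_iff)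

text \<open>A discrete stochastic integral: each new term is orthogonal to the past, so second
  moments add, at most \<open>C\<^sup>2 * v\<close> per step. The function \<open>u\<close> is left
  general to cover both the increments themselves and their centred squares.\<close>

lemma martingale_sum:
  fixes Y :: "nat \<Rightarrow> 'a \<Rightarrow> real" and u :: "real \<Rightarrow> real"
  assumes t: "t > 0" and n: "n > 0"
    and Y: "\<And>i. i < n \<Longrightarrow> Y i \<in> borel_measurable (F (grid t n i))" and C: "\<And>i \<omega>. \<bar>Y i \<omega>\<bar> \<le> C"
    and u[measurable]: "u \<in> borel_measurable borel"
    and ui: "\<And>i. i < n \<Longrightarrow> integrable M (\<lambda>\<omega>. (u (B (grid t n (Suc i)) \<omega> - B (grid t n i) \<omega>))\<^sup>2)"
    and u0: "\<And>i. i < n \<Longrightarrow> expectation (\<lambda>\<omega>. u (B (grid t n (Suc i)) \<omega> - B (grid t n i) \<omega>)) = 0"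
    and u2: "\<And>i. i < n \<Longrightarrow> expectation (\<lambda>\<omega>. (u (B (grid t n (Suc i)) \<omega> - B (grid t n i) \<omega>))\<^sup>2) = v"
  defines "S \<equiv> \<lambda>k \<omega>. \<Sum>i<k. Y i \<omega> * u (B (grid t n (Suc i)) \<omega> - B (grid t n i) \<omega>)"
  shows "k \<le> n \<Longrightarrow> S k \<in> borel_measurable (F (grid t n k)) \<and> integrable M (\<lambda>\<omega>. (S k \<omega>)\<^sup>2) \<and> integrable M (S k) \<and>
    expectation (S k) = 0 \<and> expectation (\<lambda>\<omega>. (S k \<omega>)\<^sup>2) \<le> real k * (C\<^sup>2 * v)"
proof (induction k)
  case 0 then show ?case by (simp add: S_def)
next
  case (Suc k)
  then have k: "k < n" by simp
  let ?s = "grid t n k" and ?t = "grid t n (Suc k)"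
  let ?U = "\<lambda>\<omega>. u (B ?t \<omega> - B ?s \<omega>)"
  have st: "0 \<le> ?s" "?s < ?t" using grid_nonneg grid_strict t n by auto
  have [measurable]: "B ?s \<in> borel_measurable M" "B ?t \<in> borel_measurable M" using st by auto
  have IH: "S k \<in> borel_measurable (F ?s)" "integrable M (\<lambda>\<omega>. (S k \<omega>)\<^sup>2)" "integrable M (S k)"
    "expectation (S k) = 0" "expectation (\<lambda>\<omega>. (S k \<omega>)\<^sup>2) \<le> real k * (C\<^sup>2 * v)"
    using Suc by auto
  have SkM: "S k \<in> borel_measurable M" using F_sub[OF st(1) IH(1)] .
  have YM: "Y k \<in> borel_measurable M" using F_sub[OF st(1) Y[OF k]] .
  have C0: "C \<ge> 0" using C by (rule order_trans[OF abs_ge_zero])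
  have Um: "?U \<in> borel_measurable M" by measurable
  have Ui: "integrable M ?U" by (rule square_integrable_imp_integrable[OF Um ui[OF k]])
  have Yi: "integrable M (Y k)" using C by (intro integrable_const_bound[of _ C] YM AE_I2) simp
  have Y2i: "integrable M (\<lambda>\<omega>. (Y k \<omega>)\<^sup>2)"
    using YM C C0 by (intro integrable_const_bound[of _ "C\<^sup>2"] AE_I2) (auto simp: abs_le_square_iff[symmetric])
  have SY: "integrable M (\<lambda>\<omega>. S k \<omega> * Y k \<omega>)" by (rule integrable_product_of_squares[OF SkM YM IH(2) Y2i])
  have YmF: "(\<lambda>\<omega>. S k \<omega> * Y k \<omega>) \<in> borel_measurable (F ?s)" "(\<lambda>\<omega>. (Y k \<omega>)\<^sup>2) \<in> borel_measurable (F ?s)"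
    using IH(1) Y[OF k] by measurable
  note E1 = increment_expectation[OF st Y[OF k] Yi u Ui]
  note E2 = increment_expectation[OF st YmF(1) SY u Ui]
  have u2m: "(\<lambda>x. (u x)\<^sup>2) \<in> borel_measurable borel" by measurable
  note E3 = increment_expectation[OF st YmF(2) Y2i u2m ui[OF k]]
  have SS: "S (Suc k) = (\<lambda>\<omega>. S k \<omega> + Y k \<omega> * ?U \<omega>)" by (simp add: S_def)
  have sq: "(\<lambda>\<omega>. (S (Suc k) \<omega>)\<^sup>2) = (\<lambda>\<omega>. (S k \<omega>)\<^sup>2 + 2 * ((S k \<omega> * Y k \<omega>) * ?U \<omega>) + (Y k \<omega>)\<^sup>2 * (?U \<omega>)\<^sup>2)"
    unfolding SS by (simp add: power2_eq_square algebra_simps)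
  have int: "integrable M (\<lambda>\<omega>. (S (Suc k) \<omega>)\<^sup>2)" unfolding sq
    by (intro Bochner_Integration.integrable_add integrable_mult_right IH(2) E2(1) E3(1))
  have "expectation (\<lambda>\<omega>. (S (Suc k) \<omega>)\<^sup>2) = expectation (\<lambda>\<omega>. (S k \<omega>)\<^sup>2) + expectation (\<lambda>\<omega>. (Y k \<omega>)\<^sup>2) * v"
    unfolding sq using IH(2) E2 E3 u0[OF k] u2[OF k] by simp
  also have "\<dots> \<le> real k * (C\<^sup>2 * v) + C\<^sup>2 * v"
  proof (intro add_mono mult_right_mono IH(5))
    have "expectation (\<lambda>\<omega>. (Y k \<omega>)\<^sup>2) \<le> expectation (\<lambda>_. C\<^sup>2)"
      using C C0 by (intro integral_mono Y2i) (auto simp: abs_le_square_iff[symmetric])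
    then show "expectation (\<lambda>\<omega>. (Y k \<omega>)\<^sup>2) \<le> C\<^sup>2" by (simp add: prob_space)
    show "0 \<le> v" unfolding u2[OF k, symmetric] by (rule integral_nonneg_AE) simp
  qed
  finally have b: "expectation (\<lambda>\<omega>. (S (Suc k) \<omega>)\<^sup>2) \<le> real (Suc k) * (C\<^sup>2 * v)" by (simp add: algebra_simps)
  have "S k \<in> borel_measurable (F ?t)" "Y k \<in> borel_measurable (F ?t)" "B ?s \<in> borel_measurable (F ?t)" "B ?t \<in> borel_measurable (F ?t)"
    by (rule F_mono[OF less_imp_le[OF st(2)] IH(1)] F_mono[OF less_imp_le[OF st(2)] Y[OF k]]
        F_mono[OF less_imp_le[OF st(2)] B_adapted[OF st(1)]] B_adapted[OF less_imp_le[OF le_less_trans[OF st]]])+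
  then have meas: "S (Suc k) \<in> borel_measurable (F ?t)" unfolding SS by measurable
  have "integrable M (S (Suc k))" unfolding SS using IH(3) E1(1) by simp
  moreover have "expectation (S (Suc k)) = 0" unfolding SS using IH(3,4) E1 u0[OF k] by simp
  ultimately show ?case using meas int b by blast
qed

text \<open>The expectation of \<open>running_max_sq_le\<close>: the martingale sum drops out and
  the remaining product is absorbed. Both signs of \<sigma> are needed to bound the absolute value
  of the motion.\<close>

lemma running_max_expectation:
  assumes t: "t > 0" and n: "n > 0" and \<sigma>: "\<sigma> = 1 \<or> \<sigma> = - 1"
  defines "W \<equiv> \<lambda>\<omega> i. \<sigma> * B (grid t n i) \<omega>"
  shows "integrable M (\<lambda>\<omega>. (running_max (W \<omega>) n)\<^sup>2)" "expectation (\<lambda>\<omega>. (running_max (W \<omega>) n)\<^sup>2) \<le> 4 * t"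
    "(\<lambda>\<omega>. running_max (W \<omega>) n) \<in> borel_measurable M"
proof -
  have g0: "0 \<le> grid t n i" for i using t by (intro grid_nonneg) auto
  have ss: "\<sigma> * \<sigma> = 1" using \<sigma> by auto
  have mF: "(\<lambda>\<omega>. running_max (W \<omega>) k) \<in> borel_measurable (F (grid t n k))" for k
  proof (induction k)
    case (Suc k)
    have "(\<lambda>\<omega>. running_max (W \<omega>) k) \<in> borel_measurable (F (grid t n (Suc k)))" "B (grid t n (Suc k)) \<in> borel_measurable (F (grid t n (Suc k)))"
      using F_mono[OF _ Suc] grid_mono[of t k "Suc k" n] t B_adapted g0 by auto
    then show ?case by (simp add: W_def)
  qed simp
  have mM: "(\<lambda>\<omega>. running_max (W \<omega>) k) \<in> borel_measurable M" for k by (rule F_sub[OF g0 mF])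
  have wM: "(\<lambda>\<omega>. W \<omega> k) \<in> borel_measurable M" for k unfolding W_def using g0 by measurable
  have w2: "integrable M (\<lambda>\<omega>. (W \<omega> k)\<^sup>2)" "expectation (\<lambda>\<omega>. (W \<omega> k)\<^sup>2) = grid t n k" for k
    using B_square_integrable[OF g0, of k] B_square_expectation[OF g0, of k] ss
    by (simp_all add: W_def power_mult_distrib power2_eq_square[of \<sigma>])
  have r2: "integrable M (\<lambda>\<omega>. (running_max (W \<omega>) k)\<^sup>2)" for k
  proof (induction k)
    case (Suc k)
    show ?case
    proof (rule Bochner_Integration.integrable_bound[OF Bochner_Integration.integrable_add[OF Suc w2(1)[of "Suc k"]]])
      show "(\<lambda>\<omega>. (running_max (W \<omega>) (Suc k))\<^sup>2) \<in> borel_measurable M" using mM by measurable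
      show "AE \<omega> in M. norm ((running_max (W \<omega>) (Suc k))\<^sup>2) \<le> norm ((running_max (W \<omega>) k)\<^sup>2 + (W \<omega> (Suc k))\<^sup>2)"
        by (intro AE_I2) (auto simp: max_def)
    qed
  qed simp
  have r1: "integrable M (\<lambda>\<omega>. running_max (W \<omega>) k)" for k by (rule square_integrable_imp_integrable[OF mM r2])
  \<comment> \<open>The running maximum is square integrable but unbounded, so
    \<open>martingale_sum\<close> does not apply and the independence of the increments is used term
    by term.\<close>
  have mart: "integrable M (\<lambda>\<omega>. running_max (W \<omega>) i * (W \<omega> (Suc i) - W \<omega> i))"
    "expectation (\<lambda>\<omega>. running_max (W \<omega>) i * (W \<omega> (Suc i) - W \<omega> i)) = 0" for i
  proof -
    have st: "0 \<le> grid t n i" "grid t n i < grid t n (Suc i)" using g0 grid_strict t n by auto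
    have eq: "W \<omega> (Suc i) - W \<omega> i = \<sigma> * (B (grid t n (Suc i)) \<omega> - B (grid t n i) \<omega>)" for \<omega> by (simp add: W_def algebra_simps)
    have i: "integrable M (\<lambda>\<omega>. \<sigma> * (B (grid t n (Suc i)) \<omega> - B (grid t n i) \<omega>))" using increment_moments(1)[OF st, of 1] by simp
    show "integrable M (\<lambda>\<omega>. running_max (W \<omega>) i * (W \<omega> (Suc i) - W \<omega> i))"
      unfolding eq using increment_expectation(1)[OF st mF r1 _ i] by simp
    show "expectation (\<lambda>\<omega>. running_max (W \<omega>) i * (W \<omega> (Suc i) - W \<omega> i)) = 0"
      unfolding eq using increment_expectation(2)[OF st mF r1 _ i] increment_moments(2)[OF st] by simp
  qed
  have rw: "integrable M (\<lambda>\<omega>. running_max (W \<omega>) n * W \<omega> n)" by (rule integrable_product_of_squares[OF mM wM r2 w2(1)])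
  have "expectation (\<lambda>\<omega>. (running_max (W \<omega>) n)\<^sup>2) \<le>
    expectation (\<lambda>\<omega>. (1/2 * (running_max (W \<omega>) n)\<^sup>2 + 2 * (W \<omega> n)\<^sup>2) - 2 * (\<Sum>i<n. running_max (W \<omega>) i * (W \<omega> (Suc i) - W \<omega> i)))"
  proof (rule integral_mono[OF r2])
    show "integrable M (\<lambda>\<omega>. (1/2 * (running_max (W \<omega>) n)\<^sup>2 + 2 * (W \<omega> n)\<^sup>2) - 2 * (\<Sum>i<n. running_max (W \<omega>) i * (W \<omega> (Suc i) - W \<omega> i)))"
      by (intro Bochner_Integration.integrable_diff Bochner_Integration.integrable_add integrable_mult_right Bochner_Integration.integrable_sum mart r2 w2)
    fix \<omega>
    \<comment> \<open>The weights are chosen so that half of the squared maximum can be moved to the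
      left-hand side; this gives the factor 4.\<close>
    have "2 * (m * w) \<le> 1/2 * m\<^sup>2 + 2 * w\<^sup>2" for m w :: real
      using zero_le_power2[of "m - 2 * w"] by (simp add: power2_eq_square algebra_simps)
    from this[of "running_max (W \<omega>) n" "W \<omega> n"]
    show "(running_max (W \<omega>) n)\<^sup>2 \<le> (1/2 * (running_max (W \<omega>) n)\<^sup>2 + 2 * (W \<omega> n)\<^sup>2) - 2 * (\<Sum>i<n. running_max (W \<omega>) i * (W \<omega> (Suc i) - W \<omega> i))"
      using running_max_sq_le[of "W \<omega>" n] by linarith
  qed
  also have "\<dots> = 1/2 * expectation (\<lambda>\<omega>. (running_max (W \<omega>) n)\<^sup>2) + 2 * t"
    using r2 w2 mart n by (simp add: Bochner_Integration.integral_sum)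
  finally show "expectation (\<lambda>\<omega>. (running_max (W \<omega>) n)\<^sup>2) \<le> 4 * t" by simp
  show "integrable M (\<lambda>\<omega>. (running_max (W \<omega>) n)\<^sup>2)" "(\<lambda>\<omega>. running_max (W \<omega>) n) \<in> borel_measurable M" by (rule r2 mM)+
qed

text \<open>Fatou's lemma along grids replaces the supremum over an uncountable set of times: almost
  surely every value of a continuous path is a limit of values at grid points, so the lower limit of
  the grid maxima already dominates it.\<close>

lemma brownian_maximal:
  assumes t: "t > 0"
  obtains Z where "Z \<in> borel_measurable M" "integrable M (\<lambda>\<omega>. (Z \<omega>)\<^sup>2)" "\<And>\<omega>. 0 \<le> Z \<omega>"
    "AE \<omega> in M. \<forall>s. 0 \<le> s \<and> s \<le> t \<longrightarrow> \<bar>B s \<omega>\<bar> \<le> Z \<omega>"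
proof -
  define R where "R \<sigma> n \<omega> = running_max (\<lambda>i. \<sigma> * B (grid t n i) \<omega>) n" for \<sigma> :: real and n \<omega>
  define m where "m n \<omega> = R 1 (Suc n) \<omega> + R (- 1) (Suc n) \<omega>" for n \<omega>
  have R: "integrable M (\<lambda>\<omega>. (R \<sigma> (Suc n) \<omega>)\<^sup>2)" "expectation (\<lambda>\<omega>. (R \<sigma> (Suc n) \<omega>)\<^sup>2) \<le> 4 * t" "R \<sigma> (Suc n) \<in> borel_measurable M"
    if "\<sigma> = 1 \<or> \<sigma> = - 1" for \<sigma> n
    using running_max_expectation[OF t _ that, of "Suc n"] by (simp_all add: R_def[abs_def])
  have R0: "0 \<le> R \<sigma> n \<omega>" for \<sigma> n \<omega> by (simp add: R_def running_max_nonneg)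
  have [measurable]: "m n \<in> borel_measurable M" for n unfolding m_def[abs_def] using R(3) by measurable
  have mE: "(\<integral>\<^sup>+\<omega>. ennreal ((m n \<omega>)\<^sup>2) \<partial>M) \<le> ennreal (16 * t)" for n
  proof -
    have i: "integrable M (\<lambda>\<omega>. (m n \<omega>)\<^sup>2)" unfolding m_def using R by (intro integrable_sum_square) auto
    have "expectation (\<lambda>\<omega>. (m n \<omega>)\<^sup>2) \<le> expectation (\<lambda>\<omega>. 2 * (R 1 (Suc n) \<omega>)\<^sup>2 + 2 * (R (- 1) (Suc n) \<omega>)\<^sup>2)"
    proof (rule integral_mono[OF i])
      show "integrable M (\<lambda>\<omega>. 2 * (R 1 (Suc n) \<omega>)\<^sup>2 + 2 * (R (- 1) (Suc n) \<omega>)\<^sup>2)" using R(1) by simp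
      fix \<omega>
      have "(a + b)\<^sup>2 \<le> 2 * a\<^sup>2 + 2 * b\<^sup>2" for a b :: real
        using zero_le_power2[of "a - b"] by (simp add: power2_eq_square algebra_simps)
      then show "(m n \<omega>)\<^sup>2 \<le> 2 * (R 1 (Suc n) \<omega>)\<^sup>2 + 2 * (R (- 1) (Suc n) \<omega>)\<^sup>2" by (simp add: m_def)
    qed
    also have "\<dots> \<le> 16 * t" using R(1,2)[of 1 n] R(1,2)[of "- 1" n] by simp
    finally show ?thesis using i by (simp add: nn_integral_eq_integral ennreal_leI)
  qed
  \<comment> \<open>The grids for consecutive \<open>n\<close> are not nested, so the maxima need
    not increase; the lower limit is what Fatou's lemma controls.\<close>
  define Z0 where "Z0 \<omega> = liminf (\<lambda>n. ennreal ((m n \<omega>)\<^sup>2))" for \<omega>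
  have [measurable]: "Z0 \<in> borel_measurable M" unfolding Z0_def[abs_def] by measurable
  have "(\<integral>\<^sup>+\<omega>. Z0 \<omega> \<partial>M) \<le> liminf (\<lambda>n. \<integral>\<^sup>+\<omega>. ennreal ((m n \<omega>)\<^sup>2) \<partial>M)"
    unfolding Z0_def by (rule nn_integral_liminf) measurable
  also have "\<dots> \<le> liminf (\<lambda>n. ennreal (16 * t))" by (intro Liminf_mono always_eventually allI mE)
  also have "\<dots> = ennreal (16 * t)" by (simp add: Liminf_const)
  finally have Z0E: "(\<integral>\<^sup>+\<omega>. Z0 \<omega> \<partial>M) \<le> ennreal (16 * t)" .
  then have Z0top: "(\<integral>\<^sup>+\<omega>. Z0 \<omega> \<partial>M) \<noteq> \<infinity>" by (auto simp: top_unique)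
  have Zfin: "AE \<omega> in M. Z0 \<omega> \<noteq> \<infinity>" by (rule nn_integral_PInf_AE[OF _ Z0top]) measurable
  define Z where "Z \<omega> = sqrt (enn2real (Z0 \<omega>))" for \<omega>
  have Zm[measurable]: "Z \<in> borel_measurable M" unfolding Z_def[abs_def] by measurable
  have Z2: "(Z \<omega>)\<^sup>2 = enn2real (Z0 \<omega>)" for \<omega> by (simp add: Z_def)
  show thesis
  proof (rule that[of Z])
    show "Z \<in> borel_measurable M" by measurable
    show "0 \<le> Z \<omega>" for \<omega> by (simp add: Z_def)
    show "integrable M (\<lambda>\<omega>. (Z \<omega>)\<^sup>2)"
    proof (rule integrableI_bounded)
      have "(\<integral>\<^sup>+\<omega>. ennreal (norm ((Z \<omega>)\<^sup>2)) \<partial>M) = (\<integral>\<^sup>+\<omega>. Z0 \<omega> \<partial>M)"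
        by (rule nn_integral_cong_AE) (use Zfin in \<open>eventually_elim, auto simp: Z2 less_top\<close>)
      then show "(\<integral>\<^sup>+\<omega>. ennreal (norm ((Z \<omega>)\<^sup>2)) \<partial>M) < \<infinity>" using Z0top by (simp add: less_top)
    qed measurable
    show "AE \<omega> in M. \<forall>s. 0 \<le> s \<and> s \<le> t \<longrightarrow> \<bar>B s \<omega>\<bar> \<le> Z \<omega>"
      using B_start B_continuous Zfin
    proof eventually_elim
      case (elim \<omega>)
      show ?case
      proof (intro allI impI)
        fix s assume s: "0 \<le> s \<and> s \<le> t"
        \<comment> \<open>The index of the last grid point that does not exceed
          \<open>s\<close>.\<close>
        define i where "i n = nat \<lfloor>real (Suc n) * s / t\<rfloor>" for n
        have ge: "0 \<le> real (Suc n) * s / t" for n using s t by simp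
        have i1: "real (i n) \<le> real (Suc n) * s / t" "real (Suc n) * s / t < real (i n) + 1" for n
          using ge[of n] unfolding i_def by linarith+
        have i_le: "i n \<le> Suc n" for n
        proof -
          have "real (Suc n) * s / t \<le> real (Suc n)" using s t by (simp add: divide_le_eq mult_left_mono)
          then show ?thesis using i1(1)[of n] by linarith
        qed
        have gl: "grid t (Suc n) (i n) \<le> s" "s - t / real (Suc n) \<le> grid t (Suc n) (i n)" for n
        proof -
          have "t * real (i n) \<le> real (Suc n) * s" using i1(1)[of n] t by (simp add: le_divide_eq mult.commute)
          then show "grid t (Suc n) (i n) \<le> s" unfolding grid_def by (simp add: divide_le_eq mult.commute)
          have "real (Suc n) * s < t * (real (i n) + 1)" using i1(2)[of n] t by (simp add: divide_less_eq mult.commute)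
          then have "real (Suc n) * s / real (Suc n) \<le> t * (real (i n) + 1) / real (Suc n)" by (intro divide_right_mono) auto
          also have "\<dots> = grid t (Suc n) (i n) + t / real (Suc n)" by (simp only: grid_def distrib_left mult_1_right add_divide_distrib)
          finally show "s - t / real (Suc n) \<le> grid t (Suc n) (i n)" by simp
        qed
        have "(\<lambda>n. s - t / real (Suc n)) \<longlonglongrightarrow> s - 0"
          by (intro tendsto_intros LIMSEQ_Suc[OF lim_const_over_n])
        then have low: "(\<lambda>n. s - t / real (Suc n)) \<longlonglongrightarrow> s" by simp
        have glim: "(\<lambda>n. grid t (Suc n) (i n)) \<longlonglongrightarrow> s"
          by (rule tendsto_sandwich[OF _ _ low tendsto_const]) (use gl in \<open>auto intro: always_eventually\<close>)
        have "(\<lambda>n. B (grid t (Suc n) (i n)) \<omega>) \<longlonglongrightarrow> B s \<omega>"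
          by (rule continuous_on_tendsto_compose[OF elim(2) glim]) (use s t grid_nonneg in \<open>auto intro: always_eventually\<close>)
        then have lim: "(\<lambda>n. ennreal ((B (grid t (Suc n) (i n)) \<omega>)\<^sup>2)) \<longlonglongrightarrow> ennreal ((B s \<omega>)\<^sup>2)"
          by (intro tendsto_ennrealI tendsto_power)
        \<comment> \<open>Index 0 does not enter the running maximum; there the motion vanishes
          almost surely.\<close>
        have le: "\<bar>B (grid t (Suc n) (i n)) \<omega>\<bar> \<le> m n \<omega>" for n
        proof (cases "i n = 0")
          case True then show ?thesis using elim(1) R0 by (simp add: m_def)
        next
          case False
          have "\<sigma> * B (grid t (Suc n) (i n)) \<omega> \<le> R \<sigma> (Suc n) \<omega>" for \<sigma>
            unfolding R_def using False i_le[of n] by (intro running_max_ge) auto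
          from this[of 1] this[of "- 1"] R0[of 1 "Suc n" \<omega>] R0[of "- 1" "Suc n" \<omega>] show ?thesis by (simp add: m_def)
        qed
        have "ennreal ((B s \<omega>)\<^sup>2) = liminf (\<lambda>n. ennreal ((B (grid t (Suc n) (i n)) \<omega>)\<^sup>2))"
          using lim_imp_Liminf[OF _ lim] by simp
        also have "\<dots> \<le> Z0 \<omega>" unfolding Z0_def
        proof (intro Liminf_mono always_eventually allI ennreal_leI)
          fix n show "(B (grid t (Suc n) (i n)) \<omega>)\<^sup>2 \<le> (m n \<omega>)\<^sup>2"
            using le[of n] by (metis abs_ge_zero power2_abs power_mono)
        qed
        also have "Z0 \<omega> = ennreal ((Z \<omega>)\<^sup>2)" using elim(3) by (simp add: Z2 less_top)
        finally have "(B s \<omega>)\<^sup>2 \<le> (Z \<omega>)\<^sup>2" by simp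
        then have "\<bar>B s \<omega>\<bar> \<le> \<bar>Z \<omega>\<bar>" by (simp only: abs_le_square_iff)
        then show "\<bar>B s \<omega>\<bar> \<le> Z \<omega>" by (simp add: Z_def)
      qed
    qed
  qed
qed

end

lemma mvt_bound:
  fixes f f' :: "real \<Rightarrow> real"
  assumes "\<And>u. (f has_real_derivative f' u) (at u)" "\<And>u. \<bar>u\<bar> \<le> \<bar>a\<bar> \<Longrightarrow> \<bar>f' u\<bar> \<le> K"
  shows "\<bar>f a - f 0\<bar> \<le> K * \<bar>a\<bar>"
proof -
  have "norm (f a - f 0) \<le> K * norm (a - 0)"
    by (rule field_differentiable_bound[of "{-\<bar>a\<bar>..\<bar>a\<bar>}" f f'])
       (use assms in \<open>auto intro: has_field_derivative_at_within\<close>)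
  then show ?thesis by simp
qed

section \<open>Ito's formula in expectation\<close>

locale smooth_test =
  fixes f f1 f2 :: "real \<Rightarrow> real" and C :: real
  assumes f1: "\<And>y. (f has_real_derivative f1 y) (at y)" and f2: "\<And>y. (f1 has_real_derivative f2 y) (at y)"
    and f1_le: "\<And>y. \<bar>f1 y\<bar> \<le> C" and f2_le: "\<And>y. \<bar>f2 y\<bar> \<le> C"
    and f2_lip: "\<And>y z. \<bar>f2 y - f2 z\<bar> \<le> C * \<bar>y - z\<bar>"
begin

lemma C_nonneg: "0 \<le> C"
  using f1_le by (rule order_trans[OF abs_ge_zero])

lemma f_lip: "\<bar>f y - f z\<bar> \<le> C * \<bar>y - z\<bar>"
  using mvt_bound[of "\<lambda>u. f (z + u)" "\<lambda>u. f1 (z + u)" "y - z" C] f1_le f1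
  by (simp add: DERIV_shift[symmetric] add.commute)

lemma f1_lip: "\<bar>f1 y - f1 z\<bar> \<le> C * \<bar>y - z\<bar>"
  using mvt_bound[of "\<lambda>u. f1 (z + u)" "\<lambda>u. f2 (z + u)" "y - z" C] f2_le f2
  by (simp add: DERIV_shift[symmetric] add.commute)

lemma f1_lipschitz: "C-lipschitz_on UNIV f1"
  by (rule lipschitz_onI[OF _ C_nonneg]) (use f1_lip in \<open>simp add: dist_real_def\<close>)

lemma f_measurable [measurable]: "f \<in> borel_measurable borel"
  and f1_measurable [measurable]: "f1 \<in> borel_measurable borel"
  and f2_measurable [measurable]: "f2 \<in> borel_measurable borel"
proof -
  have "continuous_on UNIV f" "continuous_on UNIV f1"
    using f1 f2 by (auto intro!: continuous_at_imp_continuous_on DERIV_isCont)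
  then show "f \<in> borel_measurable borel" "f1 \<in> borel_measurable borel"
    by (auto intro: borel_measurable_continuous_onI)
  have "C-lipschitz_on UNIV f2"
    by (rule lipschitz_onI[OF _ C_nonneg]) (use f2_lip in \<open>simp add: dist_real_def\<close>)
  then show "f2 \<in> borel_measurable borel"
    by (intro borel_measurable_continuous_onI lipschitz_on_continuous_on)
qed

lemma f2_continuous: "continuous_on UNIV f2"
  by (rule lipschitz_on_continuous_on[of C], rule lipschitz_onI[OF _ C_nonneg]) (use f2_lip in \<open>simp add: dist_real_def\<close>)

lemma taylor2: "\<bar>f (y + a) - f y - f1 y * a - f2 y / 2 * a\<^sup>2\<bar> \<le> C * \<bar>a\<bar> ^ 3"
proof -
  have 1: "\<bar>f1 (y + u) - f1 y - f2 y * u\<bar> \<le> C * \<bar>u\<bar>\<^sup>2" for u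
  proof -
    have "\<bar>(f1 (y + u) - f2 y * u) - (f1 (y + 0) - f2 y * 0)\<bar> \<le> (C * \<bar>u\<bar>) * \<bar>u\<bar>"
    proof (rule mvt_bound[of "\<lambda>u. f1 (y + u) - f2 y * u" "\<lambda>u. f2 (y + u) - f2 y"])
      fix v
      show "((\<lambda>u. f1 (y + u) - f2 y * u) has_real_derivative f2 (y + v) - f2 y) (at v)"
        using f2[of "y + v"] by (auto intro!: derivative_eq_intros simp: DERIV_shift[symmetric] add.commute)
      assume "\<bar>v\<bar> \<le> \<bar>u\<bar>"
      then have "C * \<bar>v\<bar> \<le> C * \<bar>u\<bar>" by (intro mult_left_mono C_nonneg)
      then show "\<bar>f2 (y + v) - f2 y\<bar> \<le> C * \<bar>u\<bar>" using f2_lip[of "y + v" y] by simp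
    qed
    then show ?thesis by (simp add: power2_eq_square mult.assoc diff_diff_eq add.commute)
  qed
  have "\<bar>(f (y + a) - f1 y * a - f2 y / 2 * a\<^sup>2) - (f (y + 0) - f1 y * 0 - f2 y / 2 * 0\<^sup>2)\<bar> \<le> (C * \<bar>a\<bar>\<^sup>2) * \<bar>a\<bar>"
  proof (rule mvt_bound[of "\<lambda>u. f (y + u) - f1 y * u - f2 y / 2 * u\<^sup>2" "\<lambda>u. f1 (y + u) - f1 y - f2 y * u"])
    fix v
    show "((\<lambda>u. f (y + u) - f1 y * u - f2 y / 2 * u\<^sup>2) has_real_derivative f1 (y + v) - f1 y - f2 y * v) (at v)"
      using f1[of "y + v"] by (auto intro!: derivative_eq_intros simp: DERIV_shift[symmetric] add.commute)
    assume "\<bar>v\<bar> \<le> \<bar>a\<bar>"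
    then have "C * \<bar>v\<bar>\<^sup>2 \<le> C * \<bar>a\<bar>\<^sup>2" by (intro mult_left_mono power_mono C_nonneg) auto
    then show "\<bar>f1 (y + v) - f1 y - f2 y * v\<bar> \<le> C * \<bar>a\<bar>\<^sup>2" using 1[of v] by linarith
  qed
  then show ?thesis by (simp add: power3_eq_cube power2_eq_square mult.assoc algebra_simps)
qed

text \<open>The derivative is taken at the left grid point \<open>y\<close>, before the Brownian
  step \<open>a\<close>, because the Stieltjes sums sample there; the discrepancy produces the mixed
  term in the error.\<close>

lemma first_order: "\<bar>f (y + a + c) - f (y + a) - f1 y * c\<bar> \<le> C * (\<bar>c\<bar> * (\<bar>a\<bar> + \<bar>c\<bar>))"
proof -
  have "\<bar>(f (y + a + c) - f1 y * c) - (f (y + a + 0) - f1 y * 0)\<bar> \<le> (C * (\<bar>a\<bar> + \<bar>c\<bar>)) * \<bar>c\<bar>"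
  proof (rule mvt_bound[of "\<lambda>u. f (y + a + u) - f1 y * u" "\<lambda>u. f1 (y + a + u) - f1 y"])
    fix v
    show "((\<lambda>u. f (y + a + u) - f1 y * u) has_real_derivative f1 (y + a + v) - f1 y) (at v)"
      using f1[of "y + a + v"] by (auto intro!: derivative_eq_intros simp: DERIV_shift[symmetric] add.commute)
    assume "\<bar>v\<bar> \<le> \<bar>c\<bar>"
    then have "C * \<bar>a + v\<bar> \<le> C * (\<bar>a\<bar> + \<bar>c\<bar>)" by (intro mult_left_mono C_nonneg) linarith
    then show "\<bar>f1 (y + a + v) - f1 y\<bar> \<le> C * (\<bar>a\<bar> + \<bar>c\<bar>)"
      using f1_lip[of "y + a + v" y] by (simp add: add.assoc)
  qed
  then show ?thesis by (simp add: mult_ac algebra_simps)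
qed

end

lemma (in prob_space) expectation_abs_sq_le:
  fixes Y :: "'a \<Rightarrow> real"
  assumes "integrable M Y" "integrable M (\<lambda>x. (Y x)\<^sup>2)"
  shows "(expectation (\<lambda>x. \<bar>Y x\<bar>))\<^sup>2 \<le> expectation (\<lambda>x. (Y x)\<^sup>2)"
  using variance_eq[of "\<lambda>x. \<bar>Y x\<bar>"] variance_positive[of "\<lambda>x. \<bar>Y x\<bar>"] assms by simp

locale skew_BM_at_0 = refracted_skew_BM M F B X \<beta> \<mu>p \<mu>m 0 x
  for M :: "'a measure" and F B X \<beta> \<mu>p \<mu>m x
begin

lemma X_measurable [measurable]: "0 \<le> t \<Longrightarrow> X t \<in> borel_measurable M"
  by (rule F_sub[OF _ X_adapted])

lemma AE_path: "AE \<omega> in M. sde_path (\<lambda>s. X s \<omega>) (\<lambda>s. B s \<omega>) \<beta> \<mu>p \<mu>m x"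
  using X_start X_continuous B_start B_continuous local_time_exists X_equation
proof eventually_elim
  case (elim \<omega>)
  show ?case
  proof (rule sde_path.intro)
    fix t :: real assume t: "0 \<le> t"
    show "\<exists>l. (occupation_quotient (\<lambda>s. X s \<omega>) t 0 \<longlongrightarrow> l) (at_right 0)" using elim(5) t by blast
    show "X t \<omega> = X 0 \<omega> + B t \<omega> + \<beta> * local_time (\<lambda>s. X s \<omega>) t 0
      + \<mu>p * (LBINT s:{0..t}. indicator {s. X s \<omega> > 0} s)
      + \<mu>m * (LBINT s:{0..t}. indicator {s. X s \<omega> < 0} s)" using elim(6) t by blast
  qed (rule elim)+
qed

text \<open>\<open>Z\<close> dominates the path together with the variation of \<open>X - B\<close> along all grids.  By the bound
  on \<open>\<beta> \<Lambda>\<close> by the running maximum of \<open>\<bar>B\<bar>\<close>, \<open>Z\<close> can be chosen square integrable.\<close>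

definition good :: "real \<Rightarrow> ('a \<Rightarrow> real) \<Rightarrow> 'a \<Rightarrow> bool" where
  "good t Z \<omega> \<longleftrightarrow> sde_path (\<lambda>s. X s \<omega>) (\<lambda>s. B s \<omega>) \<beta> \<mu>p \<mu>m x \<and>
    (\<forall>s. 0 \<le> s \<and> s \<le> t \<longrightarrow> \<bar>X s \<omega>\<bar> \<le> Z \<omega> \<and> \<bar>B s \<omega>\<bar> \<le> Z \<omega>) \<and>
    (\<forall>n. (\<Sum>i<n. \<bar>(X (grid t n (Suc i)) \<omega> - B (grid t n (Suc i)) \<omega>) - (X (grid t n i) \<omega> - B (grid t n i) \<omega>)\<bar>) \<le> Z \<omega>)"

lemma envelope:
  assumes t: "t > 0"
  obtains Z where "Z \<in> borel_measurable M" "integrable M (\<lambda>\<omega>. (Z \<omega>)\<^sup>2)" "\<And>\<omega>. 0 \<le> Z \<omega>" "AE \<omega> in M. good t Z \<omega>"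
proof -
  obtain S where S[measurable]: "S \<in> borel_measurable M" and S2: "integrable M (\<lambda>\<omega>. (S \<omega>)\<^sup>2)" "\<And>\<omega>. 0 \<le> S \<omega>"
    and Sb: "AE \<omega> in M. \<forall>s. 0 \<le> s \<and> s \<le> t \<longrightarrow> \<bar>B s \<omega>\<bar> \<le> S \<omega>"
    using brownian_maximal[OF t] by blast
  define k where "k = 2 * (\<bar>x\<bar> + (\<bar>\<mu>p\<bar> + \<bar>\<mu>m\<bar>) * t)"
  have k: "k \<ge> 0" using t by (simp add: k_def)
  define Z where "Z \<omega> = k + 2 * S \<omega>" for \<omega>
  show thesis
  proof (rule that[of Z])
    show "Z \<in> borel_measurable M" unfolding Z_def[abs_def] by measurable
    have "integrable M (\<lambda>\<omega>. k\<^sup>2)" "integrable M (\<lambda>\<omega>. (2 * S \<omega>)\<^sup>2)" using S2 by (auto simp: power_mult_distrib)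
    then show "integrable M (\<lambda>\<omega>. (Z \<omega>)\<^sup>2)" unfolding Z_def by (intro integrable_sum_square) auto
    show "0 \<le> Z \<omega>" for \<omega> using k S2(2)[of \<omega>] by (simp add: Z_def)
    show "AE \<omega> in M. good t Z \<omega>"
      using AE_path Sb
    proof eventually_elim
      case (elim \<omega>)
      interpret P: sde_path "\<lambda>s. X s \<omega>" "\<lambda>s. B s \<omega>" \<beta> \<mu>p \<mu>m x by (rule elim(1))
      have b: "0 \<le> s \<Longrightarrow> s \<le> t \<Longrightarrow> \<bar>B s \<omega>\<bar> \<le> S \<omega>" for s using elim(2) by blast
      have Zeq: "Z \<omega> = 2 * (\<bar>x\<bar> + S \<omega> + P.vel * t)" by (simp add: Z_def k_def P.vel_def algebra_simps)
      have "S \<omega> \<le> Z \<omega>" using k S2(2)[of \<omega>] by (simp add: Z_def)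
      then have "\<bar>X s \<omega>\<bar> \<le> Z \<omega> \<and> \<bar>B s \<omega>\<bar> \<le> Z \<omega>" if "0 \<le> s" "s \<le> t" for s
        using P.\<xi>_le[OF _ b that] b[OF that] t by (simp add: Zeq)
      moreover have "(\<Sum>i<n. \<bar>P.A (grid t n (Suc i)) - P.A (grid t n i)\<bar>) \<le> Z \<omega>" for n
      proof -
        have "P.V t \<le> 2 * (\<bar>x\<bar> + S \<omega> + P.vel * t)" by (rule P.V_le) (use t b in auto)
        then show ?thesis using P.sum_A_le[of t n] t unfolding Zeq by linarith
      qed
      ultimately show ?case using elim(1) unfolding good_def P.A_def by blast
    qed
  qed
qed

end

section \<open>Moments and pathwise limits of sums along the grid\<close>

locale skew_BM_envelope = skew_BM_at_0 M F B X \<beta> \<mu>p \<mu>m x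
  for M :: "'a measure" and F B X \<beta> \<mu>p \<mu>m x +
  fixes t :: real and Z :: "'a \<Rightarrow> real"
  assumes t: "t > 0" and Zm [measurable]: "Z \<in> borel_measurable M" and Z2: "integrable M (\<lambda>\<omega>. (Z \<omega>)\<^sup>2)"
    and Z0: "\<And>\<omega>. 0 \<le> Z \<omega>" and Zgood: "AE \<omega> in M. good t Z \<omega>"
begin

definition xi :: "nat \<Rightarrow> nat \<Rightarrow> 'a \<Rightarrow> real" where "xi n i \<omega> = X (grid t n i) \<omega>"
definition dB :: "nat \<Rightarrow> nat \<Rightarrow> 'a \<Rightarrow> real" where "dB n i \<omega> = B (grid t n (Suc i)) \<omega> - B (grid t n i) \<omega>"
definition dA :: "nat \<Rightarrow> nat \<Rightarrow> 'a \<Rightarrow> real" where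
  "dA n i \<omega> = (X (grid t n (Suc i)) \<omega> - B (grid t n (Suc i)) \<omega>) - (X (grid t n i) \<omega> - B (grid t n i) \<omega>)"

lemma t0: "0 \<le> t" using t by simp

lemma Z1: "integrable M Z" by (rule square_integrable_imp_integrable[OF Zm Z2])

lemma xi_measurable [measurable]: "xi n i \<in> borel_measurable M"
  unfolding xi_def[abs_def] using grid_nonneg[OF t0] by measurable

lemma dB_measurable [measurable]: "dB n i \<in> borel_measurable M"
  unfolding dB_def[abs_def] using grid_nonneg[OF t0] by measurable

lemma dA_measurable [measurable]: "dA n i \<in> borel_measurable M"
  unfolding dA_def[abs_def] using grid_nonneg[OF t0] by measurable

lemma xi_Suc: "xi n (Suc i) \<omega> = xi n i \<omega> + dB n i \<omega> + dA n i \<omega>"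
  by (simp add: xi_def dB_def dA_def)

lemma xi_adapted: "xi n i \<in> borel_measurable (F (grid t n i))"
  unfolding xi_def[abs_def] using X_adapted[OF grid_nonneg[OF t0]] .

lemma goodD:
  assumes "good t Z \<omega>"
  shows "i \<le> n \<Longrightarrow> \<bar>xi n i \<omega>\<bar> \<le> Z \<omega>" "i < n \<Longrightarrow> \<bar>dB n i \<omega>\<bar> \<le> 2 * Z \<omega>" "i < n \<Longrightarrow> \<bar>dA n i \<omega>\<bar> \<le> Z \<omega>" "(\<Sum>i<n. \<bar>dA n i \<omega>\<bar>) \<le> Z \<omega>"
    "\<bar>X t \<omega>\<bar> \<le> Z \<omega>" "X 0 \<omega> = x"
proof -
  have b: "\<bar>X s \<omega>\<bar> \<le> Z \<omega> \<and> \<bar>B s \<omega>\<bar> \<le> Z \<omega>" if "0 \<le> s" "s \<le> t" for s using assms that by (simp add: good_def)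
  show "i \<le> n \<Longrightarrow> \<bar>xi n i \<omega>\<bar> \<le> Z \<omega>" using b[OF grid_nonneg[OF t0] grid_le[OF t0]] by (simp add: xi_def)
  show "\<bar>dB n i \<omega>\<bar> \<le> 2 * Z \<omega>" if "i < n"
    using b[OF grid_nonneg[OF t0] grid_le[OF t0], of "Suc i" n] b[OF grid_nonneg[OF t0] grid_le[OF t0], of i n] that
    unfolding dB_def by linarith
  show s: "(\<Sum>i<n. \<bar>dA n i \<omega>\<bar>) \<le> Z \<omega>" using assms by (simp add: good_def dA_def)
  show "\<bar>dA n i \<omega>\<bar> \<le> Z \<omega>" if "i < n"
    using member_le_sum[of i "{..<n}" "\<lambda>i. \<bar>dA n i \<omega>\<bar>"] that s by simp
  show "\<bar>X t \<omega>\<bar> \<le> Z \<omega>" using b t0 by blast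
  show "X 0 \<omega> = x" using assms by (simp add: good_def sde_path_def)
qed

lemma step_pos: "n > 0 \<Longrightarrow> 0 \<le> grid t n i" "n > 0 \<Longrightarrow> grid t n i < grid t n (Suc i)"
  using grid_nonneg[OF t0] grid_strict[OF t] by auto

lemma dB_moments:
  assumes "n > 0"
  shows "integrable M (\<lambda>\<omega>. dB n i \<omega> ^ k)" "expectation (dB n i) = 0"
    "expectation (\<lambda>\<omega>. (dB n i \<omega>)\<^sup>2) = t / n" "expectation (\<lambda>\<omega>. dB n i \<omega> ^ 4) = 3 * (t / n)\<^sup>2"
  using increment_moments[OF step_pos[OF assms]] unfolding dB_def[abs_def] grid_diff by auto

lemma dB_cube:
  assumes n: "n > 0"
  shows "integrable M (\<lambda>\<omega>. \<bar>dB n i \<omega>\<bar> ^ 3)" "expectation (\<lambda>\<omega>. \<bar>dB n i \<omega>\<bar> ^ 3) \<le> 2 * (t / n) * sqrt (t / n)"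
proof -
  define d where "d = sqrt (t / n)"
  have d: "d > 0" "d\<^sup>2 = t / n" using t n by (auto simp: d_def)
  \<comment> \<open>Expands \<open>b\<^sup>2 * (\<bar>b\<bar> - d)\<^sup>2 \<ge> 0\<close>. With
    \<open>d\<close> the standard deviation of an increment the second and fourth moments contribute
    at the same order, which avoids computing an odd absolute moment.\<close>
  have le: "\<bar>b\<bar> ^ 3 \<le> d / 2 * b\<^sup>2 + 1 / (2 * d) * b ^ 4" for b :: real
  proof -
    have "0 \<le> b\<^sup>2 * (\<bar>b\<bar> - d)\<^sup>2 / (2 * d)" using d by simp
    also have "b\<^sup>2 * (\<bar>b\<bar> - d)\<^sup>2 = b ^ 4 - 2 * d * \<bar>b\<bar> ^ 3 + d\<^sup>2 * b\<^sup>2"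
    proof -
      have "b\<^sup>2 = \<bar>b\<bar>\<^sup>2" "b ^ 4 = \<bar>b\<bar> ^ 4" by (simp_all add: power_even_abs)
      then show ?thesis by (simp only:) (simp add: power2_eq_square power3_eq_cube power4_eq_xxxx algebra_simps)
    qed
    also have "(b ^ 4 - 2 * d * \<bar>b\<bar> ^ 3 + d\<^sup>2 * b\<^sup>2) / (2 * d) = 1 / (2 * d) * b ^ 4 - \<bar>b\<bar> ^ 3 + d / 2 * b\<^sup>2"
      using d(1) by (simp add: field_simps power2_eq_square)
    finally show ?thesis by simp
  qed
  have i: "integrable M (\<lambda>\<omega>. d / 2 * (dB n i \<omega>)\<^sup>2 + 1 / (2 * d) * dB n i \<omega> ^ 4)"
    by (intro Bochner_Integration.integrable_add integrable_mult_right dB_moments(1) n)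
  show i3: "integrable M (\<lambda>\<omega>. \<bar>dB n i \<omega>\<bar> ^ 3)"
    by (rule Bochner_Integration.integrable_bound[OF i]) (use le in \<open>auto intro!: AE_I2 order_trans[OF _ abs_ge_self]\<close>)
  have "expectation (\<lambda>\<omega>. \<bar>dB n i \<omega>\<bar> ^ 3) \<le> expectation (\<lambda>\<omega>. d / 2 * (dB n i \<omega>)\<^sup>2 + 1 / (2 * d) * dB n i \<omega> ^ 4)"
    by (rule integral_mono[OF i3 i le])
  also have "\<dots> = d / 2 * d\<^sup>2 + 1 / (2 * d) * (3 * (d\<^sup>2)\<^sup>2)"
    using dB_moments[OF n, of i] by (simp add: d(2))
  also have "\<dots> = 2 * d\<^sup>2 * d" using d(1) by (simp add: power2_eq_square field_simps)
  finally show "expectation (\<lambda>\<omega>. \<bar>dB n i \<omega>\<bar> ^ 3) \<le> 2 * (t / n) * sqrt (t / n)" by (simp only: d(2)) (simp add: d_def)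
qed

lemma sum_noise:
  assumes n: "n > 0" and Y[measurable]: "Y \<in> borel_measurable borel" and YC: "\<And>y. \<bar>Y y\<bar> \<le> C"
  shows "integrable M (\<lambda>\<omega>. (\<Sum>i<n. Y (xi n i \<omega>) * dB n i \<omega>)\<^sup>2)" "integrable M (\<lambda>\<omega>. \<Sum>i<n. Y (xi n i \<omega>) * dB n i \<omega>)"
    "expectation (\<lambda>\<omega>. \<Sum>i<n. Y (xi n i \<omega>) * dB n i \<omega>) = 0" "expectation (\<lambda>\<omega>. (\<Sum>i<n. Y (xi n i \<omega>) * dB n i \<omega>)\<^sup>2) \<le> C\<^sup>2 * t"
proof -
  have "(\<lambda>\<omega>. Y (xi n i \<omega>)) \<in> borel_measurable (F (grid t n i))" for i
    using xi_adapted by measurable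
  note ms = martingale_sum[OF t n this YC, of "\<lambda>z. z" "t / n" n, folded dB_def, simplified dB_moments[OF n]]
  have "(\<lambda>\<omega>. \<Sum>i<n. Y (xi n i \<omega>) * dB n i \<omega>) \<in> borel_measurable (F (grid t n n)) \<and> integrable M (\<lambda>\<omega>. (\<Sum>i<n. Y (xi n i \<omega>) * dB n i \<omega>)\<^sup>2)
     \<and> integrable M (\<lambda>\<omega>. \<Sum>i<n. Y (xi n i \<omega>) * dB n i \<omega>) \<and> expectation (\<lambda>\<omega>. \<Sum>i<n. Y (xi n i \<omega>) * dB n i \<omega>) = 0
     \<and> expectation (\<lambda>\<omega>. (\<Sum>i<n. Y (xi n i \<omega>) * dB n i \<omega>)\<^sup>2) \<le> real n * (C\<^sup>2 * (t / n))"
    by (rule ms) (use dB_moments[OF n] in \<open>auto simp: dB_def\<close>)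
  then show "integrable M (\<lambda>\<omega>. (\<Sum>i<n. Y (xi n i \<omega>) * dB n i \<omega>)\<^sup>2)" "integrable M (\<lambda>\<omega>. \<Sum>i<n. Y (xi n i \<omega>) * dB n i \<omega>)"
    "expectation (\<lambda>\<omega>. \<Sum>i<n. Y (xi n i \<omega>) * dB n i \<omega>) = 0" "expectation (\<lambda>\<omega>. (\<Sum>i<n. Y (xi n i \<omega>) * dB n i \<omega>)\<^sup>2) \<le> C\<^sup>2 * t"
    using n by auto
qed

text \<open>Quadratic variation: centred squares of increments have variance
  \<open>2 * (t / n)\<^sup>2\<close> and are orthogonal, so \<open>n\<close> of them have a second
  moment of order \<open>1 / n\<close>. Passing from the second moment to the mean absolute value
  gives the square root.\<close>

lemma sum_square_noise:
  assumes n: "n > 0" and Y[measurable]: "Y \<in> borel_measurable borel" and YC: "\<And>y. \<bar>Y y\<bar> \<le> C"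
  shows "integrable M (\<lambda>\<omega>. \<Sum>i<n. Y (xi n i \<omega>) * ((dB n i \<omega>)\<^sup>2 - t / n))"
    "expectation (\<lambda>\<omega>. \<bar>\<Sum>i<n. Y (xi n i \<omega>) * ((dB n i \<omega>)\<^sup>2 - t / n)\<bar>) \<le> C * t * sqrt (2 / n)"
proof -
  have C0: "C \<ge> 0" using YC by (rule order_trans[OF abs_ge_zero])
  have Ym: "(\<lambda>\<omega>. Y (xi n i \<omega>)) \<in> borel_measurable (F (grid t n i))" for i
    using xi_adapted by measurable
  have sq: "((dB n i \<omega>)\<^sup>2 - t / n)\<^sup>2 = dB n i \<omega> ^ 4 - 2 * (t / n) * (dB n i \<omega>)\<^sup>2 + (t / n)\<^sup>2" for i \<omega>
    by (simp add: power2_diff power_mult[symmetric])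
  have i2: "integrable M (\<lambda>\<omega>. ((dB n i \<omega>)\<^sup>2 - t / n)\<^sup>2)" for i
    unfolding sq using dB_moments(1)[OF n] by (intro Bochner_Integration.integrable_add Bochner_Integration.integrable_diff integrable_mult_right) auto
  have e2: "expectation (\<lambda>\<omega>. ((dB n i \<omega>)\<^sup>2 - t / n)\<^sup>2) = 2 * (t / n)\<^sup>2" for i
  proof -
    have "expectation (\<lambda>\<omega>. ((dB n i \<omega>)\<^sup>2 - t / n)\<^sup>2) = expectation (\<lambda>\<omega>. dB n i \<omega> ^ 4) - 2 * (t / n) * expectation (\<lambda>\<omega>. (dB n i \<omega>)\<^sup>2) + (t / n)\<^sup>2"
      unfolding sq using dB_moments(1)[OF n, of i 2] dB_moments(1)[OF n, of i 4] by (simp add: prob_space)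
    also have "\<dots> = 2 * (t / n)\<^sup>2" by (simp only: dB_moments[OF n]) (simp add: power2_eq_square)
    finally show ?thesis .
  qed
  have e1: "expectation (\<lambda>\<omega>. (dB n i \<omega>)\<^sup>2 - t / n) = 0" for i
    using dB_moments[OF n, of i] by (simp add: prob_space)
  let ?S = "\<lambda>\<omega>. \<Sum>i<n. Y (xi n i \<omega>) * ((dB n i \<omega>)\<^sup>2 - t / n)"
  have "?S \<in> borel_measurable (F (grid t n n)) \<and> integrable M (\<lambda>\<omega>. (?S \<omega>)\<^sup>2)
     \<and> integrable M ?S \<and> expectation ?S = 0 \<and> expectation (\<lambda>\<omega>. (?S \<omega>)\<^sup>2) \<le> real n * (C\<^sup>2 * (2 * (t / n)\<^sup>2))"
    using martingale_sum[OF t n, of "\<lambda>i \<omega>. Y (xi n i \<omega>)" C "\<lambda>z. z\<^sup>2 - t / n" "2 * (t / n)\<^sup>2" n] Ym YC i2 e1 e2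
    unfolding dB_def by auto
  then have S: "integrable M (\<lambda>\<omega>. (?S \<omega>)\<^sup>2)" "integrable M ?S" "expectation (\<lambda>\<omega>. (?S \<omega>)\<^sup>2) \<le> real n * (C\<^sup>2 * (2 * (t / n)\<^sup>2))" by auto
  show "integrable M ?S" by (rule S)
  have "(expectation (\<lambda>\<omega>. \<bar>?S \<omega>\<bar>))\<^sup>2 \<le> expectation (\<lambda>\<omega>. (?S \<omega>)\<^sup>2)"
    using S by (intro expectation_abs_sq_le) auto
  also have "\<dots> \<le> real n * (C\<^sup>2 * (2 * (t / n)\<^sup>2))" using S(3) by simp
  also have "\<dots> = (C * t * sqrt (2 / n))\<^sup>2"
    using n by (simp add: power_mult_distrib power_divide field_simps power2_eq_square)
  finally show "expectation (\<lambda>\<omega>. \<bar>?S \<omega>\<bar>) \<le> C * t * sqrt (2 / n)"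
    by (rule power2_le_imp_le) (use C0 t in auto)
qed

definition mu :: "real \<Rightarrow> real" where
  "mu y = \<mu>p * indicator {0<..} y + \<mu>m * indicator {..<0} y"

text \<open>Measurability of \<open>loc\<close> is not established. Statements about its expectation
  are therefore made for measurable functions almost everywhere equal to an expression in
  it.\<close>

definition loc :: "'a \<Rightarrow> real" where "loc \<omega> = local_time (\<lambda>s. X s \<omega>) t 0"

lemma mu_measurable [measurable]: "mu \<in> borel_measurable borel"
  unfolding mu_def[abs_def] by measurable

lemma mu_le: "\<bar>mu y\<bar> \<le> \<bar>\<mu>p\<bar> + \<bar>\<mu>m\<bar>"
  by (auto simp: mu_def indicator_def)

lemma xi_0: "xi n 0 \<omega> = X 0 \<omega>" and xi_top: "n > 0 \<Longrightarrow> xi n n \<omega> = X t \<omega>"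
  by (simp_all add: xi_def)

lemma good_path: "good t Z \<omega> \<Longrightarrow> sde_path (\<lambda>s. X s \<omega>) (\<lambda>s. B s \<omega>) \<beta> \<mu>p \<mu>m x"
  by (simp add: good_def)

lemma riemann_path:
  assumes "good t Z \<omega>" and v: "continuous_on UNIV v"
  shows "(\<lambda>n. \<Sum>i<n. v (xi n i \<omega>) * (t / real n)) \<longlonglongrightarrow> (LBINT s:{0..t}. v (X s \<omega>))"
proof -
  interpret P: sde_path "\<lambda>s. X s \<omega>" "\<lambda>s. B s \<omega>" \<beta> \<mu>p \<mu>m x by (rule good_path[OF assms(1)])
  have "continuous_on {0..t} (\<lambda>s. v (X s \<omega>))"
    by (rule continuous_on_compose2[OF v P.cont_\<xi>']) auto
  from riemann_sum[OF t0 this] show ?thesis by (simp add: xi_def)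
qed

lemma stieltjes_path:
  assumes "good t Z \<omega>" and v: "C-lipschitz_on UNIV v"
  shows "(\<lambda>n. \<Sum>i<n. v (xi n i \<omega>) * dA n i \<omega>) \<longlonglongrightarrow> (LBINT s:{0..t}. v (X s \<omega>) * mu (X s \<omega>)) + \<beta> * (v 0 * loc \<omega>)"
proof -
  interpret P: sde_path "\<lambda>s. X s \<omega>" "\<lambda>s. B s \<omega>" \<beta> \<mu>p \<mu>m x by (rule good_path[OF assms(1)])
  show ?thesis using P.stieltjes_A[OF t0 v]
    by (simp add: xi_def dA_def P.A_def P.drift_def mu_def loc_def P.\<Lambda>_def)
qed

lemma cross_terms:
  assumes "good t Z \<omega>"
  shows "(\<lambda>n. \<Sum>i<n. \<bar>dA n i \<omega>\<bar> * (\<bar>dB n i \<omega>\<bar> + \<bar>dA n i \<omega>\<bar>)) \<longlonglongrightarrow> 0"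
    and "(\<Sum>i<n. \<bar>dA n i \<omega>\<bar> * (\<bar>dB n i \<omega>\<bar> + \<bar>dA n i \<omega>\<bar>)) \<le> 3 * (Z \<omega>)\<^sup>2"
proof -
  interpret P: sde_path "\<lambda>s. X s \<omega>" "\<lambda>s. B s \<omega>" \<beta> \<mu>p \<mu>m x by (rule good_path[OF assms(1)])
  show "(\<lambda>n. \<Sum>i<n. \<bar>dA n i \<omega>\<bar> * (\<bar>dB n i \<omega>\<bar> + \<bar>dA n i \<omega>\<bar>)) \<longlonglongrightarrow> 0"
    using P.sum_A_small[OF t0] by (simp add: dA_def dB_def P.A_def)
  \<comment> \<open>A Brownian increment is at most \<open>2 * Z\<close> and one of
    \<open>X - B\<close> at most \<open>Z\<close>; the remaining factor sums to at most
    \<open>Z\<close>. The square of \<open>Z\<close> is integrable and serves as majorant.\<close>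
  have "(\<Sum>i<n. \<bar>dA n i \<omega>\<bar> * (\<bar>dB n i \<omega>\<bar> + \<bar>dA n i \<omega>\<bar>)) \<le> (\<Sum>i<n. \<bar>dA n i \<omega>\<bar> * (3 * Z \<omega>))"
  proof (intro sum_mono mult_left_mono)
    fix i assume "i \<in> {..<n}"
    then show "\<bar>dB n i \<omega>\<bar> + \<bar>dA n i \<omega>\<bar> \<le> 3 * Z \<omega>" using goodD(2,3)[OF assms, of i n] by simp
  qed simp
  also have "\<dots> \<le> Z \<omega> * (3 * Z \<omega>)"
    unfolding sum_distrib_right[symmetric] using goodD(4)[OF assms, of n] Z0 by (intro mult_right_mono) auto
  finally show "(\<Sum>i<n. \<bar>dA n i \<omega>\<bar> * (\<bar>dB n i \<omega>\<bar> + \<bar>dA n i \<omega>\<bar>)) \<le> 3 * (Z \<omega>)\<^sup>2"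
    by (simp add: power2_eq_square mult_ac)
qed

end

section \<open>Limit of the Taylor sums\<close>

locale ito_setup = skew_BM_envelope M F B X \<beta> \<mu>p \<mu>m x t Z + smooth_test f f1 f2 C
  for M :: "'a measure" and F B X \<beta> \<mu>p \<mu>m x t Z f f1 f2 C
begin

definition quad :: "nat \<Rightarrow> 'a \<Rightarrow> real" where
  "quad n \<omega> = (\<Sum>i<n. f (xi n i \<omega> + dB n i \<omega>) - f (xi n i \<omega>) - f1 (xi n i \<omega>) * dB n i \<omega>)"

definition curv :: "nat \<Rightarrow> 'a \<Rightarrow> real" where
  "curv n \<omega> = (\<Sum>i<n. f2 (xi n i \<omega>) / 2 * (t / real n))"

lemma quad_measurable [measurable]: "quad n \<in> borel_measurable M"
  and curv_measurable [measurable]: "curv n \<in> borel_measurable M"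
  unfolding quad_def[abs_def] curv_def[abs_def] by measurable

lemma curv_le: "\<bar>curv n \<omega>\<bar> \<le> C / 2 * t"
proof -
  have "\<bar>curv n \<omega>\<bar> \<le> (\<Sum>i<n. \<bar>f2 (xi n i \<omega>) / 2 * (t / real n)\<bar>)" unfolding curv_def by (rule sum_abs)
  also have "\<dots> \<le> (\<Sum>i<n. C / 2 * (t / real n))"
    using f2_le t0 by (intro sum_mono) (simp add: abs_mult divide_right_mono mult_right_mono)
  also have "\<dots> \<le> C / 2 * t" using C_nonneg t0 by (cases "n = 0") auto
  finally show ?thesis .
qed

text \<open>Two errors separate the sums: replacing the squared increments by \<open>t / n\<close>,
  handled by \<open>sum_square_noise\<close>, and the cubic Taylor remainder, handled by
  \<open>dB_cube\<close>. Both vanish like the inverse square root of \<open>n\<close>.\<close>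

lemma quad_curv:
  assumes n: "n > 0"
  shows "integrable M (\<lambda>\<omega>. quad n \<omega> - curv n \<omega>)"
    and "expectation (\<lambda>\<omega>. \<bar>quad n \<omega> - curv n \<omega>\<bar>) \<le> C / 2 * t * sqrt (2 / n) + C * (2 * t * sqrt (t / n))"
proof -
  define S where "S \<omega> = (\<Sum>i<n. f2 (xi n i \<omega>) / 2 * ((dB n i \<omega>)\<^sup>2 - t / n))" for \<omega>
  define T where "T \<omega> = (\<Sum>i<n. C * \<bar>dB n i \<omega>\<bar> ^ 3)" for \<omega>
  have "integrable M S" "expectation (\<lambda>\<omega>. \<bar>S \<omega>\<bar>) \<le> C / 2 * t * sqrt (2 / n)"
    using sum_square_noise[OF n, of "\<lambda>y. f2 y / 2" "C / 2"] f2_le by (auto simp: S_def[abs_def] divide_right_mono)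
  note S = this
  have T: "integrable M T" unfolding T_def[abs_def]
    by (intro Bochner_Integration.integrable_sum integrable_mult_right dB_cube n)
  have "expectation T = (\<Sum>i<n. C * expectation (\<lambda>\<omega>. \<bar>dB n i \<omega>\<bar> ^ 3))"
    unfolding T_def[abs_def] using dB_cube(1)[OF n] by (simp add: Bochner_Integration.integral_sum)
  also have "\<dots> \<le> (\<Sum>i<n. C * (2 * (t / n) * sqrt (t / n)))"
    by (intro sum_mono mult_left_mono dB_cube n C_nonneg)
  also have "\<dots> = C * (2 * t * sqrt (t / n))" using n by simp
  finally have TE: "expectation T \<le> C * (2 * t * sqrt (t / n))" .
  have le: "\<bar>quad n \<omega> - curv n \<omega>\<bar> \<le> \<bar>S \<omega>\<bar> + T \<omega>" for \<omega>
  proof -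
    have eq: "quad n \<omega> - curv n \<omega> - S \<omega> = (\<Sum>i<n. f (xi n i \<omega> + dB n i \<omega>) - f (xi n i \<omega>) - f1 (xi n i \<omega>) * dB n i \<omega> - f2 (xi n i \<omega>) / 2 * (dB n i \<omega>)\<^sup>2)"
      unfolding quad_def curv_def S_def sum_subtractf[symmetric] by (intro sum.cong refl) (simp add: right_diff_distrib)
    have "\<bar>quad n \<omega> - curv n \<omega> - S \<omega>\<bar> \<le> (\<Sum>i<n. \<bar>f (xi n i \<omega> + dB n i \<omega>) - f (xi n i \<omega>) - f1 (xi n i \<omega>) * dB n i \<omega> - f2 (xi n i \<omega>) / 2 * (dB n i \<omega>)\<^sup>2\<bar>)"
      unfolding eq by (rule sum_abs)
    also have "\<dots> \<le> T \<omega>" unfolding T_def by (intro sum_mono taylor2)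
    finally show ?thesis by linarith
  qed
  have ST: "integrable M (\<lambda>\<omega>. \<bar>S \<omega>\<bar> + T \<omega>)" using S T by simp
  show i: "integrable M (\<lambda>\<omega>. quad n \<omega> - curv n \<omega>)"
  proof (rule Bochner_Integration.integrable_bound[OF ST], measurable, rule AE_I2)
    fix \<omega> show "norm (quad n \<omega> - curv n \<omega>) \<le> norm (\<bar>S \<omega>\<bar> + T \<omega>)"
      using le[of \<omega>] unfolding real_norm_def by linarith
  qed
  have "expectation (\<lambda>\<omega>. \<bar>quad n \<omega> - curv n \<omega>\<bar>) \<le> expectation (\<lambda>\<omega>. \<bar>S \<omega>\<bar> + T \<omega>)"
    by (rule integral_mono[OF integrable_abs[OF i] ST le])
  also have "\<dots> = expectation (\<lambda>\<omega>. \<bar>S \<omega>\<bar>) + expectation T" using S T by simp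
  also have "\<dots> \<le> C / 2 * t * sqrt (2 / n) + C * (2 * t * sqrt (t / n))" using S TE by simp
  finally show "expectation (\<lambda>\<omega>. \<bar>quad n \<omega> - curv n \<omega>\<bar>) \<le> C / 2 * t * sqrt (2 / n) + C * (2 * t * sqrt (t / n))" .
qed

lemma quad_curv_tendsto:
  "(\<lambda>n. expectation (\<lambda>\<omega>. \<bar>quad (Suc n) \<omega> - curv (Suc n) \<omega>\<bar>)) \<longlonglongrightarrow> 0"
proof (rule tendsto_sandwich[OF _ _ tendsto_const])
  show "\<forall>\<^sub>F n in sequentially. 0 \<le> expectation (\<lambda>\<omega>. \<bar>quad (Suc n) \<omega> - curv (Suc n) \<omega>\<bar>)" by simp
  show "\<forall>\<^sub>F n in sequentially. expectation (\<lambda>\<omega>. \<bar>quad (Suc n) \<omega> - curv (Suc n) \<omega>\<bar>)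
    \<le> C / 2 * t * sqrt (2 / real (Suc n)) + C * (2 * t * sqrt (t / real (Suc n)))"
    by (intro always_eventually allI quad_curv(2)) simp
  have "(\<lambda>n. C / 2 * t * sqrt (2 / real (Suc n)) + C * (2 * t * sqrt (t / real (Suc n)))) \<longlonglongrightarrow> C / 2 * t * sqrt 0 + C * (2 * t * sqrt 0)"
    by (intro tendsto_intros LIMSEQ_Suc[OF lim_const_over_n])
  then show "(\<lambda>n. C / 2 * t * sqrt (2 / real (Suc n)) + C * (2 * t * sqrt (t / real (Suc n)))) \<longlonglongrightarrow> 0" by simp
qed

lemma curv_tendsto: "good t Z \<omega> \<Longrightarrow> (\<lambda>n. curv n \<omega>) \<longlonglongrightarrow> (LBINT s:{0..t}. f2 (X s \<omega>) / 2)"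
  unfolding curv_def by (rule riemann_path) (auto intro!: continuous_intros f2_continuous)

lemma telescope:
  assumes "n > 0"
  shows "f (X t \<omega>) - f (X 0 \<omega>) = (\<Sum>i<n. f1 (xi n i \<omega>) * dB n i \<omega>) + quad n \<omega> + (\<Sum>i<n. f (xi n (Suc i) \<omega>) - f (xi n i \<omega> + dB n i \<omega>))"
proof -
  have "f (X t \<omega>) - f (X 0 \<omega>) = (\<Sum>i<n. f (xi n (Suc i) \<omega>) - f (xi n i \<omega>))"
    using assms by (subst sum_lessThan_telescope) (simp add: xi_0 xi_top)
  also have "\<dots> = (\<Sum>i<n. f1 (xi n i \<omega>) * dB n i \<omega>) + quad n \<omega> + (\<Sum>i<n. f (xi n (Suc i) \<omega>) - f (xi n i \<omega> + dB n i \<omega>))"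
    unfolding quad_def sum.distrib[symmetric] by (intro sum.cong) auto
  finally show ?thesis .
qed

lemma f_X_integrable: "integrable M (\<lambda>\<omega>. f (X t \<omega>))"
proof (rule Bochner_Integration.integrable_bound)
  show "integrable M (\<lambda>\<omega>. \<bar>f 0\<bar> + C * Z \<omega>)" using Z1 by simp
  show "(\<lambda>\<omega>. f (X t \<omega>)) \<in> borel_measurable M" using t0 by measurable
  show "AE \<omega> in M. norm (f (X t \<omega>)) \<le> norm (\<bar>f 0\<bar> + C * Z \<omega>)"
    using Zgood
  proof eventually_elim
    case (elim \<omega>)
    have "C * \<bar>X t \<omega>\<bar> \<le> C * Z \<omega>" using goodD(5)[OF elim] by (intro mult_left_mono C_nonneg)
    then have "\<bar>f (X t \<omega>)\<bar> \<le> \<bar>f 0\<bar> + C * Z \<omega>" using f_lip[of "X t \<omega>" 0] by simp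
    then show ?case by simp
  qed
qed

text \<open>The increment of \<open>f\<close> telescopes into a noise sum of mean zero, a quadratic
  part close to \<open>curv\<close> in mean, and the effect of \<open>X - B\<close>. The last two
  converge pathwise under the integrable majorants supplied by \<open>Z\<close> and its
  square.\<close>

lemma ito_expectation:
  obtains G where "G \<in> borel_measurable M" "integrable M G"
    "AE \<omega> in M. G \<omega> = (LBINT s:{0..t}. f1 (X s \<omega>) * mu (X s \<omega>)) + (LBINT s:{0..t}. f2 (X s \<omega>) / 2) + \<beta> * (f1 0 * loc \<omega>)"
    "expectation (\<lambda>\<omega>. f (X t \<omega>)) = f x + expectation G"
proof -
  define G where "G n \<omega> = (\<Sum>i<n. f1 (xi n i \<omega>) * dA n i \<omega>) + curv n \<omega>" for n \<omega>
  define R where "R n \<omega> = (\<Sum>i<n. f (xi n (Suc i) \<omega>) - f (xi n i \<omega> + dB n i \<omega>) - f1 (xi n i \<omega>) * dA n i \<omega>)" for n \<omega>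
  have Gm[measurable]: "G n \<in> borel_measurable M" for n unfolding G_def[abs_def] by measurable
  have Rm[measurable]: "R n \<in> borel_measurable M" for n unfolding R_def[abs_def] by measurable
  \<comment> \<open>Defined as a limit of measurable functions, so that the expression with the
    local time acquires a measurable version.\<close>
  define g where "g \<omega> = lim (\<lambda>n. G (Suc n) \<omega>)" for \<omega>
  have gm[measurable]: "g \<in> borel_measurable M" unfolding g_def[abs_def] by measurable
  have Glim: "(\<lambda>n. G (Suc n) \<omega>) \<longlonglongrightarrow> (LBINT s:{0..t}. f1 (X s \<omega>) * mu (X s \<omega>)) + (LBINT s:{0..t}. f2 (X s \<omega>) / 2) + \<beta> * (f1 0 * loc \<omega>)"
    if "good t Z \<omega>" for \<omega>
    using LIMSEQ_Suc[OF tendsto_add[OF stieltjes_path[OF that f1_lipschitz] curv_tendsto[OF that]]] unfolding G_def by (simp add: add_ac)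
  have geq: "AE \<omega> in M. g \<omega> = (LBINT s:{0..t}. f1 (X s \<omega>) * mu (X s \<omega>)) + (LBINT s:{0..t}. f2 (X s \<omega>) / 2) + \<beta> * (f1 0 * loc \<omega>)"
    using Zgood by eventually_elim (simp add: g_def limI[OF Glim])
  have Gb: "AE \<omega> in M. norm (G n \<omega>) \<le> C * Z \<omega> + C / 2 * t" for n
    using Zgood
  proof eventually_elim
    case (elim \<omega>)
    have "\<bar>\<Sum>i<n. f1 (xi n i \<omega>) * dA n i \<omega>\<bar> \<le> (\<Sum>i<n. C * \<bar>dA n i \<omega>\<bar>)"
      by (rule order_trans[OF sum_abs]) (auto intro!: sum_mono mult_right_mono f1_le simp: abs_mult)
    also have "\<dots> \<le> C * Z \<omega>" unfolding sum_distrib_left[symmetric] by (intro mult_left_mono goodD(4)[OF elim] C_nonneg)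
    finally show ?case using curv_le[of n \<omega>] unfolding G_def real_norm_def by linarith
  qed
  have Ri: "AE \<omega> in M. norm (R n \<omega>) \<le> C * (\<Sum>i<n. \<bar>dA n i \<omega>\<bar> * (\<bar>dB n i \<omega>\<bar> + \<bar>dA n i \<omega>\<bar>))" for n
  proof (rule AE_I2)
    fix \<omega>
    have "\<bar>R n \<omega>\<bar> \<le> (\<Sum>i<n. \<bar>f (xi n (Suc i) \<omega>) - f (xi n i \<omega> + dB n i \<omega>) - f1 (xi n i \<omega>) * dA n i \<omega>\<bar>)"
      unfolding R_def by (rule sum_abs)
    also have "\<dots> \<le> (\<Sum>i<n. C * (\<bar>dA n i \<omega>\<bar> * (\<bar>dB n i \<omega>\<bar> + \<bar>dA n i \<omega>\<bar>)))"
      unfolding xi_Suc by (intro sum_mono first_order)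
    finally show "norm (R n \<omega>) \<le> C * (\<Sum>i<n. \<bar>dA n i \<omega>\<bar> * (\<bar>dB n i \<omega>\<bar> + \<bar>dA n i \<omega>\<bar>))"
      by (simp add: sum_distrib_left)
  qed
  have Rb: "AE \<omega> in M. norm (R n \<omega>) \<le> C * (3 * (Z \<omega>)\<^sup>2)" for n
    using Zgood Ri[of n]
    by eventually_elim (rule order_trans, assumption, intro mult_left_mono cross_terms C_nonneg)
  have iG: "integrable M (\<lambda>\<omega>. C * Z \<omega> + C / 2 * t)" using Z1 by simp
  have iR: "integrable M (\<lambda>\<omega>. C * (3 * (Z \<omega>)\<^sup>2))" using Z2 by simp
  have GiM: "integrable M (G n)" for n
    by (rule Bochner_Integration.integrable_bound[OF iG Gm]) (use Gb[of n] in eventually_elim, auto intro: order_trans[OF _ abs_ge_self])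
  have RiM: "integrable M (R n)" for n
    by (rule Bochner_Integration.integrable_bound[OF iR Rm]) (use Rb[of n] in eventually_elim, auto intro: order_trans[OF _ abs_ge_self])
  have gl: "AE \<omega> in M. (\<lambda>n. G (Suc n) \<omega>) \<longlonglongrightarrow> g \<omega>"
    using Zgood geq by eventually_elim (use Glim in simp)
  have gI: "integrable M g" by (rule integrable_dominated_convergence[OF gm Gm iG gl Gb])
  have GE: "(\<lambda>n. expectation (G (Suc n))) \<longlonglongrightarrow> expectation g" by (rule integral_dominated_convergence[OF gm Gm iG gl Gb])
  have Rl: "AE \<omega> in M. (\<lambda>n. R (Suc n) \<omega>) \<longlonglongrightarrow> 0"
    using Zgood
  proof eventually_elim
    case (elim \<omega>)
    show ?case
    proof (rule Lim_null_comparison)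
      show "(\<lambda>n. C * (\<Sum>i<Suc n. \<bar>dA (Suc n) i \<omega>\<bar> * (\<bar>dB (Suc n) i \<omega>\<bar> + \<bar>dA (Suc n) i \<omega>\<bar>))) \<longlonglongrightarrow> 0"
        using tendsto_mult[OF tendsto_const LIMSEQ_Suc[OF cross_terms(1)[OF elim]], of C] by simp
      have "norm (R n \<omega>) \<le> C * (\<Sum>i<n. \<bar>dA n i \<omega>\<bar> * (\<bar>dB n i \<omega>\<bar> + \<bar>dA n i \<omega>\<bar>))" for n
      proof -
        have "\<bar>R n \<omega>\<bar> \<le> (\<Sum>i<n. C * (\<bar>dA n i \<omega>\<bar> * (\<bar>dB n i \<omega>\<bar> + \<bar>dA n i \<omega>\<bar>)))"
          unfolding R_def by (rule order_trans[OF sum_abs]) (unfold xi_Suc, intro sum_mono first_order)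
        then show ?thesis by (simp add: sum_distrib_left)
      qed
      then show "\<forall>\<^sub>F n in sequentially. norm (R (Suc n) \<omega>) \<le> C * (\<Sum>i<Suc n. \<bar>dA (Suc n) i \<omega>\<bar> * (\<bar>dB (Suc n) i \<omega>\<bar> + \<bar>dA (Suc n) i \<omega>\<bar>))"
        by (intro always_eventually allI)
    qed
  qed
  have RE: "(\<lambda>n. expectation (R (Suc n))) \<longlonglongrightarrow> expectation (\<lambda>\<omega>. 0)"
    by (rule integral_dominated_convergence[OF _ Rm iR Rl Rb]) simp
  have QE: "(\<lambda>n. expectation (\<lambda>\<omega>. quad (Suc n) \<omega> - curv (Suc n) \<omega>)) \<longlonglongrightarrow> 0"
    by (rule Lim_null_comparison[OF always_eventually quad_curv_tendsto]) (simp add: integral_abs_bound)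
  have eqn: "expectation (\<lambda>\<omega>. f (X t \<omega>)) - f x = expectation (G (Suc n)) + expectation (\<lambda>\<omega>. quad (Suc n) \<omega> - curv (Suc n) \<omega>) + expectation (R (Suc n))" for n
  proof -
    let ?N = "\<lambda>\<omega>. \<Sum>i<Suc n. f1 (xi (Suc n) i \<omega>) * dB (Suc n) i \<omega>"
    have N: "integrable M ?N" "expectation ?N = 0" using sum_noise[of "Suc n" f1 C] f1_le by auto
    have Q: "integrable M (\<lambda>\<omega>. quad (Suc n) \<omega> - curv (Suc n) \<omega>)" by (rule quad_curv) simp
    have "expectation (\<lambda>\<omega>. f (X t \<omega>)) - f x = expectation (\<lambda>\<omega>. f (X t \<omega>) - f x)" using f_X_integrable by (simp add: prob_space)
    also have "\<dots> = expectation (\<lambda>\<omega>. ?N \<omega> + G (Suc n) \<omega> + (quad (Suc n) \<omega> - curv (Suc n) \<omega>) + R (Suc n) \<omega>)"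
    proof (rule integral_cong_AE)
      show "AE \<omega> in M. f (X t \<omega>) - f x = ?N \<omega> + G (Suc n) \<omega> + (quad (Suc n) \<omega> - curv (Suc n) \<omega>) + R (Suc n) \<omega>"
        using Zgood
      proof eventually_elim
        case (elim \<omega>)
        show ?case using telescope[of "Suc n" \<omega>] goodD(6)[OF elim] unfolding G_def R_def sum_subtractf by simp
      qed
    qed (use t0 in measurable)
    also have "\<dots> = expectation ?N + expectation (G (Suc n)) + expectation (\<lambda>\<omega>. quad (Suc n) \<omega> - curv (Suc n) \<omega>) + expectation (R (Suc n))"
      using N(1) GiM[of "Suc n"] Q RiM[of "Suc n"]
      by (subst Bochner_Integration.integral_add, simp, simp, subst Bochner_Integration.integral_add, simp, simp, subst Bochner_Integration.integral_add, auto)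
    finally show ?thesis using N(2) by simp
  qed
  have "(\<lambda>n. expectation (G (Suc n)) + expectation (\<lambda>\<omega>. quad (Suc n) \<omega> - curv (Suc n) \<omega>) + expectation (R (Suc n))) \<longlonglongrightarrow> expectation g + 0 + expectation (\<lambda>\<omega>. 0)"
    by (intro tendsto_add GE QE RE)
  then have "expectation (\<lambda>\<omega>. f (X t \<omega>)) - f x = expectation g" unfolding eqn[symmetric] by (simp add: LIMSEQ_const_iff)
  then show thesis by (intro that[OF gm gI geq]) simp
qed

text \<open>The right-hand side does not depend on the bound \<open>C\<close> of the second derivative.  This gives uniform
  integrability of the occupation quotients, for which \<open>C\<close> blows up.\<close>

lemma curvature_tail:
  assumes b2: "\<And>y. \<bar>f1 y\<bar> \<le> 2" and K: "K > 0" and q[measurable]: "q \<in> borel_measurable M"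
    and qeq: "AE \<omega> in M. q \<omega> = (LBINT s:{0..t}. f2 (X s \<omega>) / 2)"
  shows "integrable M q" "expectation (\<lambda>\<omega>. max 0 (q \<omega> - K)) \<le> (72 * expectation (\<lambda>\<omega>. (Z \<omega>)\<^sup>2) + 8 * t) / (4 * K)"
proof -
  have lim: "AE \<omega> in M. (\<lambda>n. curv (Suc n) \<omega>) \<longlonglongrightarrow> q \<omega>"
    using Zgood qeq
  proof eventually_elim
    case (elim \<omega>)
    show ?case unfolding elim(2) by (rule LIMSEQ_Suc[OF curv_tendsto[OF elim(1)]])
  qed
  have ic: "integrable M (\<lambda>\<omega>. C / 2 * t)" by simp
  show qi: "integrable M q"
    by (rule integrable_dominated_convergence[OF q _ ic lim]) (use curv_le in auto)
  have cE: "(\<lambda>n. expectation (\<lambda>\<omega>. max 0 (curv (Suc n) \<omega> - K))) \<longlonglongrightarrow> expectation (\<lambda>\<omega>. max 0 (q \<omega> - K))"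
  proof (rule integral_dominated_convergence[where w="\<lambda>\<omega>. C / 2 * t"])
    show "AE \<omega> in M. (\<lambda>n. max 0 (curv (Suc n) \<omega> - K)) \<longlonglongrightarrow> max 0 (q \<omega> - K)"
      using lim by eventually_elim (intro tendsto_intros)
    show "AE \<omega> in M. norm (max 0 (curv (Suc n) \<omega> - K)) \<le> C / 2 * t" for n
    proof (rule AE_I2)
      fix \<omega>
      have "0 \<le> C / 2 * t" using C_nonneg t0 by simp
      then show "norm (max 0 (curv (Suc n) \<omega> - K)) \<le> C / 2 * t" using curv_le[of "Suc n" \<omega>] K by (auto simp: max_def)
    qed
  qed auto
  \<comment> \<open>The 72 is twice the square of the 6 in the bound of \<open>Q\<close> below, and
    \<open>8 * t\<close> is twice the bound \<open>2\<^sup>2 * t\<close> for the second moment of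
    the noise sum.\<close>
  define E0 where "E0 = 72 * expectation (\<lambda>\<omega>. (Z \<omega>)\<^sup>2) + 8 * t"
  have lip2: "\<bar>f y - f z\<bar> \<le> 2 * \<bar>y - z\<bar>" for y z
    using mvt_bound[of "\<lambda>u. f (z + u)" "\<lambda>u. f1 (z + u)" "y - z" 2] b2 f1
    by (simp add: DERIV_shift[symmetric] add.commute)
  have each: "expectation (\<lambda>\<omega>. max 0 (curv (Suc n) \<omega> - K)) \<le> expectation (\<lambda>\<omega>. \<bar>quad (Suc n) \<omega> - curv (Suc n) \<omega>\<bar>) + E0 / (4 * K)" for n
  proof -
    let ?N = "\<lambda>\<omega>. \<Sum>i<Suc n. f1 (xi (Suc n) i \<omega>) * dB (Suc n) i \<omega>"
    have N: "integrable M (\<lambda>\<omega>. (?N \<omega>)\<^sup>2)" "expectation (\<lambda>\<omega>. (?N \<omega>)\<^sup>2) \<le> 2\<^sup>2 * t"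
      using sum_noise(1,4)[of "Suc n" f1 2] b2 by auto
    have iw: "integrable M (\<lambda>\<omega>. \<bar>quad (Suc n) \<omega> - curv (Suc n) \<omega>\<bar> + (72 * (Z \<omega>)\<^sup>2 + 2 * (?N \<omega>)\<^sup>2) / (4 * K))"
      using quad_curv(1)[of "Suc n"] Z2 N(1) by simp
    have "expectation (\<lambda>\<omega>. max 0 (curv (Suc n) \<omega> - K)) \<le> expectation (\<lambda>\<omega>. \<bar>quad (Suc n) \<omega> - curv (Suc n) \<omega>\<bar> + (72 * (Z \<omega>)\<^sup>2 + 2 * (?N \<omega>)\<^sup>2) / (4 * K))"
    proof (rule integral_mono_AE[OF _ iw])
      have "norm (max 0 (curv (Suc n) \<omega> - K)) \<le> C / 2 * t" for \<omega>
      proof -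
        have "0 \<le> C / 2 * t" using C_nonneg t0 by simp
        then show ?thesis using curv_le[of "Suc n" \<omega>] K by (auto simp: max_def)
      qed
      then show "integrable M (\<lambda>\<omega>. max 0 (curv (Suc n) \<omega> - K))"
        by (intro integrable_const_bound[of _ "C / 2 * t"] AE_I2) auto
      show "AE \<omega> in M. max 0 (curv (Suc n) \<omega> - K) \<le> \<bar>quad (Suc n) \<omega> - curv (Suc n) \<omega>\<bar> + (72 * (Z \<omega>)\<^sup>2 + 2 * (?N \<omega>)\<^sup>2) / (4 * K)"
        using Zgood
      proof eventually_elim
        case (elim \<omega>)
        define Q where "Q = quad (Suc n) \<omega>"
        have "\<bar>X 0 \<omega>\<bar> \<le> Z \<omega>" using goodD(1)[OF elim, of 0 1] by (simp add: xi_0)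
        moreover have "a \<le> 4 * z" if "v \<le> z" "a \<le> 2 * d" "u \<le> z" "d \<le> u + v" for a d u v z :: real
          using that by linarith
        ultimately have "\<bar>f (X t \<omega>) - f (X 0 \<omega>)\<bar> \<le> 4 * Z \<omega>"
          using lip2[of "X t \<omega>" "X 0 \<omega>"] goodD(5)[OF elim] abs_triangle_ineq4[of "X t \<omega>" "X 0 \<omega>"] by blast
        moreover have "\<bar>\<Sum>i<Suc n. f (xi (Suc n) (Suc i) \<omega>) - f (xi (Suc n) i \<omega> + dB (Suc n) i \<omega>)\<bar> \<le> 2 * Z \<omega>"
        proof -
          have "\<bar>\<Sum>i<Suc n. f (xi (Suc n) (Suc i) \<omega>) - f (xi (Suc n) i \<omega> + dB (Suc n) i \<omega>)\<bar> \<le> (\<Sum>i<Suc n. 2 * \<bar>dA (Suc n) i \<omega>\<bar>)"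
          proof (rule order_trans[OF sum_abs sum_mono])
            fix i
            show "\<bar>f (xi (Suc n) (Suc i) \<omega>) - f (xi (Suc n) i \<omega> + dB (Suc n) i \<omega>)\<bar> \<le> 2 * \<bar>dA (Suc n) i \<omega>\<bar>"
              using lip2[of "xi (Suc n) (Suc i) \<omega>" "xi (Suc n) i \<omega> + dB (Suc n) i \<omega>"] unfolding xi_Suc by simp
          qed
          also have "\<dots> \<le> 2 * Z \<omega>" unfolding sum_distrib_left[symmetric] using goodD(4)[OF elim, of "Suc n"] by (intro mult_left_mono) auto
          finally show ?thesis .
        qed
        \<comment> \<open>Four times \<open>Z\<close> comes from the values of \<open>f\<close> at
          both ends, with Lipschitz constant 2, and two times \<open>Z\<close> from the variation of
          \<open>X - B\<close>. No bound of the second derivative enters.\<close>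
        ultimately have "\<bar>Q\<bar> \<le> 6 * Z \<omega> + \<bar>?N \<omega>\<bar>" using telescope[of "Suc n" \<omega>] unfolding Q_def by linarith
        then have "\<bar>Q\<bar>\<^sup>2 \<le> (6 * Z \<omega> + \<bar>?N \<omega>\<bar>)\<^sup>2" by (rule power_mono) simp
        also have "\<dots> \<le> 72 * (Z \<omega>)\<^sup>2 + 2 * (?N \<omega>)\<^sup>2"
        proof -
          have "(6 * a + \<bar>b\<bar>)\<^sup>2 \<le> 72 * a\<^sup>2 + 2 * b\<^sup>2" for a b :: real
            using zero_le_power2[of "6 * a - \<bar>b\<bar>"] by (simp add: power2_sum power2_diff power_mult_distrib)
          then show ?thesis .
        qed
        finally have Q2: "Q\<^sup>2 \<le> 72 * (Z \<omega>)\<^sup>2 + 2 * (?N \<omega>)\<^sup>2" by simp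
        \<comment> \<open>This tangent inequality turns a bound of the second moment into a tail
          bound of order \<open>1 / K\<close>.\<close>
        have "4 * K * (\<bar>Q\<bar> - K) \<le> Q\<^sup>2" using zero_le_power2[of "\<bar>Q\<bar> - 2 * K"] by (simp add: power2_diff power2_eq_square algebra_simps)
        then have "\<bar>Q\<bar> - K \<le> Q\<^sup>2 / (4 * K)" using K by (simp add: le_divide_eq mult.commute)
        also have "\<dots> \<le> (72 * (Z \<omega>)\<^sup>2 + 2 * (?N \<omega>)\<^sup>2) / (4 * K)" using Q2 K by (intro divide_right_mono) auto
        finally have 1: "\<bar>Q\<bar> - K \<le> (72 * (Z \<omega>)\<^sup>2 + 2 * (?N \<omega>)\<^sup>2) / (4 * K)" .
        have 2: "0 \<le> (72 * (Z \<omega>)\<^sup>2 + 2 * (?N \<omega>)\<^sup>2) / (4 * K)" using K by simp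
        have "max 0 (c - K) \<le> \<bar>Q - c\<bar> + w" if "\<bar>Q\<bar> - K \<le> w" "0 \<le> w" for c w
        proof -
          have "c - K \<le> \<bar>Q - c\<bar> + w" using that by arith
          moreover have "0 \<le> \<bar>Q - c\<bar> + w" using that by simp
          ultimately show ?thesis by simp
        qed
        from this[OF 1 2] show ?case unfolding Q_def .
      qed
    qed
    also have "\<dots> = expectation (\<lambda>\<omega>. \<bar>quad (Suc n) \<omega> - curv (Suc n) \<omega>\<bar>) + (72 * expectation (\<lambda>\<omega>. (Z \<omega>)\<^sup>2) + 2 * expectation (\<lambda>\<omega>. (?N \<omega>)\<^sup>2)) / (4 * K)"
    proof -
      have "integrable M (\<lambda>\<omega>. 72 * (Z \<omega>)\<^sup>2)" "integrable M (\<lambda>\<omega>. 2 * (?N \<omega>)\<^sup>2)" using Z2 N(1) by (auto simp del: sum.lessThan_Suc)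
      then show ?thesis using quad_curv(1)[of "Suc n"]
        by (subst Bochner_Integration.integral_add) (simp_all del: sum.lessThan_Suc)
    qed
    also have "\<dots> \<le> expectation (\<lambda>\<omega>. \<bar>quad (Suc n) \<omega> - curv (Suc n) \<omega>\<bar>) + E0 / (4 * K)"
      using N(2) K unfolding E0_def by (intro add_left_mono divide_right_mono) (auto simp del: sum.lessThan_Suc)
    finally show ?thesis .
  qed
  show "expectation (\<lambda>\<omega>. max 0 (q \<omega> - K)) \<le> (72 * expectation (\<lambda>\<omega>. (Z \<omega>)\<^sup>2) + 8 * t) / (4 * K)"
    using LIMSEQ_le[OF cE tendsto_add[OF quad_curv_tendsto tendsto_const[of "E0 / (4 * K)"]]] each by (auto simp: E0_def)
qed

end

section \<open>Dynkin's formula for functions with a kink\<close>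

text \<open>Meant for a smoothing error whose derivative is of order one within distance \<epsilon>
  of the kink and of order \<epsilon> beyond it.\<close>

lemma two_zone_bound:
  fixes e e' :: "real \<Rightarrow> real"
  assumes e: "\<And>u. u \<ge> 0 \<Longrightarrow> (e has_real_derivative e' u) (at u)" and \<epsilon>: "\<epsilon> > 0" "A \<ge> 0" "B \<ge> 0"
    and near: "\<And>u. 0 \<le> u \<Longrightarrow> \<bar>e' u\<bar> \<le> A" and far: "\<And>u. \<epsilon> \<le> u \<Longrightarrow> \<bar>e' u\<bar> \<le> B" and y: "y \<ge> 0"
  shows "\<bar>e y - e 0\<bar> \<le> A * \<epsilon> + B * y"
proof -
  have mv: "\<bar>e v - e u\<bar> \<le> K * (v - u)" if "0 \<le> u" "u \<le> v" "\<And>w. u \<le> w \<Longrightarrow> \<bar>e' w\<bar> \<le> K" for u v K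
  proof -
    have "norm (e v - e u) \<le> K * norm (v - u)"
      by (rule field_differentiable_bound[of "{u..v}" e e'])
         (use that e in \<open>auto intro: has_field_derivative_at_within\<close>)
    then show ?thesis using that by simp
  qed
  show ?thesis
  proof (cases "y \<le> \<epsilon>")
    case True
    have "\<bar>e y - e 0\<bar> \<le> A * (y - 0)" using y near by (intro mv) auto
    also have "\<dots> \<le> A * \<epsilon>" using True \<epsilon> by (intro mult_left_mono) auto
    also have "\<dots> \<le> A * \<epsilon> + B * y" using \<epsilon> y by simp
    finally show ?thesis .
  next
    case False
    have "\<bar>e y - e 0\<bar> \<le> \<bar>e \<epsilon> - e 0\<bar> + \<bar>e y - e \<epsilon>\<bar>" by simp
    also have "\<dots> \<le> A * (\<epsilon> - 0) + B * (y - \<epsilon>)"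
      using False \<epsilon> near far by (intro add_mono mv) auto
    also have "\<dots> \<le> A * \<epsilon> + B * y" using \<epsilon> by (intro add_mono mult_left_mono) auto
    finally show ?thesis .
  qed
qed

text \<open>\<open>H\<close> is a smoothed sign and \<open>\<Psi>\<close> a smoothed absolute value.
  The flat part of the kernel brings \<open>H\<close> exactly to 1 at \<epsilon>.\<close>

lemma trapezoid_primitive:
  assumes \<epsilon>: "0 < \<epsilon>" "\<epsilon> \<le> 1"
  obtains H \<Psi> where "\<And>y. (H has_real_derivative 2 * trapezoid \<epsilon> y) (at y)" "\<And>y. (\<Psi> has_real_derivative H y) (at y)"
    "H 0 = 0" "\<And>y. \<bar>H y\<bar> \<le> 2" "\<And>y. y \<ge> \<epsilon> \<Longrightarrow> \<bar>H y - 1\<bar> \<le> \<epsilon>" "\<And>y. y \<le> - \<epsilon> \<Longrightarrow> \<bar>H y + 1\<bar> \<le> \<epsilon>"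
proof -
  have "continuous_on UNIV (\<lambda>y. 2 * trapezoid \<epsilon> y)" using \<epsilon> by (intro continuous_intros trapezoid_continuous)
  from continuous_antiderivative[OF this, of 0]
  obtain H where H: "H 0 = (0::real)" "\<And>y. (H has_real_derivative 2 * trapezoid \<epsilon> y) (at y)" by blast
  have "continuous_on UNIV H" using H(2) by (auto intro!: continuous_at_imp_continuous_on DERIV_isCont)
  from continuous_antiderivative[OF this, of 0]
  obtain \<Psi> where \<Psi>: "\<Psi> 0 = (0::real)" "\<And>y. (\<Psi> has_real_derivative H y) (at y)" by blast
  have mv: "\<exists>z. u < z \<and> z < v \<and> H v - H u = (v - u) * (2 * trapezoid \<epsilon> z)" if "u < v" for u v
    using MVT2[OF that, of H "\<lambda>z. 2 * trapezoid \<epsilon> z", OF H(2)] by simp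
  have small: "H y = y / \<epsilon>" if "0 \<le> y" "y \<le> \<epsilon>" for y
  proof (cases "y = 0")
    case False
    then have "0 < y" using that by simp
    from mv[OF this] obtain z where "0 < z" "z < y" "H y - H 0 = (y - 0) * (2 * trapezoid \<epsilon> z)" by blast
    then show ?thesis using that \<epsilon> by (simp add: H trapezoid_in)
  qed (simp add: H)
  \<comment> \<open>The ramp has width \<open>\<epsilon>\<^sup>2\<close> and the derivative there is
    at most \<open>1 / \<epsilon>\<close>, so \<open>H\<close> overshoots by at most
    \<epsilon>.\<close>
  have mid: "1 \<le> H y \<and> H y \<le> 1 + \<epsilon>" if "\<epsilon> \<le> y" "y \<le> \<epsilon> + \<epsilon>\<^sup>2" for y
  proof (cases "y = \<epsilon>")
    case False
    then have "\<epsilon> < y" using that by simp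
    from mv[OF this] obtain z where z: "H y - H \<epsilon> = (y - \<epsilon>) * (2 * trapezoid \<epsilon> z)" by blast
    have "(y - \<epsilon>) * (2 * trapezoid \<epsilon> z) \<le> \<epsilon>\<^sup>2 * (1 / \<epsilon>)"
      using that \<epsilon> trapezoid_le[of \<epsilon> z] trapezoid_nonneg[of \<epsilon> z] by (intro mult_mono) (auto simp: field_simps)
    also have "\<dots> = \<epsilon>" using \<epsilon> by (simp add: power2_eq_square)
    finally have "(y - \<epsilon>) * (2 * trapezoid \<epsilon> z) \<le> \<epsilon>" .
    moreover have "0 \<le> (y - \<epsilon>) * (2 * trapezoid \<epsilon> z)" using that \<epsilon> trapezoid_nonneg[of \<epsilon> z] by (intro mult_nonneg_nonneg) auto
    moreover have "H \<epsilon> = 1" using small[of \<epsilon>] \<epsilon> by simp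
    ultimately show ?thesis unfolding z[symmetric] by simp
  qed (use small[of \<epsilon>] \<epsilon> in simp)
  have far: "1 \<le> H y \<and> H y \<le> 1 + \<epsilon>" if "\<epsilon> \<le> y" for y
  proof (cases "y \<le> \<epsilon> + \<epsilon>\<^sup>2")
    case False
    then have "\<epsilon> + \<epsilon>\<^sup>2 < y" by simp
    from mv[OF this] obtain z where "\<epsilon> + \<epsilon>\<^sup>2 < z" "H y - H (\<epsilon> + \<epsilon>\<^sup>2) = (y - (\<epsilon> + \<epsilon>\<^sup>2)) * (2 * trapezoid \<epsilon> z)" by blast
    moreover have "trapezoid \<epsilon> z = 0" if "\<epsilon> + \<epsilon>\<^sup>2 < z" using that \<epsilon> by (intro trapezoid_out) auto
    ultimately have "H y = H (\<epsilon> + \<epsilon>\<^sup>2)" by simp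
    then show ?thesis using mid[of "\<epsilon> + \<epsilon>\<^sup>2"] by simp
  qed (use mid that in blast)
  have pos: "0 \<le> H y \<and> H y \<le> 2" if "0 \<le> y" for y
    using small[of y] far[of y] that \<epsilon> by (cases "y \<le> \<epsilon>") (auto simp: divide_le_eq)
  have odd: "H (- y) = - H y" for y
  proof -
    have "\<forall>y. ((\<lambda>y. H (- y) + H y) has_real_derivative 0) (at y)"
    proof
      fix y
      have "((\<lambda>y. H (- y) + H y) has_real_derivative (2 * trapezoid \<epsilon> (- y) * (- 1) + 2 * trapezoid \<epsilon> y)) (at y)"
        by (intro DERIV_add DERIV_chain2[OF H(2)] H(2)) (auto intro!: derivative_eq_intros)
      then show "((\<lambda>y. H (- y) + H y) has_real_derivative 0) (at y)" by (simp add: trapezoid_minus)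
    qed
    from DERIV_isconst_all[OF this, of y 0] show ?thesis by (simp add: H)
  qed
  show thesis
  proof (rule that[OF H(2) \<Psi>(2) H(1)])
    show "\<bar>H y\<bar> \<le> 2" for y using pos[of y] pos[of "- y"] odd[of y] by (cases "y \<ge> 0") auto
    show "\<bar>H y - 1\<bar> \<le> \<epsilon>" if "y \<ge> \<epsilon>" for y using far[OF that] by auto
    show "\<bar>H y + 1\<bar> \<le> \<epsilon>" if "y \<le> - \<epsilon>" for y using far[of "- y"] odd[of y] that by auto
  qed
qed

text \<open>The test function for \<open>curvature_tail\<close>: its constant blows up as \<epsilon>
  tends to 0, but the slope stays below 2, and half of its second derivative is the occupation
  kernel.\<close>

lemma trapezoid_smooth:
  assumes \<epsilon>: "0 < \<epsilon>" "\<epsilon> \<le> 1"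
  obtains \<Psi> H C where "smooth_test \<Psi> H (\<lambda>y. 2 * trapezoid \<epsilon> y) C" "\<And>y. \<bar>H y\<bar> \<le> 2"
proof -
  obtain H \<Psi> where H: "\<And>y. (H has_real_derivative 2 * trapezoid \<epsilon> y) (at y)" "\<And>y. (\<Psi> has_real_derivative H y) (at y)" "\<And>y. \<bar>H y\<bar> \<le> 2"
    using trapezoid_primitive[OF \<epsilon>] by metis
  define C where "C = 2 + 1 / \<epsilon> + 1 / (\<epsilon> * \<epsilon>\<^sup>2)"
  have C: "2 \<le> C" "1 / \<epsilon> \<le> C" "1 / (\<epsilon> * \<epsilon>\<^sup>2) \<le> C" using \<epsilon> by (auto simp: C_def)
  have "smooth_test \<Psi> H (\<lambda>y. 2 * trapezoid \<epsilon> y) C"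
  proof (rule smooth_test.intro[OF H(2) H(1)])
    show "\<bar>H y\<bar> \<le> C" for y using H(3)[of y] C by linarith
    show "\<bar>2 * trapezoid \<epsilon> y\<bar> \<le> C" for y
    proof -
      have "2 * trapezoid \<epsilon> y \<le> 2 * (1 / (2 * \<epsilon>))" using trapezoid_le[OF \<epsilon>(1)] by (intro mult_left_mono) auto
      also have "\<dots> = 1 / \<epsilon>" by simp
      finally show ?thesis using C trapezoid_nonneg[OF \<epsilon>(1), of y] by simp
    qed
    show "\<bar>2 * trapezoid \<epsilon> y - 2 * trapezoid \<epsilon> z\<bar> \<le> C * \<bar>y - z\<bar>" for y z
    proof -
      have "\<bar>2 * trapezoid \<epsilon> y - 2 * trapezoid \<epsilon> z\<bar> = 2 * \<bar>trapezoid \<epsilon> y - trapezoid \<epsilon> z\<bar>"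
        unfolding right_diff_distrib[symmetric] abs_mult by simp
      also have "\<dots> \<le> 2 * (1 / (2 * \<epsilon> * \<epsilon>\<^sup>2) * \<bar>y - z\<bar>)" using trapezoid_lipschitz[OF \<epsilon>(1)] by (intro mult_left_mono) auto
      also have "\<dots> = 1 / (\<epsilon> * \<epsilon>\<^sup>2) * \<bar>y - z\<bar>" by simp
      also have "\<dots> \<le> C * \<bar>y - z\<bar>" by (intro mult_right_mono C) auto
      finally show ?thesis .
    qed
  qed
  then show thesis using H(3) by (rule that)
qed

text \<open>Uniform integrability with an explicit tail rate. Fatou's lemma passes the rate to the
  limit; below the level \<open>K\<close> convergence is dominated.\<close>

lemma (in prob_space) expectation_tendsto_of_tails:
  fixes q :: "nat \<Rightarrow> 'a \<Rightarrow> real"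
  assumes q: "\<And>n. integrable M (q n)" and q0: "\<And>n. AE \<omega> in M. 0 \<le> q n \<omega>" and L[measurable]: "L \<in> borel_measurable M"
    and lim: "AE \<omega> in M. (\<lambda>n. q n \<omega>) \<longlonglongrightarrow> L \<omega>"
    and tail: "\<And>n K. K > 0 \<Longrightarrow> expectation (\<lambda>\<omega>. max 0 (q n \<omega> - K)) \<le> C / K"
  shows "integrable M L" "(\<lambda>n. expectation (q n)) \<longlonglongrightarrow> expectation L"
proof -
  have [measurable]: "q n \<in> borel_measurable M" for n using q by auto
  have C: "C \<ge> 0"
  proof -
    have "0 \<le> expectation (\<lambda>\<omega>. max 0 (q 0 \<omega> - 1))" by (rule integral_nonneg_AE) simp
    then show ?thesis using tail[of 1 0] by linarith
  qed
  have qm: "integrable M (\<lambda>\<omega>. max 0 (q n \<omega> - K))" for n K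
    using q[of n] by (intro integrable_max) auto
  have L0: "AE \<omega> in M. 0 \<le> L \<omega>"
  proof -
    have "AE \<omega> in M. \<forall>n. 0 \<le> q n \<omega>" using q0 by (simp add: AE_all_countable)
    with lim show ?thesis by eventually_elim (rule LIMSEQ_le_const, auto)
  qed
  have tailL: "(\<integral>\<^sup>+\<omega>. ennreal (max 0 (L \<omega> - K)) \<partial>M) \<le> ennreal (C / K)" if K: "K > 0" for K
  proof -
    have "(\<integral>\<^sup>+\<omega>. ennreal (max 0 (L \<omega> - K)) \<partial>M) = (\<integral>\<^sup>+\<omega>. liminf (\<lambda>n. ennreal (max 0 (q n \<omega> - K))) \<partial>M)"
    proof (rule nn_integral_cong_AE, use lim in eventually_elim)
      case (elim \<omega>)
      have "(\<lambda>n. ennreal (max 0 (q n \<omega> - K))) \<longlonglongrightarrow> ennreal (max 0 (L \<omega> - K))"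
        by (intro tendsto_ennrealI tendsto_intros elim)
      then show ?case using lim_imp_Liminf[OF sequentially_bot] by force
    qed
    also have "\<dots> \<le> liminf (\<lambda>n. \<integral>\<^sup>+\<omega>. ennreal (max 0 (q n \<omega> - K)) \<partial>M)"
      by (rule nn_integral_liminf) measurable
    also have "\<dots> \<le> liminf (\<lambda>n. ennreal (C / K))"
    proof (intro Liminf_mono always_eventually allI)
      fix n
      have "(\<integral>\<^sup>+\<omega>. ennreal (max 0 (q n \<omega> - K)) \<partial>M) = ennreal (expectation (\<lambda>\<omega>. max 0 (q n \<omega> - K)))"
        by (rule nn_integral_eq_integral[OF qm]) auto
      then show "(\<integral>\<^sup>+\<omega>. ennreal (max 0 (q n \<omega> - K)) \<partial>M) \<le> ennreal (C / K)" using tail[OF K, of n] by (simp add: ennreal_leI)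
    qed
    also have "\<dots> = ennreal (C / K)" by (simp add: Liminf_const)
    finally show ?thesis .
  qed
  have Lm: "integrable M (\<lambda>\<omega>. max 0 (L \<omega> - K))" if K: "K > 0" for K
  proof (rule integrableI_bounded)
    have "(\<integral>\<^sup>+\<omega>. ennreal (norm (max 0 (L \<omega> - K))) \<partial>M) = (\<integral>\<^sup>+\<omega>. ennreal (max 0 (L \<omega> - K)) \<partial>M)"
      by (intro nn_integral_cong) simp
    also have "\<dots> < \<infinity>" using tailL[OF K] by (rule order_le_less_trans) simp
    finally show "(\<integral>\<^sup>+\<omega>. ennreal (norm (max 0 (L \<omega> - K))) \<partial>M) < \<infinity>" .
  qed measurable
  have LE: "expectation (\<lambda>\<omega>. max 0 (L \<omega> - K)) \<le> C / K" if K: "K > 0" for K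
  proof -
    have "ennreal (expectation (\<lambda>\<omega>. max 0 (L \<omega> - K))) \<le> ennreal (C / K)"
      using tailL[OF K] by (subst nn_integral_eq_integral[OF Lm[OF K], symmetric]) auto
    then show ?thesis using C K by (subst (asm) ennreal_le_iff) auto
  qed
  show Li: "integrable M L"
  proof (rule Bochner_Integration.integrable_bound[of _ "\<lambda>\<omega>. 1 + max 0 (L \<omega> - 1)"])
    show "integrable M (\<lambda>\<omega>. 1 + max 0 (L \<omega> - 1))" using Lm[of 1] by simp
    show "AE \<omega> in M. norm (L \<omega>) \<le> norm (1 + max 0 (L \<omega> - 1))" using L0 by eventually_elim auto
  qed measurable
  show "(\<lambda>n. expectation (q n)) \<longlonglongrightarrow> expectation L"
  proof (rule LIMSEQ_I)
    fix e :: real assume e: "e > 0"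
    \<comment> \<open>Each of the two tails is then at most a quarter of \<open>e\<close>, leaving
      half of it for the truncated parts.\<close>
    define K where "K = 4 * (C + 1) / e"
    have K: "K > 0" using e C by (simp add: K_def)
    have CK: "C / K \<le> e / 4"
    proof -
      have "C * e \<le> (C + 1) * e" using e by (intro mult_right_mono) auto
      then show ?thesis using e C by (simp add: K_def divide_simps) 
    qed
    have split: "min a K + max 0 (a - K) = a" for a by (simp add: min_def max_def)
    have "(\<lambda>n. expectation (\<lambda>\<omega>. min (q n \<omega>) K)) \<longlonglongrightarrow> expectation (\<lambda>\<omega>. min (L \<omega>) K)"
    proof (rule integral_dominated_convergence[where w="\<lambda>_. K"])
      show "AE \<omega> in M. (\<lambda>n. min (q n \<omega>) K) \<longlonglongrightarrow> min (L \<omega>) K" using lim by eventually_elim (intro tendsto_intros)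
      show "AE \<omega> in M. norm (min (q n \<omega>) K) \<le> K" for n using q0[of n] by eventually_elim (use K in auto)
    qed auto
    from LIMSEQ_D[OF this, of "e/2"] e obtain N where N: "\<And>n. n \<ge> N \<Longrightarrow> \<bar>expectation (\<lambda>\<omega>. min (q n \<omega>) K) - expectation (\<lambda>\<omega>. min (L \<omega>) K)\<bar> < e/2"
      by auto
    show "\<exists>N. \<forall>n\<ge>N. norm (expectation (q n) - expectation L) < e"
    proof (intro exI allI impI)
      fix n assume n: "n \<ge> N"
      have "expectation (q n) = expectation (\<lambda>\<omega>. min (q n \<omega>) K) + expectation (\<lambda>\<omega>. max 0 (q n \<omega> - K))"
        using q[of n] qm by (subst Bochner_Integration.integral_add[symmetric]) (auto simp: split)
      moreover have "expectation L = expectation (\<lambda>\<omega>. min (L \<omega>) K) + expectation (\<lambda>\<omega>. max 0 (L \<omega> - K))"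
        using Li Lm[OF K] by (subst Bochner_Integration.integral_add[symmetric]) (auto simp: split)
      moreover have "0 \<le> expectation (\<lambda>\<omega>. max 0 (q n \<omega> - K))" "0 \<le> expectation (\<lambda>\<omega>. max 0 (L \<omega> - K))"
        by (rule integral_nonneg_AE, simp)+
      moreover note tail[OF K, of n] LE[OF K] CK N[OF n]
      ultimately show "norm (expectation (q n) - expectation L) < e" unfolding real_norm_def by linarith
    qed
  qed
qed

section \<open>Convergence of the expected occupation to the expected local time\<close>

context skew_BM_envelope
begin

text \<open>Along each good path the smoothed occupation tends to the local time; the tails from
  \<open>curvature_tail\<close> are uniform in the width of the kernel and upgrade this to
  expectations. Integrability of the local time is a by-product and holds for every \<beta>.\<close>

lemma occupation_expectation:
  obtains L q where "integrable M L" "AE \<omega> in M. L \<omega> = loc \<omega>" "\<And>k::nat. integrable M (q k)"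
    "\<And>k. AE \<omega> in M. q k \<omega> = (LBINT s:{0..t}. trapezoid (1 / real (Suc k)) (X s \<omega>))"
    "(\<lambda>k. expectation (q k)) \<longlonglongrightarrow> expectation L"
proof -
  define \<epsilon> where "\<epsilon> k = 1 / real (Suc k)" for k
  have \<epsilon>: "0 < \<epsilon> k" "\<epsilon> k \<le> 1" for k by (auto simp: \<epsilon>_def)
  have [measurable]: "trapezoid (\<epsilon> k) \<in> borel_measurable borel" for k
    by (rule borel_measurable_continuous_onI[OF trapezoid_continuous[OF \<epsilon>(1)]])
  \<comment> \<open>The time integral as a limit of Riemann sums, which makes it measurable in the
    sample point.\<close>
  define q where "q k \<omega> = lim (\<lambda>n. \<Sum>i<n. trapezoid (\<epsilon> k) (xi n i \<omega>) * (t / real n))" for k \<omega>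
  have qm[measurable]: "q k \<in> borel_measurable M" for k unfolding q_def[abs_def] by measurable
  have qeq: "AE \<omega> in M. q k \<omega> = (LBINT s:{0..t}. trapezoid (\<epsilon> k) (X s \<omega>))" for k
    using Zgood by eventually_elim (unfold q_def, rule limI, rule riemann_path, assumption, rule trapezoid_continuous[OF \<epsilon>(1)])
  define L where "L \<omega> = lim (\<lambda>k. q k \<omega>)" for \<omega>
  have Lm[measurable]: "L \<in> borel_measurable M" unfolding L_def[abs_def] by measurable
  have lim: "AE \<omega> in M. (\<lambda>k. q k \<omega>) \<longlonglongrightarrow> loc \<omega>"
  proof -
    have "AE \<omega> in M. \<forall>k. q k \<omega> = (LBINT s:{0..t}. trapezoid (\<epsilon> k) (X s \<omega>))" using qeq by (simp add: AE_all_countable)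
    with Zgood show ?thesis
    proof eventually_elim
      case (elim \<omega>)
      interpret P: sde_path "\<lambda>s. X s \<omega>" "\<lambda>s. B s \<omega>" \<beta> \<mu>p \<mu>m x by (rule good_path[OF elim(1)])
      have "filterlim \<epsilon> (at_right 0) sequentially" unfolding \<epsilon>_def by real_asymp
      from filterlim_compose[OF P.trapezoid_occupation[OF t0] this]
      show ?case using elim(2) by (simp add: loc_def P.\<Lambda>_def)
    qed
  qed
  have Leq: "AE \<omega> in M. L \<omega> = loc \<omega>" using lim by eventually_elim (simp add: L_def limI)
  have limL: "AE \<omega> in M. (\<lambda>k. q k \<omega>) \<longlonglongrightarrow> L \<omega>" using lim Leq by eventually_elim simp
  define C where "C = (72 * expectation (\<lambda>\<omega>. (Z \<omega>)\<^sup>2) + 8 * t) / 4"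
  have tail: "integrable M (q k)" "K > 0 \<Longrightarrow> expectation (\<lambda>\<omega>. max 0 (q k \<omega> - K)) \<le> C / K" for k K
  proof -
    obtain \<Psi> H Ck where ST: "smooth_test \<Psi> H (\<lambda>y. 2 * trapezoid (\<epsilon> k) y) Ck" and H: "\<And>y. \<bar>H y\<bar> \<le> 2"
      using trapezoid_smooth[OF \<epsilon>[of k]] by blast
    interpret S: smooth_test \<Psi> H "\<lambda>y. 2 * trapezoid (\<epsilon> k) y" Ck by (rule ST)
    interpret I: ito_setup M F B X \<beta> \<mu>p \<mu>m x t Z \<Psi> H "\<lambda>y. 2 * trapezoid (\<epsilon> k) y" Ck ..
    have e: "AE \<omega> in M. q k \<omega> = (LBINT s:{0..t}. 2 * trapezoid (\<epsilon> k) (X s \<omega>) / 2)" using qeq[of k] by simp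
    show "integrable M (q k)" using I.curvature_tail(1)[OF H zero_less_one qm e] .
    show "K > 0 \<Longrightarrow> expectation (\<lambda>\<omega>. max 0 (q k \<omega> - K)) \<le> C / K"
      using I.curvature_tail(2)[OF H _ qm e, of K] by (simp add: C_def)
  qed
  have q0: "AE \<omega> in M. 0 \<le> q k \<omega>" for k
    using qeq[of k]
  proof eventually_elim
    case (elim \<omega>)
    show ?case unfolding elim set_lebesgue_integral_def
      using trapezoid_nonneg[OF \<epsilon>(1)] by (intro integral_nonneg_AE AE_I2) (auto simp: indicator_def)
  qed
  note T = expectation_tendsto_of_tails[OF tail(1) q0 Lm limL tail(2)]
  show thesis using that[OF T(1) Leq tail(1) qeq[unfolded \<epsilon>_def] T(2)] .
qed

end

lemma clip_lipschitz: "\<epsilon> > 0 \<Longrightarrow> \<bar>min 1 (\<bar>y\<bar> / \<epsilon>) - min 1 (\<bar>z\<bar> / \<epsilon>)\<bar> \<le> \<bar>y - z\<bar> / \<epsilon>" for \<epsilon> :: real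
proof -
  assume e: "\<epsilon> > 0"
  have "\<bar>min 1 a - min 1 b\<bar> \<le> \<bar>a - b\<bar>" for a b :: real by (simp add: min_def)
  then have "\<bar>min 1 (\<bar>y\<bar> / \<epsilon>) - min 1 (\<bar>z\<bar> / \<epsilon>)\<bar> \<le> \<bar>\<bar>y\<bar> / \<epsilon> - \<bar>z\<bar> / \<epsilon>\<bar>" .
  also have "\<dots> = \<bar>\<bar>y\<bar> - \<bar>z\<bar>\<bar> / \<epsilon>" using e by (simp add: diff_divide_distrib[symmetric])
  also have "\<dots> \<le> \<bar>y - z\<bar> / \<epsilon>" using e by (intro divide_right_mono) auto
  finally show ?thesis .
qed

text \<open>Both branches \<open>P\<close> and \<open>N\<close> are functions on the whole line, but only \<open>P\<close> on the right and \<open>N\<close> on the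
  left half-line matter.\<close>

locale kinked_function =
  fixes P P1 P2 N N1 N2 :: "real \<Rightarrow> real" and C :: real
  assumes P: "\<And>y. (P has_real_derivative P1 y) (at y)" "\<And>y. (P1 has_real_derivative P2 y) (at y)"
    and N: "\<And>y. (N has_real_derivative N1 y) (at y)" "\<And>y. (N1 has_real_derivative N2 y) (at y)"
    and PN: "P 0 = N 0"
    and P1_le: "\<And>y. y \<ge> 0 \<Longrightarrow> \<bar>P1 y\<bar> \<le> C" and P2_le: "\<And>y. y \<ge> 0 \<Longrightarrow> \<bar>P2 y\<bar> \<le> C"
    and N1_le: "\<And>y. y \<le> 0 \<Longrightarrow> \<bar>N1 y\<bar> \<le> C" and N2_le: "\<And>y. y \<le> 0 \<Longrightarrow> \<bar>N2 y\<bar> \<le> C"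
    and P2_lip: "\<And>y z. y \<ge> 0 \<Longrightarrow> z \<ge> 0 \<Longrightarrow> \<bar>P2 y - P2 z\<bar> \<le> C * \<bar>y - z\<bar>"
    and N2_lip: "\<And>y z. y \<le> 0 \<Longrightarrow> z \<le> 0 \<Longrightarrow> \<bar>N2 y - N2 z\<bar> \<le> C * \<bar>y - z\<bar>"
begin

definition f :: "real \<Rightarrow> real" where "f y = (if y \<ge> 0 then P y else N y)"
definition f1 :: "real \<Rightarrow> real" where "f1 y = (if y \<ge> 0 then P1 y else N1 y)"
definition f2 :: "real \<Rightarrow> real" where "f2 y = (if y \<ge> 0 then P2 y else N2 y)"
definition jump :: real where "jump = P1 0 - N1 0"
text \<open>\<open>f2\<close> may jump at 0. The extra factor vanishes there and equals 1 beyond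
  distance \<epsilon>, which yields a Lipschitz function on the line.\<close>

definition clipped :: "real \<Rightarrow> real \<Rightarrow> real" where "clipped \<epsilon> y = f2 y * min 1 (\<bar>y\<bar> / \<epsilon>)"

lemma C_nonneg: "0 \<le> C" using P1_le[of 0] by linarith

lemma f2_le: "\<bar>f2 y\<bar> \<le> C" using P2_le[of y] N2_le[of y] by (simp add: f2_def)
lemma f1_le: "\<bar>f1 y\<bar> \<le> C" using P1_le[of y] N1_le[of y] by (simp add: f1_def)
lemma jump_le: "\<bar>jump\<bar> \<le> 2 * C" using P1_le[of 0] N1_le[of 0] by (simp add: jump_def)

lemma clipped_le: "\<epsilon> > 0 \<Longrightarrow> \<bar>clipped \<epsilon> y\<bar> \<le> C" "\<epsilon> > 0 \<Longrightarrow> \<bar>clipped \<epsilon> y\<bar> \<le> C * \<bar>y\<bar> / \<epsilon>"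
proof -
  assume e: "\<epsilon> > 0"
  have "\<bar>clipped \<epsilon> y\<bar> = \<bar>f2 y\<bar> * min 1 (\<bar>y\<bar> / \<epsilon>)" using e by (simp add: clipped_def abs_mult)
  also have "\<dots> \<le> C * min 1 (\<bar>y\<bar> / \<epsilon>)" using e f2_le by (intro mult_right_mono) auto
  finally have *: "\<bar>clipped \<epsilon> y\<bar> \<le> C * min 1 (\<bar>y\<bar> / \<epsilon>)" .
  also have "\<dots> \<le> C * 1" by (intro mult_left_mono C_nonneg) auto
  finally show "\<bar>clipped \<epsilon> y\<bar> \<le> C" by simp
  note *
  also have "C * min 1 (\<bar>y\<bar> / \<epsilon>) \<le> C * (\<bar>y\<bar> / \<epsilon>)" by (intro mult_left_mono C_nonneg) auto
  finally show "\<bar>clipped \<epsilon> y\<bar> \<le> C * \<bar>y\<bar> / \<epsilon>" by simp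
qed

lemma clipped_lip:
  assumes e: "\<epsilon> > 0"
  shows "\<bar>clipped \<epsilon> y - clipped \<epsilon> z\<bar> \<le> (C + C / \<epsilon>) * \<bar>y - z\<bar>"
proof -
  have same: "\<bar>clipped \<epsilon> y - clipped \<epsilon> z\<bar> \<le> (C + C / \<epsilon>) * \<bar>y - z\<bar>" if "\<bar>f2 y - f2 z\<bar> \<le> C * \<bar>y - z\<bar>"
  proof -
    have "clipped \<epsilon> y - clipped \<epsilon> z = f2 y * (min 1 (\<bar>y\<bar> / \<epsilon>) - min 1 (\<bar>z\<bar> / \<epsilon>)) + (f2 y - f2 z) * min 1 (\<bar>z\<bar> / \<epsilon>)"
      by (simp add: clipped_def algebra_simps)
    then have "\<bar>clipped \<epsilon> y - clipped \<epsilon> z\<bar> \<le> \<bar>f2 y * (min 1 (\<bar>y\<bar> / \<epsilon>) - min 1 (\<bar>z\<bar> / \<epsilon>))\<bar> + \<bar>(f2 y - f2 z) * min 1 (\<bar>z\<bar> / \<epsilon>)\<bar>"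
      by (simp only: abs_triangle_ineq)
    also have "\<dots> \<le> C * (\<bar>y - z\<bar> / \<epsilon>) + (C * \<bar>y - z\<bar>) * 1"
      unfolding abs_mult
    proof (intro add_mono mult_mono[OF f2_le clip_lipschitz[OF e] C_nonneg abs_ge_zero] mult_mono[OF that _ _ abs_ge_zero])
      show "\<bar>min 1 (\<bar>z\<bar> / \<epsilon>)\<bar> \<le> 1" using e by simp
      show "0 \<le> C * \<bar>y - z\<bar>" using C_nonneg by simp
    qed
    also have "\<dots> = (C + C / \<epsilon>) * \<bar>y - z\<bar>"
    proof -
      have "C * (d / \<epsilon>) + (C * d) * 1 = (C + C / \<epsilon>) * d" for d by (simp add: algebra_simps)
      then show ?thesis .
    qed
    finally show ?thesis .
  qed
  \<comment> \<open>On opposite sides of 0 nothing relates the two branches of \<open>f2\<close>,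
    but each value is bounded by the distance of its argument to 0, and these distances add up to
    that of the points.\<close>
  have opp: "\<bar>clipped \<epsilon> y - clipped \<epsilon> z\<bar> \<le> (C + C / \<epsilon>) * \<bar>y - z\<bar>" if "\<bar>y\<bar> + \<bar>z\<bar> = \<bar>y - z\<bar>"
  proof -
    have "\<bar>clipped \<epsilon> y - clipped \<epsilon> z\<bar> \<le> \<bar>clipped \<epsilon> y\<bar> + \<bar>clipped \<epsilon> z\<bar>" by (rule abs_triangle_ineq4)
    also have "\<dots> \<le> C * \<bar>y\<bar> / \<epsilon> + C * \<bar>z\<bar> / \<epsilon>" by (intro add_mono clipped_le e)
    also have "\<dots> = C / \<epsilon> * (\<bar>y\<bar> + \<bar>z\<bar>)" by (simp add: distrib_left)
    also have "\<dots> = C / \<epsilon> * \<bar>y - z\<bar>" by (simp only: that)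
    also have "\<dots> \<le> (C + C / \<epsilon>) * \<bar>y - z\<bar>" using C_nonneg by (intro mult_right_mono) auto
    finally show ?thesis .
  qed
  consider "y \<ge> 0" "z \<ge> 0" | "y < 0" "z < 0" | "y \<ge> 0" "z < 0" | "y < 0" "z \<ge> 0" by linarith
  then show ?thesis
  proof cases
    case 1 then show ?thesis using P2_lip[of y z] by (intro same) (simp add: f2_def)
  next
    case 2 then show ?thesis using N2_lip[of y z] by (intro same) (simp add: f2_def)
  next
    case 3 then show ?thesis by (intro opp) simp
  next
    case 4 then show ?thesis by (intro opp) simp
  qed
qed

text \<open>The jump of the first derivative is smeared out as a multiple of the occupation kernel in the
  second derivative, symmetrically, so that the derivative at \<open>0\<close> is the mean of the one-sided ones.\<close>

lemma smooth_approximation: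
  assumes \<epsilon>: "0 < \<epsilon>" "\<epsilon> \<le> 1"
  obtains F F1 C' where "smooth_test F F1 (\<lambda>y. clipped \<epsilon> y + jump * trapezoid \<epsilon> y) C'"
    "F1 0 = (P1 0 + N1 0) / 2"
    "\<And>y. \<bar>F1 y - f1 y\<bar> \<le> 4 * C" "\<And>y. \<bar>y\<bar> \<ge> \<epsilon> \<Longrightarrow> \<bar>F1 y - f1 y\<bar> \<le> 2 * C * \<epsilon>"
    "\<And>y. \<bar>F y - f y\<bar> \<le> 4 * C * \<epsilon> * (1 + \<bar>y\<bar>)"
proof -
  obtain H \<Psi> where H: "\<And>y. (H has_real_derivative 2 * trapezoid \<epsilon> y) (at y)" 
    "H 0 = 0" "\<And>y. \<bar>H y\<bar> \<le> 2" "\<And>y. y \<ge> \<epsilon> \<Longrightarrow> \<bar>H y - 1\<bar> \<le> \<epsilon>" "\<And>y. y \<le> - \<epsilon> \<Longrightarrow> \<bar>H y + 1\<bar> \<le> \<epsilon>"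
    by (rule trapezoid_primitive[OF \<epsilon>], rule that; assumption)
  have Llip: "(C + C / \<epsilon>)-lipschitz_on UNIV (clipped \<epsilon>)"
    using clipped_lip[OF \<epsilon>(1)] C_nonneg \<epsilon> by (intro lipschitz_onI) (auto simp: dist_real_def)
  obtain K where K: "K 0 = 0" "\<And>y. (K has_real_derivative clipped \<epsilon> y) (at y)"
    using continuous_antiderivative[OF lipschitz_on_continuous_on[OF Llip], of 0] by blast
  define m where "m = (P1 0 + N1 0) / 2"
  define F1 where "F1 y = m + K y + jump / 2 * H y" for y
  have dF1: "(F1 has_real_derivative clipped \<epsilon> y + jump * trapezoid \<epsilon> y) (at y)" for y
    unfolding F1_def[abs_def] by (auto intro!: derivative_eq_intros K(2) H(1))
  have "continuous_on UNIV F1" using dF1 by (auto intro!: continuous_at_imp_continuous_on DERIV_isCont)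
  from continuous_antiderivative[OF this, of 0]
  obtain F0 where F0: "F0 0 = (0::real)" "\<And>y. (F0 has_real_derivative F1 y) (at y)" by blast
  define F where "F y = P 0 + F0 y" for y
  have dF: "(F has_real_derivative F1 y) (at y)" for y
    unfolding F_def[abs_def] by (auto intro!: derivative_eq_intros F0(2))
  have Kpos: "\<bar>K y - (P1 y - P1 0)\<bar> \<le> C * \<epsilon>" if "y \<ge> 0" for y
  proof -
    have "\<bar>(K y - P1 y) - (K 0 - P1 0)\<bar> \<le> C * \<epsilon> + 0 * y"
    proof (rule two_zone_bound[where e="\<lambda>y. K y - P1 y" and e'="\<lambda>y. clipped \<epsilon> y - P2 y"])
      show "((\<lambda>y. K y - P1 y) has_real_derivative clipped \<epsilon> u - P2 u) (at u)" for u
        by (intro DERIV_diff K P)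
      show "\<bar>clipped \<epsilon> u - P2 u\<bar> \<le> C" if "0 \<le> u" for u
      proof -
        have "clipped \<epsilon> u - P2 u = - (P2 u * (1 - min 1 (\<bar>u\<bar> / \<epsilon>)))" using that by (simp add: clipped_def f2_def algebra_simps)
        moreover have "\<bar>P2 u\<bar> * \<bar>1 - min 1 (\<bar>u\<bar> / \<epsilon>)\<bar> \<le> C * 1" using that P2_le \<epsilon> by (intro mult_mono) (auto simp: C_nonneg)
        ultimately show ?thesis by (simp add: abs_mult)
      qed
      show "\<bar>clipped \<epsilon> u - P2 u\<bar> \<le> 0" if "\<epsilon> \<le> u" for u
        using that \<epsilon> by (simp add: clipped_def f2_def le_divide_eq_1)
    qed (use \<epsilon> C_nonneg that in auto)
    then show ?thesis by (simp add: K(1) algebra_simps)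
  qed
  have Kneg: "\<bar>K (- y) - (N1 (- y) - N1 0)\<bar> \<le> C * \<epsilon>" if "y \<ge> 0" for y
  proof -
    have "\<bar>(K (- y) - N1 (- y)) - (K (- 0) - N1 (- 0))\<bar> \<le> C * \<epsilon> + 0 * y"
    proof (rule two_zone_bound[where e="\<lambda>y. K (- y) - N1 (- y)" and e'="\<lambda>y. - (clipped \<epsilon> (- y) - N2 (- y))"])
      show "((\<lambda>y. K (- y) - N1 (- y)) has_real_derivative - (clipped \<epsilon> (- u) - N2 (- u))) (at u)" for u
      proof -
        have "((\<lambda>y. K (- y) - N1 (- y)) has_real_derivative (clipped \<epsilon> (- u) * (- 1) - N2 (- u) * (- 1))) (at u)"
          by (intro DERIV_diff DERIV_chain2[OF K(2)] DERIV_chain2[OF N(2)]) (auto intro!: derivative_eq_intros)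
        then show ?thesis by (simp add: algebra_simps)
      qed
      \<comment> \<open>At \<open>u = 0\<close> the function \<open>f2\<close> takes the value of
        the right branch, but the clipping factor is zero there.\<close>
      have f2n: "f2 (- u) * min 1 (\<bar>u\<bar> / \<epsilon>) = N2 (- u) * min 1 (\<bar>u\<bar> / \<epsilon>)" if "0 \<le> u" for u
        using that by (cases "u = 0") (auto simp: f2_def)
      show "\<bar>- (clipped \<epsilon> (- u) - N2 (- u))\<bar> \<le> C" if "0 \<le> u" for u
      proof -
        have "- (clipped \<epsilon> (- u) - N2 (- u)) = N2 (- u) * (1 - min 1 (\<bar>u\<bar> / \<epsilon>))" unfolding clipped_def abs_minus_cancel f2n[OF that] by (simp add: algebra_simps)
        moreover have "\<bar>N2 (- u)\<bar> * \<bar>1 - min 1 (\<bar>u\<bar> / \<epsilon>)\<bar> \<le> C * 1" using that N2_le \<epsilon> by (intro mult_mono) (auto simp: C_nonneg)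
        ultimately show ?thesis by (simp add: abs_mult)
      qed
      show "\<bar>- (clipped \<epsilon> (- u) - N2 (- u))\<bar> \<le> 0" if "\<epsilon> \<le> u" for u
        using that \<epsilon> f2n[of u] by (simp add: clipped_def le_divide_eq_1)
    qed (use \<epsilon> C_nonneg that in auto)
    then show ?thesis by (simp add: K(1) algebra_simps)
  qed
  have jl: "\<bar>jump / 2\<bar> \<le> C" using jump_le by simp
  have Ceps: "C * \<epsilon> \<le> C" using \<epsilon> C_nonneg by (simp add: mult_left_le)
  have comb: "\<bar>p + j * w\<bar> \<le> C * \<epsilon> + C * W" if "\<bar>p\<bar> \<le> C * \<epsilon>" "\<bar>j\<bar> \<le> C" "\<bar>w\<bar> \<le> W" for p j w W :: real
  proof -
    have "\<bar>p + j * w\<bar> \<le> \<bar>p\<bar> + \<bar>j\<bar> * \<bar>w\<bar>" by (metis abs_mult abs_triangle_ineq)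
    also have "\<dots> \<le> C * \<epsilon> + C * W" using that C_nonneg by (intro add_mono mult_mono) auto
    finally show ?thesis .
  qed
  \<comment> \<open>The mean slope \<open>m\<close> plus half the jump is \<open>P1 0\<close>, and
    minus half the jump it is \<open>N1 0\<close>. What remains are the clipping error of
    \<open>K\<close> and the distance of \<open>H\<close> from the sign.\<close>
  have pos_eq: "F1 y - P1 y = (K y - (P1 y - P1 0)) + jump / 2 * (H y - 1)" for y
    by (simp add: F1_def m_def jump_def algebra_simps add_divide_distrib diff_divide_distrib)
  have neg_eq: "F1 y - N1 y = (K y - (N1 y - N1 0)) + jump / 2 * (H y + 1)" for y
    by (simp add: F1_def m_def jump_def algebra_simps add_divide_distrib diff_divide_distrib)
  have posA: "\<bar>F1 y - P1 y\<bar> \<le> 4 * C" if "y \<ge> 0" for y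
  proof -
    have "\<bar>H y - 1\<bar> \<le> 3" using H(3)[of y] by linarith
    from comb[OF Kpos[OF that] jl this] show ?thesis using Ceps unfolding pos_eq by linarith
  qed
  have posB: "\<bar>F1 y - P1 y\<bar> \<le> 2 * C * \<epsilon>" if "y \<ge> \<epsilon>" for y
  proof -
    have "0 \<le> y" using that \<epsilon> by linarith
    from comb[OF Kpos[OF this] jl H(4)[OF that]] show ?thesis unfolding pos_eq by linarith
  qed
  have negA: "\<bar>F1 (- y) - N1 (- y)\<bar> \<le> 4 * C" if "y \<ge> 0" for y
  proof -
    have "\<bar>H (- y) + 1\<bar> \<le> 3" using H(3)[of "- y"] by linarith
    from comb[OF Kneg[OF that] jl this] show ?thesis using Ceps unfolding neg_eq by linarith
  qed
  have negB: "\<bar>F1 (- y) - N1 (- y)\<bar> \<le> 2 * C * \<epsilon>" if "y \<ge> \<epsilon>" for y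
  proof -
    have "0 \<le> y" "- y \<le> - \<epsilon>" using that \<epsilon> by linarith+
    from comb[OF Kneg[OF this(1)] jl H(5)[OF this(2)]] show ?thesis unfolding neg_eq by linarith
  qed
  have A: "\<bar>F1 y - f1 y\<bar> \<le> 4 * C" for y
    using posA[of y] negA[of "- y"] by (simp add: f1_def)
  have fin: "4 * C * \<epsilon> + 2 * C * \<epsilon> * y \<le> 4 * C * \<epsilon> * (1 + y)" if "y \<ge> 0" for y
    using that \<epsilon> C_nonneg by (simp add: algebra_simps)
  have Fpos: "\<bar>F y - P y\<bar> \<le> 4 * C * \<epsilon> * (1 + \<bar>y\<bar>)" if "y \<ge> 0" for y
  proof -
    have "\<bar>(F y - P y) - (F 0 - P 0)\<bar> \<le> 4 * C * \<epsilon> + (2 * C * \<epsilon>) * y"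
      by (rule two_zone_bound[where e="\<lambda>y. F y - P y" and e'="\<lambda>y. F1 y - P1 y"])
         (use \<epsilon> C_nonneg that posA posB in \<open>auto intro!: DERIV_diff dF P\<close>)
    also have "\<dots> \<le> 4 * C * \<epsilon> * (1 + y)" using fin[OF that] by simp
    finally show ?thesis using that by (simp add: F_def F0(1))
  qed
  have Fneg: "\<bar>F (- y) - N (- y)\<bar> \<le> 4 * C * \<epsilon> * (1 + \<bar>y\<bar>)" if "y \<ge> 0" for y
  proof -
    have "\<bar>(F (- y) - N (- y)) - (F (- 0) - N (- 0))\<bar> \<le> 4 * C * \<epsilon> + (2 * C * \<epsilon>) * y"
    proof (rule two_zone_bound[where e="\<lambda>y. F (- y) - N (- y)" and e'="\<lambda>y. - (F1 (- y) - N1 (- y))"])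
      fix u
      have "((\<lambda>y. F (- y) - N (- y)) has_real_derivative (F1 (- u) * (- 1) - N1 (- u) * (- 1))) (at u)"
        by (intro DERIV_diff DERIV_chain2[OF dF] DERIV_chain2[OF N(1)]) (auto intro!: derivative_eq_intros)
      then show "((\<lambda>y. F (- y) - N (- y)) has_real_derivative - (F1 (- u) - N1 (- u))) (at u)" by simp
      show "\<bar>- (F1 (- u) - N1 (- u))\<bar> \<le> 4 * C" if "0 \<le> u" unfolding abs_minus_cancel by (rule negA[OF that])
      show "\<bar>- (F1 (- u) - N1 (- u))\<bar> \<le> 2 * C * \<epsilon>" if "\<epsilon> \<le> u" unfolding abs_minus_cancel by (rule negB[OF that])
    qed (use \<epsilon> C_nonneg that in auto)
    also have "\<dots> \<le> 4 * C * \<epsilon> * (1 + y)" using fin[OF that] by simp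
    finally show ?thesis using that by (simp add: F_def F0(1) PN)
  qed
  define C' where "C' = 6 * C + 2 * C / \<epsilon> + 2 * C / (\<epsilon> * \<epsilon>\<^sup>2)"
  have C'nn: "0 \<le> C" "0 \<le> C / \<epsilon>" "0 \<le> C / (\<epsilon> * \<epsilon>\<^sup>2)" using C_nonneg \<epsilon> by auto
  have "smooth_test F F1 (\<lambda>y. clipped \<epsilon> y + jump * trapezoid \<epsilon> y) C'"
  proof (rule smooth_test.intro[OF dF dF1])
    show "\<bar>F1 y\<bar> \<le> C'" for y
    proof -
      have "\<bar>F1 y\<bar> \<le> \<bar>F1 y - f1 y\<bar> + \<bar>f1 y\<bar>" by simp
      also have "\<dots> \<le> 4 * C + C" by (intro add_mono A f1_le)
      also have "\<dots> \<le> C'" using C'nn by (simp add: C'_def)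
      finally show ?thesis .
    qed
    have jt: "\<bar>jump * v\<bar> \<le> 2 * C * w" if "\<bar>v\<bar> \<le> w" for v w
      unfolding abs_mult using that jump_le C_nonneg by (intro mult_mono) auto
    show "\<bar>clipped \<epsilon> y + jump * trapezoid \<epsilon> y\<bar> \<le> C'" for y
    proof -
      have "\<bar>clipped \<epsilon> y + jump * trapezoid \<epsilon> y\<bar> \<le> \<bar>clipped \<epsilon> y\<bar> + \<bar>jump * trapezoid \<epsilon> y\<bar>" by (rule abs_triangle_ineq)
      also have "\<dots> \<le> C + 2 * C * (1 / (2 * \<epsilon>))"
        using trapezoid_le[OF \<epsilon>(1), of y] trapezoid_nonneg[OF \<epsilon>(1), of y] by (intro add_mono clipped_le \<epsilon> jt) auto
      also have "\<dots> \<le> C'" using C'nn by (simp add: C'_def)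
      finally show ?thesis .
    qed
    show "\<bar>(clipped \<epsilon> y + jump * trapezoid \<epsilon> y) - (clipped \<epsilon> z + jump * trapezoid \<epsilon> z)\<bar> \<le> C' * \<bar>y - z\<bar>" for y z
    proof -
      have "(clipped \<epsilon> y + jump * trapezoid \<epsilon> y) - (clipped \<epsilon> z + jump * trapezoid \<epsilon> z) = (clipped \<epsilon> y - clipped \<epsilon> z) + jump * (trapezoid \<epsilon> y - trapezoid \<epsilon> z)"
        by (simp add: algebra_simps)
      then have "\<bar>(clipped \<epsilon> y + jump * trapezoid \<epsilon> y) - (clipped \<epsilon> z + jump * trapezoid \<epsilon> z)\<bar> \<le> \<bar>clipped \<epsilon> y - clipped \<epsilon> z\<bar> + \<bar>jump * (trapezoid \<epsilon> y - trapezoid \<epsilon> z)\<bar>"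
        by (simp only: abs_triangle_ineq)
      also have "\<dots> \<le> (C + C / \<epsilon>) * \<bar>y - z\<bar> + 2 * C * (1 / (2 * \<epsilon> * \<epsilon>\<^sup>2) * \<bar>y - z\<bar>)"
        by (intro add_mono clipped_lip jt trapezoid_lipschitz \<epsilon>)
      also have "\<dots> = (C + C / \<epsilon> + C / (\<epsilon> * \<epsilon>\<^sup>2)) * \<bar>y - z\<bar>" by (simp add: algebra_simps)
      also have "\<dots> \<le> C' * \<bar>y - z\<bar>" using C'nn by (intro mult_right_mono) (auto simp: C'_def)
      finally show ?thesis .
    qed
  qed
  then show thesis
  proof (rule that)
    show "F1 0 = (P1 0 + N1 0) / 2" by (simp add: F1_def m_def K(1) H(2))
    show "\<bar>F1 y - f1 y\<bar> \<le> 4 * C" for y by (rule A)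
    show "\<bar>F1 y - f1 y\<bar> \<le> 2 * C * \<epsilon>" if "\<bar>y\<bar> \<ge> \<epsilon>" for y
      using posB[of y] negB[of "- y"] that \<epsilon> by (cases "y \<ge> 0") (auto simp: f1_def)
    show "\<bar>F y - f y\<bar> \<le> 4 * C * \<epsilon> * (1 + \<bar>y\<bar>)" for y
      using Fpos[of y] Fneg[of "- y"] by (cases "y \<ge> 0") (auto simp: f_def)
  qed
qed

end

section \<open>Expectations of time integrals\<close>

context skew_BM_envelope
begin

text \<open>Time integral and expectation are exchanged through Riemann sums: both sides are limits
  of the same finite sums, so joint measurability of \<open>X\<close> in time and sample point is
  not invoked.\<close>

lemma expectation_time_integral:
  fixes c :: "real \<Rightarrow> real" and Cc :: real
  assumes c: "continuous_on UNIV c" and cb: "\<And>y. \<bar>c y\<bar> \<le> Cc"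
  obtains I where "integrable M I" "AE \<omega> in M. I \<omega> = (LBINT s:{0..t}. c (X s \<omega>))"
    "continuous_on {0..t} (\<lambda>s. expectation (\<lambda>\<omega>. c (X s \<omega>)))" "expectation I = (LBINT s:{0..t}. expectation (\<lambda>\<omega>. c (X s \<omega>)))"
proof -
  have [measurable]: "c \<in> borel_measurable borel" using c by (rule borel_measurable_continuous_onI)
  have C0: "Cc \<ge> 0" using cb by (rule order_trans[OF abs_ge_zero])
  define R where "R n \<omega> = (\<Sum>i<n. c (xi n i \<omega>) * (t / real n))" for n \<omega>
  have Rm[measurable]: "R n \<in> borel_measurable M" for n unfolding R_def[abs_def] by measurable
  define I where "I \<omega> = lim (\<lambda>n. R n \<omega>)" for \<omega>
  have Im[measurable]: "I \<in> borel_measurable M" unfolding I_def[abs_def] by measurable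
  have lim: "AE \<omega> in M. (\<lambda>n. R n \<omega>) \<longlonglongrightarrow> (LBINT s:{0..t}. c (X s \<omega>))"
    using Zgood by eventually_elim (unfold R_def, rule riemann_path[OF _ c])
  have Ieq: "AE \<omega> in M. I \<omega> = (LBINT s:{0..t}. c (X s \<omega>))" using lim by eventually_elim (simp add: I_def limI)
  have limI: "AE \<omega> in M. (\<lambda>n. R n \<omega>) \<longlonglongrightarrow> I \<omega>" using lim Ieq by eventually_elim simp
  have Rb: "AE \<omega> in M. norm (R n \<omega>) \<le> Cc * t" for n
  proof (rule AE_I2)
    fix \<omega>
    have "\<bar>R n \<omega>\<bar> \<le> (\<Sum>i<n. \<bar>c (xi n i \<omega>) * (t / real n)\<bar>)" unfolding R_def by (rule sum_abs)
    also have "\<dots> \<le> (\<Sum>i<n. Cc * (t / real n))"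
      using t0 by (intro sum_mono) (auto simp: abs_mult intro!: divide_right_mono mult_right_mono cb)
    also have "\<dots> \<le> Cc * t" using C0 t0 by (cases "n = 0") auto
    finally show "norm (R n \<omega>) \<le> Cc * t" by simp
  qed
  have iC: "integrable M (\<lambda>_. Cc * t)" by simp
  have II: "integrable M I" by (rule integrable_dominated_convergence[OF Im Rm iC limI Rb])
  have RE: "(\<lambda>n. expectation (R n)) \<longlonglongrightarrow> expectation I" by (rule integral_dominated_convergence[OF Im Rm iC limI Rb])
  have ci: "integrable M (\<lambda>\<omega>. c (X s \<omega>))" if "0 \<le> s" for s
    by (rule integrable_const_bound[of _ Cc]) (use cb that in auto)
  have cont: "continuous_on {0..t} (\<lambda>s. expectation (\<lambda>\<omega>. c (X s \<omega>)))"
    unfolding continuous_on_sequentially comp_def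
  proof (intro allI ballI impI, elim conjE)
    fix u :: "nat \<Rightarrow> real" and a assume u: "\<forall>n. u n \<in> {0..t}" and a: "a \<in> {0..t}" and ua: "u \<longlonglongrightarrow> a"
    have un: "0 \<le> u n" "u n \<le> t" for n using u by auto
    show "(\<lambda>n. expectation (\<lambda>\<omega>. c (X (u n) \<omega>))) \<longlonglongrightarrow> expectation (\<lambda>\<omega>. c (X a \<omega>))"
    proof (rule integral_dominated_convergence[where w="\<lambda>_. Cc"])
      show "AE \<omega> in M. (\<lambda>n. c (X (u n) \<omega>)) \<longlonglongrightarrow> c (X a \<omega>)"
        using Zgood
      proof eventually_elim
        case (elim \<omega>)
        interpret P: sde_path "\<lambda>s. X s \<omega>" "\<lambda>s. B s \<omega>" \<beta> \<mu>p \<mu>m x by (rule good_path[OF elim])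
        have "(\<lambda>n. X (u n) \<omega>) \<longlonglongrightarrow> X a \<omega>"
          by (rule continuous_on_tendsto_compose[OF P.cont_\<xi> ua]) (use un a in auto)
        then show ?case by (rule continuous_on_tendsto_compose[OF c]) auto
      qed
    qed (use cb un a in auto)
  qed
  have "expectation (R n) = (\<Sum>i<n. expectation (\<lambda>\<omega>. c (X (grid t n i) \<omega>)) * (t / real n))" for n
    unfolding R_def[abs_def] xi_def using ci grid_nonneg[OF t0] by (subst Bochner_Integration.integral_sum) auto
  then have "(\<lambda>n. expectation (R n)) \<longlonglongrightarrow> (LBINT s:{0..t}. expectation (\<lambda>\<omega>. c (X s \<omega>)))"
    using riemann_sum[OF t0 cont] by simp
  then have "expectation I = (LBINT s:{0..t}. expectation (\<lambda>\<omega>. c (X s \<omega>)))" by (rule LIMSEQ_unique[OF RE])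
  then show thesis by (rule that[OF II Ieq cont])
qed

end

text \<open>The image \<open>c\<close> of the kinked function under the generator is required to be
  continuous through 0, although the derivatives of the function jump there; Riemann sums of
  \<open>c\<close> along the path then converge.\<close>

locale dynkin_setup = skew_BM_envelope M F B X \<beta> \<mu>p \<mu>m x t Z + K: kinked_function P P1 P2 N N1 N2 C
  for M :: "'a measure" and F B X \<beta> \<mu>p \<mu>m x t Z P P1 P2 N N1 N2 C +
  fixes c :: "real \<Rightarrow> real" and Cc :: real
  assumes c_cont: "continuous_on UNIV c" and c_le: "\<And>y. \<bar>c y\<bar> \<le> Cc"
    and generator_pos: "\<And>y. y > 0 \<Longrightarrow> P1 y * \<mu>p + P2 y / 2 = c y"
    and generator_neg: "\<And>y. y < 0 \<Longrightarrow> N1 y * \<mu>m + N2 y / 2 = c y"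
    and interface: "(1 + \<beta>) * P1 0 = (1 - \<beta>) * N1 0"
begin

lemma generator: "y \<noteq> 0 \<Longrightarrow> K.f1 y * mu y + K.f2 y / 2 = c y"
  using generator_pos[of y] generator_neg[of y]
  by (cases "y > 0") (auto simp: K.f1_def K.f2_def mu_def)

definition vel :: real where "vel = \<bar>\<mu>p\<bar> + \<bar>\<mu>m\<bar>"

lemma f_measurable [measurable]: "K.f \<in> borel_measurable borel"
proof -
  have "continuous_on UNIV P" "continuous_on UNIV N"
    using K.P(1) K.N(1) by (auto intro!: continuous_at_imp_continuous_on DERIV_isCont)
  then have [measurable]: "P \<in> borel_measurable borel" "N \<in> borel_measurable borel"
    by (auto intro: borel_measurable_continuous_onI)
  show ?thesis unfolding K.f_def[abs_def] by measurable
qed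

text \<open>Away from 0 the smoothing error is of order \<epsilon>. Within distance \<epsilon> it is
  only bounded, but there \<open>2 * \<epsilon> * trapezoid \<epsilon> y\<close> equals 1, so after
  integration in time it costs \<epsilon> times the occupation.\<close>

lemma generator_error:
  assumes \<epsilon>: "0 < \<epsilon>" "\<epsilon> \<le> 1" and y: "y \<noteq> 0"
    and F1: "\<bar>F1 y - K.f1 y\<bar> \<le> 4 * C" "\<bar>y\<bar> \<ge> \<epsilon> \<Longrightarrow> \<bar>F1 y - K.f1 y\<bar> \<le> 2 * C * \<epsilon>"
  shows "\<bar>F1 y * mu y + K.clipped \<epsilon> y / 2 - c y\<bar> \<le> 2 * C * \<epsilon> * vel + (4 * C * vel + C) * (2 * \<epsilon>) * trapezoid \<epsilon> y"
proof -
  have C0: "C \<ge> 0" by (rule K.C_nonneg)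
  have v0: "vel \<ge> 0" and mv: "\<bar>mu y\<bar> \<le> vel" using mu_le[of y] by (auto simp: vel_def)
  have eq: "F1 y * mu y + K.clipped \<epsilon> y / 2 - c y = (F1 y - K.f1 y) * mu y + (K.clipped \<epsilon> y - K.f2 y) / 2"
    unfolding generator[OF y, symmetric] by (simp add: algebra_simps diff_divide_distrib)
  have b: "\<bar>F1 y * mu y + K.clipped \<epsilon> y / 2 - c y\<bar> \<le> w * vel + \<bar>(K.clipped \<epsilon> y - K.f2 y) / 2\<bar>" if "\<bar>F1 y - K.f1 y\<bar> \<le> w" "0 \<le> w" for w
  proof -
    have "\<bar>(F1 y - K.f1 y) * mu y\<bar> \<le> w * vel" unfolding abs_mult using that mv by (intro mult_mono) auto
    then show ?thesis unfolding eq using abs_triangle_ineq[of "(F1 y - K.f1 y) * mu y" "(K.clipped \<epsilon> y - K.f2 y) / 2"] by simp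
  qed
  show ?thesis
  proof (cases "\<bar>y\<bar> \<ge> \<epsilon>")
    case True
    then have "K.clipped \<epsilon> y = K.f2 y" using \<epsilon> by (simp add: K.clipped_def le_divide_eq_1)
    then have "\<bar>F1 y * mu y + K.clipped \<epsilon> y / 2 - c y\<bar> \<le> 2 * C * \<epsilon> * vel" using b[OF F1(2)[OF True]] \<epsilon> C0 by simp
    also have "\<dots> \<le> 2 * C * \<epsilon> * vel + (4 * C * vel + C) * (2 * \<epsilon>) * trapezoid \<epsilon> y"
      using \<epsilon> C0 v0 trapezoid_nonneg[of \<epsilon> y] by simp
    finally show ?thesis .
  next
    case False
    have "\<bar>K.clipped \<epsilon> y - K.f2 y\<bar> \<le> C + C"
      using K.clipped_le(1)[OF \<epsilon>(1), of y] K.f2_le[of y] by (intro order_trans[OF abs_triangle_ineq4 add_mono])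
    then have "\<bar>(K.clipped \<epsilon> y - K.f2 y) / 2\<bar> \<le> C" by simp
    then have "\<bar>F1 y * mu y + K.clipped \<epsilon> y / 2 - c y\<bar> \<le> 4 * C * vel + C" using b[OF F1(1)] C0 by linarith
    also have "\<dots> = (4 * C * vel + C) * (2 * \<epsilon>) * trapezoid \<epsilon> y" using False \<epsilon> by (simp add: trapezoid_in)
    also have "\<dots> \<le> 2 * C * \<epsilon> * vel + (4 * C * vel + C) * (2 * \<epsilon>) * trapezoid \<epsilon> y" using \<epsilon> C0 v0 by simp
    finally show ?thesis .
  qed
qed

text \<open>The local time appears twice: half the jump, from the second derivative, multiplies the
  smoothed occupation \<open>q\<close>, and \<beta> times the mean slope, from the equation,
  multiplies \<open>L\<close>. Keeping the two apart makes all other errors proportional to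
  \<epsilon>.\<close>

lemma dynkin_error:
  assumes \<epsilon>: "0 < \<epsilon>" "\<epsilon> \<le> 1" and q: "integrable M q" "AE \<omega> in M. q \<omega> = (LBINT s:{0..t}. trapezoid \<epsilon> (X s \<omega>))"
    and L: "integrable M L" "AE \<omega> in M. L \<omega> = loc \<omega>"
    and I: "integrable M I" "AE \<omega> in M. I \<omega> = (LBINT s:{0..t}. c (X s \<omega>))"
  shows "integrable M (\<lambda>\<omega>. K.f (X t \<omega>))"
    and "\<bar>expectation (\<lambda>\<omega>. K.f (X t \<omega>)) - K.f x - expectation I - (K.jump / 2 * expectation q + \<beta> * ((P1 0 + N1 0) / 2 * expectation L))\<bar>
      \<le> \<epsilon> * (4 * C * (2 + expectation Z + \<bar>x\<bar>) + 2 * C * vel * t + (4 * C * vel + C) * 2 * expectation q)"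
proof -
  have C0: "C \<ge> 0" by (rule K.C_nonneg)
  obtain F0 F1 C' where ST: "smooth_test F0 F1 (\<lambda>y. K.clipped \<epsilon> y + K.jump * trapezoid \<epsilon> y) C'"
    and F10: "F1 0 = (P1 0 + N1 0) / 2" and F1: "\<And>y. \<bar>F1 y - K.f1 y\<bar> \<le> 4 * C" "\<And>y. \<bar>y\<bar> \<ge> \<epsilon> \<Longrightarrow> \<bar>F1 y - K.f1 y\<bar> \<le> 2 * C * \<epsilon>"
    and F0: "\<And>y. \<bar>F0 y - K.f y\<bar> \<le> 4 * C * \<epsilon> * (1 + \<bar>y\<bar>)"
    by (rule K.smooth_approximation[OF \<epsilon>], rule that; assumption)
  let ?F2 = "\<lambda>y. K.clipped \<epsilon> y + K.jump * trapezoid \<epsilon> y"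
  interpret S: smooth_test F0 F1 ?F2 C' by (rule ST)
  interpret T: ito_setup M F B X \<beta> \<mu>p \<mu>m x t Z F0 F1 ?F2 C' ..
  obtain G where G: "G \<in> borel_measurable M" "integrable M G"
    "AE \<omega> in M. G \<omega> = (LBINT s:{0..t}. F1 (X s \<omega>) * mu (X s \<omega>)) + (LBINT s:{0..t}. ?F2 (X s \<omega>) / 2) + \<beta> * (F1 0 * loc \<omega>)"
    "expectation (\<lambda>\<omega>. F0 (X t \<omega>)) = F0 x + expectation G"
    by (rule T.ito_expectation, rule that; assumption)
  have tm[measurable]: "trapezoid \<epsilon> \<in> borel_measurable borel" by (rule borel_measurable_continuous_onI[OF trapezoid_continuous[OF \<epsilon>(1)]])
  have cm[measurable]: "c \<in> borel_measurable borel" using c_cont by (rule borel_measurable_continuous_onI)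
  have clm[measurable]: "K.clipped \<epsilon> \<in> borel_measurable borel"
  proof -
    have "(\<lambda>y. ?F2 y - K.jump * trapezoid \<epsilon> y) \<in> borel_measurable borel" using S.f2_measurable by measurable
    then show ?thesis by simp
  qed
  have fX: "AE \<omega> in M. \<bar>F0 (X t \<omega>) - K.f (X t \<omega>)\<bar> \<le> 4 * C * \<epsilon> * (1 + Z \<omega>)"
    using Zgood
  proof eventually_elim
    case (elim \<omega>)
    have "4 * C * \<epsilon> * (1 + \<bar>X t \<omega>\<bar>) \<le> 4 * C * \<epsilon> * (1 + Z \<omega>)" using goodD(5)[OF elim] C0 \<epsilon> by (intro mult_left_mono) auto
    then show ?case using F0[of "X t \<omega>"] by linarith
  qed
  have Xm[measurable]: "X t \<in> borel_measurable M" using t0 by measurable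
  have iZ: "integrable M (\<lambda>\<omega>. 4 * C * \<epsilon> * (1 + Z \<omega>))" using Z1 by simp
  have di: "integrable M (\<lambda>\<omega>. F0 (X t \<omega>) - K.f (X t \<omega>))"
  proof (rule Bochner_Integration.integrable_bound[OF iZ])
    show "(\<lambda>\<omega>. F0 (X t \<omega>) - K.f (X t \<omega>)) \<in> borel_measurable M" using t0 by measurable
    show "AE \<omega> in M. norm (F0 (X t \<omega>) - K.f (X t \<omega>)) \<le> norm (4 * C * \<epsilon> * (1 + Z \<omega>))"
      using fX by eventually_elim (unfold real_norm_def, erule order_trans[OF _ abs_ge_self])
  qed
  have "integrable M (\<lambda>\<omega>. F0 (X t \<omega>) - (F0 (X t \<omega>) - K.f (X t \<omega>)))" by (intro Bochner_Integration.integrable_diff T.f_X_integrable di)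
  then show fi: "integrable M (\<lambda>\<omega>. K.f (X t \<omega>))" by simp
  have E1: "\<bar>expectation (\<lambda>\<omega>. F0 (X t \<omega>)) - expectation (\<lambda>\<omega>. K.f (X t \<omega>))\<bar> \<le> 4 * C * \<epsilon> * (1 + expectation Z)"
  proof -
    have "\<bar>expectation (\<lambda>\<omega>. F0 (X t \<omega>)) - expectation (\<lambda>\<omega>. K.f (X t \<omega>))\<bar> = \<bar>expectation (\<lambda>\<omega>. F0 (X t \<omega>) - K.f (X t \<omega>))\<bar>"
      using T.f_X_integrable fi by simp
    also have "\<dots> \<le> expectation (\<lambda>\<omega>. \<bar>F0 (X t \<omega>) - K.f (X t \<omega>)\<bar>)" by (rule integral_abs_bound)
    also have "\<dots> \<le> expectation (\<lambda>\<omega>. 4 * C * \<epsilon> * (1 + Z \<omega>))" by (rule integral_mono_AE[OF integrable_abs[OF di] iZ fX])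
    also have "\<dots> = 4 * C * \<epsilon> * (1 + expectation Z)" using Z1 by (simp add: prob_space)
    finally show ?thesis .
  qed
  \<comment> \<open>What is left of Ito's right-hand side after both local time terms and the
    integral of \<open>c\<close> are removed: the time integral of the error in
    \<open>generator_error\<close>.\<close>
  define Y where "Y \<omega> = G \<omega> - \<beta> * (F1 0 * L \<omega>) - K.jump / 2 * q \<omega> - I \<omega>" for \<omega>
  define k1 where "k1 = 2 * C * \<epsilon> * vel"
  define k2 where "k2 = (4 * C * vel + C) * (2 * \<epsilon>)"
  have kk: "0 \<le> k1" "0 \<le> k2" using C0 \<epsilon> by (auto simp: k1_def k2_def vel_def)
  have Yi: "integrable M Y" unfolding Y_def[abs_def] by (intro Bochner_Integration.integrable_diff integrable_mult_right G L q I)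
  have Yb: "AE \<omega> in M. \<bar>Y \<omega>\<bar> \<le> k1 * t + k2 * q \<omega>"
    using Zgood G(3) L(2) q(2) I(2)
  proof eventually_elim
    case (elim \<omega>)
    interpret Q: sde_path "\<lambda>s. X s \<omega>" "\<lambda>s. B s \<omega>" \<beta> \<mu>p \<mu>m x by (rule good_path[OF elim(1)])
    have vb: "\<bar>mu y\<bar> \<le> vel" for y using mu_le[of y] by (simp add: vel_def)
    have i1: "set_integrable lborel {0..t} (\<lambda>s. F1 (X s \<omega>) * mu (X s \<omega>))"
      by (rule Q.comp_integrable[of "\<lambda>y. F1 y * mu y" "C' * vel"]) (use S.f1_le vb S.C_nonneg in \<open>auto simp: abs_mult intro!: mult_mono\<close>)
    have i2: "set_integrable lborel {0..t} (\<lambda>s. K.clipped \<epsilon> (X s \<omega>) / 2)"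
    proof (rule Q.comp_integrable[of "\<lambda>y. K.clipped \<epsilon> y / 2" C])
      show "\<bar>K.clipped \<epsilon> y / 2\<bar> \<le> C" for y using K.clipped_le(1)[OF \<epsilon>(1), of y] C0 by simp
    qed measurable
    have i3: "set_integrable lborel {0..t} (\<lambda>s. trapezoid \<epsilon> (X s \<omega>))"
      by (rule Q.comp_integrable[of _ "1 / (2 * \<epsilon>)"]) (use trapezoid_le[OF \<epsilon>(1)] trapezoid_nonneg[OF \<epsilon>(1)] in auto)
    have i4: "set_integrable lborel {0..t} (\<lambda>s. c (X s \<omega>))" by (rule Q.comp_integrable[OF cm c_le])
    have i5: "set_integrable lborel {0..t} (\<lambda>s. F1 (X s \<omega>) * mu (X s \<omega>) + K.clipped \<epsilon> (X s \<omega>) / 2 - c (X s \<omega>))"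
      using i1 i2 i4 by (intro set_integral_add set_integral_diff)
    have "(LBINT s:{0..t}. ?F2 (X s \<omega>) / 2) = (LBINT s:{0..t}. K.clipped \<epsilon> (X s \<omega>) / 2 + K.jump / 2 * trapezoid \<epsilon> (X s \<omega>))"
      by (simp add: add_divide_distrib)
    also have "\<dots> = (LBINT s:{0..t}. K.clipped \<epsilon> (X s \<omega>) / 2) + K.jump / 2 * q \<omega>"
      unfolding elim(4) using i2 i3 by (subst set_integral_add) auto
    finally have e2: "(LBINT s:{0..t}. ?F2 (X s \<omega>) / 2) = (LBINT s:{0..t}. K.clipped \<epsilon> (X s \<omega>) / 2) + K.jump / 2 * q \<omega>" .
    have "Y \<omega> = (LBINT s:{0..t}. F1 (X s \<omega>) * mu (X s \<omega>)) + (LBINT s:{0..t}. K.clipped \<epsilon> (X s \<omega>) / 2) - (LBINT s:{0..t}. c (X s \<omega>))"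
      unfolding Y_def elim(2) e2 elim(3) elim(5) by simp
    also have "\<dots> = (LBINT s:{0..t}. F1 (X s \<omega>) * mu (X s \<omega>) + K.clipped \<epsilon> (X s \<omega>) / 2 - c (X s \<omega>))"
      using i1 i2 i4 by (subst set_integral_diff(2)[OF set_integral_add(1)[OF i1 i2] i4], subst set_integral_add(2)[OF i1 i2]) simp
    finally have Yeq: "Y \<omega> = (LBINT s:{0..t}. F1 (X s \<omega>) * mu (X s \<omega>) + K.clipped \<epsilon> (X s \<omega>) / 2 - c (X s \<omega>))" .
    have "\<bar>Y \<omega>\<bar> \<le> (\<integral>s. \<bar>indicator {0..t} s *\<^sub>R (F1 (X s \<omega>) * mu (X s \<omega>) + K.clipped \<epsilon> (X s \<omega>) / 2 - c (X s \<omega>))\<bar> \<partial>lborel)"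
      unfolding Yeq set_lebesgue_integral_def by (rule integral_abs_bound)
    also have "\<dots> \<le> (\<integral>s. indicator {0..t} s *\<^sub>R (k1 + k2 * trapezoid \<epsilon> (X s \<omega>)) \<partial>lborel)"
    proof (rule integral_mono_AE)
      show "integrable lborel (\<lambda>s. \<bar>indicator {0..t} s *\<^sub>R (F1 (X s \<omega>) * mu (X s \<omega>) + K.clipped \<epsilon> (X s \<omega>) / 2 - c (X s \<omega>))\<bar>)"
        using i5 unfolding set_integrable_def by (rule integrable_abs)
      have "set_integrable lborel {0..t} (\<lambda>s. k1 + k2 * trapezoid \<epsilon> (X s \<omega>))"
        using i3 integrable_indicator_Icc[of 1 0 t] by (intro set_integral_add set_integrable_mult_right) (auto simp: set_integrable_def mult.commute intro: integrable_indicator_Icc)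
      then show "integrable lborel (\<lambda>s. indicator {0..t} s *\<^sub>R (k1 + k2 * trapezoid \<epsilon> (X s \<omega>)))" by (simp only: set_integrable_def)
      show "AE s in lborel. \<bar>indicator {0..t} s *\<^sub>R (F1 (X s \<omega>) * mu (X s \<omega>) + K.clipped \<epsilon> (X s \<omega>) / 2 - c (X s \<omega>))\<bar> \<le> indicator {0..t} s *\<^sub>R (k1 + k2 * trapezoid \<epsilon> (X s \<omega>))"
        using Q.null_at_zero[OF t0]
      proof eventually_elim
        case (elim s)
        show ?case
        proof (cases "s \<in> {0..t}")
          case True
          then have "X s \<omega> \<noteq> 0" using elim by blast
          from generator_error[of \<epsilon> "X s \<omega>" F1, OF \<epsilon> this F1] True show ?thesis by (simp add: k1_def k2_def)
        qed simp
      qed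
    qed
    also have "\<dots> = (LBINT s:{0..t}. k1) + k2 * q \<omega>"
    proof -
      have "set_integrable lborel {0..t} (\<lambda>s. k1)" using integrable_indicator_Icc[of k1 0 t] by (simp add: set_integrable_def mult.commute)
      then show ?thesis unfolding elim(4) using i3 unfolding set_lebesgue_integral_def[symmetric] by (subst set_integral_add(2)) auto
    qed
    also have "\<dots> = k1 * t + k2 * q \<omega>" using t0 by (simp add: set_lebesgue_integral_def)
    finally show ?case .
  qed
  have E2: "\<bar>expectation Y\<bar> \<le> k1 * t + k2 * expectation q"
  proof -
    have i: "integrable M (\<lambda>\<omega>. k1 * t + k2 * q \<omega>)" using q(1) by simp
    have "\<bar>expectation Y\<bar> \<le> expectation (\<lambda>\<omega>. \<bar>Y \<omega>\<bar>)" by (rule integral_abs_bound)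
    also have "\<dots> \<le> expectation (\<lambda>\<omega>. k1 * t + k2 * q \<omega>)" by (rule integral_mono_AE[OF integrable_abs[OF Yi] i Yb])
    also have "\<dots> = k1 * t + k2 * expectation q" using q(1) by (simp add: prob_space)
    finally show ?thesis .
  qed
  have EY: "expectation Y = expectation G - \<beta> * (F1 0 * expectation L) - K.jump / 2 * expectation q - expectation I"
    unfolding Y_def[abs_def] using G(2) L(1) q(1) I(1) by simp
  have E3: "\<bar>F0 x - K.f x\<bar> \<le> 4 * C * \<epsilon> * (1 + \<bar>x\<bar>)" by (rule F0)
  have comb: "\<bar>fX - fx - i - (j + l)\<bar> \<le> a + b + d" if "\<bar>FX - fX\<bar> \<le> a" "\<bar>Fx - fx\<bar> \<le> b" "\<bar>y\<bar> \<le> d" "FX = Fx + g" "y = g - l - j - i" for fX fx i j l FX Fx g y a b d :: real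
    using that by linarith
  have "\<bar>expectation (\<lambda>\<omega>. K.f (X t \<omega>)) - K.f x - expectation I - (K.jump / 2 * expectation q + \<beta> * (F1 0 * expectation L))\<bar>
     \<le> 4 * C * \<epsilon> * (1 + expectation Z) + 4 * C * \<epsilon> * (1 + \<bar>x\<bar>) + (k1 * t + k2 * expectation q)"
    by (rule comb[OF E1 E3 E2 G(4) EY])
  also have "\<dots> = \<epsilon> * (4 * C * (2 + expectation Z + \<bar>x\<bar>) + 2 * C * vel * t + (4 * C * vel + C) * 2 * expectation q)"
    by (simp add: k1_def k2_def algebra_simps)
  finally show "\<bar>expectation (\<lambda>\<omega>. K.f (X t \<omega>)) - K.f x - expectation I - (K.jump / 2 * expectation q + \<beta> * ((P1 0 + N1 0) / 2 * expectation L))\<bar>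
      \<le> \<epsilon> * (4 * C * (2 + expectation Z + \<bar>x\<bar>) + 2 * C * vel * t + (4 * C * vel + C) * 2 * expectation q)"
    by (simp only: F10)
qed

text \<open>As \<epsilon> tends to 0 the expected occupation tends to the expected local time, so
  both local time terms become multiples of \<open>expectation L\<close>; the interface condition
  makes their coefficients cancel.\<close>

lemma dynkin:
  shows "integrable M (\<lambda>\<omega>. K.f (X t \<omega>))"
    and "expectation (\<lambda>\<omega>. K.f (X t \<omega>)) = K.f x + (LBINT s:{0..t}. expectation (\<lambda>\<omega>. c (X s \<omega>)))"
proof -
  obtain L q where L: "integrable M L" "AE \<omega> in M. L \<omega> = loc \<omega>" and q: "\<And>k::nat. integrable M (q k)"
    "\<And>k. AE \<omega> in M. q k \<omega> = (LBINT s:{0..t}. trapezoid (1 / real (Suc k)) (X s \<omega>))"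
    and qL: "(\<lambda>k. expectation (q k)) \<longlonglongrightarrow> expectation L"
    by (rule occupation_expectation, rule that; assumption)
  obtain I where I: "integrable M I" "AE \<omega> in M. I \<omega> = (LBINT s:{0..t}. c (X s \<omega>))"
    "expectation I = (LBINT s:{0..t}. expectation (\<lambda>\<omega>. c (X s \<omega>)))"
    by (rule expectation_time_integral[OF c_cont c_le], rule that; assumption)
  have e: "0 < 1 / real (Suc k)" "1 / real (Suc k) \<le> 1" for k by auto
  note D = dynkin_error[OF e q(1) q(2) L I(1,2)]
  show "integrable M (\<lambda>\<omega>. K.f (X t \<omega>))" by (rule D(1))
  define D0 where "D0 = expectation (\<lambda>\<omega>. K.f (X t \<omega>)) - K.f x - expectation I"
  define m where "m = (P1 0 + N1 0) / 2"
  have "(\<lambda>k. D0 - (K.jump / 2 * expectation (q k) + \<beta> * (m * expectation L))) \<longlonglongrightarrow> 0"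
  proof (rule Lim_null_comparison)
    show "\<forall>\<^sub>F k in sequentially. norm (D0 - (K.jump / 2 * expectation (q k) + \<beta> * (m * expectation L)))
       \<le> 1 / real (Suc k) * (4 * C * (2 + expectation Z + \<bar>x\<bar>) + 2 * C * vel * t + (4 * C * vel + C) * 2 * expectation (q k))"
      unfolding real_norm_def D0_def m_def by (intro always_eventually allI D(2))
    have "(\<lambda>k. 1 / real (Suc k) * (4 * C * (2 + expectation Z + \<bar>x\<bar>) + 2 * C * vel * t + (4 * C * vel + C) * 2 * expectation (q k)))
      \<longlonglongrightarrow> 0 * (4 * C * (2 + expectation Z + \<bar>x\<bar>) + 2 * C * vel * t + (4 * C * vel + C) * 2 * expectation L)"
      by (intro tendsto_intros qL LIMSEQ_Suc[OF lim_const_over_n])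
    then show "(\<lambda>k. 1 / real (Suc k) * (4 * C * (2 + expectation Z + \<bar>x\<bar>) + 2 * C * vel * t + (4 * C * vel + C) * 2 * expectation (q k))) \<longlonglongrightarrow> 0"
      by simp
  qed
  moreover have "(\<lambda>k. D0 - (K.jump / 2 * expectation (q k) + \<beta> * (m * expectation L))) \<longlonglongrightarrow> D0 - (K.jump / 2 * expectation L + \<beta> * (m * expectation L))"
    by (intro tendsto_intros qL)
  ultimately have "D0 = K.jump / 2 * expectation L + \<beta> * (m * expectation L)" using LIMSEQ_unique by fastforce
  \<comment> \<open>Half the jump plus \<beta> times the mean slope is half the defect in the
    interface condition.\<close>
  also have "\<dots> = ((1 + \<beta>) * P1 0 - (1 - \<beta>) * N1 0) / 2 * expectation L"
    by (simp add: K.jump_def m_def algebra_simps add_divide_distrib diff_divide_distrib)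
  also have "\<dots> = 0" using interface by simp
  finally show "expectation (\<lambda>\<omega>. K.f (X t \<omega>)) = K.f x + (LBINT s:{0..t}. expectation (\<lambda>\<omega>. c (X s \<omega>)))"
    using I(3) by (simp add: D0_def)
qed

end

section \<open>Identification of the law\<close>

context skew_BM_at_0
begin

text \<open>The envelope depends on a time horizon, so continuity is first obtained on bounded
  intervals; a convergent sequence of times stays in one of them.\<close>

lemma expectation_isCont:
  fixes g :: "real \<Rightarrow> real"
  assumes g: "continuous_on UNIV g" and gb: "\<And>y. \<bar>g y\<bar> \<le> G"
  shows "continuous_on {0..} (\<lambda>s. expectation (\<lambda>\<omega>. g (X s \<omega>)))"
    and "0 < t \<Longrightarrow> isCont (\<lambda>s. expectation (\<lambda>\<omega>. g (X s \<omega>))) t"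
    and "0 \<le> s \<Longrightarrow> integrable M (\<lambda>\<omega>. g (X s \<omega>))"
    and "\<bar>expectation (\<lambda>\<omega>. g (X s \<omega>))\<bar> \<le> G"
proof -
  have [measurable]: "g \<in> borel_measurable borel" using g by (rule borel_measurable_continuous_onI)
  have c: "continuous_on {0..T} (\<lambda>s. expectation (\<lambda>\<omega>. g (X s \<omega>)))" if T0: "T > 0" for T
  proof -
    obtain Z where Z: "Z \<in> borel_measurable M" "integrable M (\<lambda>\<omega>. (Z \<omega>)\<^sup>2)" "\<And>\<omega>. 0 \<le> Z \<omega>" "AE \<omega> in M. good T Z \<omega>"
      by (rule envelope[OF T0], rule that; assumption)
    interpret S: skew_BM_envelope M F B X \<beta> \<mu>p \<mu>m x T Z by unfold_locales (use T0 Z in auto)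
    show ?thesis using S.expectation_time_integral[OF g gb] by blast
  qed
  show "continuous_on {0..} (\<lambda>s. expectation (\<lambda>\<omega>. g (X s \<omega>)))"
    unfolding continuous_on_sequentially comp_def
  proof (intro allI ballI impI, elim conjE)
    fix u :: "nat \<Rightarrow> real" and a assume u: "\<forall>n. u n \<in> {0..}" and a: "a \<in> {0..}" and ua: "u \<longlonglongrightarrow> a"
    obtain K where K: "\<And>n. \<bar>u n\<bar> \<le> K" using convergent_imp_Bseq[OF convergentI[OF ua]] by (auto simp: Bseq_def)
    define T where "T = max 1 (max K a)"
    have T: "T > 0" "K \<le> T" "a \<le> T" by (auto simp: T_def)
    have "u n \<in> {0..T}" for n
    proof -
      have "u n \<le> K" using K[of n] by linarith
      then show ?thesis using u T by auto
    qed
    moreover have "a \<in> {0..T}" using a T by auto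
    ultimately show "(\<lambda>n. expectation (\<lambda>\<omega>. g (X (u n) \<omega>))) \<longlonglongrightarrow> expectation (\<lambda>\<omega>. g (X a \<omega>))"
      by (intro continuous_on_tendsto_compose[OF c[OF T(1)] ua]) auto
  qed
  show "isCont (\<lambda>s. expectation (\<lambda>\<omega>. g (X s \<omega>))) t" if "0 < t"
    using continuous_on_interior[OF c[of "t + 1"]] that by simp
  show "0 \<le> s \<Longrightarrow> integrable M (\<lambda>\<omega>. g (X s \<omega>))"
    by (rule integrable_const_bound[of _ G]) (use gb in auto)
  have "\<bar>expectation (\<lambda>\<omega>. g (X s \<omega>))\<bar> \<le> expectation (\<lambda>\<omega>. \<bar>g (X s \<omega>)\<bar>)" by (rule integral_abs_bound)
  also have "\<dots> \<le> expectation (\<lambda>\<omega>. G)"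
    by (rule integral_mono') (use gb order_trans[OF abs_ge_zero gb] in auto)
  finally show "\<bar>expectation (\<lambda>\<omega>. g (X s \<omega>))\<bar> \<le> G" by (simp add: prob_space)
qed

lemma exp_bounded_integrable:
  fixes w :: "real \<Rightarrow> real"
  assumes \<alpha>: "\<alpha> > 0" and w: "\<And>t. t > 0 \<Longrightarrow> isCont w t" and wb: "\<And>t. t > 0 \<Longrightarrow> \<bar>w t\<bar> \<le> G"
  shows "set_integrable lborel {0<..} (\<lambda>t. exp (- \<alpha> * t) * w t)"
proof -
  have G: "G \<ge> 0" using wb[of 1] by simp
  have e: "set_integrable lborel {0<..} (\<lambda>t. exp (- \<alpha> * t))"
    unfolding set_integrable_def
  proof (rule integrableI_bounded)
    have "(\<integral>\<^sup>+t. ennreal (norm (indicator {0<..} t *\<^sub>R exp (- \<alpha> * t))) \<partial>lborel) = (\<integral>\<^sup>+t\<in>{0<..}. ennreal (exp (- \<alpha> * t)) \<partial>lborel)"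
      by (intro nn_integral_cong) (auto simp: indicator_def)
    also have "\<dots> < \<infinity>" by (subst nn_integral_exp_Ioi[OF \<alpha>]) simp
    finally show "(\<integral>\<^sup>+t. ennreal (norm (indicator {0<..} t *\<^sub>R exp (- \<alpha> * t))) \<partial>lborel) < \<infinity>" .
  qed measurable
  have "continuous_on {0<..} w" using w by (auto intro!: continuous_at_imp_continuous_on)
  then have wm: "(\<lambda>t. indicator {0<..} t *\<^sub>R w t) \<in> borel_measurable borel"
    by (intro borel_measurable_continuous_on_indicator) auto
  show ?thesis unfolding set_integrable_def
  proof (rule Bochner_Integration.integrable_bound[OF integrable_mult_right[OF e[unfolded set_integrable_def], of G]])
    have "(\<lambda>t. exp (- \<alpha> * t) * (indicator {0<..} t *\<^sub>R w t)) \<in> borel_measurable lborel" using wm by measurable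
    then show "(\<lambda>t. indicator {0<..} t *\<^sub>R (exp (- \<alpha> * t) * w t)) \<in> borel_measurable lborel" by (simp add: mult_ac)
    show "AE t in lborel. norm (indicator {0<..} t *\<^sub>R (exp (- \<alpha> * t) * w t)) \<le> norm (G * (indicator {0<..} t *\<^sub>R exp (- \<alpha> * t)))"
      using wb G by (intro AE_I2) (auto simp: indicator_def abs_mult mult.commute intro!: mult_right_mono)
  qed
qed

text \<open>With \<open>m\<close> and \<open>\<gamma>\<close> the expectations of \<open>f\<close>
  and \<open>g\<close>, Dynkin's formula says that the derivative of \<open>m\<close> is
  \<open>\<alpha> * m - \<gamma>\<close>. Hence \<open>exp (- \<alpha> * t) * \<gamma> t\<close> is
  the derivative of \<open>- exp (- \<alpha> * t) * m t\<close>, and the integral is the initial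
  value \<open>f x\<close>, as \<open>m\<close> is bounded.\<close>

lemma laplace_of_dynkin:
  fixes f g :: "real \<Rightarrow> real"
  assumes \<alpha>: "\<alpha> > 0" and f: "continuous_on UNIV f" "\<And>y. \<bar>f y\<bar> \<le> Cf" and g: "continuous_on UNIV g" "\<And>y. \<bar>g y\<bar> \<le> G"
    and dyn: "\<And>t. t > 0 \<Longrightarrow> expectation (\<lambda>\<omega>. f (X t \<omega>)) = f x + (LBINT s:{0..t}. expectation (\<lambda>\<omega>. \<alpha> * f (X s \<omega>) - g (X s \<omega>)))"
  shows "(LBINT t:{0<..}. exp (- \<alpha> * t) * expectation (\<lambda>\<omega>. g (X t \<omega>))) = f x"
proof -
  define m where "m s = expectation (\<lambda>\<omega>. f (X s \<omega>))" for s
  define \<gamma> where "\<gamma> s = expectation (\<lambda>\<omega>. g (X s \<omega>))" for s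
  note mE = expectation_isCont[OF f, folded m_def]
  note gE = expectation_isCont[OF g, folded \<gamma>_def]
  \<comment> \<open>Freezing the integrand at negative times makes it continuous on the whole line,
    where a primitive is available.\<close>
  define w where "w s = \<alpha> * m (max 0 s) - \<gamma> (max 0 s)" for s
  have "continuous_on UNIV (\<lambda>s. m (max 0 s))" "continuous_on UNIV (\<lambda>s. \<gamma> (max 0 s))"
    by (rule continuous_on_compose2[OF mE(1)] continuous_on_compose2[OF gE(1)]; auto intro!: continuous_intros)+
  then have wc: "continuous_on UNIV w" unfolding w_def by (intro continuous_intros)
  obtain K where K: "K 0 = 0" "\<And>s. (K has_real_derivative w s) (at s)"
    using continuous_antiderivative[OF wc, of 0] by blast
  have mK: "m t = f x + K t" if t: "t > 0" for t
  proof -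
    have "has_bochner_integral lborel (\<lambda>s. w s * indicator {0..t} s) (K t - K 0)"
      using t K(2) wc by (intro has_bochner_integral_FTC_Icc_real) (auto simp: continuous_on_eq_continuous_at)
    then have "(\<integral>s. w s * indicator {0..t} s \<partial>lborel) = K t - K 0" by (rule has_bochner_integral_integral_eq)
    moreover have "(\<integral>s. w s * indicator {0..t} s \<partial>lborel) = (LBINT s:{0..t}. expectation (\<lambda>\<omega>. \<alpha> * f (X s \<omega>) - g (X s \<omega>)))"
      unfolding set_lebesgue_integral_def
    proof (rule Bochner_Integration.integral_cong[OF refl])
      fix s
      show "w s * indicator {0..t} s = indicator {0..t} s *\<^sub>R expectation (\<lambda>\<omega>. \<alpha> * f (X s \<omega>) - g (X s \<omega>))"
        using mE(3)[of s] gE(3)[of s] by (auto simp: indicator_def w_def m_def \<gamma>_def)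
    qed
    ultimately show ?thesis using dyn[OF t] K(1) by (simp add: m_def)
  qed
  \<comment> \<open>A local primitive, unrelated to the first-passage density. It uses
    \<open>f x + K t\<close> instead of \<open>m t\<close> so that continuity at 0 is
    immediate.\<close>
  define h where "h t = - (exp (- \<alpha> * t) * (f x + K t))" for t
  have dh: "(h has_real_derivative exp (- \<alpha> * t) * \<gamma> t) (at t)" if t: "t > 0" for t
  proof -
    have "(h has_real_derivative (exp (- \<alpha> * t) * (\<alpha> * (f x + K t) - w t))) (at t)"
      unfolding h_def[abs_def] by (auto intro!: derivative_eq_intros K(2) simp: algebra_simps)
    moreover have "\<alpha> * (f x + K t) - w t = \<gamma> t" using t by (simp add: w_def mK[OF t, symmetric])
    ultimately show ?thesis by simp
  qed
  have isg: "isCont (\<lambda>t. exp (- \<alpha> * t) * \<gamma> t) t" if "t > 0" for t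
    using gE(2)[OF that] by (intro continuous_intros)
  have int: "set_integrable lborel {0<..} (\<lambda>t. exp (- \<alpha> * t) * \<gamma> t)"
    by (rule exp_bounded_integrable[OF \<alpha> gE(2) gE(4)])
  have ei: "einterval 0 \<infinity> = {0<..}" by (auto simp: einterval_def)
  have lim0: "(h \<longlongrightarrow> - f x) (at_right 0)"
  proof -
    have "isCont h 0" unfolding h_def using DERIV_isCont[OF K(2)] by (intro continuous_intros) auto
    then have "(h \<longlongrightarrow> h 0) (at_right 0)" by (simp add: isCont_def filterlim_at_split)
    then show ?thesis by (simp add: h_def K(1))
  qed
  have limtop: "(h \<longlongrightarrow> 0) at_top"
  proof (rule Lim_null_comparison)
    show "\<forall>\<^sub>F t in at_top. norm (h t) \<le> exp (- \<alpha> * t) * Cf"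
      using eventually_gt_at_top[of 0]
    proof eventually_elim
      case (elim t)
      then show ?case using mE(4)[of t] by (simp add: h_def mK[symmetric] abs_mult)
    qed
    have "((\<lambda>t. exp (- \<alpha> * t)) \<longlongrightarrow> 0) at_top" using \<alpha> by real_asymp
    then show "((\<lambda>t. exp (- \<alpha> * t) * Cf) \<longlongrightarrow> 0) at_top" by (rule tendsto_mult_left_zero)
  qed
  have "(LBINT t=0..\<infinity>. exp (- \<alpha> * t) * \<gamma> t) = 0 - (- f x)"
  proof (rule interval_integral_FTC_integrable[where F=h])
    show "(h has_vector_derivative exp (- \<alpha> * t) * \<gamma> t) (at t)" if "0 < ereal t" for t
      using dh[of t] that by (simp add: has_real_derivative_iff_has_vector_derivative)
    show "isCont (\<lambda>t. exp (- \<alpha> * t) * \<gamma> t) t" if "0 < ereal t" for t using isg[of t] that by simp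
    show "set_integrable lborel (einterval 0 \<infinity>) (\<lambda>t. exp (- \<alpha> * t) * \<gamma> t)" unfolding ei by (rule int)
    show "((h \<circ> real_of_ereal) \<longlongrightarrow> - f x) (at_right 0)" using lim0 by (simp add: zero_ereal_def ereal_tendsto_simps)
    show "((h \<circ> real_of_ereal) \<longlongrightarrow> 0) (at_left \<infinity>)" using limtop by (simp add: ereal_tendsto_simps)
  qed simp
  then show ?thesis by (simp add: interval_lebesgue_integral_def ei \<gamma>_def)
qed

text \<open>Both Laplace transforms are evaluated as the kinked function at \<open>x\<close>:
  through Dynkin's formula for the process, and through the Green function for the density. The left
  branch is the mirror image of the right branch for the reflected parameters and test
  function.\<close>

lemma laplace_semigroup:
  fixes g :: "real \<Rightarrow> real"
  assumes \<beta>: "\<beta> \<in> {-1<..<1}" and \<alpha>: "\<alpha> > 0" and g: "L-lipschitz_on UNIV g" and gb: "\<And>y. \<bar>g y\<bar> \<le> G"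
    and R: "R > 0" "\<And>y. \<bar>y\<bar> \<ge> R \<Longrightarrow> g y = 0"
  shows "set_integrable lborel {0<..} (\<lambda>t. exp (- \<alpha> * t) * (\<integral>y. transition_density \<beta> \<mu>p \<mu>m t x y * g y \<partial>lborel))"
    and "(LBINT t:{0<..}. exp (- \<alpha> * t) * expectation (\<lambda>\<omega>. g (X t \<omega>)))
      = (LBINT t:{0<..}. exp (- \<alpha> * t) * (\<integral>y. transition_density \<beta> \<mu>p \<mu>m t x y * g y \<partial>lborel))"
proof -
  have gc: "continuous_on UNIV g" using g by (rule lipschitz_on_continuous_on)
  have gm: "g \<in> borel_measurable borel" using gc by (rule borel_measurable_continuous_onI)
  let ?g' = "\<lambda>y. g (- y)"
  have g': "L-lipschitz_on UNIV ?g'"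
    using g by (intro lipschitz_onI) (auto simp: lipschitz_on_def dist_real_def abs_minus_commute dest!: spec[of _ "- _"])
  have R': "\<bar>y\<bar> \<ge> R \<Longrightarrow> ?g' y = 0" for y using R by simp
  have g'm: "?g' \<in> borel_measurable borel" using gm by measurable
  have \<beta>': "- \<beta> \<in> {-1<..<1}" using \<beta> by auto
  define a where "a = resolvent_at_zero \<beta> \<mu>p \<mu>m \<alpha> g"
  define J where "J = one_sided_transform \<alpha> \<mu>p g"
  define J' where "J' = one_sided_transform \<alpha> (- \<mu>m) ?g'"
  define r r' where "r = char_root \<alpha> \<mu>p" and "r' = char_root \<alpha> (- \<mu>m)"
  have r: "r > 0" "r' > 0" using \<alpha> by (auto simp: r_def r'_def char_root_pos)
  have "0 < (1 + \<beta>) * r" "0 < (1 - \<beta>) * r'" using \<beta> r by auto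
  then have W: "(1 + \<beta>) * r + (1 - \<beta>) * r' \<noteq> 0" by linarith
  have aW: "a * ((1 + \<beta>) * r + (1 - \<beta>) * r') = 2 * (1 + \<beta>) * J + 2 * (1 - \<beta>) * J'"
    using W by (simp add: a_def resolvent_at_zero_def J_def J'_def r_def r'_def)
  \<comment> \<open>Reflection merely swaps the summands in numerator and denominator, so the two
    branches meet at 0.\<close>
  have a': "resolvent_at_zero (- \<beta>) (- \<mu>m) (- \<mu>p) \<alpha> ?g' = a"
    by (simp add: a_def resolvent_at_zero_def add.commute)
  obtain P P1 P2 Cp where P: "\<And>x. (P has_real_derivative P1 x) (at x)" "\<And>x. (P1 has_real_derivative P2 x) (at x)"
    "\<And>x. P2 x = 2 * (\<alpha> * P x - g x - \<mu>p * P1 x)" "P 0 = a" "P1 0 = 2 * J - r * a"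
    "\<And>x. x \<ge> 0 \<Longrightarrow> \<bar>P x\<bar> \<le> Cp" "\<And>x. x \<ge> 0 \<Longrightarrow> \<bar>P1 x\<bar> \<le> Cp" "\<And>x. x \<ge> 0 \<Longrightarrow> \<bar>P2 x\<bar> \<le> Cp"
    "\<And>x y. x \<ge> 0 \<Longrightarrow> y \<ge> 0 \<Longrightarrow> \<bar>P2 x - P2 y\<bar> \<le> Cp * \<bar>x - y\<bar>"
    "\<And>x. x \<ge> 0 \<Longrightarrow> has_bochner_integral lborel (\<lambda>y. green \<beta> \<mu>p \<mu>m \<alpha> x y * g y) (P x)"
    by (rule half_resolvent[where \<mu>p=\<mu>p and \<mu>m=\<mu>m, OF \<beta> \<alpha> g R, folded a_def J_def r_def]) (assumption, rule that, assumption+)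
  obtain Q Q1 Q2 Cq where Q: "\<And>x. (Q has_real_derivative Q1 x) (at x)" "\<And>x. (Q1 has_real_derivative Q2 x) (at x)"
    "\<And>x. Q2 x = 2 * (\<alpha> * Q x - g (- x) - (- \<mu>m) * Q1 x)" "Q 0 = a" "Q1 0 = 2 * J' - r' * a"
    "\<And>x. x \<ge> 0 \<Longrightarrow> \<bar>Q x\<bar> \<le> Cq" "\<And>x. x \<ge> 0 \<Longrightarrow> \<bar>Q1 x\<bar> \<le> Cq" "\<And>x. x \<ge> 0 \<Longrightarrow> \<bar>Q2 x\<bar> \<le> Cq"
    "\<And>x y. x \<ge> 0 \<Longrightarrow> y \<ge> 0 \<Longrightarrow> \<bar>Q2 x - Q2 y\<bar> \<le> Cq * \<bar>x - y\<bar>"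
    "\<And>x. x \<ge> 0 \<Longrightarrow> has_bochner_integral lborel (\<lambda>y. green (- \<beta>) (- \<mu>m) (- \<mu>p) \<alpha> x y * g (- y)) (Q x)"
    by (rule half_resolvent[where \<mu>p="- \<mu>m" and \<mu>m="- \<mu>p", OF \<beta>' \<alpha> g' R(1) R', unfolded a', folded J'_def r'_def]) (assumption, rule that, assumption+)
  define C where "C = max Cp Cq"
  have CC: "Cp \<le> C" "Cq \<le> C" by (auto simp: C_def)
  have scale: "Cp * \<bar>y - z\<bar> \<le> C * \<bar>y - z\<bar>" "Cq * \<bar>y - z\<bar> \<le> C * \<bar>y - z\<bar>" for y z :: real
    by (intro mult_right_mono CC abs_ge_zero)+
  have KF: "kinked_function P P1 P2 (\<lambda>y. Q (- y)) (\<lambda>y. - Q1 (- y)) (\<lambda>y. Q2 (- y)) C"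
  proof (rule kinked_function.intro[OF P(1,2)])
    show "((\<lambda>y. Q (- y)) has_real_derivative - Q1 (- y)) (at y)" for y
      using DERIV_chain2[OF Q(1), of uminus "- 1" y] by (simp add: DERIV_minus[OF DERIV_ident])
    show "((\<lambda>y. - Q1 (- y)) has_real_derivative Q2 (- y)) (at y)" for y
      using DERIV_minus[OF DERIV_chain2[OF Q(2), of uminus "- 1" y]] by (simp add: DERIV_minus[OF DERIV_ident])
    show "P 0 = Q (- 0)" by (simp add: P(4) Q(4))
    show "\<bar>P1 y\<bar> \<le> C" "\<bar>P2 y\<bar> \<le> C" if "y \<ge> 0" for y using P(7,8)[OF that] CC by auto
    show "\<bar>- Q1 (- y)\<bar> \<le> C" "\<bar>Q2 (- y)\<bar> \<le> C" if "y \<le> 0" for y using Q(7,8)[of "- y"] that CC by auto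
    show "\<bar>P2 y - P2 z\<bar> \<le> C * \<bar>y - z\<bar>" if "y \<ge> 0" "z \<ge> 0" for y z using P(9)[OF that] scale(1)[of y z] by (rule order_trans)
    show "\<bar>Q2 (- y) - Q2 (- z)\<bar> \<le> C * \<bar>y - z\<bar>" if "y \<le> 0" "z \<le> 0" for y z
    proof -
      have "\<bar>Q2 (- y) - Q2 (- z)\<bar> \<le> Cq * \<bar>- y - - z\<bar>" using that by (intro Q(9)) auto
      also have "\<bar>- y - - z\<bar> = \<bar>y - z\<bar>" by simp
      finally show ?thesis using scale(2)[of y z] by (rule order_trans)
    qed
  qed
  interpret K: kinked_function P P1 P2 "\<lambda>y. Q (- y)" "\<lambda>y. - Q1 (- y)" "\<lambda>y. Q2 (- y)" C by (rule KF)
  have fb: "\<bar>K.f y\<bar> \<le> C" for y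
    using P(6)[of y] Q(6)[of "- y"] CC by (auto simp: K.f_def)
  \<comment> \<open>At every point one of the two terms equals \<open>a\<close>; this form shows
    continuity without a case distinction.\<close>
  have feq: "K.f = (\<lambda>y. P (max 0 y) + Q (max 0 (- y)) - a)"
    by (auto simp: K.f_def fun_eq_iff P(4) Q(4) max_def)
  have "continuous_on UNIV P" "continuous_on UNIV Q"
    using P(1) Q(1) by (auto intro!: continuous_at_imp_continuous_on DERIV_isCont)
  then have "continuous_on UNIV (\<lambda>y. P (max 0 y))" "continuous_on UNIV (\<lambda>y. Q (max 0 (- y)))"
    by (auto intro!: continuous_on_compose2[where s=UNIV and t=UNIV and g=P] continuous_on_compose2[where s=UNIV and t=UNIV and g=Q] continuous_intros)
  then have fc: "continuous_on UNIV K.f" unfolding feq by (intro continuous_intros)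
  define c where "c y = \<alpha> * K.f y - g y" for y
  have cc: "continuous_on UNIV c" unfolding c_def by (intro continuous_intros fc gc)
  have cb: "\<bar>c y\<bar> \<le> \<alpha> * C + G" for y
  proof -
    have "\<bar>\<alpha> * K.f y\<bar> \<le> \<alpha> * C" using \<alpha> fb by (simp add: abs_mult)
    then show ?thesis unfolding c_def using gb[of y] abs_triangle_ineq4[of "\<alpha> * K.f y" "g y"] by linarith
  qed
  have dyn: "expectation (\<lambda>\<omega>. K.f (X t \<omega>)) = K.f x + (LBINT s:{0..t}. expectation (\<lambda>\<omega>. \<alpha> * K.f (X s \<omega>) - g (X s \<omega>)))" if t: "t > 0" for t
  proof -
    obtain Z where Z: "Z \<in> borel_measurable M" "integrable M (\<lambda>\<omega>. (Z \<omega>)\<^sup>2)" "\<And>\<omega>. 0 \<le> Z \<omega>" "AE \<omega> in M. good t Z \<omega>"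
      by (rule envelope[OF t], rule that; assumption)
    interpret S: skew_BM_envelope M F B X \<beta> \<mu>p \<mu>m x t Z by unfold_locales (use t Z in auto)
    interpret D: dynkin_setup M F B X \<beta> \<mu>p \<mu>m x t Z P P1 P2 "\<lambda>y. Q (- y)" "\<lambda>y. - Q1 (- y)" "\<lambda>y. Q2 (- y)" C c "\<alpha> * C + G"
    proof unfold_locales
      show "continuous_on UNIV c" by (rule cc)
      show "\<bar>c y\<bar> \<le> \<alpha> * C + G" for y by (rule cb)
      show "P1 y * \<mu>p + P2 y / 2 = c y" if "y > 0" for y using that by (simp add: c_def K.f_def P(3) diff_divide_distrib)
      show "- Q1 (- y) * \<mu>m + Q2 (- y) / 2 = c y" if "y < 0" for y using that by (simp add: c_def K.f_def Q(3) diff_divide_distrib add_divide_distrib)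
      \<comment> \<open>Inserting the slopes \<open>2 * J - r * a\<close> and
        \<open>2 * J' - r' * a\<close> turns the interface condition into the defining equation of
        \<open>a\<close>.\<close>
      show "(1 + \<beta>) * P1 0 = (1 - \<beta>) * - Q1 (- 0)" using aW by (simp add: P(5) Q(5) algebra_simps)
    qed
    show ?thesis using D.dynkin(2) by (simp add: c_def)
  qed
  have lapX: "(LBINT t:{0<..}. exp (- \<alpha> * t) * expectation (\<lambda>\<omega>. g (X t \<omega>))) = K.f x"
    by (rule laplace_of_dynkin[OF \<alpha> fc fb gc gb dyn])
  have "set_integrable lborel {0<..} (\<lambda>t. exp (- \<alpha> * t) * (\<integral>y. transition_density \<beta> \<mu>p \<mu>m t x y * g y \<partial>lborel))
    \<and> (LBINT t:{0<..}. exp (- \<alpha> * t) * (\<integral>y. transition_density \<beta> \<mu>p \<mu>m t x y * g y \<partial>lborel)) = K.f x"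
  proof (cases "x \<ge> 0")
    case True
    note I = P(10)[OF True]
    show ?thesis using transition_semigroup_laplace[OF \<beta> \<alpha> True gm integrable.intros[OF I]] has_bochner_integral_integral_eq[OF I] True
      by (simp add: K.f_def)
  next
    case False
    then have x: "- x \<ge> 0" by simp
    note I = Q(10)[OF x]
    \<comment> \<open>For a negative starting point the density is the reflected one, and the change
      of sign in \<open>y\<close> is undone by substitution.\<close>
    have eq: "(\<integral>y. transition_density (- \<beta>) (- \<mu>m) (- \<mu>p) t (- x) y * g (- y) \<partial>lborel) = (\<integral>y. transition_density \<beta> \<mu>p \<mu>m t x y * g y \<partial>lborel)" if "t > 0" for t
    proof -
      have "(\<integral>y. transition_density \<beta> \<mu>p \<mu>m t x y * g y \<partial>lborel) = (\<integral>y. transition_density \<beta> \<mu>p \<mu>m t x (- y) * g (- y) \<partial>lborel)"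
        by (subst lborel_integral_real_affine[where c="-1" and t=0]) auto
      then show ?thesis using False that by (simp add: transition_density_reflect[of t x])
    qed
    have ind: "indicator {0<..} t *\<^sub>R (exp (- \<alpha> * t) * (\<integral>y. transition_density (- \<beta>) (- \<mu>m) (- \<mu>p) t (- x) y * g (- y) \<partial>lborel))
      = indicator {0<..} t *\<^sub>R (exp (- \<alpha> * t) * (\<integral>y. transition_density \<beta> \<mu>p \<mu>m t x y * g y \<partial>lborel))" for t
      by (cases "t > 0") (simp_all add: eq)
    show ?thesis using transition_semigroup_laplace[OF \<beta>' \<alpha> x g'm integrable.intros[OF I]] has_bochner_integral_integral_eq[OF I] False
      unfolding set_integrable_def set_lebesgue_integral_def ind by (simp add: K.f_def)
  qed
  then show "set_integrable lborel {0<..} (\<lambda>t. exp (- \<alpha> * t) * (\<integral>y. transition_density \<beta> \<mu>p \<mu>m t x y * g y \<partial>lborel))"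
    "(LBINT t:{0<..}. exp (- \<alpha> * t) * expectation (\<lambda>\<omega>. g (X t \<omega>)))
      = (LBINT t:{0<..}. exp (- \<alpha> * t) * (\<integral>y. transition_density \<beta> \<mu>p \<mu>m t x y * g y \<partial>lborel))"
    using lapX by auto
qed

lemma expectation_transition_density:
  fixes g :: "real \<Rightarrow> real"
  assumes \<beta>: "\<beta> \<in> {-1<..<1}" and t: "t > 0" and g: "L-lipschitz_on UNIV g" and gb: "\<And>y. \<bar>g y\<bar> \<le> G"
    and R: "R > 0" "\<And>y. \<bar>y\<bar> \<ge> R \<Longrightarrow> g y = 0"
  shows "expectation (\<lambda>\<omega>. g (X t \<omega>)) = (\<integral>y. transition_density \<beta> \<mu>p \<mu>m t x y * g y \<partial>lborel)"
proof (rule laplace_unique[OF _ _ _ _ _ t])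
  have gc: "continuous_on UNIV g" using g by (rule lipschitz_on_continuous_on)
  have gm: "g \<in> borel_measurable borel" using gc by (rule borel_measurable_continuous_onI)
  show i: "isCont (\<lambda>t. expectation (\<lambda>\<omega>. g (X t \<omega>))) t" if "t > 0" for t using expectation_isCont(2)[OF gc gb that] .
  show "isCont (\<lambda>t. \<integral>y. transition_density \<beta> \<mu>p \<mu>m t x y * g y \<partial>lborel) t" if "t > 0" for t
    by (rule transition_semigroup_isCont(2)[OF \<beta> that gm gb, of R]) (use R in auto)
  fix n :: nat assume n: "n \<ge> 1"
  then have n0: "real n > 0" by simp
  show "set_integrable lborel {0<..} (\<lambda>t. exp (- real n * t) * expectation (\<lambda>\<omega>. g (X t \<omega>)))"
    by (rule exp_bounded_integrable[OF n0 i expectation_isCont(4)[OF gc gb]])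
  show "set_integrable lborel {0<..} (\<lambda>t. exp (- real n * t) * (\<integral>y. transition_density \<beta> \<mu>p \<mu>m t x y * g y \<partial>lborel))"
    by (rule laplace_semigroup(1)[OF \<beta> n0 g gb R])
  show "(LBINT t:{0<..}. exp (- real n * t) * expectation (\<lambda>\<omega>. g (X t \<omega>)))
      = (LBINT t:{0<..}. exp (- real n * t) * (\<integral>y. transition_density \<beta> \<mu>p \<mu>m t x y * g y \<partial>lborel))"
    by (rule laplace_semigroup(2)[OF \<beta> n0 g gb R])
qed

text \<open>Open half-lines determine a finite measure on the line, and their indicators are
  increasing limits of Lipschitz functions with compact support, to which
  \<open>expectation_transition_density\<close> applies. That the density has total mass one is a
  consequence.\<close>

lemma distr_eq_transition_density:
  assumes \<beta>: "\<beta> \<in> {-1<..<1}" and t: "t > 0"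
  shows "distr M lborel (X t) = density lborel (\<lambda>y. ennreal (transition_density \<beta> \<mu>p \<mu>m t x y))"
proof (rule measure_eqI_lessThan)
  let ?p = "\<lambda>y. transition_density \<beta> \<mu>p \<mu>m t x y"
  have Xm[measurable]: "X t \<in> borel_measurable M" using t by simp
  have pm[measurable]: "?p \<in> borel_measurable borel" by (rule borel_measurable_transition_density[OF t])
  have p0: "0 \<le> ?p y" for y by (rule transition_density_nonneg[OF \<beta> t])
  show "sets (distr M lborel (X t)) = sets borel" "sets (density lborel (\<lambda>y. ennreal (?p y))) = sets borel" by simp_all
  have Xl: "X t \<in> measurable M lborel" by simp
  fix a
  show "emeasure (distr M lborel (X t)) {a<..} < \<infinity>"
    by (subst emeasure_distr[OF Xl]) (auto simp: less_top[symmetric])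
  \<comment> \<open>A ramp of slope \<open>n\<close> starting at \<open>a\<close>, brought down with
    slope 1 to reach 0 at \<open>n\<close>; both effects weaken as \<open>n\<close> grows, so the
    sequence increases.\<close>
  define g where "g n y = max 0 (min 1 (min (real n * (y - a)) (real n - y)))" for n :: nat and y :: real
  have gm[measurable]: "g n \<in> borel_measurable borel" for n unfolding g_def[abs_def] by measurable
  have g01: "0 \<le> g n y" "g n y \<le> 1" for n y by (auto simp: g_def)
  have mono: "g n y \<le> g (Suc n) y" for n y
  proof (cases "y > a")
    case True
    have "real n * (y - a) \<le> real (Suc n) * (y - a)" using True by (intro mult_right_mono) auto
    then show ?thesis unfolding g_def by (intro max.mono min.mono order_refl) auto
  next
    case False
    then have "real n * (y - a) \<le> 0" by (intro mult_nonneg_nonpos) auto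
    then have "g n y = 0" by (simp add: g_def max_def min_def)
    then show ?thesis using g01[of "Suc n" y] by simp
  qed
  have lim: "(\<lambda>n. g n y) \<longlonglongrightarrow> indicator {a<..} y" for y
  proof (cases "y > a")
    case True
    have "\<forall>\<^sub>F n in sequentially. real n * (y - a) \<ge> 1 \<and> real n - y \<ge> 1"
    proof -
      obtain N1 :: nat where N1: "1 / (y - a) \<le> real N1" using real_arch_simple by blast
      obtain N2 :: nat where N2: "y + 1 \<le> real N2" using real_arch_simple by blast
      show ?thesis
      proof (rule eventually_sequentiallyI[of "max N1 N2"])
        fix n assume n: "max N1 N2 \<le> n"
        then have "1 / (y - a) \<le> real n" "y + 1 \<le> real n" using N1 N2 by auto
        then show "real n * (y - a) \<ge> 1 \<and> real n - y \<ge> 1" using True by (simp add: divide_le_eq)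
      qed
    qed
    then have "\<forall>\<^sub>F n in sequentially. g n y = 1" by eventually_elim (simp add: g_def)
    then show ?thesis using True by (simp add: tendsto_eventually)
  next
    case False
    have "g n y = 0" for n
    proof -
      have "real n * (y - a) \<le> 0" using False by (intro mult_nonneg_nonpos) auto
      then show ?thesis by (simp add: g_def max_def min_def)
    qed
    then show ?thesis using False by simp
  qed
  have each: "(\<integral>\<^sup>+\<omega>. ennreal (g n (X t \<omega>)) \<partial>M) = (\<integral>\<^sup>+y. ennreal (?p y) * ennreal (g n y) \<partial>lborel)" for n
  proof -
    define R where "R = \<bar>a\<bar> + real n + 1"
    have R: "R > 0" by (simp add: R_def)
    have gR: "g n y = 0" if "\<bar>y\<bar> \<ge> R" for y
    proof (cases "y \<ge> 0")
      case True
      then have "real n - y \<le> 0" using that by (simp add: R_def)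
      then have "min 1 (min (real n * (y - a)) (real n - y)) \<le> 0" by (simp add: min_le_iff_disj)
      then show ?thesis unfolding g_def by (rule max_absorb1)
    next
      case False
      then have "y - a \<le> 0" using that by (simp add: R_def)
      then have "real n * (y - a) \<le> 0" by (intro mult_nonneg_nonpos) auto
      then show ?thesis by (simp add: g_def max_def min_def)
    qed
    have gl: "(real n + 1)-lipschitz_on UNIV (g n)"
    proof (rule lipschitz_onI)
      fix y z :: real
      have cl: "\<bar>max 0 (min 1 (min p q)) - max 0 (min 1 (min p' q'))\<bar> \<le> max \<bar>p - p'\<bar> \<bar>q - q'\<bar>" for p q p' q' :: real
        by (auto simp: max_def min_def)
      have "dist (g n y) (g n z) \<le> max \<bar>real n * (y - a) - real n * (z - a)\<bar> \<bar>(real n - y) - (real n - z)\<bar>"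
        unfolding dist_real_def g_def by (rule cl)
      also have "\<dots> \<le> (real n + 1) * \<bar>y - z\<bar>"
      proof (rule max.boundedI)
        have "\<bar>real n * (y - a) - real n * (z - a)\<bar> = real n * \<bar>y - z\<bar>" by (simp add: right_diff_distrib[symmetric] abs_mult)
        also have "\<dots> \<le> (real n + 1) * \<bar>y - z\<bar>" by (intro mult_right_mono) auto
        finally show "\<bar>real n * (y - a) - real n * (z - a)\<bar> \<le> (real n + 1) * \<bar>y - z\<bar>" .
        have "1 * \<bar>y - z\<bar> \<le> (real n + 1) * \<bar>y - z\<bar>" by (intro mult_right_mono) auto
        then show "\<bar>(real n - y) - (real n - z)\<bar> \<le> (real n + 1) * \<bar>y - z\<bar>" by (simp add: abs_minus_commute)
      qed
      finally show "dist (g n y) (g n z) \<le> (real n + 1) * dist y z" by (simp add: dist_real_def)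
    qed simp
    have gb: "\<bar>g n y\<bar> \<le> 1" for y using g01[of n y] by simp
    have pi: "integrable lborel (\<lambda>y. ?p y * g n y)"
      by (rule transition_semigroup_isCont(1)[OF \<beta> t gm gb, of R]) (use gR in auto)
    have "(\<integral>\<^sup>+\<omega>. ennreal (g n (X t \<omega>)) \<partial>M) = ennreal (expectation (\<lambda>\<omega>. g n (X t \<omega>)))"
      using g01 by (intro nn_integral_eq_integral integrable_const_bound[of _ 1]) auto
    also have "\<dots> = ennreal (\<integral>y. ?p y * g n y \<partial>lborel)"
      by (simp only: expectation_transition_density[OF \<beta> t gl gb R gR])
    also have "\<dots> = (\<integral>\<^sup>+y. ennreal (?p y * g n y) \<partial>lborel)"
      using p0 g01 pi by (intro nn_integral_eq_integral[symmetric]) auto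
    also have "\<dots> = (\<integral>\<^sup>+y. ennreal (?p y) * ennreal (g n y) \<partial>lborel)"
      using p0 g01 by (simp add: ennreal_mult)
    finally show ?thesis .
  qed
  have incM: "incseq (\<lambda>n \<omega>. ennreal (g n (X t \<omega>)))" "incseq (\<lambda>n y. ennreal (?p y) * ennreal (g n y))"
    using mono by (auto intro!: incseq_SucI le_funI ennreal_leI mult_left_mono)
  have "(\<lambda>n. \<integral>\<^sup>+\<omega>. ennreal (g n (X t \<omega>)) \<partial>M) \<longlonglongrightarrow> (\<integral>\<^sup>+\<omega>. indicator {a<..} (X t \<omega>) \<partial>M)"
    by (rule nn_integral_LIMSEQ[OF incM(1)]) (measurable, use tendsto_ennrealI[OF lim] in \<open>auto simp: ennreal_indicator\<close>)
  moreover have "(\<lambda>n. \<integral>\<^sup>+y. ennreal (?p y) * ennreal (g n y) \<partial>lborel) \<longlonglongrightarrow> (\<integral>\<^sup>+y. ennreal (?p y) * indicator {a<..} y \<partial>lborel)"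
  proof (rule nn_integral_LIMSEQ[OF incM(2)])
    show "(\<lambda>n. ennreal (?p y) * ennreal (g n y)) \<longlonglongrightarrow> ennreal (?p y) * indicator {a<..} y" for y
      using tendsto_ennrealI[OF tendsto_mult[OF tendsto_const[of "?p y"] lim[of y]]] p0[of y] g01
      by (simp add: ennreal_mult ennreal_indicator)
  qed measurable
  ultimately have "(\<integral>\<^sup>+\<omega>. indicator {a<..} (X t \<omega>) \<partial>M) = (\<integral>\<^sup>+y. ennreal (?p y) * indicator {a<..} y \<partial>lborel)"
    unfolding each by (rule LIMSEQ_unique)
  moreover have "emeasure (distr M lborel (X t)) {a<..} = (\<integral>\<^sup>+y. indicator {a<..} y \<partial>distr M lborel (X t))" by simp
  moreover have "(\<integral>\<^sup>+y. indicator {a<..} y \<partial>distr M lborel (X t)) = (\<integral>\<^sup>+\<omega>. indicator {a<..} (X t \<omega>) \<partial>M)"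
    by (rule nn_integral_distr[OF Xl]) simp
  moreover have "emeasure (density lborel (\<lambda>y. ennreal (?p y))) {a<..} = (\<integral>\<^sup>+y. ennreal (?p y) * indicator {a<..} y \<partial>lborel)"
    by (rule emeasure_density) auto
  ultimately show "emeasure (distr M lborel (X t)) {a<..} = emeasure (density lborel (\<lambda>y. ennreal (?p y))) {a<..}" by simp
qed

end

theorem proposition4:
  fixes M :: "'a measure" and F :: "real \<Rightarrow> 'a measure"
    and B X :: "real \<Rightarrow> 'a \<Rightarrow> real"
    and \<beta> \<mu>p \<mu>m t x :: real
  assumes "\<beta> \<in> {-1<..<1}" and "t > 0"
    and "refracted_skew_BM M F B X \<beta> \<mu>p \<mu>m 0 x"
  shows "(\<forall>y. transition_density \<beta> \<mu>p \<mu>m t x y \<ge> 0) \<and>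
    distributed M lborel (X t) (\<lambda>y. ennreal (transition_density \<beta> \<mu>p \<mu>m t x y))"
proof -
  interpret skew_BM_at_0 M F B X \<beta> \<mu>p \<mu>m x
    using assms(3) by (rule skew_BM_at_0.intro)
  have "X t \<in> measurable M lborel" using X_measurable[of t] assms(2) by simp
  moreover have "(\<lambda>y. ennreal (transition_density \<beta> \<mu>p \<mu>m t x y)) \<in> borel_measurable lborel"
    using borel_measurable_transition_density[OF assms(2)] by measurable
  ultimately show ?thesis
    using distr_eq_transition_density[OF assms(1,2)] transition_density_nonneg[OF assms(1,2)]
    by (auto simp: distributed_def)
qed

end
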